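(* Let $\mathcal{P}$ be a finite set of prime numbers. Then there exists an infinite family $\mathcal{F}$ of pairwise distinct totally real Galois extensions $F$ of $\mathbb{Q}$ with $\mathrm{Gal}(F/\mathbb{Q})\cong S_3$ such that $\mathrm{Leo}(F,p)$ holds for every $F\in\mathcal{F}$ and every $p\in\mathcal{P}$.
   Context: For a number field $E$ and prime $p$, with $S_p(E)$ the places above $p$ and $U^1_{E_w}$ the principal units of the completion $E_w$, the diagonal embedding of units induces $\lambda_{E,p}:\mathbb{Z}_p\otimes_{\mathbb{Z}}\mathcal{O}_E^\times\to\prod_{w\in S_p(E)}U^1_{E_w}$; $\mathrm{Leo}(E,p)$ holds if $\lambda_{E,p}$ is injective. *)

theory Defs
  imports
    Complex_Main
    "HOL-Computational_Algebra.Computational_Algebra"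
    "HOL-Algebra.Algebra"
    "HOL-Algebra.Algebraic_Closure_Type"
begin

section \<open>Number fields\<close>

text \<open>
  Number fields are taken to be subfields of the complex numbers that are finite over the
  rationals. Two Galois extensions of the rationals inside the complex numbers are isomorphic
  only if they are equal, so nothing is counted twice.
\<close>

abbreviation complex_ring :: "complex ring"
  where "complex_ring \<equiv> ring_of_type_algebra"

abbreviation subfield_ring :: "complex set \<Rightarrow> complex ring"
  where "subfield_ring E \<equiv> complex_ring\<lparr>carrier := E\<rparr>"

definition number_field :: "complex set \<Rightarrow> bool"
  where "number_field E \<longleftrightarrow>
    subfield E complex_ring \<and> ring.finite_dimension complex_ring \<rat> E"

definition ring_of_integers :: "complex set \<Rightarrow> complex ring"
  where "ring_of_integers E = complex_ring\<lparr>carrier := {x \<in> E. algebraic_int x}\<rparr>"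

definition totally_real :: "complex set \<Rightarrow> bool"
  where "totally_real E \<longleftrightarrow>
    number_field E \<and> (\<forall>\<tau> \<in> ring_hom (subfield_ring E) complex_ring. \<tau> ` E \<subseteq> \<real>)"

definition galois_group :: "complex set \<Rightarrow> complex set \<Rightarrow> (complex \<Rightarrow> complex) monoid"
  where "galois_group K F = (BijGroup F)\<lparr>carrier :=
    {\<sigma> \<in> Bij F. \<sigma> \<in> ring_iso (subfield_ring F) (subfield_ring F) \<and> (\<forall>x\<in>K. \<sigma> x = x)}\<rparr>"

definition finite_galois_extension :: "complex set \<Rightarrow> complex set \<Rightarrow> bool"
  where "finite_galois_extension K F \<longleftrightarrow>
    subfield K complex_ring \<and> subfield F complex_ring \<and> K \<subseteq> F \<and>
    ring.finite_dimension complex_ring K F \<and>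
    {x \<in> F. \<forall>\<sigma> \<in> carrier (galois_group K F). \<sigma> x = x} = K"


section \<open>Places and completions\<close>

definition absolute_value :: "complex set \<Rightarrow> (complex \<Rightarrow> real) \<Rightarrow> bool"
  where "absolute_value E w \<longleftrightarrow>
    w \<in> E \<rightarrow>\<^sub>E {0..} \<and>
    (\<forall>x\<in>E. w x = 0 \<longleftrightarrow> x = 0) \<and>
    (\<forall>x\<in>E. \<forall>y\<in>E. w (x * y) = w x * w y) \<and>
    (\<forall>x\<in>E. \<forall>y\<in>E. w (x + y) \<le> w x + w y)"

definition padic_abs :: "nat \<Rightarrow> rat \<Rightarrow> real"
  where "padic_abs p q =
    (if q = 0 then 0
     else case quotient_of q of (a, b) \<Rightarrow>
       real p powi (int (multiplicity (int p) b) - int (multiplicity (int p) a)))"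

text \<open>
  A place above \<open>p\<close> is an equivalence class of absolute values on \<open>E\<close> whose restriction to the
  rationals is equivalent to the \<open>p\<close>-adic one. Each such class contains exactly one absolute value
  that actually extends \<open>padic_abs p\<close>, and that one is used to represent the place.
  Absolute values are extensional functions, so that distinct functions are distinct places.
\<close>

definition places_above :: "complex set \<Rightarrow> nat \<Rightarrow> (complex \<Rightarrow> real) set"
  where "places_above E p =
    {w. absolute_value E w \<and> (\<forall>q. w (of_rat q) = padic_abs p q)}"

definition cauchy_ring :: "complex set \<Rightarrow> (complex \<Rightarrow> real) \<Rightarrow> (nat \<Rightarrow> complex) ring"
  where "cauchy_ring E w =
    \<lparr>carrier = {s. range s \<subseteq> E \<and> (\<forall>e>0. \<exists>N. \<forall>m\<ge>N. \<forall>n\<ge>N. w (s m - s n) < e)},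
     monoid.mult = (\<lambda>s t n. s n * t n), one = (\<lambda>n. 1),
     ring.zero = (\<lambda>n. 0), add = (\<lambda>s t n. s n + t n)\<rparr>"

definition null_sequences :: "complex set \<Rightarrow> (complex \<Rightarrow> real) \<Rightarrow> (nat \<Rightarrow> complex) set"
  where "null_sequences E w = {s. range s \<subseteq> E \<and> (\<lambda>n. w (s n)) \<longlonglongrightarrow> 0}"

definition completion :: "complex set \<Rightarrow> (complex \<Rightarrow> real) \<Rightarrow> (nat \<Rightarrow> complex) set ring"
  where "completion E w = cauchy_ring E w Quot null_sequences E w"

definition completion_embed ::
    "complex set \<Rightarrow> (complex \<Rightarrow> real) \<Rightarrow> complex \<Rightarrow> (nat \<Rightarrow> complex) set"
  where "completion_embed E w x = null_sequences E w +>\<^bsub>cauchy_ring E w\<^esub> (\<lambda>n. x)"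

text \<open>The continuous extension of \<open>w\<close> to the completion; all representatives of an element
  give the same limit.\<close>

definition completion_abs :: "(complex \<Rightarrow> real) \<Rightarrow> (nat \<Rightarrow> complex) set \<Rightarrow> real"
  where "completion_abs w S = (THE r. \<exists>s\<in>S. (\<lambda>n. w (s n)) \<longlonglongrightarrow> r)"

definition principal_units ::
    "complex set \<Rightarrow> (complex \<Rightarrow> real) \<Rightarrow> (nat \<Rightarrow> complex) set monoid"
  where "principal_units E w = (units_of (completion E w))\<lparr>carrier :=
    {u \<in> carrier (completion E w).
       completion_abs w (u \<ominus>\<^bsub>completion E w\<^esub> \<one>\<^bsub>completion E w\<^esub>) < 1}\<rparr>"

text \<open>
  A unit of the valuation ring of the completion at a place above \<open>p\<close> is uniquely the product of
  a root of unity of order prime to \<open>p\<close> and a principal unit; this is the second component.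
\<close>

definition principal_part ::
    "complex set \<Rightarrow> nat \<Rightarrow> (complex \<Rightarrow> real) \<Rightarrow> (nat \<Rightarrow> complex) set \<Rightarrow> (nat \<Rightarrow> complex) set"
  where "principal_part E p w u =
    (THE v. v \<in> carrier (principal_units E w) \<and>
       (\<exists>\<zeta>\<in>carrier (completion E w). \<exists>m::nat. m > 0 \<and> coprime m p \<and>
          \<zeta> [^]\<^bsub>completion E w\<^esub> m = \<one>\<^bsub>completion E w\<^esub> \<and>
          u = \<zeta> \<otimes>\<^bsub>completion E w\<^esub> v))"


section \<open>The ring of \<open>p\<close>-adic integers and its action on principal units\<close>

text \<open>The inverse limit of the rings of integers modulo \<open>p ^ n\<close>, with residues represented by
  \<open>{0..<p ^ n}\<close>.\<close>

definition padic_integers :: "nat \<Rightarrow> (nat \<Rightarrow> int) ring"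
  where "padic_integers p =
    \<lparr>carrier = {a. \<forall>n. a n \<in> {0..<int p ^ n} \<and> a (Suc n) mod int p ^ n = a n},
     monoid.mult = (\<lambda>a b n. (a n * b n) mod int p ^ n), one = (\<lambda>n. 1 mod int p ^ n),
     ring.zero = (\<lambda>n. 0), add = (\<lambda>a b n. (a n + b n) mod int p ^ n)\<rparr>"

text \<open>The power \<open>v\<^sup>a\<close> is the limit of \<open>v\<close> raised to integers converging \<open>p\<close>-adically to \<open>a\<close>.\<close>

definition padic_pow ::
    "complex set \<Rightarrow> (complex \<Rightarrow> real) \<Rightarrow> (nat \<Rightarrow> complex) set \<Rightarrow> (nat \<Rightarrow> int) \<Rightarrow>
     (nat \<Rightarrow> complex) set"
  where "padic_pow E w v a =
    (THE y. y \<in> carrier (principal_units E w) \<and>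
       (\<lambda>n. completion_abs w
          ((v [^]\<^bsub>principal_units E w\<^esub> a n) \<ominus>\<^bsub>completion E w\<^esub> y)) \<longlonglongrightarrow> 0)"


section \<open>Tensor products of abelian groups\<close>

definition tensor_relations ::
    "('a, 'c) monoid_scheme \<Rightarrow> ('b, 'd) monoid_scheme \<Rightarrow> ('a \<times> 'b \<Rightarrow>\<^sub>0 int) set"
  where "tensor_relations G H =
    {frag_of (x \<otimes>\<^bsub>G\<^esub> y, u) - frag_of (x, u) - frag_of (y, u) | x y u.
       x \<in> carrier G \<and> y \<in> carrier G \<and> u \<in> carrier H} \<union>
    {frag_of (x, u \<otimes>\<^bsub>H\<^esub> v) - frag_of (x, u) - frag_of (x, v) | x u v.
       x \<in> carrier G \<and> u \<in> carrier H \<and> v \<in> carrier H}"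

definition tensor_group ::
    "('a, 'c) monoid_scheme \<Rightarrow> ('b, 'd) monoid_scheme \<Rightarrow> ('a \<times> 'b \<Rightarrow>\<^sub>0 int) set monoid"
  where "tensor_group G H =
    free_Abelian_group (carrier G \<times> carrier H) Mod
    generate (free_Abelian_group (carrier G \<times> carrier H)) (tensor_relations G H)"


section \<open>Leopoldt's conjecture\<close>

definition units_tensor ::
    "complex set \<Rightarrow> nat \<Rightarrow> ((nat \<Rightarrow> int) \<times> complex \<Rightarrow>\<^sub>0 int) set monoid"
  where "units_tensor E p =
    tensor_group (add_monoid (padic_integers p)) (units_of (ring_of_integers E))"

text \<open>The component at \<open>w\<close> of the map on the free abelian group: a formal sum of pairs \<open>(a, u)\<close>
  goes to the product of the powers \<open>v\<^sup>a\<close>, with \<open>v\<close> the principal part of \<open>u\<close> at \<open>w\<close>.\<close>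

definition leopoldt_free ::
    "complex set \<Rightarrow> nat \<Rightarrow> (complex \<Rightarrow> real) \<Rightarrow> ((nat \<Rightarrow> int) \<times> complex \<Rightarrow>\<^sub>0 int) \<Rightarrow>
     (nat \<Rightarrow> complex) set"
  where "leopoldt_free E p w c =
    finprod (principal_units E w)
      (\<lambda>(a, u). padic_pow E w (principal_part E p w (completion_embed E w u)) a
         [^]\<^bsub>principal_units E w\<^esub> Poly_Mapping.lookup c (a, u))
      (Poly_Mapping.keys c)"

text \<open>The map induced on the tensor product: \<open>leopoldt_free\<close> is constant on each coset.
  Its codomain is \<open>product_group (places_above E p) (principal_units E)\<close>.\<close>

definition leopoldt_map ::
    "complex set \<Rightarrow> nat \<Rightarrow> ((nat \<Rightarrow> int) \<times> complex \<Rightarrow>\<^sub>0 int) set \<Rightarrow>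
     (complex \<Rightarrow> real) \<Rightarrow> (nat \<Rightarrow> complex) set"
  where "leopoldt_map E p C = (\<lambda>w\<in>places_above E p. the_elem (leopoldt_free E p w ` C))"

definition Leo :: "complex set \<Rightarrow> nat \<Rightarrow> bool"
  where "Leo E p \<longleftrightarrow> inj_on (leopoldt_map E p) (carrier (units_tensor E p))"

end

theory Submission
  imports Defs "Jordan_Normal_Form.Char_Poly"
begin

text \<open>For a positive integer \<open>c\<close> and \<open>a = 3 c\<close>, the polynomial \<open>x (x - a) (x + a) - 1\<close> has three real
  roots \<open>y\<^sub>i\<close>; they are units, and so are the quotients \<open>(y\<^sub>i + a) / (y\<^sub>i - a)\<close>. Its discriminant \<open>27 (108 c\<^sup>6 - 1)\<close> is never a square, so the splitting field \<open>F\<close> has group \<open>S\<^sub>3\<close>;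
  moreover the quadratic subfield contains the explicit unit
  \<open>\<eta> = 216 c\<^sup>6 - 1 + 4 c\<^sup>3 \<delta>\<close>.

  If \<open>p\<^sup>2\<close> divides \<open>a\<close>, then to first order the \<open>p\<close>-adic logarithm of \<open>- (y\<^sub>i + a) / (y\<^sub>i - a)\<close> is
  \<open>2 a / y\<^sub>i\<close> and that of \<open>y\<^sub>i\<^sup>3 = 1 + a\<^sup>2 y\<^sub>i\<close> is \<open>a\<^sup>2 y\<^sub>i\<close>. A \<open>p\<close>-adic relation between these units for two of
  the roots and \<open>\<eta>\<close> can be conjugated by \<open>S\<^sub>3\<close>: the product over the rotations isolates the exponent
  of \<open>\<eta>\<close>, and the remaining conjugates, compared in first order, force the other exponents to vanish.
  So these five units are \<open>p\<close>-adically independent. Since the logarithm vectors of units span a space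
  of dimension at most 5, every unit has a power in the group that they generate, and Leopoldt's
  conjecture at \<open>p\<close> follows.

  Taking for \<open>c\<close> suitable multiples of \<open>\<Prod>p\<in>P. p\<^sup>2\<close> makes the numbers \<open>108 c\<^sup>6 - 1\<close> pairwise coprime; as
  they are congruent to 3 modulo 4, the quadratic subfields are pairwise different.\<close>

section \<open>Algebraic integers and linear algebra\<close>

text \<open>No \<open>p\<close>-adic logarithm is ever defined. Its role is taken by
  \<open>power_int_expansion\<close>: \<open>(1 + t) powi b\<close> is \<open>1 + b t\<close> with
  an error smaller than \<open>b t\<close> by a factor \<open>1 / p\<close>, and
  \<open>p ^ 2 dvd a\<close> is the smallness this requires. Independence then comes from comparing
  sizes of leading terms. The delicate prime is 3, modulo which the roots \<open>y i\<close> are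
  congruent; \<open>w_root_difference\<close> shows that they are just far enough apart.

  Five is the unit rank of a totally real field of degree 6. Only the upper bound is obtained from
  the real logarithms; the lower bound is the \<open>p\<close>-adic independence itself, applied to
  constant exponents.

  The explicit units generate only a subgroup of finite index, so an element of the tensor product
  cannot be expanded in a basis. It is treated as a list of pairs whose units carry exponent
  vectors, and these vectors are cleared by the Euclidean algorithm. What is left is the torsion
  unit -1, which is a real obstruction only for \<open>p = 2\<close>.\<close>

lemma algebraic_int_eigen:
  fixes x :: complex and b :: "nat \<Rightarrow> complex" and A :: "nat \<Rightarrow> nat \<Rightarrow> int"
  assumes eq: "\<And>i. i < n \<Longrightarrow> x * b i = (\<Sum>j<n. of_int (A i j) * b j)"
    and nz: "i0 < n" "b i0 \<noteq> 0"
  shows "algebraic_int x"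
proof -
  define M where "M = mat n n (\<lambda>(i,j). A i j)"
  have M: "M \<in> carrier_mat n n" by (simp add: M_def)
  let ?M = "map_mat of_int M :: complex mat"
  have M': "?M \<in> carrier_mat n n" using M by simp
  \<comment> \<open>The relations \<open>eq\<close> make \<open>b\<close> an eigenvector of an
    integer matrix, whose characteristic polynomial is the monic integer equation sought for
    \<open>x\<close>.\<close>
  have "eigenvector ?M (vec n b) x"
    unfolding eigenvector_def
  proof (intro conjI)
    show "vec n b \<in> carrier_vec (dim_row ?M)" using M by simp
    show "vec n b \<noteq> 0\<^sub>v (dim_row ?M)"
      using nz M by (metis M' carrier_matD(1) index_vec index_zero_vec(1))
    show "?M *\<^sub>v vec n b = x \<cdot>\<^sub>v vec n b"
      using M by (intro eq_vecI) (auto simp: M_def scalar_prod_def eq lessThan_atLeast0)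
  qed
  hence "eigenvalue ?M x" unfolding eigenvalue_def by blast
  hence "poly (char_poly ?M) x = 0" using eigenvalue_root_char_poly[OF M'] by simp
  moreover have "char_poly ?M = map_poly of_int (char_poly M)"
    by (rule of_int_hom.char_poly_hom[OF M])
  moreover have "lead_coeff (char_poly M) = 1"
    using degree_monic_char_poly[OF M] by auto
  ultimately show ?thesis
    unfolding algebraic_int_altdef_ipoly by metis
qed

definition int_span :: "complex set \<Rightarrow> complex set"
  where "int_span B = range (\<lambda>c. \<Sum>b\<in>B. of_int (c b) * b)"

lemma int_span_add: "x \<in> int_span B \<Longrightarrow> y \<in> int_span B \<Longrightarrow> x + y \<in> int_span B"
  unfolding int_span_def
proof (clarify)
  fix c d :: "complex \<Rightarrow> int"
  have "(\<Sum>b\<in>B. of_int (c b) * b) + (\<Sum>b\<in>B. of_int (d b) * b) = (\<Sum>b\<in>B. of_int (c b + d b) * b)"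
    by (simp add: sum.distrib algebra_simps)
  thus "(\<Sum>b\<in>B. of_int (c b) * b) + (\<Sum>b\<in>B. of_int (d b) * b) \<in> range (\<lambda>c. \<Sum>b\<in>B. of_int (c b) * b)"
    by (rule range_eqI[where x = "\<lambda>b. c b + d b"])
qed

lemma int_span_scale: "x \<in> int_span B \<Longrightarrow> of_int k * x \<in> int_span B"
  unfolding int_span_def
proof (clarify)
  fix c :: "complex \<Rightarrow> int"
  have "of_int k * (\<Sum>b\<in>B. of_int (c b) * b) = (\<Sum>b\<in>B. of_int (k * c b) * b)"
    by (simp add: sum_distrib_left algebra_simps)
  thus "of_int k * (\<Sum>b\<in>B. of_int (c b) * b) \<in> range (\<lambda>c. \<Sum>b\<in>B. of_int (c b) * b)"
    by (rule range_eqI[where x = "\<lambda>b. k * c b"])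
qed

lemma int_span_zero: "0 \<in> int_span B"
  unfolding int_span_def by (rule range_eqI[of _ _ "\<lambda>_. 0"]) simp

lemma int_span_sum: "(\<And>i. i \<in> I \<Longrightarrow> f i \<in> int_span B) \<Longrightarrow> sum f I \<in> int_span B"
  by (induction I rule: infinite_finite_induct) (auto simp: int_span_zero int_span_add)

lemma int_span_base: "finite B \<Longrightarrow> b \<in> B \<Longrightarrow> b \<in> int_span B"
  unfolding int_span_def
  by (rule range_eqI[of _ _ "\<lambda>x. if x = b then 1 else 0"])
    (simp add: if_distrib[of of_int] if_distrib[of "\<lambda>z. z * _"] sum.delta cong: if_cong)

lemma int_span_mult_closed:
  assumes "\<And>b. b \<in> B \<Longrightarrow> z * b \<in> int_span B" and "y \<in> int_span B"
  shows "z * y \<in> int_span B"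
proof -
  obtain c where y: "y = (\<Sum>b\<in>B. of_int (c b) * b)" using assms(2) unfolding int_span_def by blast
  have "z * y = (\<Sum>b\<in>B. of_int (c b) * (z * b))" unfolding y by (simp add: sum_distrib_left algebra_simps)
  thus ?thesis using assms(1) by (simp add: int_span_sum int_span_scale)
qed

text \<open>Multiplication by \<open>z\<close> acts on the lattice spanned by \<open>B\<close>
  through an integer matrix; the element 1 in \<open>B\<close> guarantees a nonzero
  eigenvector.\<close>

lemma algebraic_int_span:
  assumes fin: "finite B" and one: "1 \<in> B" and cl: "\<And>b. b \<in> B \<Longrightarrow> z * b \<in> int_span B"
  shows "algebraic_int z"
proof -
  obtain h where h: "bij_betw h {..<card B} B"
    using ex_bij_betw_nat_finite[OF fin] by (auto simp: atLeast0LessThan)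
  have "\<forall>b. \<exists>c. b \<in> B \<longrightarrow> z * b = (\<Sum>b'\<in>B. of_int (c b') * b')"
    using cl unfolding int_span_def by blast
  then obtain c where c: "\<And>b. b \<in> B \<Longrightarrow> z * b = (\<Sum>b'\<in>B. of_int (c b b') * b')"
    by metis
  have hB: "h i \<in> B" if "i < card B" for i using h that by (auto simp: bij_betw_def)
  obtain i0 where i0: "i0 < card B" "h i0 = 1"
    using h one by (metis bij_betw_iff_bijections lessThan_iff)
  show ?thesis
  proof (rule algebraic_int_eigen[where b = h and A = "\<lambda>i j. c (h i) (h j)" and n = "card B"])
    fix i assume "i < card B"
    thus "z * h i = (\<Sum>j<card B. of_int (c (h i) (h j)) * h j)"
      using c[OF hB] sum.reindex_bij_betw[OF h, of "\<lambda>b'. of_int (c (h i) b') * b'"] by simp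
  qed (use i0 in auto)
qed

text \<open>The monic equation solved for its leading power. In this form it closes lattices of
  powers under multiplication and lets an absolute value compare the leading power with the
  rest.\<close>

lemma algebraic_int_power_reduce:
  assumes "algebraic_int (x :: complex)"
  obtains n c where "n > 0" "x ^ n = (\<Sum>i<n. of_int (c i) * x ^ i)"
proof -
  obtain p where p: "poly (map_poly of_int p) x = 0" "lead_coeff p = 1"
    using assms unfolding algebraic_int_altdef_ipoly by auto
  have deg: "degree p > 0"
  proof (rule ccontr)
    assume "\<not> degree p > 0"
    then obtain c where "p = [:c:]" by (auto elim: degree_eq_zeroE)
    thus False using p by simp
  qed
  have "0 = (\<Sum>i\<le>degree p. of_int (coeff p i) * x ^ i)"
    using p(1) by (simp add: poly_altdef degree_map_poly coeff_map_poly)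
  also have "\<dots> = (\<Sum>i<degree p. of_int (coeff p i) * x ^ i) + x ^ degree p"
    using p(2) by (simp add: lessThan_Suc_atMost[symmetric])
  finally have "x ^ degree p = (\<Sum>i<degree p. of_int (- coeff p i) * x ^ i)"
    by (simp add: sum_negf eq_neg_iff_add_eq_0 add.commute)
  thus ?thesis by (rule that[OF deg])
qed

text \<open>The monomials \<open>x ^ i * y ^ j\<close> below the two degrees span a lattice stable
  under \<open>x\<close> and under \<open>y\<close>, hence under their sum and product.\<close>

lemma algebraic_int_add_mult:
  assumes "algebraic_int (x :: complex)" "algebraic_int y"
  shows "algebraic_int (x + y)" "algebraic_int (x * y)"
proof -
  obtain n c where n: "n > 0" "x ^ n = (\<Sum>i<n. of_int (c i) * x ^ i)"
    using algebraic_int_power_reduce[OF assms(1)] by metis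
  obtain m d where m: "m > 0" "y ^ m = (\<Sum>i<m. of_int (d i) * y ^ i)"
    using algebraic_int_power_reduce[OF assms(2)] by metis
  define B where "B = {x ^ i * y ^ j | i j. i < n \<and> j < m}"
  have fin: "finite B" unfolding B_def by (rule finite_image_set2) auto
  have one: "1 \<in> B" unfolding B_def using n m by (force intro: exI[of _ 0])
  have base: "x ^ i * y ^ j \<in> int_span B" if "i < n" "j < m" for i j
    by (rule int_span_base[OF fin]) (use that in \<open>auto simp: B_def\<close>)
  have X: "x * b \<in> int_span B" if "b \<in> B" for b
  proof -
    obtain i j where ij: "b = x ^ i * y ^ j" "i < n" "j < m" using \<open>b \<in> B\<close> unfolding B_def by blast
    show ?thesis
    proof (cases "Suc i < n")
      case True
      thus ?thesis using base[OF True ij(3)] ij(1) by (simp add: mult.assoc)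
    next
      case False
      hence "x * b = x ^ n * y ^ j" using ij by (metis Suc_lessI mult.assoc power_Suc)
      also have "\<dots> = (\<Sum>i<n. of_int (c i) * (x ^ i * y ^ j))" by (simp add: n sum_distrib_right mult.assoc)
      also have "\<dots> \<in> int_span B" using ij by (intro int_span_sum int_span_scale base) auto
      finally show ?thesis .
    qed
  qed
  have Y: "y * b \<in> int_span B" if "b \<in> B" for b
  proof -
    obtain i j where ij: "b = x ^ i * y ^ j" "i < n" "j < m" using \<open>b \<in> B\<close> unfolding B_def by blast
    show ?thesis
    proof (cases "Suc j < m")
      case True
      thus ?thesis using base[OF ij(2) True] ij(1) by (simp add: ac_simps)
    next
      case False
      hence "Suc j = m" using ij by simp
      hence "y * b = x ^ i * y ^ m" using ij(1) by (auto simp: ac_simps)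
      also have "\<dots> = (\<Sum>j<m. of_int (d j) * (x ^ i * y ^ j))" by (simp add: m sum_distrib_left ac_simps)
      also have "\<dots> \<in> int_span B" using ij by (intro int_span_sum int_span_scale base) auto
      finally show ?thesis .
    qed
  qed
  show "algebraic_int (x + y)"
    by (rule algebraic_int_span[OF fin one]) (simp add: distrib_right int_span_add X Y)
  show "algebraic_int (x * y)"
    by (rule algebraic_int_span[OF fin one]) (simp add: mult.assoc int_span_mult_closed X Y)
qed

lemma algebraic_int_diff: "algebraic_int (x :: complex) \<Longrightarrow> algebraic_int y \<Longrightarrow> algebraic_int (x - y)"
  using algebraic_int_add_mult(1)[of x "-y"] by simp

lemma algebraic_int_of_int: "algebraic_int (of_int n :: complex)"
  by (rule int_imp_algebraic_int) simp

lemma algebraic_int_of_nat: "algebraic_int (of_nat n :: complex)"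
  by (rule int_imp_algebraic_int) simp

lemma algebraic_int_pow: "algebraic_int (x :: complex) \<Longrightarrow> algebraic_int (x ^ n)"
  by (induction n) (auto simp: algebraic_int_add_mult)

lemma algebraic_int_sum: "(\<And>i. i \<in> I \<Longrightarrow> algebraic_int (f i :: complex)) \<Longrightarrow> algebraic_int (sum f I)"
  by (induction I rule: infinite_finite_induct) (auto simp: algebraic_int_add_mult)

lemma algebraic_int_prod: "(\<And>i. i \<in> I \<Longrightarrow> algebraic_int (f i :: complex)) \<Longrightarrow> algebraic_int (prod f I)"
  by (induction I rule: infinite_finite_induct) (auto simp: algebraic_int_add_mult)

text \<open>A zero row completes the \<open>m\<close> equations in \<open>m + 1\<close> unknowns to
  a singular square matrix, whose kernel supplies the solution.\<close>

lemma homogeneous_system_nontrivial: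
  fixes a :: "nat \<Rightarrow> nat \<Rightarrow> real"
  obtains c where "\<exists>i\<le>m. c i \<noteq> 0" "\<And>j. j < m \<Longrightarrow> (\<Sum>i\<le>m. a j i * c i) = 0"
proof -
  define M where "M = mat (Suc m) (Suc m) (\<lambda>(j,i). if j < m then a j i else 0)"
  have M: "M \<in> carrier_mat (Suc m) (Suc m)" by (simp add: M_def)
  have "row M m = 0\<^sub>v (Suc m)" by (intro eq_vecI) (auto simp: M_def)
  hence "M $$ (m, j) = 0" if "j < Suc m" for j using that M
    by (metis carrier_matD index_row(1) index_zero_vec(1) lessI)
  hence "det M = 0" using laplace_expansion_row[OF M lessI] by simp
  then obtain v where v: "v \<in> carrier_vec (Suc m)" "v \<noteq> 0\<^sub>v (Suc m)" "M *\<^sub>v v = 0\<^sub>v (Suc m)"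
    using det_0_iff_vec_prod_zero_field[OF M] by auto
  show ?thesis
  proof (rule that[of "\<lambda>i. v $ i"])
    show "\<exists>i\<le>m. v $ i \<noteq> 0"
    proof (rule ccontr)
      assume "\<not> ?thesis"
      hence "v = 0\<^sub>v (Suc m)" using v(1) by (intro eq_vecI) auto
      thus False using v(2) by simp
    qed
    fix j assume j: "j < m"
    have "0 = (M *\<^sub>v v) $ j" using v(3) j by simp
    also have "\<dots> = (\<Sum>i\<le>m. a j i * v $ i)"
      using j v(1) M by (simp add: scalar_prod_def M_def atLeast0LessThan lessThan_Suc_atMost)
    finally show "(\<Sum>i\<le>m. a j i * v $ i) = 0" by simp
  qed
qed

section \<open>Subfields of the complex numbers\<close>

lemma complex_ring_simps [simp]:
  "carrier complex_ring = UNIV" "x \<otimes>\<^bsub>complex_ring\<^esub> y = x * y" "x \<oplus>\<^bsub>complex_ring\<^esub> y = x + y"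
  "\<one>\<^bsub>complex_ring\<^esub> = 1" "\<zero>\<^bsub>complex_ring\<^esub> = 0"
  by (auto simp: ring_of_type_algebra_def)

lemma complex_ring_field: "field complex_ring" by (rule field_from_type_algebra)

lemma complex_ring_ring: "ring complex_ring" by (rule ring_from_type_algebra)

lemma complex_ring_a_inv [simp]: "\<ominus>\<^bsub>complex_ring\<^esub> x = - x"
proof -
  interpret ring complex_ring by (rule complex_ring_ring)
  show ?thesis by (rule minus_equality) simp_all
qed

lemma complex_ring_inv: assumes "x \<noteq> 0" shows "inv\<^bsub>complex_ring\<^esub> x = inverse x"
proof -
  interpret field complex_ring by (rule complex_ring_field)
  show ?thesis using assms by (intro comm_inv_char) auto
qed

lemma subfield_complexI:
  assumes "1 \<in> E" "\<And>x y. x \<in> E \<Longrightarrow> y \<in> E \<Longrightarrow> x - y \<in> E"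
    "\<And>x y. x \<in> E \<Longrightarrow> y \<in> E \<Longrightarrow> x * y \<in> E" "\<And>x. x \<in> E \<Longrightarrow> inverse x \<in> E"
  shows "subfield E complex_ring"
proof -
  interpret field complex_ring by (rule complex_ring_field)
  have 0: "0 \<in> E" using assms(1) assms(2)[of 1 1] by simp
  have neg: "- x \<in> E" if "x \<in> E" for x using assms(2)[OF 0 that] by simp
  have add: "x + y \<in> E" if "x \<in> E" "y \<in> E" for x y using assms(2)[OF that(1) neg[OF that(2)]] by simp
  show ?thesis
  proof (rule subfieldI')
    show "subring E complex_ring"
      by (rule subringI) (use assms add neg in auto)
    fix k assume "k \<in> E - {\<zero>\<^bsub>complex_ring\<^esub>}"
    thus "inv\<^bsub>complex_ring\<^esub> k \<in> E" using assms(4) complex_ring_inv by simp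
  qed
qed

locale complex_subfield =
  fixes E :: "complex set"
  assumes subfield_E: "subfield E complex_ring"
begin

lemma one_mem [simp]: "1 \<in> E"
  using subfieldE(1)[OF subfield_E] subringE(3) by force

lemma zero_mem [simp]: "0 \<in> E"
  using subfieldE(1)[OF subfield_E] subringE(2) by force

lemma add_mem [simp, intro!]: "x \<in> E \<Longrightarrow> y \<in> E \<Longrightarrow> x + y \<in> E"
  using subfieldE(1)[OF subfield_E] subringE(7) by force

lemma minus_mem [simp, intro!]: "x \<in> E \<Longrightarrow> - x \<in> E"
  using subfieldE(1)[OF subfield_E] subringE(5) by force

lemma diff_mem [simp, intro!]: "x \<in> E \<Longrightarrow> y \<in> E \<Longrightarrow> x - y \<in> E"
  using add_mem[of x "-y"] by auto

lemma mult_mem [simp, intro!]: "x \<in> E \<Longrightarrow> y \<in> E \<Longrightarrow> x * y \<in> E"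
  using subfieldE(1)[OF subfield_E] subringE(6) by force

lemma inverse_mem [simp, intro!]: assumes "x \<in> E" shows "inverse x \<in> E"
proof (cases "x = 0")
  case False
  interpret field complex_ring by (rule complex_ring_field)
  show ?thesis using subfield_m_inv(1)[OF subfield_E, of x] False assms by (simp add: complex_ring_inv)
qed simp

lemma divide_mem [simp, intro!]: "x \<in> E \<Longrightarrow> y \<in> E \<Longrightarrow> x / y \<in> E"
  by (simp add: divide_inverse inverse_mem mult_mem)

lemma power_mem [simp, intro!]: "x \<in> E \<Longrightarrow> x ^ n \<in> E"
  by (induction n) auto

lemma power_int_mem [simp, intro!]: "x \<in> E \<Longrightarrow> x powi n \<in> E"
  by (auto simp: power_int_def)

lemma sum_mem [intro]: "(\<And>i. i \<in> I \<Longrightarrow> f i \<in> E) \<Longrightarrow> sum f I \<in> E"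
  by (induction I rule: infinite_finite_induct) auto

lemma prod_mem [intro]: "(\<And>i. i \<in> I \<Longrightarrow> f i \<in> E) \<Longrightarrow> prod f I \<in> E"
  by (induction I rule: infinite_finite_induct) auto

lemma of_nat_mem [simp, intro]: "of_nat n \<in> E"
  by (induction n) auto

lemma of_int_mem [simp, intro]: "of_int n \<in> E"
  by (cases n) (auto intro: minus_mem simp del: of_nat_Suc)

lemma numeral_mem [simp, intro]: "numeral n \<in> E"
  using of_nat_mem[of "numeral n"] by simp

lemma of_rat_mem [simp, intro]: "of_rat q \<in> E"
  by (cases q) (auto simp: of_rat_rat)

lemma Rats_subset: "\<rat> \<subseteq> E"
  by (auto simp: Rats_def)

end

section \<open>Places above a prime\<close>

lemma padic_abs_of_int:
  assumes "z \<noteq> 0"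
  shows "padic_abs p (of_int z) = real p powi (- int (multiplicity (int p) z))"
  using assms by (simp add: padic_abs_def)

locale place = complex_subfield E for E :: "complex set" +
  fixes w :: "complex \<Rightarrow> real" and p :: nat
  assumes prime_p: "Factorial_Ring.prime p"
    and abs_w: "absolute_value E w"
    and w_of_rat: "\<And>q. w (of_rat q) = padic_abs p q"
begin

lemma p_gt_1: "p > 1" using prime_p by (rule prime_gt_1_nat)

lemma w_nonneg: "x \<in> E \<Longrightarrow> w x \<ge> 0"
  using abs_w by (auto simp: absolute_value_def PiE_def Pi_def)

lemma w_eq_0: "x \<in> E \<Longrightarrow> w x = 0 \<longleftrightarrow> x = 0"
  using abs_w by (auto simp: absolute_value_def)

lemma w_0 [simp]: "w 0 = 0" using w_eq_0 by simp

lemma w_mult: "x \<in> E \<Longrightarrow> y \<in> E \<Longrightarrow> w (x * y) = w x * w y"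
  using abs_w by (auto simp: absolute_value_def)

lemma w_triangle: "x \<in> E \<Longrightarrow> y \<in> E \<Longrightarrow> w (x + y) \<le> w x + w y"
  using abs_w by (auto simp: absolute_value_def)

lemma w_1 [simp]: "w 1 = 1"
  using w_mult[of 1 1] w_eq_0[of 1] by simp

lemma w_minus_1: "w (-1) = 1"
proof -
  have "w (-1) * w (-1) = 1" using w_mult[of "-1" "-1"] by (simp add: minus_mem)
  moreover have "w (-1) \<ge> 0" by (rule w_nonneg) (simp add: minus_mem)
  ultimately show ?thesis by (metis abs_of_nonneg abs_mult_self_eq abs_1 power2_eq_square real_sqrt_abs real_sqrt_one)
qed

lemma w_minus [simp]: "x \<in> E \<Longrightarrow> w (- x) = w x"
  using w_mult[of "-1" x] w_minus_1 by (simp add: minus_mem)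

lemma w_power: "x \<in> E \<Longrightarrow> w (x ^ n) = w x ^ n"
  by (induction n) (auto simp: w_mult power_mem)

lemma w_inverse: assumes "x \<in> E" shows "w (inverse x) = inverse (w x)"
proof (cases "x = 0")
  case False
  hence "w x * w (inverse x) = 1" using w_mult[of x "inverse x"] assms by (simp add: inverse_mem)
  thus ?thesis by (metis inverse_unique)
qed simp

lemma w_divide: "x \<in> E \<Longrightarrow> y \<in> E \<Longrightarrow> w (x / y) = w x / w y"
  by (simp add: divide_inverse w_mult w_inverse inverse_mem)

lemma w_power_int: "x \<in> E \<Longrightarrow> w (x powi n) = w x powi n"
  by (auto simp: power_int_def w_power w_inverse power_mem inverse_mem)

lemma w_diff_commute: "x \<in> E \<Longrightarrow> y \<in> E \<Longrightarrow> w (x - y) = w (y - x)"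
  using w_minus[of "x - y"] by (simp add: diff_mem)

lemma w_of_int: "z \<noteq> 0 \<Longrightarrow> w (of_int z) = real p powi (- int (multiplicity (int p) z))"
  using w_of_rat[of "of_int z"] padic_abs_of_int[of z p] by simp

lemma w_of_int_le_1: "w (of_int z) \<le> 1"
  using w_of_int[of z] p_gt_1
  by (cases "z = 0") (auto simp: power_int_minus inverse_le_1_iff one_le_power)

lemma w_of_nat_le_1: "w (of_nat z) \<le> 1"
  using w_of_int_le_1[of "int z"] by simp

lemma w_of_int_le_iff: "w (of_int z) \<le> 1 / real p ^ n \<longleftrightarrow> int p ^ n dvd z"
proof (cases "z = 0")
  case False
  let ?m = "multiplicity (int p) z"
  have "w (of_int z) \<le> 1 / real p ^ n \<longleftrightarrow> real p ^ n \<le> real p ^ ?m"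
    using p_gt_1 by (simp add: w_of_int[OF False] power_int_minus field_simps)
  also have "\<dots> \<longleftrightarrow> n \<le> ?m" using p_gt_1 by simp
  also have "\<dots> \<longleftrightarrow> int p ^ n dvd z"
    using False prime_p by (subst power_dvd_iff_le_multiplicity) (auto simp: prime_int_nat_transfer)
  finally show ?thesis .
qed auto

lemma w_of_int_unit: assumes "\<not> int p dvd z" shows "w (of_int z) = 1"
proof -
  have "z \<noteq> 0" using assms by auto
  thus ?thesis using w_of_int[of z] assms by (simp add: not_dvd_imp_multiplicity_0)
qed

lemma w_p: "w (of_nat p) = 1 / p"
proof -
  have "multiplicity (int p) (int p) = 1"
    using prime_p by (intro multiplicity_prime) (auto)
  thus ?thesis using w_of_int[of "int p"] p_gt_1 by (simp add: power_int_minus field_simps)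
qed

lemma w_sum_le_card:
  assumes "finite I" "\<And>i. i \<in> I \<Longrightarrow> f i \<in> E" "\<And>i. i \<in> I \<Longrightarrow> w (f i) \<le> B"
  shows "w (sum f I) \<le> real (card I) * B"
  using assms
proof (induction I)
  case (insert x I)
  have "w (sum f (insert x I)) \<le> w (f x) + w (sum f I)"
    using insert by (auto intro!: w_triangle sum_mem)
  also have "\<dots> \<le> B + card I * B" using insert by (intro add_mono) auto
  finally show ?case using insert by (simp add: algebra_simps)
qed simp

text \<open>Comparing \<open>w (x + y) ^ n\<close> with the binomial expansion, whose coefficients have absolute
  value at most 1, and letting \<open>n\<close> tend to infinity.\<close>

lemma w_add_le_max:
  assumes "x \<in> E" "y \<in> E"
  shows "w (x + y) \<le> max (w x) (w y)"
proof (rule ccontr)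
  define m where "m = max (w x) (w y)"
  assume "\<not> ?thesis"
  hence gt: "w (x + y) > m" unfolding m_def by linarith
  have m0: "m \<ge> 0" using w_nonneg assms by (simp add: m_def le_max_iff_disj)
  have "m \<noteq> 0"
  proof
    assume "m = 0"
    hence "w x = 0" "w y = 0" using w_nonneg[OF assms(1)] w_nonneg[OF assms(2)] by (auto simp: m_def max_def split: if_splits)
    hence "x + y = 0" using w_eq_0 assms by simp
    thus False using gt \<open>m = 0\<close> by simp
  qed
  hence m: "m > 0" using m0 by simp
  have bound: "w (x + y) ^ n \<le> real (Suc n) * m ^ n" for n
  proof -
    have "w (x + y) ^ n = w ((x + y) ^ n)" using assms by (simp add: w_power add_mem)
    also have "\<dots> = w (\<Sum>k\<le>n. of_nat (n choose k) * x ^ k * y ^ (n - k))" by (simp add: binomial_ring)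
    also have "\<dots> \<le> real (card {..n}) * m ^ n"
    proof (rule w_sum_le_card)
      fix k assume k: "k \<in> {..n}"
      show "of_nat (n choose k) * x ^ k * y ^ (n - k) \<in> E" using assms by (auto intro!: mult_mem)
      have "w (of_nat (n choose k) * x ^ k * y ^ (n - k)) = w (of_nat (n choose k)) * (w x ^ k * w y ^ (n - k))"
        using assms by (simp add: w_mult w_power mult_mem power_mem)
      also have "\<dots> \<le> 1 * (m ^ k * m ^ (n - k))"
        using assms w_nonneg by (intro mult_mono w_of_nat_le_1 power_mono) (auto simp: m_def le_max_iff_disj)
      also have "\<dots> = m ^ n" using k by (simp flip: power_add)
      finally show "w (of_nat (n choose k) * x ^ k * y ^ (n - k)) \<le> m ^ n" .
    qed simp
    finally show ?thesis by simp
  qed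
  define h where "h = w (x + y) / m - 1"
  have h: "h > 0" using gt m by (simp add: h_def)
  \<comment> \<open>Bernoulli makes \<open>(1 + h) ^ (2 * k)\<close> grow at least quadratically in
    \<open>k\<close>, while \<open>bound\<close> allows only \<open>2 * k + 1\<close>;
    \<open>k h^2 > 2\<close> is already enough for the contradiction.\<close>
  obtain k :: nat where k: "real k * h\<^sup>2 > 2" using reals_Archimedean3[of "h\<^sup>2"] h by (metis zero_less_power)
  have k0: "real k > 0" using k h by (cases k) auto
  have "(1 + real k * h)\<^sup>2 \<le> ((1 + h) ^ k)\<^sup>2"
    using h Bernoulli_inequality[of h k] by (intro power_mono) auto
  also have "\<dots> = (1 + h) ^ (2 * k)" by (simp add: power_mult mult.commute[of 2])
  also have "\<dots> = w (x + y) ^ (2 * k) / m ^ (2 * k)" by (simp add: h_def power_divide)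
  also have "\<dots> \<le> real (Suc (2 * k))" using bound[of "2 * k"] m by (simp add: field_simps)
  finally have "(1 + real k * h)\<^sup>2 \<le> 1 + 2 * real k" by simp
  hence "real k * (2 * h) + real k * (real k * h\<^sup>2) \<le> real k * 2" by (simp add: power2_eq_square algebra_simps)
  moreover have "real k * (real k * h\<^sup>2) > real k * 2" using k k0 by simp
  moreover have "real k * (2 * h) \<ge> 0" using h by simp
  ultimately show False by linarith
qed

lemma w_add_le: "x \<in> E \<Longrightarrow> y \<in> E \<Longrightarrow> w x \<le> B \<Longrightarrow> w y \<le> B \<Longrightarrow> w (x + y) \<le> B"
  using w_add_le_max[of x y] by simp

lemma w_add_less: "x \<in> E \<Longrightarrow> y \<in> E \<Longrightarrow> w x < B \<Longrightarrow> w y < B \<Longrightarrow> w (x + y) < B"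
  using w_add_le_max[of x y] by simp

lemma w_diff_le: "x \<in> E \<Longrightarrow> y \<in> E \<Longrightarrow> w x \<le> B \<Longrightarrow> w y \<le> B \<Longrightarrow> w (x - y) \<le> B"
  using w_add_le[of x "-y" B] by (simp add: minus_mem)

lemma w_diff_less: "x \<in> E \<Longrightarrow> y \<in> E \<Longrightarrow> w x < B \<Longrightarrow> w y < B \<Longrightarrow> w (x - y) < B"
  using w_add_less[of x "-y" B] by (simp add: minus_mem)

lemma w_sum_le:
  assumes "\<And>i. i \<in> I \<Longrightarrow> f i \<in> E" "\<And>i. i \<in> I \<Longrightarrow> w (f i) \<le> B" "B \<ge> 0"
  shows "w (sum f I) \<le> B"
  using assms by (induction I rule: infinite_finite_induct) (auto intro!: w_add_le)

text \<open>Writing \<open>x\<close> as \<open>(x + y) - y\<close> gives the reverse inequality,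
  since \<open>y\<close> alone is too small to account for \<open>x\<close>.\<close>

lemma w_add_eq: assumes "x \<in> E" "y \<in> E" "w y < w x" shows "w (x + y) = w x"
proof -
  have "w (x + y) \<le> w x" using assms by (intro w_add_le) auto
  moreover have "w x \<le> max (w (x + y)) (w (- y))" using w_add_le_max[of "x + y" "- y"] assms by (simp add: add_mem minus_mem)
  ultimately show ?thesis using assms by (auto simp: max_def split: if_splits)
qed

lemma w_diff_abs_le: assumes "x \<in> E" "y \<in> E" shows "\<bar>w x - w y\<bar> \<le> w (x - y)"
  using w_triangle[of "x - y" y] w_triangle[of "y - x" x] w_diff_commute[of x y] assms by (simp add: diff_mem)

lemma w_eq_1_if_near_1: assumes "x \<in> E" "w (x - 1) < 1" shows "w x = 1"
  using w_add_eq[of 1 "x - 1"] assms by (simp add: diff_mem)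

text \<open>If \<open>w x > 1\<close>, the leading power in the monic equation would strictly exceed
  every other term, which the ultrametric inequality forbids.\<close>

lemma w_algebraic_int: assumes "x \<in> E" "algebraic_int x" shows "w x \<le> 1"
proof (rule ccontr)
  assume "\<not> ?thesis"
  hence gt: "w x > 1" by simp
  obtain n c where n: "n > 0" "x ^ n = (\<Sum>i<n. of_int (c i) * x ^ i)"
    using algebraic_int_power_reduce[OF assms(2)] by metis
  have "w x ^ n = w (x ^ n)" using assms by (simp add: w_power)
  also have "\<dots> \<le> w x ^ (n - 1)" unfolding n(2)
  proof (rule w_sum_le)
    fix i assume i: "i \<in> {..<n}"
    show "of_int (c i) * x ^ i \<in> E" using assms by auto
    have "w (of_int (c i) * x ^ i) \<le> 1 * w x ^ i" using assms gt
      by (auto simp: w_mult w_power power_mem intro!: mult_right_mono w_of_int_le_1)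
    also have "\<dots> \<le> w x ^ (n - 1)" using gt i by (auto intro!: power_increasing)
    finally show "w (of_int (c i) * x ^ i) \<le> w x ^ (n - 1)" .
  qed (use gt in auto)
  also have "\<dots> < w x ^ n" using gt n(1) by (intro power_strict_increasing) auto
  finally show False by simp
qed

lemma w_unit: assumes "x \<in> E" "algebraic_int x" "algebraic_int (inverse x)" "x \<noteq> 0" shows "w x = 1"
proof -
  have "w (inverse x) \<le> 1" using assms by (intro w_algebraic_int) auto
  hence "inverse (w x) \<le> 1" using w_inverse assms by simp
  moreover have "w x \<le> 1" "w x > 0" using w_algebraic_int w_nonneg[of x] w_eq_0[of x] assms by force+
  ultimately show ?thesis by (simp add: field_simps)
qed

section \<open>Powers of elements close to 1\<close>

lemma mult_near_1:
  assumes "x \<in> E" "y \<in> E" "w (x - 1) \<le> r" "w (y - 1) \<le> r" "w y \<le> 1"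
  shows "w (x * y - 1) \<le> r"
proof -
  have "w ((x - 1) * y) = w (x - 1) * w y" using assms by (intro w_mult diff_mem) auto
  also have "\<dots> \<le> w (x - 1)" using assms w_nonneg[OF diff_mem[OF assms(1) one_mem]] w_nonneg[OF assms(2)]
    by (intro mult_left_le) (auto)
  finally have "w ((x - 1) * y) \<le> r" using assms by simp
  moreover have "x * y - 1 = (x - 1) * y + (y - 1)" by (simp add: algebra_simps)
  ultimately show ?thesis using assms by (auto intro!: w_add_le simp only: one_mem)
qed

lemma power_near_1:
  assumes "x \<in> E" "w (x - 1) \<le> r" "w x \<le> 1" "r \<ge> 0"
  shows "w (x ^ n - 1) \<le> r"
proof (induction n)
  case (Suc n)
  have "w (x ^ n) \<le> 1" using assms w_nonneg by (simp add: w_power power_le_one)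
  thus ?case using mult_near_1[of x "x ^ n" r] Suc assms by (simp add: power_mem)
qed (use assms in simp)

lemma inverse_near_1:
  assumes "x \<in> E" "w (x - 1) \<le> r" "w x = 1"
  shows "w (inverse x - 1) \<le> r"
proof -
  have "x \<noteq> 0" using assms by auto
  hence "inverse x - 1 = (1 - x) / x" by (simp add: field_simps)
  hence "w (inverse x - 1) = w (1 - x)" using assms by (simp add: w_divide diff_mem)
  thus ?thesis using assms w_diff_commute[of x 1] by simp
qed

lemma power_int_near_1:
  assumes "x \<in> E" "w (x - 1) \<le> r" "w x = 1" "r \<ge> 0"
  shows "w (x powi n - 1) \<le> r"
  using assms power_near_1[of x r "nat n"] power_near_1[of "inverse x" r "nat (-n)"] inverse_near_1[of x r]
  by (auto simp: power_int_def w_inverse inverse_mem)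

text \<open>The cofactor of \<open>x - 1\<close> in \<open>x ^ p - 1\<close> is a sum of
  \<open>p\<close> powers of \<open>x\<close>. Each is within \<open>r\<close> of 1, so the sum is
  within \<open>r\<close> of \<open>p\<close>.\<close>

lemma p_power_near_1_step:
  assumes "x \<in> E" "w (x - 1) \<le> r" "r < 1"
  shows "w (x ^ p - 1) \<le> r * max r (1 / p)"
proof -
  have r0: "r \<ge> 0" using w_nonneg[OF diff_mem[OF assms(1) one_mem]] assms(2) by linarith
  have wx: "w x = 1" using assms by (intro w_eq_1_if_near_1) auto
  have "x ^ p - 1 = (x - 1) * (\<Sum>i<p. x ^ i)" by (simp add: power_diff_1_eq)
  also have "(\<Sum>i<p. x ^ i) = of_nat p + (\<Sum>i<p. x ^ i - 1)" by (simp add: sum_subtractf)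
  finally have "w (x ^ p - 1) = w (x - 1) * w (of_nat p + (\<Sum>i<p. x ^ i - 1))"
    using assms by (simp add: w_mult diff_mem add_mem sum_mem power_mem)
  also have "w (of_nat p + (\<Sum>i<p. x ^ i - 1)) \<le> max r (1 / p)"
    using assms r0 wx by (intro w_add_le w_sum_le sum_mem) (auto simp: w_p le_max_iff_disj intro!: power_near_1)
  hence "w (x - 1) * w (of_nat p + (\<Sum>i<p. x ^ i - 1)) \<le> r * max r (1 / p)"
    using assms r0 by (intro mult_mono) (auto intro!: w_nonneg add_mem sum_mem)
  finally show ?thesis by simp
qed

text \<open>Every further \<open>p\<close>-th power gains at least the fixed factor
  \<open>max r (1 / p) < 1\<close>, so the convergence to 1 is geometric.\<close>

lemma p_power_near_1:
  assumes "x \<in> E" "w (x - 1) \<le> r" "r < 1"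
  shows "w (x ^ (p ^ n) - 1) \<le> r * max r (1 / p) ^ n"
proof (induction n)
  case (Suc n)
  have r0: "r \<ge> 0" using w_nonneg[OF diff_mem[OF assms(1) one_mem]] assms(2) by linarith
  let ?t = "max r (1 / p)"
  have t: "?t \<ge> 0" "?t < 1" using r0 assms(3) p_gt_1 by auto
  have "?t ^ n \<le> 1" using t by (simp add: power_le_one)
  hence le: "r * ?t ^ n \<le> r" using r0 by (simp add: mult_left_le)
  have "w ((x ^ p ^ n) ^ p - 1) \<le> (r * ?t ^ n) * max (r * ?t ^ n) (1 / p)"
    using Suc assms le by (intro p_power_near_1_step) auto
  also have "\<dots> \<le> (r * ?t ^ n) * ?t" using le r0 t by (intro mult_left_mono) auto
  finally show ?case unfolding power_Suc2 power_mult mult.assoc .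
qed (use assms in simp)

lemma p_power_mult_near_1:
  assumes "x \<in> E" "w (x - 1) \<le> r" "r < 1" "int p ^ n dvd k"
  shows "w (x powi k - 1) \<le> r * max r (1 / p) ^ n"
proof -
  have r0: "r \<ge> 0" using w_nonneg[OF diff_mem[OF assms(1) one_mem]] assms(2) by linarith
  have wx: "w x = 1" using assms by (intro w_eq_1_if_near_1) auto
  obtain j where j: "k = int p ^ n * j" using assms(4) by blast
  have "x powi k = (x ^ (p ^ n)) powi j"
    by (simp add: j power_int_mult flip: power_int_of_nat of_nat_power)
  thus ?thesis using p_power_near_1[OF assms(1-3), of n] wx r0 assms(1)
    by (auto intro!: power_int_near_1 simp: w_power)
qed

text \<open>All terms of the binomial expansion beyond the linear one are divisible by
  \<open>t ^ 2\<close>. Divisibility of \<open>n\<close> by \<open>p\<close> is not yet exploited;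
  that is the task of \<open>power_expansion\<close>.\<close>

lemma quadratic_error:
  assumes "t \<in> E" "w t \<le> 1"
  shows "w ((1 + t) ^ n - 1 - of_nat n * t) \<le> (w t)\<^sup>2"
proof (induction n)
  case (Suc n)
  have "(1 + t) ^ Suc n - 1 - of_nat (Suc n) * t =
      (1 + t) * ((1 + t) ^ n - 1 - of_nat n * t) + of_nat n * t\<^sup>2"
    by (simp add: algebra_simps power2_eq_square)
  moreover have "w ((1 + t) * ((1 + t) ^ n - 1 - of_nat n * t)) \<le> 1 * (w t)\<^sup>2"
  proof -
    have "w (1 + t) \<le> 1" using assms by (intro w_add_le) auto
    hence "w (1 + t) * w ((1 + t) ^ n - 1 - of_nat n * t) \<le> 1 * (w t)\<^sup>2"
      using Suc assms by (intro mult_mono) (auto intro!: w_nonneg)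
    thus ?thesis using assms by (subst w_mult) auto
  qed
  moreover have "w (of_nat n * t\<^sup>2) \<le> 1 * (w t)\<^sup>2"
  proof -
    have "w (of_nat n) * (w t)\<^sup>2 \<le> 1 * (w t)\<^sup>2" by (intro mult_right_mono w_of_nat_le_1) auto
    thus ?thesis using assms by (simp add: w_mult w_power power_mem)
  qed
  ultimately show ?case using assms by (auto intro!: w_add_le add_mem diff_mem mult_mem power_mem simp only: one_mem)
qed simp

text \<open>The linear term must dominate uniformly in \<open>n\<close>, even when \<open>n\<close>
  is divisible by a high power of \<open>p\<close>. For \<open>n\<close> prime to \<open>p\<close>
  and for \<open>n = p\<close> the quadratic estimate suffices; otherwise one factor
  \<open>p\<close> is peeled off by writing \<open>(1 + t) ^ p\<close> as \<open>1 + s\<close> with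
  \<open>s\<close> close to \<open>p t\<close>, and the induction continues with \<open>s\<close>
  and the cofactor.\<close>

lemma power_expansion:
  assumes "t \<in> E" "w t \<le> 1 / real p ^ 2"
  shows "w ((1 + t) ^ n - 1 - of_nat n * t) \<le> w (of_nat n) * w t / p"
  using assms
proof (induction n arbitrary: t rule: less_induct)
  case (less n)
  have wt0: "w t \<ge> 0" using less.prems w_nonneg by simp
  have p1: "1 / real p ^ 2 \<le> 1 / real p" "1 / real p \<le> 1"
    using p_gt_1 by (auto simp: field_simps power2_eq_square)
  have wt1: "w t \<le> 1" using less.prems p1 by linarith
  have sq: "(w t)\<^sup>2 \<le> w t / real p ^ 2"
    using mult_left_mono[OF less.prems(2) wt0] by (simp add: power2_eq_square)
  consider "n = 0" | "n > 0" "\<not> p dvd n" | "n = p" | c where "n = p * c" "c > 1"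
    by (metis dvdE gr0I mult.right_neutral mult_0_right nat_neq_iff less_one)
  thus ?case
  proof cases
    case 1
    thus ?thesis by simp
  next
    case 2
    hence "w (of_nat n) = 1" using w_of_int_unit[of "int n"] by simp
    moreover have "w t / real p ^ 2 \<le> w t / p" using mult_left_mono[OF p1(1) wt0] by simp
    ultimately show ?thesis using quadratic_error[OF less.prems(1) wt1, of n] sq by simp
  next
    case 3
    \<comment> \<open>Here the bound \<open>1 / p ^ 2\<close> on \<open>w t\<close> is used in full:
      one factor \<open>1 / p\<close> is \<open>w p\<close>, the other is the gain claimed.\<close>
    have "w t / real p ^ 2 = w (of_nat n) * w t / p" using 3 w_p by (simp add: power2_eq_square)
    thus ?thesis using quadratic_error[OF less.prems(1) wt1, of n] sq by simp
  next
    case (4 c)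
    have c: "c < n" "p < n" using 4 p_gt_1 by auto
    define s where "s = (1 + t) ^ p - 1"
    define e where "e = s - of_nat p * t"
    have mem: "s \<in> E" "e \<in> E" using less.prems by (auto simp: s_def e_def)
    have e: "w e \<le> w (of_nat p) * w t / p" using less.IH[OF c(2) less.prems] by (simp add: e_def s_def)
    also have "w (of_nat p) * w t / p \<le> w (of_nat p) * w t" using p_gt_1 wt0 w_nonneg[of "of_nat p"]
      by (simp add: divide_le_eq mult_le_cancel_left1 not_less)
    finally have "w (of_nat p * t + e) \<le> w (of_nat p) * w t"
      using less.prems mem by (intro w_add_le) (auto simp: w_mult)
    hence ws: "w s \<le> w (of_nat p) * w t" by (simp add: e_def)
    also have "\<dots> \<le> w t" using wt0 w_of_nat_le_1[of p] by (simp add: mult_left_le_one_le w_nonneg)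
    finally have ws': "w s \<le> 1 / real p ^ 2" using less.prems by simp
    have "(1 + t) ^ n = (1 + s) ^ c" by (simp add: 4 s_def power_mult)
    hence "(1 + t) ^ n - 1 - of_nat n * t = ((1 + s) ^ c - 1 - of_nat c * s) + of_nat c * e"
      by (simp add: e_def 4 algebra_simps)
    moreover have "w ((1 + s) ^ c - 1 - of_nat c * s) \<le> w (of_nat n) * w t / p"
    proof -
      have "w ((1 + s) ^ c - 1 - of_nat c * s) \<le> w (of_nat c) * w s / p"
        by (rule less.IH[OF c(1) mem(1) ws'])
      also have "\<dots> \<le> w (of_nat c) * (w (of_nat p) * w t) / p"
        using ws w_nonneg[of "of_nat c"] by (intro divide_right_mono mult_left_mono) auto
      finally show ?thesis by (simp add: 4 w_mult ac_simps)
    qed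
    moreover have "w (of_nat c * e) \<le> w (of_nat n) * w t / p"
    proof -
      have "w (of_nat c * e) \<le> w (of_nat c) * (w (of_nat p) * w t / p)"
        unfolding w_mult[OF of_nat_mem mem(2)] using w_nonneg[of "of_nat c"] by (intro mult_left_mono[OF e]) auto
      thus ?thesis by (simp add: 4 w_mult ac_simps)
    qed
    ultimately show ?thesis using less.prems mem by (auto intro!: w_add_le simp only: add_mem diff_mem mult_mem power_mem of_nat_mem one_mem)
  qed
qed

text \<open>For a negative exponent, division by the unit \<open>(1 + t) ^ n\<close> combines the
  old error with \<open>n t ((1 + t) ^ n - 1)\<close>, which gains the factor \<open>1 / p\<close>
  because \<open>(1 + t) ^ n\<close> is within \<open>1 / p\<close> of 1.\<close>

lemma power_int_expansion:
  assumes "t \<in> E" "w t \<le> 1 / real p ^ 2"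
  shows "w ((1 + t) powi b - 1 - of_int b * t) \<le> w (of_int b) * w t / p"
proof (cases "b \<ge> 0")
  case True
  thus ?thesis using power_expansion[OF assms, of "nat b"] by (simp add: power_int_def)
next
  case False
  define n where "n = nat (- b)"
  have b: "b = - int n" using False by (simp add: n_def)
  have wt0: "w t \<ge> 0" using assms w_nonneg by simp
  have p1: "1 / real p ^ 2 \<le> 1 / real p" "1 / real p < 1"
    using p_gt_1 by (auto simp: field_simps power2_eq_square)
  have wt: "w t \<le> 1 / p" "w t < 1" using assms p1 by linarith+
  define e where "e = (1 + t) ^ n - 1 - of_nat n * t"
  have mem: "e \<in> E" using assms by (auto simp: e_def)
  define B where "B = w (of_nat n) * w t / p"
  have e: "w e \<le> B" unfolding e_def B_def by (rule power_expansion[OF assms])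
  have B0: "B \<ge> 0" using wt0 w_nonneg[of "of_nat n"] by (simp add: B_def)
  have w1: "w (1 + t) = 1" using w_add_eq[of 1 t] wt assms by simp
  hence w1n: "w ((1 + t) ^ n) = 1" using assms by (simp add: w_power add_mem)
  have nz: "(1 + t) ^ n \<noteq> 0" using w1 by auto
  have "(1 + t) powi b - 1 - of_int b * t = (1 - (1 + t) ^ n + of_nat n * t * (1 + t) ^ n) / (1 + t) ^ n"
    using nz by (simp add: b power_int_minus field_simps)
  also have "1 - (1 + t) ^ n + of_nat n * t * (1 + t) ^ n = of_nat n * t * ((1 + t) ^ n - 1) - e"
    by (simp add: e_def algebra_simps)
  finally have "w ((1 + t) powi b - 1 - of_int b * t) = w (of_nat n * t * ((1 + t) ^ n - 1) - e)"
    using w1n assms mem by (simp add: w_divide diff_mem mult_mem add_mem power_mem)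
  also have "\<dots> \<le> B"
  proof (rule w_diff_le)
    have "w ((1 + t) ^ n - 1) \<le> 1 / p" using assms wt w1 by (intro power_near_1) auto
    hence "w (of_nat n) * w t * w ((1 + t) ^ n - 1) \<le> w (of_nat n) * w t * (1 / p)"
      using wt0 w_nonneg[of "of_nat n"] by (intro mult_left_mono) auto
    thus "w (of_nat n * t * ((1 + t) ^ n - 1)) \<le> B"
      using assms by (simp add: w_mult mult_mem diff_mem add_mem power_mem B_def)
  qed (use assms mem e in auto)
  finally show ?thesis using w_minus[of "of_nat n"] by (simp add: B_def b)
qed

text \<open>The linear term strictly dominates its error, so the distance of a power from 1 measures
  the exponent exactly. In this way a limit of powers yields a limit of exponents.\<close>

lemma w_power_int_minus_1:
  assumes "t \<in> E" "w t \<le> 1 / real p ^ 2"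
  shows "w ((1 + t) powi b - 1) = w (of_int b) * w t"
proof (cases "b = 0 \<or> t = 0")
  case False
  hence pos: "w (of_int b) * w t > 0"
    using assms w_nonneg[of t] w_nonneg[of "of_int b"] w_eq_0[of t] w_eq_0[of "of_int b"] by (simp add: less_le)
  have "w (of_int b) * w t / p < w (of_int b) * w t"
    using mult_strict_left_mono[of 1 "real p", OF _ pos] p_gt_1 by (simp add: pos_divide_less_eq)
  hence "w ((1 + t) powi b - 1 - of_int b * t) < w (of_int b * t)"
    using power_int_expansion[OF assms, of b] assms by (simp add: w_mult)
  hence "w (of_int b * t + ((1 + t) powi b - 1 - of_int b * t)) = w (of_int b * t)"
    using assms by (intro w_add_eq) auto
  thus ?thesis using assms by (simp add: w_mult)
qed auto

text \<open>Modulo \<open>p\<close> the power \<open>(x - 1) ^ p\<close> agrees with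
  \<open>x ^ p - 1\<close>, the middle binomial coefficients being divisible by \<open>p\<close>; so
  Frobenius is injective on residue classes.\<close>

lemma frobenius_near_1:
  assumes "x \<in> E" "w x \<le> 1" "w (x ^ p - 1) < 1"
  shows "w (x - 1) < 1"
proof -
  define r where "r = (\<Sum>k\<in>{0<..<p}. of_nat (p choose k) * x ^ k * (-1) ^ (p - k))"
  have r: "w r \<le> 1 / p"
    unfolding r_def
  proof (rule w_sum_le)
    fix k assume k: "k \<in> {0<..<p}"
    show "of_nat (p choose k) * x ^ k * (-1) ^ (p - k) \<in> E" using assms by (auto intro!: mult_mem minus_mem power_mem)
    have "p dvd (p choose k)" using k prime_p by (intro dvd_choose_prime) auto
    hence "w (of_nat (p choose k)) \<le> 1 / p" using w_of_int_le_iff[of "int (p choose k)" 1] by simp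
    moreover have "w (x ^ k * (-1) ^ (p - k)) \<le> 1"
      using assms w_nonneg by (simp add: w_mult w_power power_mem minus_mem w_minus_1 power_le_one)
    ultimately have "w (of_nat (p choose k)) * w (x ^ k * (-1) ^ (p - k)) \<le> 1 / p * 1"
      using assms by (intro mult_mono) (auto intro!: w_nonneg mult_mem power_mem minus_mem)
    thus "w (of_nat (p choose k) * x ^ k * (-1) ^ (p - k)) \<le> 1 / p"
      using assms by (simp add: mult.assoc w_mult mult_mem power_mem minus_mem)
  qed simp
  have rE: "r \<in> E" unfolding r_def using assms by (auto intro!: sum_mem mult_mem minus_mem power_mem)
  have set: "{..p} = insert 0 (insert p {0<..<p})" using p_gt_1 by auto
  have "(x + (-1)) ^ p = (\<Sum>k\<le>p. of_nat (p choose k) * x ^ k * (-1) ^ (p - k))" by (rule binomial_ring)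
  also have "\<dots> = (-1) ^ p + x ^ p + r" unfolding set r_def using p_gt_1 by simp
  also have "\<dots> = (x ^ p - 1) + (r + ((-1) ^ p + 1))" by simp
  finally have eq: "(x - 1) ^ p = (x ^ p - 1) + (r + ((-1) ^ p + 1))" by simp
  \<comment> \<open>The sign matters only for \<open>p = 2\<close>, where it contributes 2, which is
    still small.\<close>
  have sgn: "w ((-1) ^ p + 1) < 1"
  proof (cases "even p")
    case True
    hence "p = 2" using prime_p primes_dvd_imp_eq two_is_prime_nat by blast
    thus ?thesis using w_p by simp
  qed simp
  have "w r < 1" using r p_gt_1 by (auto intro: le_less_trans)
  hence "w (r + ((-1) ^ p + 1)) < 1" using sgn rE by (intro w_add_less[of r "(-1) ^ p + 1"]) auto
  hence "w ((x - 1) ^ p) < 1" unfolding eq using assms rE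
    by (intro w_add_less[of "x ^ p - 1"]) auto
  hence "w (x - 1) ^ p < 1" using assms by (simp add: w_power diff_mem)
  thus ?thesis using w_nonneg[of "x - 1"] assms by (metis diff_mem linorder_not_less one_le_power one_mem)
qed

lemma frobenius_power_near_1:
  assumes "x \<in> E" "w x \<le> 1" "w (x ^ (p ^ n) - 1) < 1"
  shows "w (x - 1) < 1"
  using assms
proof (induction n)
  case (Suc n)
  have "w ((x ^ p ^ n) ^ p - 1) < 1" using Suc.prems(3) unfolding power_Suc2 power_mult .
  hence "w (x ^ p ^ n - 1) < 1"
    using frobenius_near_1[of "x ^ p ^ n"] Suc.prems(1,2) w_nonneg[of x] by (auto simp: w_power power_le_one)
  thus ?case using Suc by simp
qed simp

text \<open>The residue class of a unit has finite order, by the pigeonhole principle on the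
  \<open>p\<close>-power Frobenius orbit.\<close>

lemma residue_order:
  assumes u: "u \<in> E" "algebraic_int u" "w u = 1"
  obtains f where "f > 0" "w (u ^ (p ^ f - 1) - 1) < 1"
proof -
  obtain n c where n: "n > 0" "u ^ n = (\<Sum>i<n. of_int (c i) * u ^ i)"
    using algebraic_int_power_reduce[OF u(2)] by metis
  define B where "B = (\<lambda>i. u ^ i) ` {..<n}"
  have fin: "finite B" by (simp add: B_def)
  have BE: "B \<subseteq> E" and B1: "w b \<le> 1" if "b \<in> B" for b using u that by (auto simp: B_def w_power)
  have cl: "u * b \<in> int_span B" if b: "b \<in> B" for b
  proof -
    obtain i where i: "b = u ^ i" "i < n" using b by (auto simp: B_def)
    show ?thesis
    proof (cases "Suc i < n")
      case True
      hence "u * b \<in> B" using i by (auto simp: B_def intro!: image_eqI[of _ _ "Suc i"])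
      thus ?thesis using int_span_base fin by simp
    next
      case False
      hence "Suc i = n" using i by simp
      hence "u * b = u ^ n" using i by auto
      also have "\<dots> \<in> int_span B" unfolding n(2)
        by (intro int_span_sum int_span_scale int_span_base fin) (auto simp: B_def)
      finally show ?thesis .
    qed
  qed
  have one: "1 \<in> int_span B"
    using n(1) fin by (intro int_span_base) (auto simp: B_def intro!: image_eqI[of _ _ 0])
  have pow: "u ^ k \<in> int_span B" for k
    by (induction k) (use one cl int_span_mult_closed in auto)
  \<comment> \<open>Reducing coefficients modulo \<open>p\<close> leaves finitely many combinations,
    and every power of \<open>u\<close> has the residue of one of them.\<close>
  define S where "S = (\<lambda>r. \<Sum>b\<in>B. of_int (r b) * b) ` (PiE B (\<lambda>_. {0..<int p}))"
  have finS: "finite S" unfolding S_def using fin by (intro finite_imageI finite_PiE) auto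
  have SE: "S \<subseteq> E" unfolding S_def using BE by (auto intro!: sum_mem mult_mem simp: B_def u)
  have "\<exists>s\<in>S. w (u ^ k - s) < 1" for k
  proof -
    obtain d where d: "u ^ k = (\<Sum>b\<in>B. of_int (d b) * b)" using pow[of k] by (auto simp: int_span_def)
    define r where "r = (\<lambda>b\<in>B. d b mod int p)"
    have rS: "(\<Sum>b\<in>B. of_int (r b) * b) \<in> S"
      unfolding S_def r_def using p_gt_1 by (intro imageI) auto
    have "w ((\<Sum>b\<in>B. of_int (d b) * b) - (\<Sum>b\<in>B. of_int (r b) * b)) = w (\<Sum>b\<in>B. of_int (d b - r b) * b)"
      by (simp add: sum_subtractf algebra_simps)
    also have "\<dots> \<le> 1 / p"
    proof (rule w_sum_le)
      fix b assume b: "b \<in> B"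
      have "int p dvd d b - r b" using b by (simp add: r_def dvd_minus_mod)
      hence "w (of_int (d b - r b)) \<le> 1 / p" using w_of_int_le_iff[of "d b - r b" 1] by simp
      moreover have bE: "b \<in> E" using b u by (auto simp: B_def)
      ultimately have "w (of_int (d b - r b)) * w b \<le> 1 / p * 1"
        using B1[OF b] by (intro mult_mono) (auto intro!: w_nonneg)
      thus "w (of_int (d b - r b) * b) \<le> 1 / p" using bE by (subst w_mult) auto
      show "of_int (d b - r b) * b \<in> E" using bE by blast
    qed simp
    also have "\<dots> < 1" using p_gt_1 by simp
    finally show ?thesis using rS d by auto
  qed
  then obtain s where s: "\<And>k. s k \<in> S" "\<And>k. w (u ^ k - s k) < 1" by metis
  have "\<not> inj (\<lambda>j. s (p ^ j))"
    using finS s(1) finite_subset[of "range (\<lambda>j. s (p ^ j))" S] finite_imageD[of "\<lambda>j. s (p ^ j)" UNIV]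
    by (metis image_subsetI infinite_UNIV_nat)
  then obtain k l where kl: "k < l" "s (p ^ k) = s (p ^ l)"
    by (metis injI linorder_neqE_nat)
  have sE: "s k \<in> E" for k using s SE by auto
  have "w ((u ^ p ^ l - s (p ^ l)) - (u ^ p ^ k - s (p ^ k))) < 1"
    by (intro w_diff_less s(2) diff_mem power_mem u(1) sE)
  hence lt: "w (u ^ p ^ l - u ^ p ^ k) < 1" using kl by (simp add: algebra_simps)
  define f where "f = l - k"
  have l: "l = f + k" using kl by (simp add: f_def)
  \<comment> \<open>The difference of two congruent Frobenius iterates is a unit times a
    \<open>p ^ k\<close>-th power minus 1; injectivity of Frobenius then removes the exponent
    \<open>p ^ k\<close>.\<close>
  have "p ^ l = p ^ k + p ^ k * (p ^ f - 1)" using p_gt_1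
    by (simp add: l power_add algebra_simps)
  hence "u ^ p ^ l - u ^ p ^ k = u ^ p ^ k * ((u ^ (p ^ f - 1)) ^ p ^ k - 1)"
    by (simp add: power_add power_mult[symmetric] algebra_simps)
  hence "w ((u ^ (p ^ f - 1)) ^ p ^ k - 1) < 1" using lt u by (simp add: w_mult w_power power_mem diff_mem)
  hence "w (u ^ (p ^ f - 1) - 1) < 1"
    by (rule frobenius_power_near_1[rotated 2]) (use u in \<open>auto simp: w_power\<close>)
  moreover have "f > 0" using kl by (simp add: f_def)
  ultimately show ?thesis using that by blast
qed

end

section \<open>Existence of places\<close>

lemma power_int_power_nat: "(x powi i) ^ n = (x :: complex) powi (i * int n)"
  by (simp add: power_int_mult)

text \<open>Chevalley's argument: a subring that is maximal among those not containing \<open>1 / p\<close> is a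
  valuation ring; its real-valued valuation is the Dedekind cut \<open>{k / n. x ^ n / p ^ k \<in> A}\<close>.\<close>

locale chevalley = complex_subfield E for E :: "complex set" +
  fixes A :: "complex set" and p :: nat
  assumes prime_p: "Factorial_Ring.prime p"
    and AE: "A \<subseteq> E" and A1: "1 \<in> A"
    and A_diff: "\<And>x y. x \<in> A \<Longrightarrow> y \<in> A \<Longrightarrow> x - y \<in> A"
    and A_mult: "\<And>x y. x \<in> A \<Longrightarrow> y \<in> A \<Longrightarrow> x * y \<in> A"
    and no_p: "inverse (of_nat p) \<notin> A"
    and A_max: "\<And>B. A \<subseteq> B \<Longrightarrow> B \<subseteq> E \<Longrightarrow> (\<And>x y. x \<in> B \<Longrightarrow> y \<in> B \<Longrightarrow> x - y \<in> B) \<Longrightarrow>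
       (\<And>x y. x \<in> B \<Longrightarrow> y \<in> B \<Longrightarrow> x * y \<in> B) \<Longrightarrow> inverse (of_nat p) \<notin> B \<Longrightarrow> B = A"
    and A_units: "\<And>x. x \<in> E \<Longrightarrow> \<exists>d::nat. d > 0 \<and> \<not> p dvd d \<and> algebraic_int (of_nat d * x) \<Longrightarrow> x \<in> A"
    and E_alg: "\<And>x. x \<in> E \<Longrightarrow> \<exists>d::nat. d > 0 \<and> algebraic_int (of_nat d * x)"
begin

lemma p0: "of_nat p \<noteq> (0 :: complex)" using prime_p prime_gt_0_nat by force

lemma A0: "0 \<in> A" using A_diff[OF A1 A1] by simp

lemma A_minus: "x \<in> A \<Longrightarrow> - x \<in> A" using A_diff[OF A0] by simp

lemma A_add: "x \<in> A \<Longrightarrow> y \<in> A \<Longrightarrow> x + y \<in> A" using A_diff[of x "-y"] A_minus by simp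

lemma A_sum: "(\<And>i. i \<in> I \<Longrightarrow> f i \<in> A) \<Longrightarrow> sum f I \<in> A"
  by (induction I rule: infinite_finite_induct) (auto simp: A0 A_add)

lemma A_pow: "x \<in> A \<Longrightarrow> x ^ n \<in> A"
  by (induction n) (auto simp: A1 A_mult)

lemma A_of_nat: "of_nat n \<in> A" by (induction n) (auto simp: A0 A1 A_add)

text \<open>A witness that \<open>1 / p\<close> lies in the ring \<open>A[y]\<close>. Its degree is
  recorded because the valuation property is proved by lowering it.\<close>

definition expressible :: "complex \<Rightarrow> nat \<Rightarrow> bool"
  where "expressible y n \<longleftrightarrow> (\<exists>c. (\<forall>i. c i \<in> A) \<and> inverse (of_nat p) = (\<Sum>i\<le>n. c i * y ^ i))"

text \<open>The ring \<open>A[y]\<close> is strictly larger than \<open>A\<close>, so by maximality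
  it contains the forbidden element \<open>1 / p\<close>.\<close>

lemma expressible_if_notin:
  assumes "y \<in> E" "y \<notin> A"
  shows "\<exists>n. expressible y n"
proof (rule ccontr)
  assume no: "\<not> ?thesis"
  define B where "B = {poly q y | q. \<forall>i. coeff q i \<in> A}"
  have "B = A"
  proof (rule A_max)
    show "A \<subseteq> B"
    proof
      fix x assume "x \<in> A"
      hence "\<forall>i. coeff [:x:] i \<in> A" using A0 by (auto simp: coeff_pCons split: nat.splits)
      moreover have "x = poly [:x:] y" by simp
      ultimately show "x \<in> B" unfolding B_def by blast
    qed
    show "B \<subseteq> E" using AE assms by (auto simp: B_def poly_altdef intro!: sum_mem mult_mem power_mem)
    show "x - z \<in> B" if "x \<in> B" "z \<in> B" for x z
    proof -
      from that obtain q r where qr: "x = poly q y" "\<forall>i. coeff q i \<in> A" "z = poly r y" "\<forall>i. coeff r i \<in> A"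
        unfolding B_def by blast
      have "x - z = poly (q - r) y" "\<forall>i. coeff (q - r) i \<in> A" using qr A_diff by auto
      thus ?thesis unfolding B_def by blast
    qed
    show "x * z \<in> B" if "x \<in> B" "z \<in> B" for x z
    proof -
      from that obtain q r where qr: "x = poly q y" "\<forall>i. coeff q i \<in> A" "z = poly r y" "\<forall>i. coeff r i \<in> A"
        unfolding B_def by blast
      have "x * z = poly (q * r) y" "\<forall>i. coeff (q * r) i \<in> A"
        using qr by (simp_all add: coeff_mult A_sum A_mult)
      thus ?thesis unfolding B_def by blast
    qed
    show "inverse (of_nat p) \<notin> B"
    proof
      assume "inverse (of_nat p) \<in> B"
      then obtain q where "inverse (of_nat p) = poly q y" "\<forall>i. coeff q i \<in> A" unfolding B_def by blast
      hence "expressible y (degree q)" unfolding expressible_def poly_altdef by blast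
      thus False using no by blast
    qed
  qed
  moreover have "y \<in> B"
  proof -
    have "\<forall>i. coeff [:0, 1:] i \<in> A" using A0 A1 by (auto simp: coeff_pCons split: nat.splits)
    moreover have "y = poly [:0, 1:] y" by simp
    ultimately show ?thesis unfolding B_def by blast
  qed
  ultimately show False using assms by blast
qed

text \<open>Otherwise \<open>1 / p\<close> would be a polynomial in \<open>1 / s\<close>. Clearing
  denominators puts \<open>s ^ n / p\<close> into \<open>A\<close>; as \<open>s ^ n\<close> is 1
  modulo \<open>p A\<close>, the element \<open>1 / p\<close> would be in \<open>A\<close> as
  well.\<close>

lemma inverse_one_minus_p:
  assumes d: "d \<in> A"
  defines "s \<equiv> 1 - of_nat p * d"
  shows "s \<noteq> 0" "inverse s \<in> A"
proof -
  show s0: "s \<noteq> 0"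
  proof
    assume "s = 0"
    hence "inverse (of_nat p) = d" using p0 by (simp add: s_def field_simps)
    thus False using no_p d by simp
  qed
  have sA: "s \<in> A" using d A1 A_of_nat A_mult A_diff by (simp add: s_def)
  show "inverse s \<in> A"
  proof (rule ccontr)
    assume "inverse s \<notin> A"
    then obtain n c where c: "\<forall>i. c i \<in> A" "inverse (of_nat p) = (\<Sum>i\<le>n. c i * inverse s ^ i)"
      using expressible_if_notin[of "inverse s"] sA AE unfolding expressible_def by blast
    define b where "b = (\<Sum>i\<le>n. c i * s ^ (n - i))"
    have bA: "b \<in> A" unfolding b_def using c sA by (intro A_sum A_mult A_pow) auto
    have "s ^ n * inverse (of_nat p) = (\<Sum>i\<le>n. c i * (s ^ n * inverse s ^ i))"
      unfolding c(2) by (simp add: sum_distrib_left ac_simps)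
    also have "\<dots> = b" unfolding b_def
      using s0 by (intro sum.cong) (auto simp: power_diff field_simps)
    finally have sn: "s ^ n * inverse (of_nat p) = b" .
    have "\<exists>b'\<in>A. s ^ m = 1 - of_nat p * b'" for m
    proof (induction m)
      case 0
      show ?case using A0 by auto
    next
      case (Suc m)
      then obtain b' where b': "b' \<in> A" "s ^ m = 1 - of_nat p * b'" by blast
      have "s ^ Suc m = 1 - of_nat p * (d + b' - of_nat p * (d * b'))"
        unfolding power_Suc b'(2) by (simp add: s_def algebra_simps)
      moreover have "d + b' - of_nat p * (d * b') \<in> A"
        using d b' by (intro A_diff A_add A_mult A_of_nat)
      ultimately show ?case by blast
    qed
    then obtain b' where b': "b' \<in> A" "s ^ n = 1 - of_nat p * b'" by blast
    have "inverse (of_nat p) = b + b'" using sn p0 unfolding b'(2) by (simp add: field_simps)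
    thus False using no_p A_add bA b' by simp
  qed
qed

text \<open>The constant term of the expression in \<open>1 / y\<close> is absorbed into the unit
  \<open>1 - p d 0\<close>. After multiplication by \<open>y ^ n\<close> the relation writes
  \<open>y ^ n\<close> through lower powers, which eliminates the top term of the expression in
  \<open>y\<close>.\<close>

lemma expressible_reduce:
  assumes y: "y \<noteq> 0" and n: "expressible y n" and m: "expressible (inverse y) m" and mn: "m \<le> n"
  shows "\<exists>n'<n. expressible y n'"
proof -
  obtain c where c: "\<And>i. c i \<in> A" "inverse (of_nat p) = (\<Sum>i\<le>n. c i * y ^ i)"
    using n unfolding expressible_def by blast
  obtain d where d: "\<And>i. d i \<in> A" "inverse (of_nat p) = (\<Sum>i\<le>m. d i * inverse y ^ i)"
    using m unfolding expressible_def by blast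
  have m0: "m > 0" using d no_p by (cases m) auto
  then obtain n' where n': "n = Suc n'" using mn by (cases n) auto
  define s where "s = 1 - of_nat p * d 0"
  have s: "s \<noteq> 0" "inverse s \<in> A" using inverse_one_minus_p[OF d(1)[of 0]] by (auto simp: s_def)
  have "{..m} = insert 0 {1..m}" by auto
  hence "inverse (of_nat p) = d 0 + (\<Sum>i=1..m. d i * inverse y ^ i)" using d(2) by simp
  hence "1 = of_nat p * (d 0 + (\<Sum>i=1..m. d i * inverse y ^ i))"
    using p0 by (metis right_inverse)
  hence h: "s = of_nat p * (\<Sum>i=1..m. d i * inverse y ^ i)" by (simp add: s_def algebra_simps)
  have "1 = inverse s * s" using s(1) by simp
  hence "1 = inverse s * (of_nat p * (\<Sum>i=1..m. d i * inverse y ^ i))" unfolding h[symmetric] .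
  hence "y ^ n = y ^ n * (inverse s * (of_nat p * (\<Sum>i=1..m. d i * inverse y ^ i)))" by simp
  also have "\<dots> = inverse s * (of_nat p * (\<Sum>i=1..m. d i * (y ^ n * inverse y ^ i)))"
    by (simp add: sum_distrib_left mult.left_commute)
  finally have "y ^ n = \<dots>" .
  also have "(\<Sum>i=1..m. d i * (y ^ n * inverse y ^ i)) = (\<Sum>i=1..m. d i * y ^ (n - i))"
    using mn y by (intro sum.cong) (auto simp: power_diff field_simps)
  also have "\<dots> = (\<Sum>j\<in>{n-m..n'}. d (n - j) * y ^ j)"
    using mn m0 n' by (intro sum.reindex_bij_witness[of _ "\<lambda>j. n - j" "\<lambda>i. n - i"]) auto
  finally have yn: "y ^ n = inverse s * (of_nat p * (\<Sum>j\<in>{n-m..n'}. d (n - j) * y ^ j))" .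
  define e where "e = (\<lambda>j. if n - m \<le> j then inverse s * of_nat p * d (n - j) else 0)"
  have eA: "e j \<in> A" for j unfolding e_def using s d by (auto intro!: A_mult A_of_nat A0)
  have "(\<Sum>j\<le>n'. e j * y ^ j) = (\<Sum>j\<in>{n-m..n'}. inverse s * of_nat p * d (n - j) * y ^ j)"
    by (rule sum.mono_neutral_cong_right) (auto simp: e_def)
  hence yn': "y ^ n = (\<Sum>j\<le>n'. e j * y ^ j)" unfolding yn by (simp add: sum_distrib_left ac_simps)
  have "inverse (of_nat p) = (\<Sum>i\<le>n'. c i * y ^ i) + c n * (\<Sum>j\<le>n'. e j * y ^ j)"
    unfolding yn'[symmetric] c(2) n' by simp
  also have "\<dots> = (\<Sum>i\<le>n'. (c i + c n * e i) * y ^ i)"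
    by (simp add: sum_distrib_left sum.distrib algebra_simps)
  finally have "expressible y n'" unfolding expressible_def
    using c(1) eA by (intro exI[of _ "\<lambda>i. c i + c n * e i"]) (auto intro!: A_add A_mult)
  thus ?thesis using n' by blast
qed

text \<open>If neither \<open>y\<close> nor its inverse were in \<open>A\<close>, both would express
  \<open>1 / p\<close>; in a pair of degrees with least sum the larger one could still be
  lowered.\<close>

lemma valuation_ring:
  assumes "y \<in> E"
  shows "y \<in> A \<or> inverse y \<in> A"
proof (rule ccontr)
  assume no: "\<not> ?thesis"
  hence y0: "y \<noteq> 0" using A0 by auto
  define P where "P = (\<lambda>k. \<exists>n m. k = n + m \<and> expressible y n \<and> expressible (inverse y) m)"
  have "\<exists>k. P k" using expressible_if_notin[of y] expressible_if_notin[of "inverse y"] no assms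
    unfolding P_def by blast
  define k where "k = (LEAST k. P k)"
  have Pk: "P k" unfolding k_def using \<open>\<exists>k. P k\<close> by (rule LeastI_ex)
  have least: "\<not> P j" if "j < k" for j using that not_less_Least unfolding k_def by blast
  obtain n m where nm: "k = n + m" "expressible y n" "expressible (inverse y) m" using Pk P_def by blast
  show False
  proof (cases "m \<le> n")
    case True
    then obtain n' where "n' < n" "expressible y n'" using expressible_reduce[OF y0 nm(2,3)] by blast
    thus False using least[of "n' + m"] nm unfolding P_def by auto
  next
    case False
    then obtain m' where "m' < m" "expressible (inverse y) m'"
      using expressible_reduce[of "inverse y" m n] y0 nm(2,3) by auto
    thus False using least[of "n + m'"] nm unfolding P_def by auto
  qed
qed

lemma root_closed: assumes "z \<in> E" "n > 0" "z ^ n \<in> A" shows "z \<in> A"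
proof (rule ccontr)
  assume z: "z \<notin> A"
  hence "inverse z \<in> A" using valuation_ring assms by blast
  hence "z ^ n * inverse z ^ (n - 1) \<in> A" by (rule A_mult[OF assms(3) A_pow])
  moreover have "z \<noteq> 0" using z A0 by auto
  hence "z ^ n * inverse z ^ (n - 1) = z" using assms(2)
    by (cases n) (auto simp: power_inverse)
  ultimately show False using z by metis
qed

lemma powi_p: "of_nat p powi k \<in> A \<longleftrightarrow> k \<ge> 0"
proof
  assume k: "of_nat p powi k \<in> A"
  show "k \<ge> 0"
  proof (rule ccontr)
    assume neg: "\<not> k \<ge> 0"
    hence "inverse (of_nat p) ^ nat (- k) \<in> A" using k by (simp add: power_int_def)
    hence "inverse (of_nat p) \<in> A" using neg root_closed[of "inverse (of_nat p)" "nat (- k)"] by auto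
    thus False using no_p by simp
  qed
qed (auto simp: power_int_def intro!: A_pow A_of_nat)

section \<open>The real-valued valuation of the valuation ring\<close>

definition cut :: "complex \<Rightarrow> real set"
  where "cut x = {of_int k / of_nat n | k n. n > 0 \<and> x ^ n * of_nat p powi (- k) \<in> A}"

text \<open>Two fractions for the same rational give conditions that agree after taking powers, and
  \<open>root_closed\<close> undoes the powers.\<close>

lemma cut_iff:
  assumes x: "x \<in> E" and n: "n > 0"
  shows "of_int k / of_nat n \<in> cut x \<longleftrightarrow> x ^ n * of_nat p powi (- k) \<in> A"
proof
  assume "of_int k / of_nat n \<in> cut x"
  then obtain k' n' where k': "(of_int k / of_nat n :: real) = of_int k' / of_nat n'" "n' > 0"
    "x ^ n' * of_nat p powi (- k') \<in> A" unfolding cut_def by blast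
  have "of_int k * of_nat n' = (of_int k' * of_nat n :: real)" using k'(1,2) n by (simp add: field_simps)
  hence eq: "k * int n' = k' * int n" by (metis of_int_eq_iff of_int_mult of_int_of_nat_eq)
  have "(x ^ n * of_nat p powi (- k)) ^ n' = (x ^ n' * of_nat p powi (- k')) ^ n"
    using eq by (simp add: power_mult_distrib power_int_power_nat power_mult[symmetric] mult.commute[of n n'])
  hence "(x ^ n * of_nat p powi (- k)) ^ n' \<in> A" using A_pow k' by simp
  thus "x ^ n * of_nat p powi (- k) \<in> A" using x k' root_closed[of "x ^ n * of_nat p powi (- k)" n'] by auto
qed (use n in \<open>auto simp: cut_def\<close>)

text \<open>The part of a denominator prime to \<open>p\<close> is harmless by
  \<open>A_units\<close>, so some power of \<open>p\<close> carries \<open>x\<close> into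
  \<open>A\<close> and provides a member of the cut. The same for \<open>1 / x\<close> provides an
  upper bound.\<close>

lemma cut_bounds:
  assumes x: "x \<in> E" "x \<noteq> 0"
  shows "cut x \<noteq> {}" "bdd_above (cut x)"
proof -
  have ex: "\<exists>j::nat. y * of_nat p ^ j \<in> A" if y: "y \<in> E" for y
  proof -
    obtain d :: nat where d: "d > 0" "algebraic_int (of_nat d * y)" using E_alg[OF y] by blast
    obtain d' where d': "d = p ^ multiplicity p d * d'" "\<not> p dvd d'"
      using multiplicity_decompose'[of d p] d prime_p by (metis not_prime_unit not_gr0)
    have "algebraic_int (of_nat d' * (y * of_nat p ^ multiplicity p d))"
      using d(2) by (subst (asm) d'(1)) (simp add: ac_simps)
    moreover have "d' > 0" using d'(2) by (cases d') auto
    ultimately have "y * of_nat p ^ multiplicity p d \<in> A"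
      using d' y by (intro A_units) auto
    thus ?thesis by blast
  qed
  obtain j where "x * of_nat p ^ j \<in> A" using ex x by blast
  hence "x ^ 1 * of_nat p powi (- (- int j)) \<in> A" by simp
  thus "cut x \<noteq> {}" using cut_iff[OF x(1), of 1 "- int j"] by auto
  obtain j where j: "inverse x * of_nat p ^ j \<in> A" using ex[of "inverse x"] x by blast
  have "q \<le> j" if "q \<in> cut x" for q
  proof -
    from that obtain k n where kn: "q = of_int k / of_nat n" "n > 0" "x ^ n * of_nat p powi (- k) \<in> A"
      unfolding cut_def by blast
    have "(inverse x * of_nat p ^ j) ^ n * (x ^ n * of_nat p powi (- k)) \<in> A"
      by (rule A_mult[OF A_pow[OF j] kn(3)])
    also have "(inverse x * of_nat p ^ j) ^ n * (x ^ n * of_nat p powi (- k)) = of_nat p powi (int (j * n) - k)"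
    proof -
      have "(inverse x * of_nat p ^ j) ^ n * (x ^ n * of_nat p powi (- k))
          = (inverse x * x) ^ n * (of_nat p powi int (j * n) * of_nat p powi (- k))"
        by (simp only: power_mult_distrib power_mult power_int_of_nat ac_simps)
      thus ?thesis using x p0 by (simp add: power_int_diff power_int_minus divide_inverse)
    qed
    finally have "int (j * n) - k \<ge> 0" by (simp add: powi_p)
    hence "of_int k \<le> real j * real n" by (metis diff_ge_0_iff_ge of_int_le_iff of_int_of_nat_eq of_nat_mult)
    thus ?thesis using kn(1,2) by (simp add: divide_le_eq)
  qed
  thus "bdd_above (cut x)" by (auto simp: bdd_above_def)
qed

definition val :: "complex \<Rightarrow> real" where "val x = Sup (cut x)"

lemma cut_le_val: "x \<in> E \<Longrightarrow> x \<noteq> 0 \<Longrightarrow> q \<in> cut x \<Longrightarrow> q \<le> val x"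
  unfolding val_def using cut_bounds by (intro cSup_upper)

lemma cut_add:
  assumes "x \<in> E" "y \<in> E" "q \<in> cut x" "r \<in> cut y"
  shows "q + r \<in> cut (x * y)"
proof -
  obtain k n where kn: "q = of_int k / of_nat n" "n > 0" "x ^ n * of_nat p powi (- k) \<in> A"
    using assms unfolding cut_def by blast
  obtain l m where lm: "r = of_int l / of_nat m" "m > 0" "y ^ m * of_nat p powi (- l) \<in> A"
    using assms unfolding cut_def by blast
  have "(x ^ n * of_nat p powi (- k)) ^ m * (y ^ m * of_nat p powi (- l)) ^ n \<in> A"
    using kn lm by (intro A_mult[OF A_pow A_pow])
  also have "(x ^ n * of_nat p powi (- k)) ^ m * (y ^ m * of_nat p powi (- l)) ^ n
     = (x * y) ^ (n * m) * of_nat p powi (- (k * int m + l * int n))"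
  proof -
    have "of_nat p powi (- (k * int m + l * int n)) = (of_nat p powi (- k * int m) * of_nat p powi (- l * int n) :: complex)"
      using p0 by (subst power_int_add[symmetric]) auto
    thus ?thesis by (simp only: power_mult_distrib power_int_power_nat power_mult[symmetric]) (simp add: ac_simps)
  qed
  finally have "of_int (k * int m + l * int n) / of_nat (n * m) \<in> cut (x * y)"
    using assms kn lm by (subst cut_iff) auto
  also have "of_int (k * int m + l * int n) / of_nat (n * m) = q + r"
    using kn lm by (simp add: field_simps)
  finally show ?thesis .
qed

lemma val_add_le:
  assumes "x \<in> E" "y \<in> E" "x \<noteq> 0" "y \<noteq> 0"
  shows "val x + val y \<le> val (x * y)"
proof -
  have xy: "x * y \<in> E" "x * y \<noteq> 0" using assms by auto
  have "val x \<le> val (x * y) - val y"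
    unfolding val_def[of x]
  proof (rule cSup_least)
    fix q assume q: "q \<in> cut x"
    have "val y \<le> val (x * y) - q" unfolding val_def[of y]
      using cut_bounds[OF assms(2,4)] cut_le_val[OF xy cut_add[OF assms(1,2) q]]
      by (intro cSup_least) (auto simp: algebra_simps)
    thus "q \<le> val (x * y) - val y" by simp
  qed (use cut_bounds assms in auto)
  thus ?thesis by simp
qed

text \<open>A rational just above \<open>val x\<close> is outside the cut of \<open>x\<close>, and
  the valuation ring property then puts its negative into the cut of the inverse.\<close>

lemma val_inverse_ge:
  assumes "x \<in> E" "x \<noteq> 0"
  shows "- val x \<le> val (inverse x)"
proof (rule field_le_epsilon)
  fix e :: real assume e: "e > 0"
  obtain q where q: "q \<in> \<rat>" "val x < q" "q < val x + e" using Rats_dense_in_real[of "val x" "val x + e"] e by auto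
  obtain k n where kn: "q = of_int k / of_nat n" "n > 0"
    using q(1) by (metis Rats_cases' of_int_of_nat_eq zero_less_imp_eq_int of_nat_0_less_iff)
  have "x ^ n * of_nat p powi (- k) \<notin> A"
    using q cut_le_val[OF assms, of q] cut_iff[OF assms(1) kn(2), of k] kn by auto
  hence "inverse (x ^ n * of_nat p powi (- k)) \<in> A"
    using valuation_ring[of "x ^ n * of_nat p powi (- k)"] assms by (auto simp del: inverse_mult_distrib)
  also have "inverse (x ^ n * of_nat p powi (- k)) = inverse x ^ n * of_nat p powi (- (- k))"
    by (simp add: power_int_minus field_simps power_inverse)
  finally have "of_int (- k) / of_nat n \<in> cut (inverse x)"
    using assms kn by (subst cut_iff) auto
  hence "- q \<le> val (inverse x)" using cut_le_val[of "inverse x"] assms kn by force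
  thus "- val x \<le> val (inverse x) + e" using q by simp
qed

lemma val_mult:
  assumes "x \<in> E" "y \<in> E" "x \<noteq> 0" "y \<noteq> 0"
  shows "val (x * y) = val x + val y"
proof -
  have "val (x * y) + val (inverse y) \<le> val (x * y * inverse y)"
    using assms by (intro val_add_le) auto
  moreover have "x * y * inverse y = x" using assms by simp
  ultimately show ?thesis using val_add_le[OF assms] val_inverse_ge[OF assms(2,4)] by simp
qed

lemma val_nonneg: assumes "x \<in> A" "x \<noteq> 0" shows "val x \<ge> 0"
proof -
  have "of_int 0 / of_nat 1 \<in> cut x" using assms AE by (subst cut_iff) auto
  thus ?thesis using cut_le_val[of x] assms AE by force
qed

lemma val_1: "val 1 = 0" using val_mult[of 1 1] by simp

lemma val_p: "val (of_nat p) = 1"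
proof (rule antisym)
  have mem: "of_nat p \<in> E" by simp
  have "of_int 1 / of_nat 1 \<in> cut (of_nat p)"
    using p0 A1 by (subst cut_iff) (auto simp: power_int_minus)
  thus "1 \<le> val (of_nat p)" using cut_le_val[OF mem p0] by force
  show "val (of_nat p) \<le> 1" unfolding val_def
  proof (rule cSup_least)
    fix q assume "q \<in> cut (of_nat p)"
    then obtain k n where kn: "q = of_int k / of_nat n" "n > 0" "of_nat p ^ n * of_nat p powi (- k) \<in> A"
      unfolding cut_def by blast
    have "of_nat p ^ n * of_nat p powi (- k) = (of_nat p powi (int n - k) :: complex)"
      using p0 by (simp add: power_int_diff power_int_minus field_simps)
    hence "int n - k \<ge> 0" using kn(3) by (simp add: powi_p)
    hence "of_int k \<le> real n" by linarith
    thus "q \<le> 1" using kn(1,2) by simp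
  qed (use cut_bounds[OF mem p0] in auto)
qed

text \<open>One of \<open>x / y\<close> and \<open>y / x\<close> lies in \<open>A\<close>. Factoring
  out its denominator leaves \<open>1 + q\<close> with \<open>q\<close> in \<open>A\<close>, whose
  valuation is nonnegative.\<close>

lemma val_add:
  assumes "x \<in> E" "y \<in> E" "x \<noteq> 0" "y \<noteq> 0" "x + y \<noteq> 0"
  shows "min (val x) (val y) \<le> val (x + y)"
proof -
  have *: "val y \<le> val (x + y)" if "x / y \<in> A" "x \<in> E" "y \<in> E" "y \<noteq> 0" "x + y \<noteq> 0" for x y
  proof -
    have A: "1 + x / y \<in> A" using that by (intro A_add A1)
    have eq: "x + y = y * (1 + x / y)" using that by (simp add: field_simps)
    hence nz: "1 + x / y \<noteq> 0" using that by auto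
    have "val (x + y) = val y + val (1 + x / y)"
      unfolding eq using that nz A AE by (intro val_mult) auto
    thus ?thesis using val_nonneg[OF A nz] by simp
  qed
  consider "x / y \<in> A" | "y / x \<in> A" using valuation_ring[of "x / y"] assms by auto
  thus ?thesis
    using *[of x y] *[of y x] assms by cases (auto simp: add.commute min_le_iff_disj)
qed

lemma val_of_int_unit: assumes "\<not> int p dvd z" shows "val (of_int z) = 0"
proof -
  have z0: "z \<noteq> 0" using assms by auto
  have mem: "of_int z \<in> A" "inverse (of_int z) \<in> A"
  proof -
    show "of_int z \<in> A" using A_of_nat A_minus by (cases z) (auto simp del: of_nat_Suc)
    show "inverse (of_int z) \<in> A"
    proof (rule A_units)
      have "algebraic_int (of_nat (nat \<bar>z\<bar>) * inverse (of_int z :: complex))"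
      proof (cases "z > 0")
        case True
        thus ?thesis by simp
      next
        case False
        hence "of_nat (nat \<bar>z\<bar>) = (- of_int z :: complex)" by simp
        thus ?thesis using z0 by simp
      qed
      moreover have "\<not> p dvd nat \<bar>z\<bar>" using assms by (simp add: nat_dvd_iff flip: int_dvd_int_iff)
      ultimately show "\<exists>d>0. \<not> p dvd d \<and> algebraic_int (of_nat d * inverse (of_int z :: complex))"
        using z0 by (intro exI[of _ "nat \<bar>z\<bar>"]) auto
    qed auto
  qed
  have "val (of_int z * inverse (of_int z)) = val (of_int z) + val (inverse (of_int z))"
    using z0 by (intro val_mult) auto
  thus ?thesis using val_nonneg[OF mem(1)] val_nonneg[OF mem(2)] z0 val_1 by simp
qed

lemma val_of_int: assumes "z \<noteq> 0" shows "val (of_int z) = multiplicity (int p) z"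
proof -
  have unit: "\<not> is_unit (int p)" using prime_p by (metis not_prime_unit prime_nat_int_transfer)
  obtain z' where z': "z = int p ^ multiplicity (int p) z * z'" "\<not> int p dvd z'"
    using multiplicity_decompose'[OF assms unit] by metis
  have pow: "val (of_nat p ^ n) = n" for n
    by (induction n) (use p0 in \<open>auto simp: val_1 val_p val_mult power_mem\<close>)
  have z'0: "z' \<noteq> 0" using z'(2) by auto
  have "val (of_int z) = val (of_nat p ^ multiplicity (int p) z * of_int z')"
    by (subst z'(1)) simp
  also have "\<dots> = val (of_nat p ^ multiplicity (int p) z) + val (of_int z')"
    using p0 z'0 by (intro val_mult) auto
  finally show ?thesis using pow val_of_int_unit[OF z'(2)] by simp
qed

definition val_abs :: "complex \<Rightarrow> real"
  where "val_abs = (\<lambda>x\<in>E. if x = 0 then 0 else real p powr (- val x))"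

lemma val_abs_place: "val_abs \<in> places_above E p"
  unfolding places_above_def absolute_value_def
proof (intro CollectI conjI ballI allI)
  have p1: "real p > 1" using prime_p prime_gt_1_nat by force
  show "val_abs \<in> E \<rightarrow>\<^sub>E {0..}" by (auto simp: val_abs_def)
  fix x assume x: "x \<in> E"
  show "val_abs x = 0 \<longleftrightarrow> x = 0" using x p1 by (simp add: val_abs_def)
  fix y assume y: "y \<in> E"
  show "val_abs (x * y) = val_abs x * val_abs y"
    using x y val_mult[OF x y] by (auto simp: val_abs_def mult_mem simp flip: powr_add)
  show "val_abs (x + y) \<le> val_abs x + val_abs y"
  proof (cases "x = 0 \<or> y = 0 \<or> x + y = 0")
    case False
    have "val x \<le> val (x + y) \<or> val y \<le> val (x + y)"
      using val_add[OF x y] False by (auto simp: min_def split: if_splits)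
    hence "val_abs (x + y) \<le> val_abs x \<or> val_abs (x + y) \<le> val_abs y"
      using False x y p1 by (auto simp: val_abs_def add_mem)
    moreover have "val_abs x \<ge> 0" "val_abs y \<ge> 0" using x y by (auto simp: val_abs_def)
    ultimately show ?thesis by linarith
  qed (use x y in \<open>auto simp: val_abs_def add_mem\<close>)
next
  fix q :: rat
  have p1: "real p > 1" using prime_p prime_gt_1_nat by force
  obtain a b where ab: "quotient_of q = (a, b)" by fastforce
  have b: "b > 0" using quotient_of_denom_pos[OF ab] .
  have q: "q = of_int a / of_int b" using quotient_of_div[OF ab] .
  show "val_abs (of_rat q) = padic_abs p q"
  proof (cases "q = 0")
    case False
    hence a: "a \<noteq> 0" using q by auto
    have "val (of_rat q) + val (of_int b) = val (of_rat q * of_int b)"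
      using False b by (intro val_mult[symmetric]) auto
    also have "of_rat q * of_int b = (of_int a :: complex)"
      using b by (simp add: q of_rat_divide)
    finally have "val (of_rat q) = multiplicity (int p) a - real (multiplicity (int p) b)"
      using a b by (simp add: val_of_int)
    hence "val_abs (of_rat q) = real p powr (real_of_int (int (multiplicity (int p) b) - int (multiplicity (int p) a)))"
      using False by (simp add: val_abs_def)
    also have "\<dots> = real p powi (int (multiplicity (int p) b) - int (multiplicity (int p) a))"
      using p1 by (subst powr_real_of_int') auto
    finally show ?thesis using False by (simp add: padic_abs_def ab)
  qed (simp add: val_abs_def padic_abs_def)
qed

end

text \<open>Zorn's lemma is applied above \<open>R\<close>, the elements that become algebraic
  integers after multiplication by a number prime to \<open>p\<close>. Starting from
  \<open>R\<close> makes \<open>A_units\<close> automatic, and \<open>1 / p\<close> is outside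
  \<open>R\<close> because rational algebraic integers are integers.\<close>

theorem place_exists:
  assumes E: "subfield E complex_ring" and p: "Factorial_Ring.prime p"
    and alg: "\<And>x. x \<in> E \<Longrightarrow> \<exists>d::nat. d > 0 \<and> algebraic_int (of_nat d * x)"
  shows "\<exists>w. w \<in> places_above E p"
proof -
  interpret complex_subfield E by (rule complex_subfield.intro[OF E])
  have p0: "of_nat p \<noteq> (0 :: complex)" using p prime_gt_0_nat by force
  define R where "R = {x \<in> E. \<exists>d::nat. d > 0 \<and> \<not> p dvd d \<and> algebraic_int (of_nat d * x)}"
  define \<A> where "\<A> = {B. R \<subseteq> B \<and> B \<subseteq> E \<and> (\<forall>x\<in>B. \<forall>y\<in>B. x - y \<in> B \<and> x * y \<in> B) \<and> inverse (of_nat p) \<notin> B}"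
  have R: "R \<in> \<A>"
  proof -
    have "x - y \<in> R \<and> x * y \<in> R" if "x \<in> R" "y \<in> R" for x y
    proof -
      from that obtain d e :: nat where d: "d > 0" "\<not> p dvd d" "algebraic_int (of_nat d * x)"
        and e: "e > 0" "\<not> p dvd e" "algebraic_int (of_nat e * y)" unfolding R_def by blast
      have "algebraic_int (of_nat e * (of_nat d * x) - of_nat d * (of_nat e * y))"
        by (rule algebraic_int_diff[OF algebraic_int_add_mult(2)[OF algebraic_int_of_nat d(3)]
              algebraic_int_add_mult(2)[OF algebraic_int_of_nat e(3)]])
      hence "algebraic_int (of_nat (d * e) * (x - y))" by (simp add: algebra_simps)
      moreover have "algebraic_int ((of_nat d * x) * (of_nat e * y))"
        by (rule algebraic_int_add_mult(2)[OF d(3) e(3)])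
      hence "algebraic_int (of_nat (d * e) * (x * y))" by (simp add: algebra_simps)
      moreover have "d * e > 0" "\<not> p dvd d * e" using d e p by (auto simp: prime_dvd_mult_iff)
      ultimately show ?thesis using that unfolding R_def by blast
    qed
    moreover have "inverse (of_nat p) \<notin> R"
    proof
      assume "inverse (of_nat p) \<in> R"
      then obtain d :: nat where d: "\<not> p dvd d" "algebraic_int (of_nat d * inverse (of_nat p) :: complex)"
        unfolding R_def by blast
      have "of_nat d * inverse (of_nat p) \<in> (\<rat> :: complex set)" by (intro Rats_mult Rats_inverse) auto
      hence "of_nat d * inverse (of_nat p) \<in> (\<int> :: complex set)" using rational_algebraic_int_is_int d by blast
      then obtain z where "of_nat d * inverse (of_nat p) = (of_int z :: complex)" by (auto simp: Ints_def)
      hence "of_nat d = (of_int (z * int p) :: complex)" using p0 by (simp add: field_simps)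
      hence "int d = z * int p" by (metis of_int_eq_iff of_int_of_nat_eq)
      hence "int p dvd int d" by simp
      thus False using d by simp
    qed
    ultimately show ?thesis by (auto simp: \<A>_def R_def)
  qed
  have "\<exists>M\<in>\<A>. \<forall>S\<in>\<A>. M \<subseteq> S \<longrightarrow> S = M"
  proof (rule subset_Zorn_nonempty)
    fix \<C> assume C: "\<C> \<noteq> {}" "subset.chain \<A> \<C>"
    have sub: "\<C> \<subseteq> \<A>" using C by (simp add: subset.chain_def)
    have "x - y \<in> \<Union>\<C> \<and> x * y \<in> \<Union>\<C>" if "x \<in> \<Union>\<C>" "y \<in> \<Union>\<C>" for x y
    proof -
      obtain S T where "S \<in> \<C>" "x \<in> S" "T \<in> \<C>" "y \<in> T" using \<open>x \<in> \<Union>\<C>\<close> \<open>y \<in> \<Union>\<C>\<close> by blast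
      moreover have "S \<subseteq> T \<or> T \<subseteq> S" using C(2) calculation unfolding subset.chain_def by blast
      ultimately obtain W where W: "W \<in> \<C>" "x \<in> W" "y \<in> W" by blast
      thus ?thesis using sub unfolding \<A>_def by blast
    qed
    thus "\<Union>\<C> \<in> \<A>" using C(1) sub unfolding \<A>_def by blast
  next
    show "\<A> \<noteq> {}" using R by blast
  qed
  then obtain A where A: "A \<in> \<A>" and max: "\<And>S. S \<in> \<A> \<Longrightarrow> A \<subseteq> S \<Longrightarrow> S = A" by blast
  have 1: "1 \<in> R"
  proof -
    have "\<not> p dvd 1" using p not_prime_unit by blast
    thus ?thesis unfolding R_def by (intro CollectI conjI exI[of _ "1::nat"]) simp_all
  qed
  have RA: "R \<subseteq> A" and AE: "A \<subseteq> E" and closed: "\<And>x y. x \<in> A \<Longrightarrow> y \<in> A \<Longrightarrow> x - y \<in> A \<and> x * y \<in> A"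
    and np: "inverse (of_nat p) \<notin> A" using A unfolding \<A>_def by blast+
  have "chevalley E A p"
  proof (rule chevalley.intro[OF complex_subfield.intro[OF E] chevalley_axioms.intro])
    fix B assume B: "A \<subseteq> B" "B \<subseteq> E" "\<And>x y. x \<in> B \<Longrightarrow> y \<in> B \<Longrightarrow> x - y \<in> B"
       "\<And>x y. x \<in> B \<Longrightarrow> y \<in> B \<Longrightarrow> x * y \<in> B" "inverse (of_nat p) \<notin> B"
    have "B \<in> \<A>" using RA B unfolding \<A>_def by blast
    thus "B = A" using max B(1) by blast
  next
    fix x assume "x \<in> E" "\<exists>d>0. \<not> p dvd d \<and> algebraic_int (of_nat d * x)"
    thus "x \<in> A" using RA unfolding R_def by blast
  next
    show "1 \<in> A" using 1 RA by blast
  qed (use p AE closed np alg in \<open>simp_all\<close>)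
  thus ?thesis using chevalley.val_abs_place by blast
qed

section \<open>Completions\<close>

lemma real_null_comparison:
  fixes f g :: "nat \<Rightarrow> real"
  assumes "\<forall>\<^sub>F n in sequentially. norm (f n) \<le> g n" "g \<longlonglongrightarrow> 0"
  shows "f \<longlonglongrightarrow> 0"
  by (rule tendsto_0_le[OF assms(2), of _ 1]) (use assms(1) in \<open>auto elim!: eventually_mono\<close>)

definition alg_unit :: "complex set \<Rightarrow> complex \<Rightarrow> bool"
  where "alg_unit E u \<longleftrightarrow> u \<in> E \<and> u \<noteq> 0 \<and> algebraic_int u \<and> algebraic_int (inverse u)"

text \<open>The integers \<open>proj_exp p n\<close> tend to 1 in the \<open>p\<close>-adic integers and to 0 in the \<open>l\<close>-adic
  integers for every other prime \<open>l\<close>, so raising to the power \<open>proj_exp p n\<close> approximates the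
  projection of a unit to its principal part.\<close>

definition proj_exp :: "nat \<Rightarrow> nat \<Rightarrow> int"
  where "proj_exp p n = (int p ^ fact n - 1)\<^sup>2"

text \<open>Representatives of a \<open>p\<close>-adic integer without the reduction to
  \<open>{0..<p ^ n}\<close>, so that sums, differences and integer multiples can be formed
  termwise.\<close>

definition padic_coherent :: "nat \<Rightarrow> (nat \<Rightarrow> int) \<Rightarrow> bool"
  where "padic_coherent p b \<longleftrightarrow> (\<forall>n. int p ^ n dvd b (Suc n) - b n)"

text \<open>A sequence in the number field itself whose class in the completion is
  \<open>leopoldt_free\<close> (see \<open>leopoldt_free_eq\<close>). It does not mention the place,
  so one sequence serves all places at once.\<close>

definition leo_prod :: "nat \<Rightarrow> ((nat \<Rightarrow> int) \<times> complex \<Rightarrow>\<^sub>0 int) \<Rightarrow> nat \<Rightarrow> complex"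
  where "leo_prod p c n =
    (\<Prod>(a,u)\<in>Poly_Mapping.keys c. u powi (proj_exp p n * a n * Poly_Mapping.lookup c (a,u)))"

context place
begin

lemma null_bound:
  assumes "\<And>n. x n \<in> E" "eventually (\<lambda>n. w (x n) \<le> g n) sequentially" "g \<longlonglongrightarrow> 0"
  shows "(\<lambda>n. w (x n)) \<longlonglongrightarrow> 0"
  by (rule real_null_comparison[OF _ assms(3)]) (use assms(1,2) w_nonneg in \<open>auto elim: eventually_mono\<close>)

lemma null_add:
  assumes "\<And>n. x n \<in> E" "\<And>n. y n \<in> E" "(\<lambda>n. w (x n)) \<longlonglongrightarrow> 0" "(\<lambda>n. w (y n)) \<longlonglongrightarrow> 0"
  shows "(\<lambda>n. w (x n + y n)) \<longlonglongrightarrow> 0"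
  by (rule null_bound[where g = "\<lambda>n. w (x n) + w (y n)"])
    (use assms w_triangle tendsto_add[OF assms(3,4)] in auto)

lemma null_mult_bounded:
  assumes "\<And>n. x n \<in> E" "\<And>n. y n \<in> E" "(\<lambda>n. w (x n)) \<longlonglongrightarrow> 0" "eventually (\<lambda>n. w (y n) \<le> B) sequentially"
  shows "(\<lambda>n. w (x n * y n)) \<longlonglongrightarrow> 0"
proof (rule null_bound[where g = "\<lambda>n. w (x n) * B"])
  show "\<forall>\<^sub>F n in sequentially. w (x n * y n) \<le> w (x n) * B"
    using assms(4) by eventually_elim (use assms w_nonneg in \<open>auto simp: w_mult intro!: mult_left_mono\<close>)
  show "(\<lambda>n. w (x n) * B) \<longlonglongrightarrow> 0" using tendsto_mult_right[OF assms(3), of B] by simp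
qed (use assms in auto)

section \<open>The completion as Cauchy sequences modulo null sequences\<close>

abbreviation "\<R> \<equiv> cauchy_ring E w"
abbreviation "\<N> \<equiv> null_sequences E w"
abbreviation "\<Q> \<equiv> completion E w"
abbreviation "\<U> \<equiv> principal_units E w"

definition cauchy :: "(nat \<Rightarrow> complex) \<Rightarrow> bool"
  where "cauchy s \<longleftrightarrow> (\<forall>n. s n \<in> E) \<and> (\<forall>e>0. \<exists>N. \<forall>m\<ge>N. \<forall>n\<ge>N. w (s m - s n) < e)"

lemma cauchy_ring_simps [simp]:
  "s \<in> carrier \<R> \<longleftrightarrow> cauchy s" "s \<otimes>\<^bsub>\<R>\<^esub> t = (\<lambda>n. s n * t n)" "s \<oplus>\<^bsub>\<R>\<^esub> t = (\<lambda>n. s n + t n)"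
  "\<one>\<^bsub>\<R>\<^esub> = (\<lambda>n. 1)" "\<zero>\<^bsub>\<R>\<^esub> = (\<lambda>n. 0)"
  by (auto simp: cauchy_ring_def cauchy_def)

lemma cauchy_mem [simp, intro]: "cauchy s \<Longrightarrow> s n \<in> E" by (simp add: cauchy_def)

lemma cauchyI:
  assumes "\<And>n. s n \<in> E" "g \<longlonglongrightarrow> 0" "\<And>m n. m \<ge> n \<Longrightarrow> n \<ge> N0 \<Longrightarrow> w (s m - s n) \<le> g n"
  shows "cauchy s"
  unfolding cauchy_def
proof (intro conjI allI impI)
  fix e :: real assume "e > 0"
  then obtain N where N: "\<And>n. n \<ge> N \<Longrightarrow> g n < e"
    using order_tendstoD(2)[OF assms(2)] unfolding eventually_sequentially by blast
  show "\<exists>N. \<forall>m\<ge>N. \<forall>n\<ge>N. w (s m - s n) < e"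
  proof (intro exI allI impI)
    fix m n assume mn: "m \<ge> max N N0" "n \<ge> max N N0"
    show "w (s m - s n) < e"
    proof (cases "m \<ge> n")
      case True
      thus ?thesis using assms(3)[of n m] N[of n] mn by simp
    next
      case False
      thus ?thesis using assms(3)[of m n] N[of m] mn w_diff_commute[of "s m" "s n"] assms(1) by simp
    qed
  qed
qed (use assms in auto)

lemma cauchy_const [simp]: "x \<in> E \<Longrightarrow> cauchy (\<lambda>_. x)" by (simp add: cauchy_def)

lemma cauchy_add: assumes "cauchy s" "cauchy t" shows "cauchy (\<lambda>n. s n + t n)"
  unfolding cauchy_def
proof (intro conjI allI impI)
  fix e :: real assume e: "e > 0"
  obtain N where N: "\<And>m n. m \<ge> N \<Longrightarrow> n \<ge> N \<Longrightarrow> w (s m - s n) < e" using assms(1) e unfolding cauchy_def by blast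
  obtain M where M: "\<And>m n. m \<ge> M \<Longrightarrow> n \<ge> M \<Longrightarrow> w (t m - t n) < e" using assms(2) e unfolding cauchy_def by blast
  show "\<exists>N. \<forall>m\<ge>N. \<forall>n\<ge>N. w (s m + t m - (s n + t n)) < e"
  proof (intro exI allI impI)
    fix m n assume mn: "m \<ge> max M N" "n \<ge> max M N"
    have "w ((s m - s n) + (t m - t n)) < e" using mn N[of m n] M[of m n] assms by (intro w_add_less) auto
    thus "w (s m + t m - (s n + t n)) < e" by (simp add: algebra_simps)
  qed
qed (use assms in auto)

lemma cauchy_minus: "cauchy s \<Longrightarrow> cauchy (\<lambda>n. - s n)"
  unfolding cauchy_def
proof (elim conjE, intro conjI allI impI)
  fix e :: real assume s: "\<forall>n. s n \<in> E" "\<forall>e>0. \<exists>N. \<forall>m\<ge>N. \<forall>n\<ge>N. w (s m - s n) < e" "e > 0"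
  have "w (- s m - - s n) = w (s m - s n)" for m n using s(1) w_diff_commute[of "s n" "s m"] by simp
  thus "\<exists>N. \<forall>m\<ge>N. \<forall>n\<ge>N. w (- s m - - s n) < e" using s by simp
qed auto

lemma cauchy_bounded: assumes "cauchy s" obtains B where "B > 0" "\<And>n. w (s n) \<le> B"
proof -
  have "\<exists>N. \<forall>m\<ge>N. \<forall>n\<ge>N. w (s m - s n) < 1" using assms unfolding cauchy_def by simp
  then obtain N where N: "\<And>m n. m \<ge> N \<Longrightarrow> n \<ge> N \<Longrightarrow> w (s m - s n) < 1" by blast
  define B where "B = Max ((\<lambda>n. w (s n)) ` {..N}) + 1"
  have le: "w (s n) \<le> B - 1" if "n \<le> N" for n using that by (simp add: B_def)
  have "B > 0" using le[of 0] w_nonneg[of "s 0"] assms by simp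
  moreover have "w (s n) \<le> B" for n
  proof (cases "n \<le> N")
    case True
    thus ?thesis using le by force
  next
    case False
    have "w ((s n - s N) + s N) \<le> w (s n - s N) + w (s N)" using assms by (intro w_triangle) auto
    thus ?thesis using N[of n N] le[of N] False by simp
  qed
  ultimately show ?thesis using that by blast
qed

lemma cauchy_mult: assumes "cauchy s" "cauchy t" shows "cauchy (\<lambda>n. s n * t n)"
  unfolding cauchy_def
proof (intro conjI allI impI)
  fix e :: real assume e: "e > 0"
  obtain B where B: "B > 0" "\<And>n. w (s n) \<le> B" using cauchy_bounded[OF assms(1)] by blast
  obtain C where C: "C > 0" "\<And>n. w (t n) \<le> C" using cauchy_bounded[OF assms(2)] by blast
  obtain N where N: "\<And>m n. m \<ge> N \<Longrightarrow> n \<ge> N \<Longrightarrow> w (s m - s n) < e / C"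
    using assms(1) e C unfolding cauchy_def by (meson divide_pos_pos)
  obtain M where M: "\<And>m n. m \<ge> M \<Longrightarrow> n \<ge> M \<Longrightarrow> w (t m - t n) < e / B"
    using assms(2) e B unfolding cauchy_def by (meson divide_pos_pos)
  show "\<exists>N. \<forall>m\<ge>N. \<forall>n\<ge>N. w (s m * t m - s n * t n) < e"
  proof (intro exI allI impI)
    fix m n assume mn: "m \<ge> max M N" "n \<ge> max M N"
    have "w ((s m - s n) * t m) \<le> w (s m - s n) * C"
      using assms C by (subst w_mult) (auto intro!: mult_left_mono w_nonneg)
    also have "\<dots> < e" using N[of m n] mn C by (simp add: pos_less_divide_eq)
    finally have 1: "w ((s m - s n) * t m) < e" .
    have "w (s n * (t m - t n)) \<le> B * w (t m - t n)"
      using assms B by (subst w_mult) (auto intro!: mult_right_mono w_nonneg)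
    also have "\<dots> < e" using M[of m n] mn B by (simp add: pos_less_divide_eq mult.commute)
    finally have 2: "w (s n * (t m - t n)) < e" .
    have "w ((s m - s n) * t m + s n * (t m - t n)) < e" using 1 2 assms by (intro w_add_less) auto
    thus "w (s m * t m - s n * t n) < e" by (simp add: algebra_simps)
  qed
qed (use assms in auto)

lemma null_iff: "s \<in> \<N> \<longleftrightarrow> (\<forall>n. s n \<in> E) \<and> (\<lambda>n. w (s n)) \<longlonglongrightarrow> 0"
  by (auto simp: null_sequences_def)

lemma null_cauchy: assumes "s \<in> \<N>" shows "cauchy s"
  unfolding cauchy_def
proof (intro conjI allI impI)
  fix e :: real assume "e > 0"
  moreover have "(\<lambda>n. w (s n)) \<longlonglongrightarrow> 0" using assms by (simp add: null_iff)
  ultimately have "\<forall>\<^sub>F n in sequentially. w (s n) < e" by (intro order_tendstoD(2))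
  then obtain N where N: "\<And>n. n \<ge> N \<Longrightarrow> w (s n) < e" unfolding eventually_sequentially by blast
  show "\<exists>N. \<forall>m\<ge>N. \<forall>n\<ge>N. w (s m - s n) < e"
    using N assms by (intro exI[of _ N]) (auto simp: null_iff intro!: w_diff_less)
qed (use assms null_iff in auto)

lemma cring_cauchy: "cring \<R>"
proof (rule cringI)
  show "abelian_group \<R>"
  proof (rule abelian_groupI)
    fix x assume "x \<in> carrier \<R>"
    thus "\<exists>y\<in>carrier \<R>. y \<oplus>\<^bsub>\<R>\<^esub> x = \<zero>\<^bsub>\<R>\<^esub>"
      using cauchy_minus by (intro bexI[of _ "\<lambda>n. - x n"]) auto
  qed (auto simp: cauchy_add algebra_simps)
  show "comm_monoid \<R>" by (rule comm_monoidI) (auto simp: cauchy_mult algebra_simps)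
qed (auto simp: algebra_simps)

lemma ideal_null: "ideal \<N> \<R>"
proof (rule idealI)
  interpret cring \<R> by (rule cring_cauchy)
  show "ring \<R>" by (rule ring_axioms)
  show "subgroup \<N> (add_monoid \<R>)"
  proof (rule add.subgroupI)
    show "\<N> \<subseteq> carrier \<R>" using null_cauchy by auto
    show "\<N> \<noteq> {}" using null_iff[of "\<lambda>_. 0"] by auto
    fix s assume s: "s \<in> \<N>"
    have "\<ominus>\<^bsub>\<R>\<^esub> s = (\<lambda>n. - s n)"
      using null_cauchy[OF s] cauchy_minus by (intro minus_equality) auto
    thus "\<ominus>\<^bsub>\<R>\<^esub> s \<in> \<N>" using s by (auto simp: null_iff)
    fix t assume "t \<in> \<N>"
    thus "s \<oplus>\<^bsub>\<R>\<^esub> t \<in> \<N>" using s null_add by (auto simp: null_iff)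
  qed
  fix s t assume st: "s \<in> \<N>" "t \<in> carrier \<R>"
  from st have "cauchy t" by simp
  then obtain B where "\<And>n. w (t n) \<le> B" by (rule cauchy_bounded) blast
  hence "(\<lambda>n. w (s n * t n)) \<longlonglongrightarrow> 0" using st by (intro null_mult_bounded[where B = B]) (auto simp: null_iff)
  thus "s \<otimes>\<^bsub>\<R>\<^esub> t \<in> \<N>" "t \<otimes>\<^bsub>\<R>\<^esub> s \<in> \<N>" using st by (auto simp: null_iff mult.commute)
qed

definition cls :: "(nat \<Rightarrow> complex) \<Rightarrow> (nat \<Rightarrow> complex) set"
  where "cls s = \<N> +>\<^bsub>\<R>\<^esub> s"

lemma cls_iff: "t \<in> cls s \<longleftrightarrow> (\<exists>h\<in>\<N>. t = (\<lambda>n. h n + s n))"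
  by (auto simp: cls_def a_r_coset_def')

lemma cring_completion: "cring \<Q>"
  unfolding completion_def by (rule ideal.quotient_is_cring[OF ideal_null cring_cauchy])

lemma completion_simps [simp]:
  "carrier \<Q> = cls ` Collect cauchy"
  "cauchy s \<Longrightarrow> cauchy t \<Longrightarrow> cls s \<otimes>\<^bsub>\<Q>\<^esub> cls t = cls (\<lambda>n. s n * t n)"
  "cauchy s \<Longrightarrow> cauchy t \<Longrightarrow> cls s \<oplus>\<^bsub>\<Q>\<^esub> cls t = cls (\<lambda>n. s n + t n)"
  "\<one>\<^bsub>\<Q>\<^esub> = cls (\<lambda>n. 1)"
proof -
  interpret ideal \<N> \<R> by (rule ideal_null)
  show "carrier \<Q> = cls ` Collect cauchy"
    by (auto simp: completion_def FactRing_def A_RCOSETS_defs cls_def[abs_def] a_r_coset_def)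
  show "cauchy s \<Longrightarrow> cauchy t \<Longrightarrow> cls s \<otimes>\<^bsub>\<Q>\<^esub> cls t = cls (\<lambda>n. s n * t n)"
    using rcoset_mult_add[of s t] by (simp add: completion_def FactRing_def cls_def)
  show "cauchy s \<Longrightarrow> cauchy t \<Longrightarrow> cls s \<oplus>\<^bsub>\<Q>\<^esub> cls t = cls (\<lambda>n. s n + t n)"
    using a_rcos_sum[of s t] by (simp add: completion_def FactRing_def cls_def)
  show "\<one>\<^bsub>\<Q>\<^esub> = cls (\<lambda>n. 1)" by (simp add: completion_def FactRing_def cls_def)
qed

lemma cls_eq_iff:
  assumes "cauchy s" "cauchy t"
  shows "cls s = cls t \<longleftrightarrow> (\<lambda>n. w (s n - t n)) \<longlonglongrightarrow> 0"
proof
  have "s \<in> cls s" by (auto simp: cls_iff null_iff intro!: bexI[of _ "\<lambda>_. 0"])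
  moreover assume "cls s = cls t"
  ultimately obtain h where "h \<in> \<N>" "s = (\<lambda>n. h n + t n)" by (auto simp: cls_iff)
  thus "(\<lambda>n. w (s n - t n)) \<longlonglongrightarrow> 0" by (simp add: null_iff)
next
  assume st: "(\<lambda>n. w (s n - t n)) \<longlonglongrightarrow> 0"
  have *: "cls s \<subseteq> cls t" if st: "cauchy s" "cauchy t" "(\<lambda>n. w (s n - t n)) \<longlonglongrightarrow> 0" for s t
  proof
    fix z assume "z \<in> cls s"
    then obtain h where h: "h \<in> \<N>" "z = (\<lambda>n. h n + s n)" by (auto simp: cls_iff)
    have "(\<lambda>n. w (h n + (s n - t n))) \<longlonglongrightarrow> 0"
      by (rule null_add) (use h st in \<open>auto simp: null_iff\<close>)
    hence "(\<lambda>n. h n + (s n - t n)) \<in> \<N>" using h st by (auto simp: null_iff)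
    thus "z \<in> cls t" using h unfolding cls_iff by (intro bexI[of _ "\<lambda>n. h n + (s n - t n)"]) auto
  qed
  have "(\<lambda>n. w (t n - s n)) \<longlonglongrightarrow> 0" using st w_diff_commute assms by simp
  thus "cls s = cls t" using * assms st by blast
qed

lemma completion_minus:
  assumes "cauchy s" "cauchy t"
  shows "cls s \<ominus>\<^bsub>\<Q>\<^esub> cls t = cls (\<lambda>n. s n - t n)"
proof -
  interpret cring \<Q> by (rule cring_completion)
  have zero: "\<zero>\<^bsub>\<Q>\<^esub> = cls (\<lambda>n. 0)"
  proof -
    have "cls (\<lambda>n. 0) = \<N>" unfolding set_eq_iff cls_iff by auto
    thus ?thesis by (simp add: completion_def FactRing_def)
  qed
  have "\<ominus>\<^bsub>\<Q>\<^esub> cls t = cls (\<lambda>n. - t n)"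
    using assms cauchy_minus by (intro minus_equality) (auto simp: zero)
  thus ?thesis using assms cauchy_minus by (simp add: a_minus_def)
qed

lemma cauchy_diff: "cauchy s \<Longrightarrow> cauchy t \<Longrightarrow> cauchy (\<lambda>n. s n - t n)"
  using cauchy_add[of s "\<lambda>n. - t n"] cauchy_minus[of t] by simp

lemma cauchy_convergent: assumes "cauchy s" shows "convergent (\<lambda>n. w (s n))"
proof -
  have "Cauchy (\<lambda>n. w (s n))"
  proof (rule metric_CauchyI)
    fix e :: real assume "e > 0"
    then obtain N where "\<And>m n. m \<ge> N \<Longrightarrow> n \<ge> N \<Longrightarrow> w (s m - s n) < e"
      using assms unfolding cauchy_def by blast
    thus "\<exists>N. \<forall>m\<ge>N. \<forall>n\<ge>N. dist (w (s m)) (w (s n)) < e"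
      using assms by (intro exI[of _ N]) (auto simp: dist_real_def intro: le_less_trans[OF w_diff_abs_le])
  qed
  thus ?thesis by (simp add: Cauchy_convergent_iff)
qed

text \<open>Representatives differ by null sequences and \<open>w\<close> is 1-Lipschitz, so the
  definite description has exactly one candidate.\<close>

lemma completion_abs_eq:
  assumes "cauchy s" "(\<lambda>n. w (s n)) \<longlonglongrightarrow> r"
  shows "completion_abs w (cls s) = r"
  unfolding completion_abs_def
proof (rule the_equality)
  show "\<exists>t\<in>cls s. (\<lambda>n. w (t n)) \<longlonglongrightarrow> r"
    using assms by (intro bexI[of _ s]) (auto simp: cls_iff null_iff intro!: bexI[of _ "\<lambda>_. 0"])
  fix r' assume "\<exists>t\<in>cls s. (\<lambda>n. w (t n)) \<longlonglongrightarrow> r'"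
  then obtain h where h: "h \<in> \<N>" "(\<lambda>n. w (h n + s n)) \<longlonglongrightarrow> r'" by (auto simp: cls_iff)
  have "(\<lambda>n. w (h n + s n) - w (s n)) \<longlonglongrightarrow> 0"
  proof (rule real_null_comparison[rotated])
    show "(\<lambda>n. w (h n)) \<longlonglongrightarrow> 0" using h by (simp add: null_iff)
    have "\<bar>w (h n + s n) - w (s n)\<bar> \<le> w (h n)" for n
      using w_diff_abs_le[of "h n + s n" "s n"] h assms by (auto simp: null_iff)
    thus "\<forall>\<^sub>F n in sequentially. norm (w (h n + s n) - w (s n)) \<le> w (h n)" by simp
  qed
  moreover have "(\<lambda>n. w (h n + s n) - w (s n)) \<longlonglongrightarrow> r' - r" by (intro tendsto_diff h assms)
  ultimately show "r' = r" using LIMSEQ_unique by fastforce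
qed

lemma completion_abs_tendsto: "cauchy s \<Longrightarrow> (\<lambda>n. w (s n)) \<longlonglongrightarrow> completion_abs w (cls s)"
  using completion_abs_eq cauchy_convergent unfolding convergent_def by metis

text \<open>The description of principal units on representatives. A uniform bound
  \<open>r < 1\<close> is demanded because termwise strict inequalities alone would not keep the
  limit below 1.\<close>

definition principal :: "(nat \<Rightarrow> complex) \<Rightarrow> bool"
  where "principal s \<longleftrightarrow> cauchy s \<and> (\<exists>r<1. \<forall>\<^sub>F n in sequentially. w (s n - 1) \<le> r)"

lemma principal_cauchy: "principal s \<Longrightarrow> cauchy s" by (simp add: principal_def)

lemma cls_principal_iff:
  assumes "cauchy s"
  shows "completion_abs w (cls s \<ominus>\<^bsub>\<Q>\<^esub> \<one>\<^bsub>\<Q>\<^esub>) < 1 \<longleftrightarrow> principal s"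
proof -
  have c: "cauchy (\<lambda>n. s n - 1)" using assms by (intro cauchy_diff) auto
  have eq: "cls s \<ominus>\<^bsub>\<Q>\<^esub> \<one>\<^bsub>\<Q>\<^esub> = cls (\<lambda>n. s n - 1)"
    using assms completion_minus[of s "\<lambda>_. 1"] by simp
  define L where "L = completion_abs w (cls (\<lambda>n. s n - 1))"
  have lim: "(\<lambda>n. w (s n - 1)) \<longlonglongrightarrow> L" unfolding L_def using completion_abs_tendsto[OF c] .
  have "L < 1 \<longleftrightarrow> principal s"
  proof
    assume "L < 1"
    then obtain r where r: "L < r" "r < 1" using dense by blast
    have "\<forall>\<^sub>F n in sequentially. w (s n - 1) \<le> r"
      using order_tendstoD(2)[OF lim r(1)] by (auto elim: eventually_mono)
    thus "principal s" using assms r unfolding principal_def by blast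
  next
    assume "principal s"
    then obtain r where r: "r < 1" "\<forall>\<^sub>F n in sequentially. w (s n - 1) \<le> r" unfolding principal_def by blast
    hence "L \<le> r" using tendsto_upperbound[OF lim r(2)] by simp
    thus "L < 1" using r by simp
  qed
  thus ?thesis unfolding eq L_def .
qed

lemma carrier_principal_units: "carrier \<U> = cls ` Collect principal"
  by (auto simp: principal_units_def cls_principal_iff[simplified] principal_cauchy intro!: imageI)

lemma principal_units_simps [simp]:
  "\<one>\<^bsub>\<U>\<^esub> = \<one>\<^bsub>\<Q>\<^esub>" "u \<otimes>\<^bsub>\<U>\<^esub> v = u \<otimes>\<^bsub>\<Q>\<^esub> v"
  by (auto simp: principal_units_def units_of_def)

lemma principal_one: "principal (\<lambda>_. 1)"
  by (auto simp: principal_def intro!: exI[of _ 0])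

lemma principal_mult: assumes "principal s" "principal t" shows "principal (\<lambda>n. s n * t n)"
proof -
  obtain q where q: "q < 1" "\<forall>\<^sub>F n in sequentially. w (s n - 1) \<le> q" using assms unfolding principal_def by blast
  obtain r where r: "r < 1" "\<forall>\<^sub>F n in sequentially. w (t n - 1) \<le> r" using assms unfolding principal_def by blast
  have mem: "s n \<in> E" "t n \<in> E" for n using assms by (auto simp: principal_def)
  have "\<forall>\<^sub>F n in sequentially. w (s n * t n - 1) \<le> max q r"
    using q(2) r(2)
  proof eventually_elim
    case (elim n)
    have "w (t n) = 1" using elim r(1) mem by (intro w_eq_1_if_near_1) auto
    thus ?case using elim mem by (intro mult_near_1) auto
  qed
  thus ?thesis using assms q r cauchy_mult unfolding principal_def by (metis max_less_iff_conj)
qed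

lemma principal_w_1: "principal s \<Longrightarrow> \<forall>\<^sub>F n in sequentially. w (s n) = 1"
  unfolding principal_def by (auto elim!: eventually_mono intro!: w_eq_1_if_near_1)

lemma principal_inverse: assumes "principal s" shows "principal (\<lambda>n. inverse (s n))"
proof -
  obtain r where r: "r < 1" "\<forall>\<^sub>F n in sequentially. w (s n - 1) \<le> r" using assms unfolding principal_def by blast
  have c: "cauchy s" using assms by (simp add: principal_def)
  \<comment> \<open>Early terms may be 0, where \<open>inverse\<close> takes its default value; only
    the tail from \<open>N\<close> on affects the class.\<close>
  obtain N where N: "\<And>n. n \<ge> N \<Longrightarrow> w (s n) = 1" using principal_w_1[OF assms] unfolding eventually_sequentially by blast
  have diff: "w (inverse (s m) - inverse (s n)) = w (s m - s n)" if "m \<ge> N" "n \<ge> N" for m n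
  proof -
    have "s m \<noteq> 0" "s n \<noteq> 0" using N that w_0 by (metis zero_neq_one)+
    hence "inverse (s m) - inverse (s n) = (s n - s m) / (s m * s n)" by (simp add: field_simps)
    thus ?thesis using N that c w_diff_commute[of "s m" "s n"] by (simp add: w_divide w_mult mult_mem diff_mem)
  qed
  have "cauchy (\<lambda>n. inverse (s n))" unfolding cauchy_def
  proof (intro conjI allI impI)
    fix e :: real assume "e > 0"
    then obtain M where M: "\<And>m n. m \<ge> M \<Longrightarrow> n \<ge> M \<Longrightarrow> w (s m - s n) < e" using c unfolding cauchy_def by blast
    show "\<exists>N. \<forall>m\<ge>N. \<forall>n\<ge>N. w (inverse (s m) - inverse (s n)) < e"
      using M diff by (intro exI[of _ "max M N"]) auto
  qed (use c in auto)
  moreover have "\<forall>\<^sub>F n in sequentially. w (inverse (s n) - 1) \<le> r"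
    using r(2) principal_w_1[OF assms] by eventually_elim (use c in \<open>auto intro!: inverse_near_1\<close>)
  ultimately show ?thesis using r unfolding principal_def by blast
qed

lemma comm_group_principal_units: "comm_group \<U>"
proof -
  interpret cring \<Q> by (rule cring_completion)
  have sub: "x \<in> carrier \<Q>" if "x \<in> carrier \<U>" for x using that by (simp add: principal_units_def)
  show ?thesis
  proof (rule comm_groupI)
    fix x assume "x \<in> carrier \<U>"
    then obtain s where s: "x = cls s" "principal s" by (auto simp: carrier_principal_units)
    have "(\<lambda>n. w (inverse (s n) * s n - 1)) \<longlonglongrightarrow> 0"
    proof (rule null_bound[where g = "\<lambda>_. 0"])
      show "\<forall>\<^sub>F n in sequentially. w (inverse (s n) * s n - 1) \<le> 0"
        using principal_w_1[OF s(2)] by eventually_elim (auto simp: field_simps)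
    qed (use s in \<open>auto simp: principal_def\<close>)
    hence "cls (\<lambda>n. inverse (s n) * s n) = cls (\<lambda>n. 1)"
      using s principal_inverse by (subst cls_eq_iff) (auto intro!: cauchy_mult simp: principal_def)
    thus "\<exists>y\<in>carrier \<U>. y \<otimes>\<^bsub>\<U>\<^esub> x = \<one>\<^bsub>\<U>\<^esub>"
      using s principal_inverse[OF s(2)] by (intro bexI[of _ "cls (\<lambda>n. inverse (s n))"])
        (auto simp: carrier_principal_units principal_cauchy)
  next
    show "x \<otimes>\<^bsub>\<U>\<^esub> y \<in> carrier \<U>" if "x \<in> carrier \<U>" "y \<in> carrier \<U>" for x y
      using that by (auto simp: carrier_principal_units principal_cauchy intro!: imageI principal_mult)
    show "\<one>\<^bsub>\<U>\<^esub> \<in> carrier \<U>" using principal_one by (auto simp: carrier_principal_units)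
  qed (use sub m_assoc m_comm l_one in \<open>simp_all del: completion_simps(1,2)\<close>)
qed

lemma cls_nat_pow: "cauchy s \<Longrightarrow> cls s [^]\<^bsub>\<Q>\<^esub> (k::nat) = cls (\<lambda>n. s n ^ k) \<and> cauchy (\<lambda>n. s n ^ k)"
proof (induction k)
  case (Suc k)
  thus ?case using cauchy_mult[of "\<lambda>n. s n ^ k" s] by (simp add: mult.commute)
qed auto

lemma principal_units_nat_pow: "principal s \<Longrightarrow> cls s [^]\<^bsub>\<U>\<^esub> (k::nat) = cls (\<lambda>n. s n ^ k) \<and> principal (\<lambda>n. s n ^ k)"
proof (induction k)
  case (Suc k)
  thus ?case using principal_mult[of "\<lambda>n. s n ^ k" s] by (simp add: mult.commute principal_cauchy)
qed (auto simp: principal_one)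

lemma principal_units_int_pow:
  assumes "principal s"
  shows "cls s [^]\<^bsub>\<U>\<^esub> (k::int) = cls (\<lambda>n. s n powi k)" "principal (\<lambda>n. s n powi k)"
proof -
  interpret comm_group \<U> by (rule comm_group_principal_units)
  have "cls s [^]\<^bsub>\<U>\<^esub> k = cls (\<lambda>n. s n powi k) \<and> principal (\<lambda>n. s n powi k)"
  proof (cases "k \<ge> 0")
    case True
    hence "s n powi k = s n ^ nat k" for n by (simp add: power_int_def)
    thus ?thesis using principal_units_nat_pow[OF assms, of "nat k"] pow_nat[OF True, of \<U> "cls s"] by simp
  next
    case False
    define j where "j = nat (- k)"
    have P: "principal (\<lambda>n. s n ^ j)" "principal (\<lambda>n. inverse (s n ^ j))"
      using principal_units_nat_pow[OF assms, of j] principal_inverse by auto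
    have "(\<lambda>n. w (inverse (s n ^ j) * s n ^ j - 1)) \<longlonglongrightarrow> 0"
    proof (rule null_bound[where g = "\<lambda>_. 0"])
      show "\<forall>\<^sub>F n in sequentially. w (inverse (s n ^ j) * s n ^ j - 1) \<le> 0"
        using principal_w_1[OF P(1)] by eventually_elim (metis diff_self left_inverse order_refl w_0 zero_neq_one)
    qed (use assms in \<open>auto simp: principal_def\<close>)
    hence "cls (\<lambda>n. inverse (s n ^ j) * s n ^ j) = cls (\<lambda>n. 1)"
      using P by (subst cls_eq_iff) (auto intro!: cauchy_mult simp: principal_def)
    hence "inv\<^bsub>\<U>\<^esub> (cls (\<lambda>n. s n ^ j)) = cls (\<lambda>n. inverse (s n ^ j))"
      using P by (intro inv_equality) (auto simp: carrier_principal_units principal_cauchy)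
    moreover have "cls s [^]\<^bsub>\<U>\<^esub> k = inv\<^bsub>\<U>\<^esub> (cls s [^]\<^bsub>\<U>\<^esub> j)" using False by (simp only: int_pow_def2 j_def) simp
    moreover have "s n powi k = inverse (s n ^ j)" for n using False by (simp add: power_int_def j_def power_inverse)
    ultimately show ?thesis using principal_units_nat_pow[OF assms, of j] P by simp
  qed
  thus "cls s [^]\<^bsub>\<U>\<^esub> k = cls (\<lambda>n. s n powi k)" "principal (\<lambda>n. s n powi k)" by auto
qed

section \<open>The Leopoldt map on units\<close>

abbreviation "unit \<equiv> alg_unit E"
abbreviation "proj \<equiv> proj_exp p"
abbreviation "coherent \<equiv> padic_coherent p"
abbreviation "leo_seq \<equiv> leo_prod p"

lemma unit_E [simp, intro]: "unit u \<Longrightarrow> u \<in> E" by (simp add: alg_unit_def)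

lemma unit_w [simp]: "unit u \<Longrightarrow> w u = 1" by (auto simp: alg_unit_def intro: w_unit)

text \<open>The square in \<open>proj_exp\<close> turns the residue -1 of
  \<open>p ^ fact n - 1\<close> into 1.\<close>

lemma proj_cong: "int p ^ n dvd proj n - 1"
proof -
  have "n \<le> fact n" by (rule fact_ge_self)
  hence "int p ^ n dvd int p ^ fact n" by (rule le_imp_power_dvd)
  moreover have "proj n - 1 = int p ^ fact n * (int p ^ fact n - 2)"
    by (simp add: proj_exp_def power2_eq_square algebra_simps)
  ultimately show ?thesis by simp
qed

lemma minus_1_dvd_power: "(x - 1 :: int) dvd x ^ n - 1"
proof (induction n)
  case (Suc n)
  have "x ^ Suc n - 1 = x * (x ^ n - 1) + (x - 1)" by (simp add: algebra_simps)
  thus ?case using Suc by (metis dvd_add dvd_mult dvd_refl)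
qed simp

text \<open>Once \<open>n\<close> reaches \<open>f\<close>, the factorial is a multiple of
  \<open>f\<close>, so \<open>p ^ f - 1\<close> divides \<open>p ^ fact n - 1\<close>. The factorial
  serves all \<open>f\<close>, hence all units, simultaneously.\<close>

lemma proj_dvd: assumes "f > 0" "n \<ge> f" shows "int (p ^ f - 1) dvd proj n"
proof -
  obtain j :: nat where "fact n = f * j" using dvd_fact[of f n] assms by (auto elim: dvdE)
  hence "int p ^ fact n - 1 = (int p ^ f) ^ j - 1" by (simp add: power_mult)
  hence "int p ^ f - 1 dvd int p ^ fact n - 1" using minus_1_dvd_power by metis
  moreover have "int (p ^ f - 1) = int p ^ f - 1" using p_gt_1 by (simp add: of_nat_diff)
  ultimately show ?thesis unfolding proj_exp_def power2_eq_square by (metis dvd_mult)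
qed

lemma coprime_power_minus_1: assumes "f > 0" shows "coprime (p ^ f - 1) p"
proof (rule coprimeI)
  fix c assume c: "c dvd p ^ f - 1" "c dvd p"
  have "c dvd p ^ f" by (rule dvd_trans[OF c(2) dvd_power]) (simp add: assms)
  moreover have "p ^ f = (p ^ f - 1) + 1" using p_gt_1 by simp
  ultimately show "is_unit c" using c(1) by (metis dvd_add_right_iff)
qed

text \<open>The power \<open>u ^ (p ^ f - 1)\<close> is principal, and further factors
  \<open>p\<close> in the exponent bring it to 1 geometrically. The two divisibility conditions
  combine because \<open>p\<close> is prime to \<open>p ^ f - 1\<close>; the constants depend on
  \<open>u\<close> alone.\<close>

lemma unit_exponents:
  assumes "unit u"
  obtains f r \<theta> where "f > 0" "0 \<le> r" "r < 1" "0 \<le> \<theta>" "\<theta> < 1"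
    "\<And>n k. int (p ^ f - 1) dvd k \<Longrightarrow> int p ^ n dvd k \<Longrightarrow> w (u powi k - 1) \<le> r * \<theta> ^ n"
proof -
  have alg: "algebraic_int u" using assms by (simp add: alg_unit_def)
  obtain f where f: "f > 0" "w (u ^ (p ^ f - 1) - 1) < 1"
    by (rule residue_order[OF unit_E[OF assms] alg unit_w[OF assms]])
  define x where "x = u ^ (p ^ f - 1)"
  define r where "r = w (x - 1)"
  have xE: "x \<in> E" using assms by (auto simp: x_def)
  have r: "0 \<le> r" "r < 1" using f w_nonneg[of "x - 1"] xE by (auto simp: r_def x_def)
  have "w (u powi k - 1) \<le> r * max r (1 / p) ^ n" if "int (p ^ f - 1) dvd k" "int p ^ n dvd k" for n k
  proof -
    from that(1) obtain j where j: "k = int (p ^ f - 1) * j" by (rule dvdE)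
    have "coprime (int p) (int (p ^ f - 1))"
      unfolding coprime_int_iff using coprime_power_minus_1[OF f(1)] by (simp add: coprime_commute)
    hence "coprime (int p ^ n) (int (p ^ f - 1))" by simp
    hence "int p ^ n dvd j" using that(2) unfolding j by (simp add: coprime_dvd_mult_right_iff)
    hence "w (x powi j - 1) \<le> r * max r (1 / p) ^ n"
      using xE r by (intro p_power_mult_near_1) (auto simp: r_def)
    moreover have "x powi j = u powi k" by (simp add: x_def j power_int_mult flip: power_int_of_nat)
    ultimately show ?thesis by simp
  qed
  moreover have "max r (1 / p) < 1" "0 \<le> max r (1 / p)" using r p_gt_1 by auto
  ultimately show ?thesis using that[OF f(1) r] by blast
qed

lemma coherent_dvd: assumes "coherent b" "m \<ge> n" shows "int p ^ n dvd b m - b n"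
  using assms(2)
proof (induction m rule: dec_induct)
  case (step m)
  have "int p ^ n dvd b (Suc m) - b m"
    using assms(1) le_imp_power_dvd[of n m "int p"] step unfolding padic_coherent_def by (meson dvd_trans)
  hence "int p ^ n dvd (b (Suc m) - b m) + (b m - b n)" using step by (intro dvd_add)
  thus ?case by simp
qed simp

lemma proj_mult_diff_dvd:
  assumes "coherent b" "m \<ge> n"
  shows "int p ^ n dvd proj m * b m - proj n * b n"
proof -
  have "int p ^ n dvd int p ^ m" using assms by (simp add: le_imp_power_dvd)
  hence "int p ^ n dvd proj m - 1" using proj_cong dvd_trans by blast
  moreover have "proj m * b m - proj n * b n = (proj m - 1) * b m - (proj n - 1) * b n + (b m - b n)"
    by (simp add: algebra_simps)
  ultimately show ?thesis using proj_cong[of n] coherent_dvd[OF assms] by (metis dvd_add dvd_diff dvd_mult2)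
qed

lemma unit_diff:
  assumes "unit u"
  shows "w (u powi a - u powi b) = w (u powi (a - b) - 1)"
proof -
  have "u \<noteq> 0" using assms by (simp add: alg_unit_def)
  hence "u powi a - u powi b = u powi b * (u powi (a - b) - 1)"
    by (simp add: power_int_diff field_simps)
  thus ?thesis using assms by (simp add: w_mult w_power_int power_int_mem diff_mem)
qed

text \<open>From \<open>n = f\<close> on, the exponents are divisible by \<open>p ^ f - 1\<close>,
  and their differences are divisible by growing powers of \<open>p\<close>;
  \<open>unit_exponents\<close> then gives both closeness to 1 and the Cauchy property.\<close>

lemma proj_powers_principal:
  assumes u: "unit u" and b: "coherent b"
  shows "principal (\<lambda>n. u powi (proj n * b n))"
proof -
  obtain f r \<theta> where f: "f > 0" "0 \<le> r" "r < 1" "0 \<le> \<theta>" "\<theta> < 1"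
    and near: "\<And>n k. int (p ^ f - 1) dvd k \<Longrightarrow> int p ^ n dvd k \<Longrightarrow> w (u powi k - 1) \<le> r * \<theta> ^ n"
    using unit_exponents[OF u] by metis
  have "cauchy (\<lambda>n. u powi (proj n * b n))"
  proof (rule cauchyI[where g = "\<lambda>n. r * \<theta> ^ n" and ?N0.0 = f])
    show "(\<lambda>n. r * \<theta> ^ n) \<longlonglongrightarrow> 0" using f by (intro tendsto_mult_right_zero LIMSEQ_realpow_zero)
    fix m n assume mn: "m \<ge> n" "n \<ge> f"
    have "int (p ^ f - 1) dvd proj m * b m - proj n * b n"
      using proj_dvd[of f m] proj_dvd[of f n] mn f by (intro dvd_diff) auto
    thus "w (u powi (proj m * b m) - u powi (proj n * b n)) \<le> r * \<theta> ^ n"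
      unfolding unit_diff[OF u] by (rule near[OF _ proj_mult_diff_dvd[OF b mn(1)]])
  qed (use u in auto)
  moreover have "\<forall>\<^sub>F n in sequentially. w (u powi (proj n * b n) - 1) \<le> r"
    using eventually_ge_at_top[of f]
  proof eventually_elim
    case (elim n)
    thus ?case using near[of "proj n * b n" 0] proj_dvd[of f n] f by simp
  qed
  ultimately show ?thesis using f unfolding principal_def by blast
qed

lemma proj_powers_null:
  assumes u: "unit u" and b: "\<And>n. int p ^ n dvd b n"
  shows "(\<lambda>n. w (u powi (proj n * b n) - 1)) \<longlonglongrightarrow> 0"
proof -
  obtain f r \<theta> where f: "f > 0" "0 \<le> r" "r < 1" "0 \<le> \<theta>" "\<theta> < 1"
    and near: "\<And>n k. int (p ^ f - 1) dvd k \<Longrightarrow> int p ^ n dvd k \<Longrightarrow> w (u powi k - 1) \<le> r * \<theta> ^ n"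
    using unit_exponents[OF u] by metis
  show ?thesis
  proof (rule null_bound[where g = "\<lambda>n. r * \<theta> ^ n"])
    show "(\<lambda>n. r * \<theta> ^ n) \<longlonglongrightarrow> 0" using f by (intro tendsto_mult_right_zero LIMSEQ_realpow_zero)
    show "\<forall>\<^sub>F n in sequentially. w (u powi (proj n * b n) - 1) \<le> r * \<theta> ^ n"
      using eventually_ge_at_top[of f]
    proof eventually_elim
      case (elim n)
      thus ?case using near[of "proj n * b n" n] proj_dvd[of f n] b[of n] f by simp
    qed
  qed (use u in auto)
qed

text \<open>With \<open>M\<close> a \<open>p\<close>-adic unit, the linear term of
  \<open>(1 + t) ^ M - 1\<close> has size \<open>w t\<close> and dominates the quadratic
  error.\<close>

lemma w_power_minus_1_coprime:
  assumes "x \<in> E" "w (x - 1) < 1" "\<not> p dvd M"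
  shows "w (x ^ M - 1) = w (x - 1)"
proof (cases "x = 1")
  case False
  define t where "t = x - 1"
  have t: "t \<in> E" "w t < 1" "w t > 0" using assms False w_eq_0[of t] w_nonneg[of t] by (auto simp: t_def less_le)
  have M: "w (of_nat M) = 1" using assms(3) w_of_int_unit[of "int M"] by simp
  have "(w t)\<^sup>2 < w t" using t by (simp add: power2_eq_square)
  hence "w ((1 + t) ^ M - 1 - of_nat M * t) < w (of_nat M * t)"
    using quadratic_error[of t M] t M by (simp add: w_mult)
  hence "w (of_nat M * t + ((1 + t) ^ M - 1 - of_nat M * t)) = w (of_nat M * t)"
    using t by (intro w_add_eq) auto
  thus ?thesis using t M by (simp add: w_mult t_def)
qed simp

text \<open>The quotient of the two sequences is principal, so its distance from 1 is unchanged by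
  the \<open>M\<close>-th power. This yields the uniqueness of the principal part.\<close>

lemma principal_root_unique:
  assumes s: "principal s" and t: "principal t" and M: "\<not> p dvd M"
    and eq: "cls s [^]\<^bsub>\<Q>\<^esub> M = cls t [^]\<^bsub>\<Q>\<^esub> M"
  shows "cls s = cls t"
proof -
  have c: "cauchy s" "cauchy t" using s t by (auto simp: principal_def)
  have lim: "(\<lambda>n. w (s n ^ M - t n ^ M)) \<longlonglongrightarrow> 0"
    using eq cls_nat_pow[OF c(1), of M] cls_nat_pow[OF c(2), of M] by (simp add: cls_eq_iff)
  have P: "principal (\<lambda>n. s n * inverse (t n))" by (intro principal_mult s principal_inverse t)
  then obtain r where r: "r < 1" "\<forall>\<^sub>F n in sequentially. w (s n * inverse (t n) - 1) \<le> r"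
    unfolding principal_def by blast
  have "(\<lambda>n. w (s n - t n)) \<longlonglongrightarrow> 0"
  proof (rule null_bound[OF _ _ lim])
    show "\<forall>\<^sub>F n in sequentially. w (s n - t n) \<le> w (s n ^ M - t n ^ M)"
      using r(2) principal_w_1[OF t]
    proof eventually_elim
      case (elim n)
      have t0: "t n \<noteq> 0" using elim by auto
      define x where "x = s n * inverse (t n)"
      have x: "x \<in> E" "s n = t n * x" using c t0 by (auto simp: x_def)
      have "w (s n - t n) = w (t n * (x - 1))" by (simp add: x algebra_simps)
      also have "\<dots> = w (x - 1)" using elim x c by (simp add: w_mult diff_mem)
      also have "\<dots> = w (x ^ M - 1)"
        using elim(1)[folded x_def] r(1) x(1) M by (intro w_power_minus_1_coprime[symmetric]) auto
      also have "\<dots> = w (t n ^ M * (x ^ M - 1))" using elim x c by (simp add: w_mult w_power power_mem diff_mem)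
      also have "t n ^ M * (x ^ M - 1) = s n ^ M - t n ^ M" by (simp add: x power_mult_distrib algebra_simps)
      finally show ?case by simp
    qed
  qed (use c in auto)
  thus ?thesis using c by (simp add: cls_eq_iff)
qed

lemma completion_embed_eq: "completion_embed E w x = cls (\<lambda>_. x)"
  by (simp add: completion_embed_def cls_def)

lemma proj_principal: "unit u \<Longrightarrow> principal (\<lambda>n. u powi proj n)"
  using proj_powers_principal[of u "\<lambda>_. 1"] by (simp add: padic_coherent_def)

text \<open>The unit splits as the limits of \<open>u powi (1 - proj n)\<close> and of
  \<open>u powi proj n\<close>: the first is a root of unity of order dividing
  \<open>p ^ f - 1\<close>, the second is principal. For uniqueness both decompositions are raised
  to the product of the two orders.\<close>

lemma principal_part_unit:
  assumes u: "unit u"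
  shows "principal_part E p w (completion_embed E w u) = cls (\<lambda>n. u powi proj n)"
  unfolding principal_part_def completion_embed_eq
proof (rule the_equality)
  interpret cring \<Q> by (rule cring_completion)
  have u0: "u \<noteq> 0" using u by (simp add: alg_unit_def)
  let ?v = "\<lambda>n. u powi proj n"
  have v: "principal ?v" by (rule proj_principal[OF u])
  obtain f r \<theta> where f: "f > 0" "0 \<le> r" "r < 1" "0 \<le> \<theta>" "\<theta> < 1"
    and near: "\<And>n k. int (p ^ f - 1) dvd k \<Longrightarrow> int p ^ n dvd k \<Longrightarrow> w (u powi k - 1) \<le> r * \<theta> ^ n"
    using unit_exponents[OF u] by metis
  let ?m = "p ^ f - 1"
  have pf: "p ^ f > 1" using one_less_power[OF p_gt_1 f(1)] .
  hence m0: "?m > 0" by simp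
  have cop: "coprime ?m p" by (rule coprime_power_minus_1[OF f(1)])
  \<comment> \<open>The root of unity part: its exponents \<open>1 - proj n\<close> tend to 0 in the
    \<open>p\<close>-adic integers, so the power \<open>p ^ f - 1\<close> sends it to 1.\<close>
  define z where "z = (\<lambda>n. u * inverse (u powi proj n))"
  have zc: "cauchy z" unfolding z_def
    using u v by (intro cauchy_mult principal_cauchy[OF principal_inverse] cauchy_const) auto
  have z: "z n = u powi (1 - proj n)" for n using u0 by (simp add: z_def power_int_diff field_simps)
  have "(\<lambda>n. w (z n ^ ?m - 1)) \<longlonglongrightarrow> 0"
  proof (rule null_bound[where g = "\<lambda>n. r * \<theta> ^ n"])
    show "(\<lambda>n. r * \<theta> ^ n) \<longlonglongrightarrow> 0" using f by (intro tendsto_mult_right_zero LIMSEQ_realpow_zero)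
    have "w (z n ^ ?m - 1) \<le> r * \<theta> ^ n" for n
    proof -
      have "z n ^ ?m = u powi ((1 - proj n) * int ?m)" unfolding z by (simp add: power_int_mult)
      moreover have "int p ^ n dvd 1 - proj n" using proj_cong[of n] by (metis dvd_minus_iff minus_diff_eq)
      ultimately show ?thesis using near[of "(1 - proj n) * int ?m" n] by simp
    qed
    thus "\<forall>\<^sub>F n in sequentially. w (z n ^ ?m - 1) \<le> r * \<theta> ^ n" by simp
  qed (use zc in auto)
  hence zm: "cls z [^]\<^bsub>\<Q>\<^esub> ?m = \<one>\<^bsub>\<Q>\<^esub>" using cls_nat_pow[OF zc, of ?m] by (simp add: cls_eq_iff)
  have uz: "cls (\<lambda>_. u) = cls z \<otimes>\<^bsub>\<Q>\<^esub> cls ?v"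
    using zc principal_cauchy[OF v] u0 by (simp add: z power_int_add[symmetric])
  show "cls ?v \<in> carrier \<U> \<and> (\<exists>\<zeta>\<in>carrier \<Q>. \<exists>m>0. coprime m p \<and> \<zeta> [^]\<^bsub>\<Q>\<^esub> m = \<one>\<^bsub>\<Q>\<^esub> \<and> cls (\<lambda>_. u) = \<zeta> \<otimes>\<^bsub>\<Q>\<^esub> cls ?v)"
  proof (intro conjI bexI[of _ "cls z"] exI[of _ ?m])
    show "cls ?v \<in> carrier \<U>" using v by (auto simp: carrier_principal_units)
    show "cls z \<in> carrier \<Q>" using zc by simp
  qed (fact m0 cop zm uz)+
  fix y assume "y \<in> carrier \<U> \<and> (\<exists>\<zeta>\<in>carrier \<Q>. \<exists>m>0. coprime m p \<and> \<zeta> [^]\<^bsub>\<Q>\<^esub> m = \<one>\<^bsub>\<Q>\<^esub> \<and> cls (\<lambda>_. u) = \<zeta> \<otimes>\<^bsub>\<Q>\<^esub> y)"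
  then obtain s \<zeta> m where y: "y = cls s" "principal s" "\<zeta> \<in> carrier \<Q>" "m > 0" "coprime m p"
    "\<zeta> [^]\<^bsub>\<Q>\<^esub> m = \<one>\<^bsub>\<Q>\<^esub>" "cls (\<lambda>_. u) = \<zeta> \<otimes>\<^bsub>\<Q>\<^esub> y" by (auto simp: carrier_principal_units)
  have yQ: "y \<in> carrier \<Q>" using y principal_cauchy by auto
  have vQ: "cls ?v \<in> carrier \<Q>" "cls z \<in> carrier \<Q>" using v zc principal_cauchy by auto
  have "cls (\<lambda>_. u) [^]\<^bsub>\<Q>\<^esub> (m * ?m) = (\<zeta> [^]\<^bsub>\<Q>\<^esub> m) [^]\<^bsub>\<Q>\<^esub> ?m \<otimes>\<^bsub>\<Q>\<^esub> y [^]\<^bsub>\<Q>\<^esub> (m * ?m)"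
    unfolding y(7) using y(3) yQ by (simp add: nat_pow_distrib nat_pow_pow del: completion_simps)
  also have "\<dots> = y [^]\<^bsub>\<Q>\<^esub> (m * ?m)" unfolding y(6) using yQ by (simp del: completion_simps)
  finally have 1: "cls (\<lambda>_. u) [^]\<^bsub>\<Q>\<^esub> (m * ?m) = y [^]\<^bsub>\<Q>\<^esub> (m * ?m)" .
  have "cls (\<lambda>_. u) [^]\<^bsub>\<Q>\<^esub> (?m * m) = (cls z [^]\<^bsub>\<Q>\<^esub> ?m) [^]\<^bsub>\<Q>\<^esub> m \<otimes>\<^bsub>\<Q>\<^esub> cls ?v [^]\<^bsub>\<Q>\<^esub> (?m * m)"
    unfolding uz using vQ by (simp add: nat_pow_distrib nat_pow_pow del: completion_simps)
  also have "\<dots> = cls ?v [^]\<^bsub>\<Q>\<^esub> (?m * m)" unfolding zm using vQ by (simp del: completion_simps)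
  finally have "cls ?v [^]\<^bsub>\<Q>\<^esub> (m * ?m) = y [^]\<^bsub>\<Q>\<^esub> (m * ?m)" using 1 by (simp add: mult.commute)
  moreover have "\<not> p dvd m * ?m"
  proof -
    have "coprime (m * ?m) p" using y(5) cop by simp
    thus ?thesis using p_gt_1 by (metis coprime_commute coprime_absorb_left is_unit_gcd nat_dvd_1_iff_1 less_irrefl)
  qed
  ultimately show "y = cls ?v" using principal_root_unique[OF v y(2)] y(1) by metis
qed

lemma completion_abs_triangle:
  assumes "cauchy s" "cauchy t" "cauchy x"
  shows "completion_abs w (cls s \<ominus>\<^bsub>\<Q>\<^esub> cls x) \<le> completion_abs w (cls t \<ominus>\<^bsub>\<Q>\<^esub> cls s) + completion_abs w (cls t \<ominus>\<^bsub>\<Q>\<^esub> cls x)"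
proof -
  have "w (s n - x n) \<le> w (t n - s n) + w (t n - x n)" for n
    using w_triangle[of "s n - t n" "t n - x n"] w_diff_commute[of "s n" "t n"] assms
    by (simp add: cauchy_mem)
  moreover have "(\<lambda>n. w (t n - s n) + w (t n - x n)) \<longlonglongrightarrow>
      completion_abs w (cls (\<lambda>n. t n - s n)) + completion_abs w (cls (\<lambda>n. t n - x n))"
    using assms by (intro tendsto_add completion_abs_tendsto cauchy_diff)
  moreover have "(\<lambda>n. w (s n - x n)) \<longlonglongrightarrow> completion_abs w (cls (\<lambda>n. s n - x n))"
    using assms by (intro completion_abs_tendsto cauchy_diff)
  ultimately show ?thesis using assms by (simp add: completion_minus LIMSEQ_le)
qed

lemma padic_integers_coherent:
  assumes "a \<in> carrier (padic_integers p)"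
  shows "coherent a" "a n \<ge> 0"
proof -
  have "int p ^ n dvd a (Suc n) - a n" for n
    using assms unfolding padic_integers_def by (simp add: dvd_minus_mod) (metis dvd_minus_mod)
  thus "coherent a" by (simp add: padic_coherent_def)
  show "a n \<ge> 0" using assms by (simp add: padic_integers_def)
qed

text \<open>By definition this is a limit of integer powers of an element that is itself a limit.
  The estimate from \<open>unit_exponents\<close> is uniform in the inner index, so the double limit
  collapses to the diagonal sequence.\<close>

lemma padic_pow_unit:
  assumes u: "unit u" and a: "a \<in> carrier (padic_integers p)"
  shows "padic_pow E w (cls (\<lambda>n. u powi proj n)) a = cls (\<lambda>n. u powi (proj n * a n))"
  unfolding padic_pow_def
proof (rule the_equality)
  let ?v = "\<lambda>n. u powi proj n" and ?y = "\<lambda>n. u powi (proj n * a n)"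
  have v: "principal ?v" by (rule proj_principal[OF u])
  have y: "principal ?y" by (rule proj_powers_principal[OF u padic_integers_coherent(1)[OF a]])
  have pow: "cls ?v [^]\<^bsub>\<U>\<^esub> a n = cls (\<lambda>m. u powi (proj m * a n))" "principal (\<lambda>m. u powi (proj m * a n))" for n
    using principal_units_int_pow[OF v, of "a n"] by (auto simp: power_int_mult)
  obtain f r \<theta> where f: "f > 0" "0 \<le> r" "r < 1" "0 \<le> \<theta>" "\<theta> < 1"
    and near: "\<And>n k. int (p ^ f - 1) dvd k \<Longrightarrow> int p ^ n dvd k \<Longrightarrow> w (u powi k - 1) \<le> r * \<theta> ^ n"
    using unit_exponents[OF u] by metis
  have bound: "completion_abs w (cls ?v [^]\<^bsub>\<U>\<^esub> a n \<ominus>\<^bsub>\<Q>\<^esub> cls ?y) \<le> r * \<theta> ^ n" for n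
  proof -
    let ?d = "\<lambda>m. u powi (proj m * a n) - u powi (proj m * a m)"
    have c: "cauchy ?d" using pow y by (intro cauchy_diff principal_cauchy) auto
    have "\<forall>\<^sub>F m in sequentially. w (?d m) \<le> r * \<theta> ^ n"
      using eventually_ge_at_top[of "max f n"]
    proof eventually_elim
      case (elim m)
      have "int p ^ n dvd proj m * a n - proj m * a m"
        using coherent_dvd[OF padic_integers_coherent(1)[OF a], of n m] elim
        by (metis dvd_minus_iff dvd_mult max.boundedE minus_diff_eq right_diff_distrib)
      moreover have "int (p ^ f - 1) dvd proj m * a n - proj m * a m"
        using elim f(1) proj_dvd[of f m] by (intro dvd_diff dvd_mult2) auto
      ultimately show ?case unfolding unit_diff[OF u] by (intro near)
    qed
    hence "completion_abs w (cls ?d) \<le> r * \<theta> ^ n"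
      using tendsto_upperbound[OF completion_abs_tendsto[OF c]] by simp
    thus ?thesis unfolding pow using pow y by (subst completion_minus) (auto simp: principal_cauchy)
  qed
  have nonneg: "completion_abs w (cls s) \<ge> 0" if "cauchy s" for s
    using tendsto_lowerbound[OF completion_abs_tendsto[OF that], of 0] w_nonneg that by simp
  have nonneg': "completion_abs w (cls ?v [^]\<^bsub>\<U>\<^esub> a n \<ominus>\<^bsub>\<Q>\<^esub> cls t) \<ge> 0" if "cauchy t" for n t
    unfolding pow using pow that principal_cauchy by (subst completion_minus) (auto intro!: nonneg cauchy_diff)
  have lim: "(\<lambda>n. completion_abs w (cls ?v [^]\<^bsub>\<U>\<^esub> a n \<ominus>\<^bsub>\<Q>\<^esub> cls ?y)) \<longlonglongrightarrow> 0"
  proof (rule real_null_comparison[rotated])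
    show "(\<lambda>n. r * \<theta> ^ n) \<longlonglongrightarrow> 0" using f by (intro tendsto_mult_right_zero LIMSEQ_realpow_zero)
    show "\<forall>\<^sub>F n in sequentially. norm (completion_abs w (cls ?v [^]\<^bsub>\<U>\<^esub> a n \<ominus>\<^bsub>\<Q>\<^esub> cls ?y)) \<le> r * \<theta> ^ n"
      using bound nonneg'[OF principal_cauchy[OF y]] by simp
  qed
  show "cls ?y \<in> carrier \<U> \<and> (\<lambda>n. completion_abs w (cls ?v [^]\<^bsub>\<U>\<^esub> a n \<ominus>\<^bsub>\<Q>\<^esub> cls ?y)) \<longlonglongrightarrow> 0"
    using lim y by (auto simp: carrier_principal_units)
  fix y' assume y': "y' \<in> carrier \<U> \<and> (\<lambda>n. completion_abs w (cls ?v [^]\<^bsub>\<U>\<^esub> a n \<ominus>\<^bsub>\<Q>\<^esub> y')) \<longlonglongrightarrow> 0"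
  then obtain t where t: "y' = cls t" "principal t" by (auto simp: carrier_principal_units)
  have ct: "cauchy t" "cauchy ?y" using t y principal_cauchy by auto
  let ?D = "completion_abs w (cls t \<ominus>\<^bsub>\<Q>\<^esub> cls ?y)"
  have "?D \<le> completion_abs w (cls ?v [^]\<^bsub>\<U>\<^esub> a n \<ominus>\<^bsub>\<Q>\<^esub> cls t) + completion_abs w (cls ?v [^]\<^bsub>\<U>\<^esub> a n \<ominus>\<^bsub>\<Q>\<^esub> cls ?y)" for n
    unfolding pow using pow(2) ct principal_cauchy by (intro completion_abs_triangle) auto
  moreover have "(\<lambda>n. completion_abs w (cls ?v [^]\<^bsub>\<U>\<^esub> a n \<ominus>\<^bsub>\<Q>\<^esub> cls t) + completion_abs w (cls ?v [^]\<^bsub>\<U>\<^esub> a n \<ominus>\<^bsub>\<Q>\<^esub> cls ?y)) \<longlonglongrightarrow> 0 + 0"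
    using y' lim unfolding t by (intro tendsto_add) auto
  ultimately have "?D \<le> 0" using LIMSEQ_le_const[of _ "0 + 0" ?D] by auto
  hence "completion_abs w (cls (\<lambda>n. t n - ?y n)) = 0"
    using nonneg[OF cauchy_diff[OF ct]] ct by (simp add: completion_minus)
  hence "(\<lambda>n. w (t n - ?y n)) \<longlonglongrightarrow> 0" using completion_abs_tendsto[OF cauchy_diff[OF ct]] by simp
  thus "y' = cls ?y" using ct t by (simp add: cls_eq_iff)
qed

section \<open>The Leopoldt map on formal sums, computed by sequences in \<open>E\<close>\<close>

abbreviation generators :: "((nat \<Rightarrow> int) \<times> complex) set"
  where "generators \<equiv> carrier (padic_integers p) \<times> Collect unit"

lemma leo_seq_superset:
  assumes "finite S" "Poly_Mapping.keys c \<subseteq> S"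
  shows "leo_seq c n = (\<Prod>(a,u)\<in>S. u powi (proj n * a n * Poly_Mapping.lookup c (a,u)))"
  unfolding leo_prod_def using assms
  by (intro prod.mono_neutral_left) (auto simp: in_keys_iff)

text \<open>The multiplicities \<open>k\<close> are kept apart from any formal sum, so that the
  induction can run over finite sets of generators.\<close>

lemma leo_seq_principal_prod:
  assumes "finite S" "S \<subseteq> generators"
  shows "finprod \<U> (\<lambda>(a,u). padic_pow E w (principal_part E p w (completion_embed E w u)) a [^]\<^bsub>\<U>\<^esub> (k (a,u) :: int)) S
    = cls (\<lambda>n. \<Prod>(a,u)\<in>S. u powi (proj n * a n * k (a,u)))
    \<and> principal (\<lambda>n. \<Prod>(a,u)\<in>S. u powi (proj n * a n * k (a,u)))"
  using assms
proof (induction S)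
  case empty
  interpret comm_group \<U> by (rule comm_group_principal_units)
  show ?case using principal_one by simp
next
  case (insert x S)
  interpret comm_group \<U> by (rule comm_group_principal_units)
  define g where "g = (\<lambda>(a,u). padic_pow E w (principal_part E p w (completion_embed E w u)) a [^]\<^bsub>\<U>\<^esub> (k (a,u) :: int))"
  define h where "h = (\<lambda>n (a,u). u powi (proj n * a n * k (a,u)))"
  have g: "g y = cls (\<lambda>n. h n y) \<and> principal (\<lambda>n. h n y)" if "y \<in> generators" for y
  proof -
    from that obtain a u where y: "y = (a,u)" "a \<in> carrier (padic_integers p)" "unit u" by auto
    have P: "principal (\<lambda>n. u powi (proj n * a n))"
      by (rule proj_powers_principal[OF y(3) padic_integers_coherent(1)[OF y(2)]])
    show ?thesis using principal_units_int_pow[OF P, of "k (a,u)"] y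
      by (simp add: g_def h_def principal_part_unit padic_pow_unit power_int_mult)
  qed
  have gc: "g y \<in> carrier \<U>" if "y \<in> generators" for y using g[OF that] by (auto simp: carrier_principal_units)
  have fp: "finprod \<U> g (insert x S) = g x \<otimes>\<^bsub>\<U>\<^esub> finprod \<U> g S"
    using insert gc by (intro finprod_insert) auto
  have IH: "finprod \<U> g S = cls (\<lambda>n. \<Prod>y\<in>S. h n y)" "principal (\<lambda>n. \<Prod>y\<in>S. h n y)"
    using insert unfolding g_def h_def by (auto simp: case_prod_unfold)
  have gx: "g x = cls (\<lambda>n. h n x)" "principal (\<lambda>n. h n x)" using g insert by auto
  have "finprod \<U> g (insert x S) = cls (\<lambda>n. h n x * (\<Prod>y\<in>S. h n y))"
    unfolding fp IH gx using IH(2) gx(2) by (simp add: principal_cauchy)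
  moreover have "principal (\<lambda>n. h n x * (\<Prod>y\<in>S. h n y))" by (intro principal_mult gx IH)
  ultimately show ?case using insert(1,2) unfolding g_def h_def by (simp add: case_prod_unfold)
qed

lemma leopoldt_free_eq:
  assumes "Poly_Mapping.keys c \<subseteq> generators"
  shows "leopoldt_free E p w c = cls (leo_seq c)" "principal (leo_seq c)"
  using leo_seq_principal_prod[OF _ assms, of "Poly_Mapping.lookup c"]
  unfolding leopoldt_free_def leo_prod_def[abs_def] by auto

lemma leo_seq_nonzero: "Poly_Mapping.keys c \<subseteq> generators \<Longrightarrow> leo_seq c n \<noteq> 0"
  unfolding leo_prod_def by (auto simp: prod_zero_iff alg_unit_def)

lemma leo_seq_w: "Poly_Mapping.keys c \<subseteq> generators \<Longrightarrow> w (leo_seq c n) = 1"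
proof -
  assume c: "Poly_Mapping.keys c \<subseteq> generators"
  have "w (\<Prod>(a,u)\<in>S. u powi (proj n * a n * Poly_Mapping.lookup c (a,u))) = 1 \<and> (\<Prod>(a,u)\<in>S. u powi (proj n * a n * Poly_Mapping.lookup c (a,u))) \<in> E"
    if "finite S" "S \<subseteq> generators" for S
    using that by (induction S) (auto simp: w_mult[OF power_int_mem[OF unit_E]] w_power_int)
  thus ?thesis using c unfolding leo_prod_def by auto
qed

lemma leo_seq_E: "Poly_Mapping.keys c \<subseteq> generators \<Longrightarrow> leo_seq c n \<in> E"
  using leopoldt_free_eq(2) principal_cauchy by blast

lemma leo_seq_add:
  assumes "Poly_Mapping.keys c \<subseteq> generators" "Poly_Mapping.keys d \<subseteq> generators"
  shows "leo_seq (c + d) n = leo_seq c n * leo_seq d n"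
proof -
  let ?S = "Poly_Mapping.keys c \<union> Poly_Mapping.keys d"
  have S: "finite ?S" "Poly_Mapping.keys (c + d) \<subseteq> ?S" by (auto simp: keys_add)
  have u: "u \<noteq> 0" if "(a,u) \<in> ?S" for a u using assms that by (auto simp: alg_unit_def)
  have "leo_seq (c + d) n = (\<Prod>(a,u)\<in>?S. u powi (proj n * a n * Poly_Mapping.lookup (c + d) (a,u)))"
    by (rule leo_seq_superset[OF S])
  also have "\<dots> = (\<Prod>(a,u)\<in>?S. u powi (proj n * a n * Poly_Mapping.lookup c (a,u)) * u powi (proj n * a n * Poly_Mapping.lookup d (a,u)))"
  proof (intro prod.cong refl, clarify)
    fix a u assume "(a,u) \<in> ?S"
    hence "u \<noteq> 0" by (rule u)
    thus "u powi (proj n * a n * Poly_Mapping.lookup (c + d) (a,u))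
       = u powi (proj n * a n * Poly_Mapping.lookup c (a,u)) * u powi (proj n * a n * Poly_Mapping.lookup d (a,u))"
      by (simp add: lookup_add distrib_left power_int_add)
  qed
  also have "\<dots> = leo_seq c n * leo_seq d n"
    using leo_seq_superset[OF S(1), of c n] leo_seq_superset[OF S(1), of d n]
    by (simp add: prod.distrib case_prod_unfold)
  finally show ?thesis .
qed

lemma leo_seq_minus: "leo_seq (- c) n = inverse (leo_seq c n)"
  unfolding leo_prod_def keys_minus
  by (simp add: power_int_minus case_prod_unfold prod_inversef[symmetric] o_def)

lemma leo_seq_frag_of: "leo_seq (frag_of (a,u)) n = u powi (proj n * a n)"
  by (simp add: leo_prod_def)

text \<open>All \<open>leo_seq\<close> have absolute value 1, so the difference of two of them is as
  large as the distance of their quotient from 1.\<close>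

lemma leopoldt_free_eq_iff:
  assumes "Poly_Mapping.keys c \<subseteq> generators" "Poly_Mapping.keys d \<subseteq> generators"
  shows "leopoldt_free E p w c = leopoldt_free E p w d \<longleftrightarrow> (\<lambda>n. w (leo_seq (c - d) n - 1)) \<longlonglongrightarrow> 0"
proof -
  have "leo_seq (c - d) n = leo_seq c n * inverse (leo_seq d n)" for n
    using leo_seq_add[of c "- d" n] assms leo_seq_minus[of d n] by simp
  hence "leo_seq c n - leo_seq d n = leo_seq d n * (leo_seq (c - d) n - 1)" for n
    using leo_seq_nonzero[OF assms(2)] by (simp add: field_simps)
  moreover have "leo_seq (c - d) n \<in> E" for n
    using assms by (intro leo_seq_E) (meson Un_least keys_diff subset_trans)
  ultimately have "w (leo_seq c n - leo_seq d n) = w (leo_seq (c - d) n - 1)" for n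
    using leo_seq_w[OF assms(2)] leo_seq_E[OF assms(2)] by (simp add: w_mult diff_mem)
  thus ?thesis using leopoldt_free_eq assms by (simp add: cls_eq_iff principal_cauchy)
qed

end

section \<open>The tensor product\<close>

context complex_subfield
begin

lemma alg_unit_mult: "alg_unit E u \<Longrightarrow> alg_unit E v \<Longrightarrow> alg_unit E (u * v)"
  by (auto simp: alg_unit_def algebraic_int_add_mult)

lemma alg_unit_inverse: "alg_unit E u \<Longrightarrow> alg_unit E (inverse u)"
  by (auto simp: alg_unit_def)

lemma alg_unit_1: "alg_unit E 1" by (simp add: alg_unit_def)

lemma alg_unit_minus_1: "alg_unit E (-1)" using minus_mem[OF one_mem] by (simp add: alg_unit_def)

lemma alg_unit_power: "alg_unit E u \<Longrightarrow> alg_unit E (u ^ n)"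
  by (induction n) (auto simp: alg_unit_1 alg_unit_mult)

lemma alg_unit_powi: "alg_unit E u \<Longrightarrow> alg_unit E (u powi n)"
  by (auto simp: power_int_def alg_unit_power alg_unit_inverse)

lemma alg_unit_prod: "(\<And>i. i \<in> I \<Longrightarrow> alg_unit E (f i)) \<Longrightarrow> alg_unit E (prod f I)"
  by (induction I rule: infinite_finite_induct) (auto simp: alg_unit_1 alg_unit_mult)

end

locale unit_tensor = complex_subfield E for E :: "complex set" +
  fixes p :: nat
  assumes prime_p: "Factorial_Ring.prime p"
begin

abbreviation "Zp \<equiv> padic_integers p"
abbreviation "OU \<equiv> units_of (ring_of_integers E)"
abbreviation "gens \<equiv> carrier Zp \<times> Collect (alg_unit E)"
abbreviation "FA \<equiv> free_Abelian_group (carrier (add_monoid Zp) \<times> carrier OU)"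
abbreviation "rels \<equiv> tensor_relations (add_monoid Zp) OU"
abbreviation "rel_group \<equiv> generate FA rels"

lemma p_gt_1: "p > 1" using prime_p by (rule prime_gt_1_nat)

lemma carrier_OU: "carrier OU = Collect (alg_unit E)"
proof -
  have "x \<in> Units (ring_of_integers E) \<longleftrightarrow> alg_unit E x" for x
  proof
    assume "x \<in> Units (ring_of_integers E)"
    then obtain y where y: "x \<in> E" "algebraic_int x" "algebraic_int y" "x * y = 1"
      by (auto simp: Units_def ring_of_integers_def)
    hence "y = inverse x" by (metis inverse_unique)
    thus "alg_unit E x" using y by (auto simp: alg_unit_def)
  next
    assume "alg_unit E x"
    thus "x \<in> Units (ring_of_integers E)"
      by (auto simp: Units_def ring_of_integers_def alg_unit_def intro!: bexI[of _ "inverse x"])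
  qed
  thus ?thesis by (auto simp: units_of_def)
qed

lemma mult_OU: "u \<otimes>\<^bsub>OU\<^esub> v = u * v"
  by (simp add: units_of_def ring_of_integers_def)

lemma carrier_FA: "c \<in> carrier FA \<longleftrightarrow> Poly_Mapping.keys c \<subseteq> gens"
  by (simp add: carrier_OU)

lemma carrier_Zp: "a \<in> carrier Zp \<longleftrightarrow> (\<forall>n. a n \<in> {0..<int p ^ n} \<and> a (Suc n) mod int p ^ n = a n)"
  by (simp add: padic_integers_def)

definition padd :: "(nat \<Rightarrow> int) \<Rightarrow> (nat \<Rightarrow> int) \<Rightarrow> nat \<Rightarrow> int"
  where "padd a b = (\<lambda>n. (a n + b n) mod int p ^ n)"

definition pdiff :: "(nat \<Rightarrow> int) \<Rightarrow> (nat \<Rightarrow> int) \<Rightarrow> nat \<Rightarrow> int"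
  where "pdiff a b = (\<lambda>n. (a n - b n) mod int p ^ n)"

lemma Zp_mod: assumes "padic_coherent p b" shows "(\<lambda>n. b n mod int p ^ n) \<in> carrier Zp"
proof -
  have "(b (Suc n) mod int p ^ Suc n) mod int p ^ n = b n mod int p ^ n" for n
  proof -
    have "int p ^ n dvd int p ^ Suc n" by simp
    hence "(b (Suc n) mod int p ^ Suc n) mod int p ^ n = b (Suc n) mod int p ^ n" by (rule mod_mod_cancel)
    also have "\<dots> = b n mod int p ^ n" using assms by (simp add: padic_coherent_def mod_eq_dvd_iff)
    finally show ?thesis .
  qed
  thus ?thesis using p_gt_1 by (simp add: carrier_Zp)
qed

lemma Zp_coherent: assumes "a \<in> carrier Zp" shows "padic_coherent p a"
proof -
  have "int p ^ n dvd a (Suc n) - a n" for n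
    using assms unfolding carrier_Zp by (metis dvd_minus_mod)
  thus ?thesis by (simp add: padic_coherent_def)
qed

lemma coherent_add: "padic_coherent p a \<Longrightarrow> padic_coherent p b \<Longrightarrow> padic_coherent p (\<lambda>n. a n + b n)"
  unfolding padic_coherent_def by (metis add_diff_add dvd_add)

lemma coherent_diff: "padic_coherent p a \<Longrightarrow> padic_coherent p b \<Longrightarrow> padic_coherent p (\<lambda>n. a n - b n)"
  unfolding padic_coherent_def
proof
  fix n assume ab: "\<forall>n. int p ^ n dvd a (Suc n) - a n" "\<forall>n. int p ^ n dvd b (Suc n) - b n"
  have "a (Suc n) - b (Suc n) - (a n - b n) = (a (Suc n) - a n) - (b (Suc n) - b n)" by simp
  thus "int p ^ n dvd a (Suc n) - b (Suc n) - (a n - b n)" using ab by (metis dvd_diff)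
qed

lemma coherent_const_mult: "padic_coherent p a \<Longrightarrow> padic_coherent p (\<lambda>n. a n * k)"
  unfolding padic_coherent_def by (metis dvd_mult2 left_diff_distrib)

lemma coherent_sum_list:
  "(\<And>t. t \<in> set xs \<Longrightarrow> padic_coherent p (f t)) \<Longrightarrow> padic_coherent p (\<lambda>n. \<Sum>t\<leftarrow>xs. f t n)"
  by (induction xs) (auto simp: coherent_add padic_coherent_def[of p "\<lambda>n. 0"])

lemma Zp_padd: "a \<in> carrier Zp \<Longrightarrow> b \<in> carrier Zp \<Longrightarrow> padd a b \<in> carrier Zp"
  unfolding padd_def by (intro Zp_mod coherent_add Zp_coherent)

lemma Zp_pdiff: "a \<in> carrier Zp \<Longrightarrow> b \<in> carrier Zp \<Longrightarrow> pdiff a b \<in> carrier Zp"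
  unfolding pdiff_def by (intro Zp_mod coherent_diff Zp_coherent)

lemma Zp_0: "(\<lambda>n. 0) \<in> carrier Zp" using p_gt_1 by (simp add: carrier_Zp)

lemma padd_pdiff: assumes "b \<in> carrier Zp" shows "padd a (pdiff b a) = b"
proof
  fix n
  have "(a n + (b n - a n) mod int p ^ n) mod int p ^ n = (a n + (b n - a n)) mod int p ^ n" by (rule mod_add_right_eq)
  thus "padd a (pdiff b a) n = b n" using assms by (simp add: padd_def pdiff_def carrier_Zp)
qed

lemma FA_diff: "c \<in> carrier FA \<Longrightarrow> d \<in> carrier FA \<Longrightarrow> c - d \<in> carrier FA"
  unfolding carrier_FA by (meson Un_least keys_diff order_trans)

lemma FA_frag_of: "a \<in> carrier Zp \<Longrightarrow> alg_unit E u \<Longrightarrow> frag_of (a,u) \<in> carrier FA"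
  unfolding carrier_FA by simp

lemma rel_group_FA: "r \<in> rel_group \<Longrightarrow> r \<in> carrier FA"
proof -
  interpret FA: group FA by simp
  have "rels \<subseteq> carrier FA"
  proof
    fix r assume "r \<in> rels"
    then consider
      x y u where "r = frag_of (padd x y, u) - frag_of (x, u) - frag_of (y, u)" "x \<in> carrier Zp" "y \<in> carrier Zp" "alg_unit E u"
    | x u v where "r = frag_of (x, u * v) - frag_of (x, u) - frag_of (x, v)" "x \<in> carrier Zp" "alg_unit E u" "alg_unit E v"
      unfolding tensor_relations_def carrier_OU mult_OU by (auto simp: padic_integers_def padd_def)
    thus "r \<in> carrier FA"
    proof cases
      case 1
      show ?thesis unfolding 1(1) by (intro FA_diff FA_frag_of Zp_padd 1)
    next
      case 2
      show ?thesis unfolding 2(1) by (intro FA_diff FA_frag_of alg_unit_mult 2)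
    qed
  qed
  moreover assume "r \<in> rel_group"
  ultimately show ?thesis using FA.generate_in_carrier by blast
qed

lemma rel_group_0: "0 \<in> rel_group"
  using generate.one[of FA rels] by simp

lemma rel_group_add: "r \<in> rel_group \<Longrightarrow> s \<in> rel_group \<Longrightarrow> r + s \<in> rel_group"
  using generate.eng[of r FA rels s] by simp

lemma rel_group_minus: "r \<in> rel_group \<Longrightarrow> - r \<in> rel_group"
proof -
  interpret FA: group FA by simp
  assume r: "r \<in> rel_group"
  have "rels \<subseteq> carrier FA" using rel_group_FA generate.incl[of _ rels FA] by (intro subsetI) metis
  hence "inv\<^bsub>FA\<^esub> r \<in> rel_group" by (rule FA.generate_m_inv_closed[OF _ r])
  thus ?thesis using rel_group_FA[OF r] by simp
qed

lemma rel_group_diff: "r \<in> rel_group \<Longrightarrow> s \<in> rel_group \<Longrightarrow> r - s \<in> rel_group"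
  using rel_group_add[of r "- s"] rel_group_minus by simp

text \<open>Equality in the tensor product, expressed on formal sums instead of cosets.\<close>

definition teq :: "((nat \<Rightarrow> int) \<times> complex \<Rightarrow>\<^sub>0 int) \<Rightarrow> ((nat \<Rightarrow> int) \<times> complex \<Rightarrow>\<^sub>0 int) \<Rightarrow> bool" (infix \<open>\<asymp>\<close> 50)
  where "c \<asymp> d \<longleftrightarrow> c - d \<in> rel_group"

lemma teq_refl [simp]: "c \<asymp> c" unfolding teq_def diff_self by (rule rel_group_0)

lemma teq_sym: "c \<asymp> d \<Longrightarrow> d \<asymp> c" unfolding teq_def using rel_group_minus by fastforce

lemma teq_trans [trans]: "c \<asymp> d \<Longrightarrow> d \<asymp> e \<Longrightarrow> c \<asymp> e"
  unfolding teq_def using rel_group_add[of "c - d" "d - e"] by simp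

lemma teq_eq_trans [trans]: "c = d \<Longrightarrow> d \<asymp> e \<Longrightarrow> c \<asymp> e" "c \<asymp> d \<Longrightarrow> d = e \<Longrightarrow> c \<asymp> e" by auto

lemma teq_add: "c \<asymp> d \<Longrightarrow> c' \<asymp> d' \<Longrightarrow> c + c' \<asymp> d + d'"
  unfolding teq_def using rel_group_add[of "c - d" "c' - d'"] by (simp add: add_diff_add)

lemma teq_diff: "c \<asymp> d \<Longrightarrow> c' \<asymp> d' \<Longrightarrow> c - c' \<asymp> d - d'"
proof -
  assume "c \<asymp> d" "c' \<asymp> d'"
  hence "(c - d) - (c' - d') \<in> rel_group" unfolding teq_def by (rule rel_group_diff)
  moreover have "(c - d) - (c' - d') = (c - c') - (d - d')" by simp
  ultimately show ?thesis unfolding teq_def by simp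
qed

lemma teq_padd:
  assumes "a \<in> carrier Zp" "b \<in> carrier Zp" "alg_unit E u"
  shows "frag_of (padd a b, u) \<asymp> frag_of (a, u) + frag_of (b, u)"
proof -
  have "a \<otimes>\<^bsub>add_monoid Zp\<^esub> b = padd a b" by (simp add: padic_integers_def padd_def)
  moreover have "frag_of (a \<otimes>\<^bsub>add_monoid Zp\<^esub> b, u) - frag_of (a, u) - frag_of (b, u) \<in> rels"
    unfolding tensor_relations_def using assms
    by (intro UnI1 CollectI exI[of _ a] exI[of _ b] exI[of _ u]) (simp add: carrier_OU)
  ultimately have "frag_of (padd a b, u) - frag_of (a, u) - frag_of (b, u) \<in> rels" by (simp only:)
  thus ?thesis unfolding teq_def using generate.incl[of _ rels FA] by (simp add: diff_diff_eq)
qed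

lemma teq_mult:
  assumes "a \<in> carrier Zp" "alg_unit E u" "alg_unit E v"
  shows "frag_of (a, u * v) \<asymp> frag_of (a, u) + frag_of (a, v)"
proof -
  have "frag_of (a, u * v) - frag_of (a, u) - frag_of (a, v) \<in> rels"
    unfolding tensor_relations_def carrier_OU mult_OU using assms by (intro UnI2 CollectI) auto
  thus ?thesis unfolding teq_def using generate.incl[of _ rels FA] by (simp add: diff_diff_eq)
qed

lemma teq_cancel: "c \<asymp> c + d \<Longrightarrow> d \<asymp> 0"
  unfolding teq_def using rel_group_minus[of "c - (c + d)"] by simp

lemma teq_one: assumes "a \<in> carrier Zp" shows "frag_of (a, 1) \<asymp> 0"
  using teq_mult[OF assms alg_unit_1 alg_unit_1] by (intro teq_cancel[of "frag_of (a, 1)"]) simp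

lemma teq_zero: assumes "alg_unit E u" shows "frag_of (\<lambda>n. 0, u) \<asymp> 0"
proof -
  have "padd (\<lambda>n. 0) (\<lambda>n. 0) = (\<lambda>n. 0)" by (simp add: padd_def)
  thus ?thesis using teq_padd[OF Zp_0 Zp_0 assms] by (intro teq_cancel[of "frag_of (\<lambda>n. 0, u)"]) simp
qed

lemma teq_inverse:
  assumes "a \<in> carrier Zp" "alg_unit E u"
  shows "frag_of (a, inverse u) \<asymp> - frag_of (a, u)"
proof -
  have "frag_of (a, u * inverse u) \<asymp> frag_of (a, u) + frag_of (a, inverse u)"
    using assms by (intro teq_mult alg_unit_inverse)
  moreover have "u * inverse u = 1" using assms by (simp add: alg_unit_def)
  ultimately have "frag_of (a, u) + frag_of (a, inverse u) \<asymp> 0"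
    using teq_one[OF assms(1)] teq_sym teq_trans by metis
  thus ?thesis unfolding teq_def by (simp add: add.commute)
qed

text \<open>One step of the Euclidean algorithm on the second components.\<close>

lemma teq_shift:
  assumes "a \<in> carrier Zp" "b \<in> carrier Zp" "alg_unit E u" "alg_unit E v"
  shows "frag_of (a, u) + frag_of (b, v) \<asymp> frag_of (a, u * v) + frag_of (pdiff b a, v)"
    and "frag_of (a, u) + frag_of (b, v) \<asymp> frag_of (a, u * inverse v) + frag_of (padd a b, v)"
proof -
  have "frag_of (padd a (pdiff b a), v) \<asymp> frag_of (a, v) + frag_of (pdiff b a, v)"
    using assms by (intro teq_padd Zp_pdiff)
  hence 1: "frag_of (b, v) \<asymp> frag_of (a, v) + frag_of (pdiff b a, v)"
    using padd_pdiff[OF assms(2)] by simp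
  have "frag_of (a, u) + frag_of (b, v) \<asymp> frag_of (a, u) + (frag_of (a, v) + frag_of (pdiff b a, v))"
    by (rule teq_add[OF teq_refl 1])
  also have "\<dots> = (frag_of (a, u) + frag_of (a, v)) + frag_of (pdiff b a, v)" by (simp add: add.assoc)
  also have "\<dots> \<asymp> frag_of (a, u * v) + frag_of (pdiff b a, v)"
    by (intro teq_add teq_refl teq_sym[OF teq_mult] assms)
  finally show "frag_of (a, u) + frag_of (b, v) \<asymp> frag_of (a, u * v) + frag_of (pdiff b a, v)" .
  have "frag_of (a, u * inverse v) + frag_of (padd a b, v) \<asymp>
      (frag_of (a, u) + frag_of (a, inverse v)) + (frag_of (a, v) + frag_of (b, v))"
    by (intro teq_add teq_mult teq_padd alg_unit_inverse assms)
  also have "\<dots> \<asymp> (frag_of (a, u) + (- frag_of (a, v))) + (frag_of (a, v) + frag_of (b, v))"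
    by (intro teq_add teq_refl teq_inverse assms)
  also have "\<dots> = frag_of (a, u) + frag_of (b, v)" by simp
  finally show "frag_of (a, u) + frag_of (b, v) \<asymp> frag_of (a, u * inverse v) + frag_of (padd a b, v)"
    by (rule teq_sym)
qed

text \<open>Multiplicities other than 1 disappear: a repeated term is listed repeatedly, and a
  negative one is absorbed into the inverse of its unit.\<close>

lemma tensor_list:
  assumes "c \<in> carrier FA"
  shows "\<exists>xs. set xs \<subseteq> gens \<and> c \<asymp> (\<Sum>y\<leftarrow>xs. frag_of y)"
proof -
  have "Poly_Mapping.keys c \<subseteq> gens" using assms carrier_FA by blast
  thus ?thesis
  proof (rule free_Abelian_group_induct)
    show "\<exists>xs. set xs \<subseteq> gens \<and> 0 \<asymp> (\<Sum>y\<leftarrow>xs. frag_of y)" by (intro exI[of _ "[]"]) simp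
    show "\<exists>xs. set xs \<subseteq> gens \<and> frag_of y \<asymp> (\<Sum>y\<leftarrow>xs. frag_of y)" if "y \<in> gens" for y
      using that by (intro exI[of _ "[y]"]) simp
    fix c d assume IH: "\<exists>xs. set xs \<subseteq> gens \<and> c \<asymp> (\<Sum>y\<leftarrow>xs. frag_of y)"
       "\<exists>xs. set xs \<subseteq> gens \<and> d \<asymp> (\<Sum>y\<leftarrow>xs. frag_of y)"
    obtain xs where xs: "set xs \<subseteq> gens" "c \<asymp> (\<Sum>y\<leftarrow>xs. frag_of y)" using IH(1) by blast
    obtain ys where ys: "set ys \<subseteq> gens" "d \<asymp> (\<Sum>y\<leftarrow>ys. frag_of y)" using IH(2) by blast
    define zs where "zs = map (\<lambda>(a,u). (a, inverse u)) ys"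
    have "(\<Sum>y\<leftarrow>zs. frag_of y) \<asymp> - (\<Sum>y\<leftarrow>ys. frag_of y)" using ys(1) unfolding zs_def
    proof (induction ys)
      case (Cons y ys)
      obtain a u where y: "y = (a,u)" by fastforce
      have "frag_of (a, inverse u) + (\<Sum>y\<leftarrow>map (\<lambda>(a,u). (a, inverse u)) ys. frag_of y)
          \<asymp> - frag_of (a, u) + - (\<Sum>y\<leftarrow>ys. frag_of y)"
        using Cons y by (intro teq_add teq_inverse) auto
      thus ?case by (simp add: y)
    qed simp
    hence "(\<Sum>y\<leftarrow>xs @ zs. frag_of y) \<asymp> (\<Sum>y\<leftarrow>xs. frag_of y) + - (\<Sum>y\<leftarrow>ys. frag_of y)"
      by (simp del: add_uminus_conv_diff add: teq_add)
    also have "\<dots> \<asymp> c + - d" unfolding add_uminus_conv_diff by (intro teq_diff teq_sym[OF xs(2)] teq_sym[OF ys(2)])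
    finally have "c - d \<asymp> (\<Sum>y\<leftarrow>xs @ zs. frag_of y)" using teq_sym by simp
    moreover have "set (xs @ zs) \<subseteq> gens" using xs(1) ys(1) alg_unit_inverse unfolding zs_def by auto
    ultimately show "\<exists>xs. set xs \<subseteq> gens \<and> c - d \<asymp> (\<Sum>y\<leftarrow>xs. frag_of y)" by blast
  qed
qed

text \<open>Triples consist of a \<open>p\<close>-adic integer, a unit and an exponent vector of the unit.\<close>

type_synonym triple = "(nat \<Rightarrow> int) \<times> complex \<times> (nat \<Rightarrow> int)"

definition tens :: "triple list \<Rightarrow> ((nat \<Rightarrow> int) \<times> complex \<Rightarrow>\<^sub>0 int)"
  where "tens xs = (\<Sum>(a,u,x)\<leftarrow>xs. frag_of (a,u))"

text \<open>The \<open>p\<close>-adic exponent, at level \<open>n\<close>, that the whole list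
  assigns to the \<open>j\<close>-th reference unit.\<close>

definition pairing :: "triple list \<Rightarrow> nat \<Rightarrow> nat \<Rightarrow> int"
  where "pairing xs j n = (\<Sum>(a,u,x)\<leftarrow>xs. a n * x j)"

definition vanish :: "triple list \<Rightarrow> nat \<Rightarrow> bool"
  where "vanish xs j \<longleftrightarrow> (\<forall>t\<in>set xs. snd (snd t) j = 0)"

lemma vanish_simps [simp]:
  "vanish [] j" "vanish ((a,u,x) # xs) j \<longleftrightarrow> x j = 0 \<and> vanish xs j"
  "vanish (xs @ ys) j \<longleftrightarrow> vanish xs j \<and> vanish ys j"
  by (auto simp: vanish_def)

text \<open>The last condition ensures that a coordinate already cleared stays clear while later
  ones are treated.\<close>

definition equiv_lists :: "triple list \<Rightarrow> triple list \<Rightarrow> bool"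
  where "equiv_lists xs ys \<longleftrightarrow> tens xs \<asymp> tens ys \<and> (\<forall>j n. int p ^ n dvd pairing xs j n - pairing ys j n) \<and>
     (\<forall>j. vanish xs j \<longrightarrow> vanish ys j)"

lemma tens_simps [simp]: "tens [] = 0" "tens ((a,u,x) # xs) = frag_of (a,u) + tens xs"
  by (auto simp: tens_def)

lemma pairing_simps [simp]: "pairing [] j n = 0" "pairing ((a,u,x) # xs) j n = a n * x j + pairing xs j n"
  by (auto simp: pairing_def)

lemma equiv_lists_refl [simp]: "equiv_lists xs xs" by (simp add: equiv_lists_def)

lemma equiv_lists_trans:
  assumes "equiv_lists xs ys" "equiv_lists ys zs"
  shows "equiv_lists xs zs"
proof -
  have "int p ^ n dvd pairing xs j n - pairing zs j n" for j n
  proof -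
    have "int p ^ n dvd (pairing xs j n - pairing ys j n) + (pairing ys j n - pairing zs j n)"
      using assms by (intro dvd_add) (auto simp: equiv_lists_def)
    thus ?thesis by simp
  qed
  moreover have "tens xs \<asymp> tens ys" "tens ys \<asymp> tens zs" using assms by (simp_all add: equiv_lists_def)
  hence "tens xs \<asymp> tens zs" by (rule teq_trans)
  ultimately show ?thesis using assms unfolding equiv_lists_def by simp
qed

lemma equiv_lists_append: assumes "equiv_lists xs ys" shows "equiv_lists (xs @ zs) (ys @ zs)"
proof -
  have "tens (xs @ zs) = tens xs + tens zs" "pairing (xs @ zs) j n = pairing xs j n + pairing zs j n" for xs j n
    by (auto simp: tens_def pairing_def)
  moreover have "tens xs + tens zs \<asymp> tens ys + tens zs"
    using assms by (intro teq_add teq_refl) (simp add: equiv_lists_def)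
  ultimately show ?thesis using assms unfolding equiv_lists_def by simp
qed

lemma equiv_lists_Cons: assumes "equiv_lists xs ys" shows "equiv_lists (t # xs) (t # ys)"
proof -
  obtain a u x where t: "t = (a,u,x)" by (cases t)
  have "frag_of (a,u) + tens xs \<asymp> frag_of (a,u) + tens ys"
    using assms by (intro teq_add teq_refl) (simp add: equiv_lists_def)
  thus ?thesis using assms unfolding equiv_lists_def t by simp
qed

lemma equiv_lists_swap: "equiv_lists [s, t] [t, s]"
  unfolding equiv_lists_def by (cases s; cases t) (simp add: add.commute)

text \<open>\<open>Q u x\<close> stands for the statement that \<open>x\<close> is an exponent
  vector of \<open>u\<close>. The elimination uses only its compatibility with products and
  quotients.\<close>

definition good_triple :: "(complex \<Rightarrow> (nat \<Rightarrow> int) \<Rightarrow> bool) \<Rightarrow> triple \<Rightarrow> bool"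
  where "good_triple Q = (\<lambda>(a,u,x). a \<in> carrier Zp \<and> alg_unit E u \<and> Q u x)"

context
  fixes Q :: "complex \<Rightarrow> (nat \<Rightarrow> int) \<Rightarrow> bool"
  assumes Q_one: "Q 1 (\<lambda>_. 0)"
    and Q_mult: "\<And>u v x y. alg_unit E u \<Longrightarrow> alg_unit E v \<Longrightarrow> Q u x \<Longrightarrow> Q v y \<Longrightarrow> Q (u * v) (\<lambda>j. x j + y j)"
    and Q_div: "\<And>u v x y. alg_unit E u \<Longrightarrow> alg_unit E v \<Longrightarrow> Q u x \<Longrightarrow> Q v y \<Longrightarrow> Q (u * inverse v) (\<lambda>j. x j - y j)"
begin

lemma equiv_shift:
  assumes "good_triple Q (a,u,x)" "good_triple Q (b,v,y)"
  shows "equiv_lists [(a,u,x), (b,v,y)] [(a, u * v, \<lambda>j. x j + y j), (pdiff b a, v, y)]"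
    and "equiv_lists [(a,u,x), (b,v,y)] [(a, u * inverse v, \<lambda>j. x j - y j), (padd a b, v, y)]"
    and "good_triple Q (a, u * v, \<lambda>j. x j + y j)" "good_triple Q (pdiff b a, v, y)"
    and "good_triple Q (a, u * inverse v, \<lambda>j. x j - y j)" "good_triple Q (padd a b, v, y)"
proof -
  have g: "a \<in> carrier Zp" "b \<in> carrier Zp" "alg_unit E u" "alg_unit E v" "Q u x" "Q v y"
    using assms by (auto simp: good_triple_def)
  show "good_triple Q (a, u * v, \<lambda>j. x j + y j)" "good_triple Q (pdiff b a, v, y)"
    "good_triple Q (a, u * inverse v, \<lambda>j. x j - y j)" "good_triple Q (padd a b, v, y)"
    using g Q_mult Q_div alg_unit_mult alg_unit_inverse Zp_pdiff Zp_padd by (auto simp: good_triple_def)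
  have "int p ^ n dvd a n * x j + b n * y j - (a n * (x j + y j) + pdiff b a n * y j)" for j n
  proof -
    have "a n * x j + b n * y j - (a n * (x j + y j) + pdiff b a n * y j) = ((b n - a n) - pdiff b a n) * y j"
      by (simp add: algebra_simps)
    moreover have "int p ^ n dvd (b n - a n) - pdiff b a n" by (simp add: pdiff_def dvd_minus_mod)
    ultimately show ?thesis by simp
  qed
  thus "equiv_lists [(a,u,x), (b,v,y)] [(a, u * v, \<lambda>j. x j + y j), (pdiff b a, v, y)]"
    using teq_shift(1)[OF g(1-4)] unfolding equiv_lists_def by simp
  have "int p ^ n dvd a n * x j + b n * y j - (a n * (x j - y j) + padd a b n * y j)" for j n
  proof -
    have "a n * x j + b n * y j - (a n * (x j - y j) + padd a b n * y j) = ((a n + b n) - padd a b n) * y j"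
      by (simp add: algebra_simps)
    moreover have "int p ^ n dvd (a n + b n) - padd a b n" by (simp add: padd_def dvd_minus_mod)
    ultimately show ?thesis by simp
  qed
  thus "equiv_lists [(a,u,x), (b,v,y)] [(a, u * inverse v, \<lambda>j. x j - y j), (padd a b, v, y)]"
    using teq_shift(2)[OF g(1-4)] unfolding equiv_lists_def by simp
qed

text \<open>The subtractive Euclidean algorithm on the two entries in position \<open>k\<close>: the
  signs decide whether the units are multiplied or divided, and the \<open>p\<close>-adic
  coefficients change so that the tensor stays the same.\<close>

lemma euclid_pair:
  assumes "good_triple Q s" "good_triple Q t"
  shows "\<exists>s' t'. good_triple Q s' \<and> good_triple Q t' \<and> equiv_lists [s, t] [s', t'] \<and> snd (snd t') k = 0"
  using assms
proof (induction "nat \<bar>snd (snd s) k\<bar> + nat \<bar>snd (snd t) k\<bar>" arbitrary: s t rule: less_induct)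
  case less
  show ?case
  proof (cases "snd (snd t) k = 0")
    case True
    thus ?thesis using less.prems equiv_lists_refl by blast
  next
    case t0: False
    have step: "\<exists>s' t'. good_triple Q s' \<and> good_triple Q t' \<and> equiv_lists [s1, t1] [s', t'] \<and> snd (snd t') k = 0"
      if g: "good_triple Q s1" "good_triple Q t1" and nz: "snd (snd t1) k \<noteq> 0" and le: "\<bar>snd (snd t1) k\<bar> \<le> \<bar>snd (snd s1) k\<bar>"
        and sum: "nat \<bar>snd (snd s1) k\<bar> + nat \<bar>snd (snd t1) k\<bar> = nat \<bar>snd (snd s) k\<bar> + nat \<bar>snd (snd t) k\<bar>" for s1 t1
    proof -
      obtain a u x where s1: "s1 = (a,u,x)" by (cases s1)
      obtain b v y where t1: "t1 = (b,v,y)" by (cases t1)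
      note sh = equiv_shift[OF g[unfolded s1 t1]]
      show ?thesis
      proof (cases "(x k > 0) = (y k > 0)")
        case True
        have "nat \<bar>snd (snd (a, u * inverse v, \<lambda>j. x j - y j)) k\<bar> + nat \<bar>snd (snd (padd a b, v, y)) k\<bar>
           < nat \<bar>snd (snd s) k\<bar> + nat \<bar>snd (snd t) k\<bar>"
          unfolding sum[symmetric] using True nz le s1 t1 by auto
        from less.hyps[OF this sh(5,6)] sh(2) show ?thesis unfolding s1 t1 using equiv_lists_trans by blast
      next
        case False
        have "nat \<bar>snd (snd (a, u * v, \<lambda>j. x j + y j)) k\<bar> + nat \<bar>snd (snd (pdiff b a, v, y)) k\<bar>
           < nat \<bar>snd (snd s) k\<bar> + nat \<bar>snd (snd t) k\<bar>"
          unfolding sum[symmetric] using False nz le s1 t1 by auto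
        from less.hyps[OF this sh(3,4)] sh(1) show ?thesis unfolding s1 t1 using equiv_lists_trans by blast
      qed
    qed
    show ?thesis
    proof (cases "\<bar>snd (snd t) k\<bar> \<le> \<bar>snd (snd s) k\<bar>")
      case True
      show ?thesis by (rule step[OF less.prems t0 True refl])
    next
      case False
      show ?thesis
      proof (cases "snd (snd s) k = 0")
        case True
        thus ?thesis using less.prems equiv_lists_swap by blast
      next
        case s0: False
        have "\<exists>s' t'. good_triple Q s' \<and> good_triple Q t' \<and> equiv_lists [t, s] [s', t'] \<and> snd (snd t') k = 0"
          using False by (intro step less.prems s0) auto
        thus ?thesis using equiv_lists_swap equiv_lists_trans by blast
      qed
    qed
  qed
qed

lemma euclid_list:
  assumes "\<forall>t\<in>set xs. good_triple Q t"
  shows "\<exists>s zs. good_triple Q s \<and> (\<forall>t\<in>set zs. good_triple Q t) \<and> equiv_lists xs (s # zs) \<and> (\<forall>t\<in>set zs. snd (snd t) k = 0)"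
  using assms
proof (induction xs)
  case Nil
  \<comment> \<open>A zero triple serves as the head of the empty list.\<close>
  have "equiv_lists [] [(\<lambda>n. 0, 1, \<lambda>_. 0)]"
    unfolding equiv_lists_def using teq_sym[OF teq_zero[OF alg_unit_1]] by simp
  moreover have "good_triple Q (\<lambda>n. 0, 1, \<lambda>_. 0)" using Q_one Zp_0 alg_unit_1 by (simp add: good_triple_def)
  ultimately show ?case by (metis empty_iff list.set(1))
next
  case (Cons t xs)
  then obtain s zs where s: "good_triple Q s" "\<forall>t\<in>set zs. good_triple Q t" "equiv_lists xs (s # zs)"
    "\<forall>t\<in>set zs. snd (snd t) k = 0" by auto
  obtain s' t' where st: "good_triple Q s'" "good_triple Q t'" "equiv_lists [t, s] [s', t']" "snd (snd t') k = 0"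
    using euclid_pair[of t s k] Cons.prems s(1) by auto
  have "equiv_lists (t # xs) (t # s # zs)" by (rule equiv_lists_Cons[OF s(3)])
  moreover have "equiv_lists (t # s # zs) (s' # t' # zs)" using equiv_lists_append[OF st(3), of zs] by simp
  ultimately have "equiv_lists (t # xs) (s' # t' # zs)" by (rule equiv_lists_trans)
  thus ?case using st s by (intro exI[of _ s'] exI[of _ "t' # zs"]) auto
qed

text \<open>If \<open>p ^ e\<close> is the power of \<open>p\<close> in \<open>y\<close>, the
  hypothesis at level \<open>n + e\<close> gives divisibility by \<open>p ^ n\<close>, and coherence
  brings this down to level \<open>n\<close>.\<close>

lemma padic_torsion_free:
  assumes b: "b \<in> carrier Zp" and y: "y \<noteq> 0" and dvd: "\<And>n. int p ^ n dvd b n * y"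
  shows "b = (\<lambda>n. 0)"
proof
  fix n
  have unit: "\<not> is_unit (int p)" using p_gt_1 by auto
  obtain y' where y': "y = int p ^ multiplicity (int p) y * y'" "\<not> int p dvd y'"
    using multiplicity_decompose'[OF y unit] by metis
  define e where "e = multiplicity (int p) y"
  have "int p ^ (n + e) dvd b (n + e) * (int p ^ e * y')" using dvd[of "n + e"] y'(1) by (simp add: e_def)
  hence "int p ^ e * int p ^ n dvd int p ^ e * (b (n + e) * y')" by (simp add: power_add ac_simps)
  hence "int p ^ n dvd b (n + e) * y'" using p_gt_1 by (subst (asm) dvd_mult_cancel_left) auto
  moreover have "coprime (int p ^ n) y'"
    using y'(2) prime_p by (simp add: prime_imp_coprime)
  ultimately have 1: "int p ^ n dvd b (n + e)" by (simp add: coprime_dvd_mult_left_iff)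
  have "int p ^ n dvd b m - b n" if "m \<ge> n" for m
    using that
  proof (induction m rule: dec_induct)
    case (step m)
    have "int p ^ n dvd b (Suc m) - b m"
      using Zp_coherent[OF b] le_imp_power_dvd[of n m "int p"] step unfolding padic_coherent_def by (meson dvd_trans)
    hence "int p ^ n dvd (b (Suc m) - b m) + (b m - b n)" using step by (intro dvd_add)
    thus ?case by simp
  qed simp
  from dvd_diff[OF 1 this[of "n + e", OF le_add1]] have "int p ^ n dvd b n" by simp
  moreover have "0 \<le> b n" "b n < int p ^ n" using b by (auto simp: carrier_Zp)
  ultimately show "b n = 0" by (metis zdvd_not_zless order_le_less)
qed

lemma eliminate_coordinate:
  assumes g: "\<forall>t\<in>set xs. good_triple Q t" and z: "\<And>n. int p ^ n dvd pairing xs k n"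
  shows "\<exists>ys. (\<forall>t\<in>set ys. good_triple Q t) \<and> equiv_lists xs ys \<and> (\<forall>t\<in>set ys. snd (snd t) k = 0)"
proof -
  obtain s zs where s: "good_triple Q s" "\<forall>t\<in>set zs. good_triple Q t" "equiv_lists xs (s # zs)"
    "\<forall>t\<in>set zs. snd (snd t) k = 0" using euclid_list[OF g, of k] by blast
  obtain b v y where byv: "s = (b,v,y)" by (cases s)
  show ?thesis
  proof (cases "y k = 0")
    case True
    thus ?thesis using s byv by (intro exI[of _ "s # zs"]) auto
  next
    case False
    have "pairing zs k n = 0" for n using s(4) by (induction zs) auto
    hence "int p ^ n dvd b n * y k" for n
    proof -
      have "int p ^ n dvd pairing xs k n - pairing (s # zs) k n" using s(3) by (simp add: equiv_lists_def)
      from dvd_diff[OF z this] have "int p ^ n dvd pairing (s # zs) k n" by simp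
      thus ?thesis using \<open>pairing zs k n = 0\<close> by (simp add: byv)
    qed
    hence b0: "b = (\<lambda>n. 0)" using s(1) False by (intro padic_torsion_free) (auto simp: byv good_triple_def)
    have "equiv_lists (s # zs) zs"
      unfolding equiv_lists_def byv b0
      using teq_add[OF teq_zero[of v] teq_refl, of "tens zs"] s(1) by (auto simp: byv good_triple_def)
    thus ?thesis using s equiv_lists_trans by blast
  qed
qed

lemma eliminate_coordinates:
  assumes g: "\<forall>t\<in>set xs. good_triple Q t" and z: "\<And>k n. k < d \<Longrightarrow> int p ^ n dvd pairing xs k n"
  shows "\<exists>ys. (\<forall>t\<in>set ys. good_triple Q t) \<and> equiv_lists xs ys \<and> (\<forall>k<d. \<forall>t\<in>set ys. snd (snd t) k = 0)"
  using z
proof (induction d)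
  case 0
  thus ?case using g equiv_lists_refl by blast
next
  case (Suc d)
  then obtain ys where ys: "\<forall>t\<in>set ys. good_triple Q t" "equiv_lists xs ys" "\<forall>k<d. \<forall>t\<in>set ys. snd (snd t) k = 0"
    by (metis less_SucI)
  have "int p ^ n dvd pairing ys d n" for n
  proof -
    have "int p ^ n dvd pairing xs d n - pairing ys d n" using ys(2) by (simp add: equiv_lists_def)
    from dvd_diff[OF Suc.prems[OF lessI] this] show ?thesis by simp
  qed
  then obtain zs where zs: "\<forall>t\<in>set zs. good_triple Q t" "equiv_lists ys zs" "\<forall>t\<in>set zs. snd (snd t) d = 0"
    using eliminate_coordinate[OF ys(1)] by blast
  have "\<forall>k<Suc d. \<forall>t\<in>set zs. snd (snd t) k = 0"
  proof (intro allI impI)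
    fix k assume "k < Suc d"
    show "\<forall>t\<in>set zs. snd (snd t) k = 0"
    proof (cases "k = d")
      case False
      hence "vanish ys k" using ys(3) \<open>k < Suc d\<close> unfolding vanish_def by simp
      hence "vanish zs k" using zs(2) unfolding equiv_lists_def by simp
      thus ?thesis unfolding vanish_def .
    qed (use zs in simp)
  qed
  thus ?case using zs ys equiv_lists_trans by blast
qed

end

end

section \<open>A criterion for Leopoldt's conjecture\<close>

lemma prod_powi: "(\<Prod>i\<in>I. f i) powi k = (\<Prod>i\<in>I. (f i :: complex) powi k)"
  by (induction I rule: infinite_finite_induct) (auto simp: power_int_mult_distrib)

context unit_tensor
begin

lemma place_if: "w \<in> places_above E p \<Longrightarrow> place E w p"
  by (rule place.intro[OF complex_subfield.intro[OF subfield_E] place_axioms.intro])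
    (auto simp: places_above_def prime_p)

lemma null_product:
  assumes w: "w \<in> places_above E p" and E: "\<And>n. s n \<in> E" "\<And>n. t n \<in> E"
    and lim: "(\<lambda>n. w (s n - 1)) \<longlonglongrightarrow> 0" "(\<lambda>n. w (t n - 1)) \<longlonglongrightarrow> 0" and wt: "\<And>n. w (t n) \<le> 1"
  shows "(\<lambda>n. w (s n * t n - 1)) \<longlonglongrightarrow> 0"
proof -
  interpret place E w p by (rule place_if[OF w])
  have "(\<lambda>n. w ((s n - 1) * t n + (t n - 1))) \<longlonglongrightarrow> 0"
    by (intro null_add null_mult_bounded[where B = 1]) (use E lim wt in auto)
  thus ?thesis by (simp add: algebra_simps)
qed

lemma null_inverse:
  assumes w: "w \<in> places_above E p" and E: "\<And>n. s n \<in> E"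
    and lim: "(\<lambda>n. w (s n - 1)) \<longlonglongrightarrow> 0" and ws: "\<And>n. w (s n) = 1"
  shows "(\<lambda>n. w (inverse (s n) - 1)) \<longlonglongrightarrow> 0"
proof -
  interpret place E w p by (rule place_if[OF w])
  have "w (inverse (s n) - 1) = w (s n - 1)" for n
  proof -
    have "s n \<noteq> 0" using ws[of n] by auto
    hence "inverse (s n) - 1 = (1 - s n) * inverse (s n)" by (simp add: algebra_simps)
    thus ?thesis using E ws w_diff_commute[of "s n" 1] by (simp add: w_mult w_inverse)
  qed
  thus ?thesis using lim by simp
qed

lemma rels_kernel:
  assumes w: "w \<in> places_above E p" and r: "r \<in> rels"
  shows "(\<lambda>n. w (leo_prod p r n - 1)) \<longlonglongrightarrow> 0"
proof -
  interpret place E w p by (rule place_if[OF w])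
  from r consider
    x y u where "r = frag_of (padd x y, u) - frag_of (x, u) - frag_of (y, u)" "x \<in> carrier Zp" "y \<in> carrier Zp" "alg_unit E u"
  | x u v where "r = frag_of (x, u * v) - frag_of (x, u) - frag_of (x, v)" "x \<in> carrier Zp" "alg_unit E u" "alg_unit E v"
    unfolding tensor_relations_def carrier_OU mult_OU by (auto simp: padic_integers_def padd_def)
  thus ?thesis
  proof cases
    case 1
    have g: "frag_of (padd x y, u) \<in> carrier FA" "frag_of (x, u) \<in> carrier FA" "frag_of (y, u) \<in> carrier FA"
      by (intro FA_frag_of Zp_padd 1)+
    have "leo_prod p r n = u powi (proj n * padd x y n) * inverse (u powi (proj n * x n)) * inverse (u powi (proj n * y n))" for n
      using g leo_seq_add[of "frag_of (padd x y, u) - frag_of (x, u)" "- frag_of (y, u)" n]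
        leo_seq_add[of "frag_of (padd x y, u)" "- frag_of (x, u)" n] FA_diff[OF g(1,2)]
      unfolding 1(1) carrier_FA by (simp add: leo_seq_minus leo_seq_frag_of)
    also have "\<dots> n = u powi (proj n * (padd x y n - (x n + y n)))" for n
      using 1(4) by (simp add: alg_unit_def algebra_simps power_int_diff power_int_add field_simps)
    finally have eq: "leo_prod p r n = u powi (proj n * (padd x y n - (x n + y n)))" for n .
    have "int p ^ n dvd padd x y n - (x n + y n)" for n
      unfolding padd_def by (metis dvd_minus_mod dvd_minus_iff minus_diff_eq)
    thus ?thesis unfolding eq by (rule proj_powers_null[OF 1(4)])
  next
    case 2
    have g: "frag_of (x, u * v) \<in> carrier FA" "frag_of (x, u) \<in> carrier FA" "frag_of (x, v) \<in> carrier FA"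
      by (intro FA_frag_of alg_unit_mult 2)+
    have "leo_prod p r n = (u * v) powi (proj n * x n) * inverse (u powi (proj n * x n)) * inverse (v powi (proj n * x n))" for n
      using g leo_seq_add[of "frag_of (x, u * v) - frag_of (x, u)" "- frag_of (x, v)" n]
        leo_seq_add[of "frag_of (x, u * v)" "- frag_of (x, u)" n] FA_diff[OF g(1,2)]
      unfolding 2(1) carrier_FA by (simp add: leo_seq_minus leo_seq_frag_of)
    moreover have "u \<noteq> 0" "v \<noteq> 0" using 2 by (auto simp: alg_unit_def)
    hence "(u * v) powi (proj n * x n) * inverse (u powi (proj n * x n)) * inverse (v powi (proj n * x n)) = 1" for n
      by (simp add: power_int_mult_distrib field_simps)
    ultimately have "leo_prod p r n = 1" for n by metis
    thus ?thesis by simp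
  qed
qed

text \<open>This makes the map well defined: bilinearity relations are sent to sequences tending to
  1 at every place.\<close>

lemma rel_group_kernel:
  assumes w: "w \<in> places_above E p" and c: "c \<in> rel_group"
  shows "(\<lambda>n. w (leo_prod p c n - 1)) \<longlonglongrightarrow> 0"
proof -
  interpret place E w p by (rule place_if[OF w])
  show ?thesis using c
  proof (induction rule: generate.induct)
    case one
    thus ?case by (simp add: leo_prod_def)
  next
    case (incl r)
    thus ?case by (rule rels_kernel[OF w])
  next
    case (inv r)
    have "r \<in> carrier FA" by (rule rel_group_FA[OF generate.incl[OF inv]])
    hence k: "Poly_Mapping.keys r \<subseteq> gens" "inv\<^bsub>FA\<^esub> r = - r" unfolding carrier_FA by (auto simp: carrier_OU)
    have "(\<lambda>n. w (inverse (leo_prod p r n) - 1)) \<longlonglongrightarrow> 0"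
      using k(1) rels_kernel[OF w inv] leo_seq_E leo_seq_w by (intro null_inverse[OF w]) auto
    thus ?case unfolding k(2) leo_seq_minus .
  next
    case (eng r s)
    have g: "r \<in> carrier FA" "s \<in> carrier FA" using eng rel_group_FA by auto
    have "leo_prod p (r + s) n = leo_prod p r n * leo_prod p s n" for n
      using g leo_seq_add[of r s n] unfolding carrier_FA by simp
    moreover have "(\<lambda>n. w (leo_prod p r n * leo_prod p s n - 1)) \<longlonglongrightarrow> 0"
      using g leo_seq_E leo_seq_w eng.IH unfolding carrier_FA by (intro null_product[OF w]) auto
    ultimately show ?case by simp
  qed
qed

theorem Leo_if_kernel:
  assumes ker: "\<And>c. c \<in> carrier FA \<Longrightarrow> (\<And>w. w \<in> places_above E p \<Longrightarrow> (\<lambda>n. w (leo_prod p c n - 1)) \<longlonglongrightarrow> 0) \<Longrightarrow> c \<in> rel_group"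
  shows "Leo E p"
  unfolding Leo_def
proof (rule inj_onI)
  interpret FA: group FA by simp
  fix C D assume "C \<in> carrier (units_tensor E p)" "D \<in> carrier (units_tensor E p)"
    and eq: "leopoldt_map E p C = leopoldt_map E p D"
  then obtain c d where c: "c \<in> carrier FA" "C = rel_group #>\<^bsub>FA\<^esub> c" and d: "d \<in> carrier FA" "D = rel_group #>\<^bsub>FA\<^esub> d"
    unfolding units_tensor_def tensor_group_def FactGroup_def RCOSETS_def by auto
  \<comment> \<open>The value of \<open>the_elem\<close> is meaningful because the image of a coset
    is a singleton.\<close>
  have map: "leopoldt_map E p (rel_group #>\<^bsub>FA\<^esub> c) w = leopoldt_free E p w c" if w: "w \<in> places_above E p" and c: "c \<in> carrier FA" for w c
  proof -
    interpret place E w p by (rule place_if[OF w])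
    have "leopoldt_free E p w (r + c) = leopoldt_free E p w c" if r: "r \<in> rel_group" for r
    proof -
      have "r + c \<in> carrier FA" using FA.m_closed[OF rel_group_FA[OF r] c] by simp
      hence "Poly_Mapping.keys (r + c) \<subseteq> gens" "Poly_Mapping.keys c \<subseteq> gens" using c unfolding carrier_FA by auto
      from leopoldt_free_eq_iff[OF this] show ?thesis using rel_group_kernel[OF w r] by simp
    qed
    moreover have "rel_group #>\<^bsub>FA\<^esub> c = (\<lambda>r. r + c) ` rel_group" by (auto simp: r_coset_def)
    ultimately have "leopoldt_free E p w ` (rel_group #>\<^bsub>FA\<^esub> c) = {leopoldt_free E p w c}"
      using rel_group_0 by (auto simp: image_iff intro!: bexI[of _ 0])
    thus ?thesis using w by (simp add: leopoldt_map_def)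
  qed
  have "c - d \<in> rel_group"
  proof (rule ker)
    show "c - d \<in> carrier FA" by (rule FA_diff[OF c(1) d(1)])
    fix w assume w: "w \<in> places_above E p"
    interpret place E w p by (rule place_if[OF w])
    have "leopoldt_free E p w c = leopoldt_free E p w d"
      using map[OF w c(1)] map[OF w d(1)] eq c(2) d(2) by simp
    moreover have "Poly_Mapping.keys c \<subseteq> gens" "Poly_Mapping.keys d \<subseteq> gens" using c(1) d(1) unfolding carrier_FA by auto
    ultimately show "(\<lambda>n. w (leo_prod p (c - d) n - 1)) \<longlonglongrightarrow> 0" using leopoldt_free_eq_iff by blast
  qed
  have "(\<lambda>r. r + c) ` rel_group = (\<lambda>r. r + d) ` rel_group"
  proof (intro equalityI image_subsetI)
    fix r assume r: "r \<in> rel_group"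
    have "r + c = (r + (c - d)) + d" "r + d = (r - (c - d)) + c" by simp_all
    thus "r + c \<in> (\<lambda>r. r + d) ` rel_group" "r + d \<in> (\<lambda>r. r + c) ` rel_group"
      using rel_group_add[OF r \<open>c - d \<in> rel_group\<close>] rel_group_diff[OF r \<open>c - d \<in> rel_group\<close>] by blast+
  qed
  thus "C = D" unfolding c(2) d(2) r_coset_def by auto
qed

text \<open>Multiplication by 2 is surjective on \<open>Z_p\<close> for odd \<open>p\<close>, and its image consists of the even
  elements for \<open>p = 2\<close>.\<close>

lemma half_exists:
  assumes A: "A \<in> carrier Zp" and even: "p = 2 \<Longrightarrow> \<forall>n. even (A (Suc n))"
  shows "\<exists>B\<in>carrier Zp. padd B B = A"
proof (cases "p = 2")
  case True
  \<comment> \<open>Halving loses one binary digit, so level \<open>n\<close> of the half is read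
    off level \<open>Suc n\<close>.\<close>
  define B where "B = (\<lambda>n. A (Suc n) div 2)"
  have e: "A (Suc n) = 2 * B n" for n using even[OF True] by (simp add: B_def)
  have A': "0 \<le> A n" "A n < 2 ^ n" "A (Suc n) mod 2 ^ n = A n" for n using A[unfolded carrier_Zp] True by auto
  have "B \<in> carrier Zp" unfolding carrier_Zp
  proof (intro allI conjI)
    fix n
    show "B n \<in> {0..<int p ^ n}" using A'(1,2)[of "Suc n"] e[of n] True by simp
    have "2 * (B (Suc n) mod 2 ^ n) = (2 * B (Suc n)) mod (2 * 2 ^ n)" by (rule mult_mod_right)
    also have "\<dots> = 2 * B n" using A'(3)[of "Suc n"] e by simp
    finally show "B (Suc n) mod int p ^ n = B n" using True by simp
  qed
  moreover have "padd B B = A"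
  proof
    fix n
    have "padd B B n = 2 * B n mod int p ^ n" by (simp add: padd_def)
    also have "\<dots> = A n" using A'(3)[of n] e[of n] True by simp
    finally show "padd B B n = A n" .
  qed
  ultimately show ?thesis by blast
next
  case False
  hence odd: "odd p" using prime_p by (metis primes_dvd_imp_eq two_is_prime_nat)
  \<comment> \<open>The inverse of 2 modulo \<open>p ^ n\<close>.\<close>
  define h where "h = (\<lambda>n. (int p ^ n + 1) div 2)"
  have h: "2 * h n = int p ^ n + 1" for n
  proof -
    have "2 dvd int p ^ n + 1" using odd by simp
    thus ?thesis unfolding h_def by (rule dvd_mult_div_cancel)
  qed
  define B where "B = (\<lambda>n. A n * h n mod int p ^ n)"
  have "padic_coherent p (\<lambda>n. A n * h n)"
    unfolding padic_coherent_def
  proof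
    fix n
    have cop: "coprime (int p ^ n) 2" using odd by simp
    have "2 * (A (Suc n) * h (Suc n) - A n * h n) = A (Suc n) * (2 * h (Suc n)) - A n * (2 * h n)" by (simp add: algebra_simps)
    also have "\<dots> = int p ^ n * (int p * A (Suc n) - A n) + (A (Suc n) - A n)" unfolding h by (simp add: algebra_simps)
    finally have "int p ^ n dvd 2 * (A (Suc n) * h (Suc n) - A n * h n)"
      using Zp_coherent[OF A] unfolding padic_coherent_def by simp
    thus "int p ^ n dvd A (Suc n) * h (Suc n) - A n * h n"
      by (rule iffD1[OF coprime_dvd_mult_right_iff[OF cop]])
  qed
  hence "B \<in> carrier Zp" unfolding B_def by (rule Zp_mod)
  moreover have "padd B B = A"
  proof
    fix n
    have "padd B B n = (A n * h n + A n * h n) mod int p ^ n" unfolding padd_def B_def by (rule mod_add_eq)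
    also have "A n * h n + A n * h n = A n + int p ^ n * A n" using h[of n] by (simp add: algebra_simps flip: mult_2)
    also have "\<dots> mod int p ^ n = A n" using A by (simp add: carrier_Zp)
    finally show "padd B B n = A n" .
  qed
  ultimately show ?thesis by blast
qed

text \<open>By \<open>GEN\<close> all units in a tensor acquire exponent vectors after one common
  power; \<open>IND\<close> makes every pairing vanish for a tensor in the kernel. Elimination then
  leaves only units with zero exponents. These are 1 or -1, because the field is real, so the tensor
  is that of a single pair with second entry -1, and it remains to halve its coefficient.\<close>

theorem Leo_criterion:
  fixes \<epsilon> :: "nat \<Rightarrow> complex"
  assumes real: "E \<subseteq> \<real>" and pl: "\<exists>w. w \<in> places_above E p"
    and unit: "\<And>j. j < d \<Longrightarrow> alg_unit E (\<epsilon> j)"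
    and IND: "\<And>B j n. (\<And>j. j < d \<Longrightarrow> padic_coherent p (B j)) \<Longrightarrow>
      (\<And>w. w \<in> places_above E p \<Longrightarrow> (\<lambda>n. w ((\<Prod>j<d. \<epsilon> j powi (proj_exp p n * B j n)) - 1)) \<longlonglongrightarrow> 0) \<Longrightarrow>
      j < d \<Longrightarrow> int p ^ n dvd B j n"
    and GEN: "\<And>u. alg_unit E u \<Longrightarrow> \<exists>m>0. \<exists>x :: nat \<Rightarrow> int. u ^ m = (\<Prod>j<d. \<epsilon> j powi x j)"
  shows "Leo E p"
proof (rule Leo_if_kernel)
  fix c assume c: "c \<in> carrier FA" and ker: "\<And>w. w \<in> places_above E p \<Longrightarrow> (\<lambda>n. w (leo_prod p c n - 1)) \<longlonglongrightarrow> 0"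
  have eps0: "\<epsilon> j \<noteq> 0" if "j < d" for j using unit[OF that] by (simp add: alg_unit_def)
  obtain xs where xs: "set xs \<subseteq> gens" "c \<asymp> (\<Sum>y\<leftarrow>xs. frag_of y)" using tensor_list[OF c] by blast
  obtain m0 x0 where m0: "\<And>u. alg_unit E u \<Longrightarrow> m0 u > 0 \<and> u ^ m0 u = (\<Prod>j<d. \<epsilon> j powi x0 u j)"
    using GEN by metis
  \<comment> \<open>A common exponent for the finitely many units in the list; \<open>e\<close>
    rescales their exponent vectors accordingly.\<close>
  define m where "m = (\<Prod>(a,u)\<in>set xs. m0 u)"
  define e where "e = (\<lambda>u j. x0 u j * int (m div m0 u))"
  have m: "m > 0" unfolding m_def using xs(1) m0 by (intro prod_pos) auto
  have me: "u ^ m = (\<Prod>j<d. \<epsilon> j powi e u j)" if "(a,u) \<in> set xs" for a u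
  proof -
    have u: "alg_unit E u" using xs(1) that by auto
    have "m0 u dvd m" unfolding m_def using that by (metis (no_types, lifting) List.finite_set case_prod_conv dvd_prodI)
    hence "u ^ m = (u ^ m0 u) ^ (m div m0 u)" by (simp add: power_mult[symmetric])
    also have "\<dots> = (\<Prod>j<d. \<epsilon> j powi e u j)"
      using m0[OF u] by (simp add: prod_power_distrib e_def power_int_mult)
    finally show ?thesis .
  qed
  define Q where "Q = (\<lambda>u x. u ^ m = (\<Prod>j<d. \<epsilon> j powi x j))"
  define ts where "ts = map (\<lambda>(a,u). (a, u, e u)) xs"
  have Q1: "Q 1 (\<lambda>_. 0)" by (simp add: Q_def)
  have Qm: "Q (u * v) (\<lambda>j. x j + y j)" if "Q u x" "Q v y" for u v x y
    using that eps0 unfolding Q_def by (simp add: power_mult_distrib power_int_add prod.distrib[symmetric])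
  have Qd: "Q (u * inverse v) (\<lambda>j. x j - y j)" if "Q u x" "Q v y" for u v x y
    using that eps0 unfolding Q_def
    by (simp add: power_int_diff prod_dividef divide_inverse[symmetric] power_divide)
  have good: "\<forall>t\<in>set ts. good_triple Q t"
    unfolding ts_def good_triple_def Q_def using xs(1) me by auto
  have tens_ts: "tens ts = (\<Sum>y\<leftarrow>xs. frag_of y)" unfolding tens_def ts_def by (simp add: o_def case_prod_unfold)
  have keys: "Poly_Mapping.keys (tens ts) \<subseteq> gens" "Poly_Mapping.keys c \<subseteq> gens"
  proof -
    have "c - tens ts \<in> carrier FA" using xs(2) rel_group_FA unfolding teq_def tens_ts by blast
    hence "c - (c - tens ts) \<in> carrier FA" using FA_diff[OF c] by blast
    thus "Poly_Mapping.keys (tens ts) \<subseteq> gens" unfolding carrier_FA by simp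
    show "Poly_Mapping.keys c \<subseteq> gens" using c unfolding carrier_FA .
  qed
  have lp: "leo_prod p (tens zs) n ^ m = (\<Prod>j<d. \<epsilon> j powi (proj_exp p n * pairing zs j n)) \<and> Poly_Mapping.keys (tens zs) \<subseteq> gens"
    if "\<forall>t\<in>set zs. good_triple Q t" for zs n
  proof -
    obtain w where w: "w \<in> places_above E p" using pl by blast
    interpret place E w p by (rule place_if[OF w])
    show ?thesis using that
    proof (induction zs)
      case Nil
      thus ?case by (simp add: leo_prod_def)
    next
      case (Cons t zs)
      obtain a u x where t: "t = (a,u,x)" by (cases t)
      have g: "a \<in> carrier Zp" "alg_unit E u" "Q u x" using Cons.prems t by (auto simp: good_triple_def)
      have k: "Poly_Mapping.keys (frag_of (a,u)) \<subseteq> gens" "Poly_Mapping.keys (tens zs) \<subseteq> gens" using g Cons by auto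
      have "leo_prod p (tens (t # zs)) n ^ m = (u powi (proj_exp p n * a n)) ^ m * leo_prod p (tens zs) n ^ m"
        unfolding t tens_simps leo_seq_add[OF k] leo_seq_frag_of by (rule power_mult_distrib)
      also have "(u powi (proj_exp p n * a n)) ^ m = (u ^ m) powi (proj_exp p n * a n)"
        by (simp add: power_int_mult[symmetric] mult.commute flip: power_int_of_nat)
      also have "\<dots> = (\<Prod>j<d. \<epsilon> j powi (proj_exp p n * (a n * x j)))"
        using g(3) unfolding Q_def by (simp add: prod_powi power_int_mult[symmetric] ac_simps)
      also have "\<dots> * leo_prod p (tens zs) n ^ m = (\<Prod>j<d. \<epsilon> j powi (proj_exp p n * pairing (t # zs) j n))"
        using Cons eps0 by (simp add: t prod.distrib[symmetric] distrib_left power_int_add)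
      finally show ?case using k keys_add[of "frag_of (a,u)" "tens zs"] unfolding t by auto
    qed
  qed
  have conv: "(\<lambda>n. w (leo_prod p d' n - 1)) \<longlonglongrightarrow> 0"
    if w: "w \<in> places_above E p" and d: "c \<asymp> d'" "Poly_Mapping.keys d' \<subseteq> gens" for w d'
  proof -
    interpret place E w p by (rule place_if[OF w])
    have "d' - c \<in> rel_group" using teq_sym[OF d(1)] by (simp add: teq_def)
    hence r: "(\<lambda>n. w (leo_prod p (d' - c) n - 1)) \<longlonglongrightarrow> 0" "Poly_Mapping.keys (d' - c) \<subseteq> gens"
      using rel_group_kernel[OF w] rel_group_FA unfolding carrier_FA by auto
    have "leo_prod p d' n = leo_prod p (d' - c) n * leo_prod p c n" for n
      using leo_seq_add[OF r(2) keys(2), of n] by simp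
    moreover have "(\<lambda>n. w (leo_prod p (d' - c) n * leo_prod p c n - 1)) \<longlonglongrightarrow> 0"
      using r keys ker[OF w] leo_seq_E leo_seq_w by (intro null_product[OF w]) auto
    ultimately show ?thesis by simp
  qed
  have pair: "int p ^ n dvd pairing ts j n" if "j < d" for j n
  proof (rule IND[OF _ _ that, of "pairing ts"])
    show "padic_coherent p (pairing ts j)" for j
      unfolding pairing_def[abs_def]
    proof (rule coherent_sum_list)
      fix t assume "t \<in> set ts"
      thus "padic_coherent p (\<lambda>n. (\<lambda>(a,u,x). a n * x j) t)"
        using good Zp_coherent by (cases t) (auto simp: good_triple_def intro!: coherent_const_mult)
    qed
    fix w assume w: "w \<in> places_above E p"
    interpret place E w p by (rule place_if[OF w])
    have lim: "(\<lambda>n. w (leo_prod p (tens ts) n - 1)) \<longlonglongrightarrow> 0"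
      using conv[OF w _ keys(1)] xs(2) tens_ts by simp
    have "(\<lambda>n. w (leo_prod p (tens ts) n ^ k - 1)) \<longlonglongrightarrow> 0" for k
    proof (induction k)
      case (Suc k)
      show ?case unfolding power_Suc
        using lim Suc leo_seq_E[OF keys(1)] leo_seq_w[OF keys(1)] by (intro null_product[OF w]) (auto simp: w_power)
    qed simp
    from this[of m] show "(\<lambda>n. w ((\<Prod>j<d. \<epsilon> j powi (proj_exp p n * pairing ts j n)) - 1)) \<longlonglongrightarrow> 0"
      by (simp only: lp[OF good, THEN conjunct1])
  qed
  obtain ys where ys: "\<forall>t\<in>set ys. good_triple Q t" "equiv_lists ts ys" "\<forall>k<d. \<forall>t\<in>set ys. snd (snd t) k = 0"
    using eliminate_coordinates[of Q ts d] Q1 Qm Qd good pair by blast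
  \<comment> \<open>All exponents have been cleared, so \<open>u\<close> is a root of unity, and a
    real one.\<close>
  have pm: "u = 1 \<or> u = -1" if "(a,u,x) \<in> set ys" for a u x
  proof -
    have g: "alg_unit E u" "Q u x" using ys(1) that by (auto simp: good_triple_def)
    have "\<forall>k<d. x k = 0" using ys(3) that by fastforce
    hence "u ^ m = 1" using g(2) by (simp add: Q_def)
    have "u \<in> \<real>" using real g(1) by (auto simp: alg_unit_def)
    then obtain r where r: "u = of_real r" by (rule Reals_cases)
    have "\<bar>r\<bar> = 1" using power_eq_1_iff[OF \<open>u ^ m = 1\<close>] m by (simp add: r)
    thus ?thesis using r by (auto simp: abs_if split: if_splits)
  qed
  have "\<exists>A\<in>carrier Zp. tens zs \<asymp> frag_of (A, -1)" if "set zs \<subseteq> set ys" for zs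
    using that
  proof (induction zs)
    case Nil
    thus ?case using teq_sym[OF teq_zero[OF alg_unit_minus_1]] Zp_0 by (intro bexI[of _ "\<lambda>n. 0"]) auto
  next
    case (Cons t zs)
    obtain a u x where t: "t = (a,u,x)" by (cases t)
    have a: "a \<in> carrier Zp" "u = 1 \<or> u = -1" using Cons.prems ys(1) pm t by (auto simp: good_triple_def)
    obtain A where A: "A \<in> carrier Zp" "tens zs \<asymp> frag_of (A, -1)" using Cons by auto
    show ?case
    proof (cases "u = 1")
      case True
      have "tens (t # zs) \<asymp> 0 + frag_of (A, -1)" unfolding t tens_simps True by (intro teq_add teq_one a A)
      thus ?thesis using A by auto
    next
      case False
      have "tens (t # zs) \<asymp> frag_of (a, -1) + frag_of (A, -1)"
        using False a unfolding t tens_simps by (intro teq_add A) auto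
      also have "\<dots> \<asymp> frag_of (padd a A, -1)" by (rule teq_sym[OF teq_padd[OF a(1) A(1) alg_unit_minus_1]])
      finally show ?thesis using Zp_padd[OF a(1) A(1)] by blast
    qed
  qed
  then obtain A where A: "A \<in> carrier Zp" "tens ys \<asymp> frag_of (A, -1)" by blast
  have "c \<asymp> tens ts" using xs(2) tens_ts by simp
  also have "\<dots> \<asymp> tens ys" using ys(2) by (simp add: equiv_lists_def)
  also note A(2)
  finally have cA: "c \<asymp> frag_of (A, -1)" .
  \<comment> \<open>For \<open>p = 2\<close> the unit -1 is itself principal and is seen by the map:
    an odd exponent would keep the sequence at distance \<open>w 2 = 1 / 2\<close> from 1. Parity is
    visible only from level 1 on, hence \<open>Suc n\<close>.\<close>
  have "\<forall>n. even (A (Suc n))" if p2: "p = 2"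
  proof -
    obtain w where w: "w \<in> places_above E p" using pl by blast
    interpret place E w p by (rule place_if[OF w])
    have "(\<lambda>n. w (leo_prod p (frag_of (A, -1)) n - 1)) \<longlonglongrightarrow> 0"
      using A(1) alg_unit_minus_1 by (intro conv[OF w cA]) auto
    hence "(\<lambda>n. w ((-1) powi (proj n * A n) - 1)) \<longlonglongrightarrow> 0" by (simp only: leo_seq_frag_of)
    hence "\<forall>\<^sub>F n in sequentially. w ((-1) powi (proj n * A n) - 1) < 1/2" by (rule order_tendstoD) simp
    then obtain N where N: "\<And>n. n \<ge> N \<Longrightarrow> w ((-1) powi (proj n * A n) - 1) < 1/2" unfolding eventually_sequentially by blast
    have ev: "even (A n)" if n: "n \<ge> N" "n > 0" for n
    proof (rule ccontr)
      assume "odd (A n)"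
      moreover have "int p ^ n dvd proj n - 1" by (rule proj_cong)
      hence "2 dvd proj n - 1" using n(2) p2 by (metis dvd_power dvd_trans of_nat_numeral)
      hence "odd (proj n)" by simp
      ultimately have "(-1) powi (proj n * A n) = (-1 :: complex)" by (simp add: power_int_minus_left_odd)
      hence "w (- of_nat 2) < 1/2" using N[OF n(1)] by simp
      moreover have "w (- of_nat 2) = w (of_nat 2)" by (rule w_minus) blast
      ultimately show False using w_p p2 by simp
    qed
    show ?thesis
    proof
      fix n
      have "int p ^ Suc n dvd A (Suc (n + N)) - A (Suc n)" by (rule coherent_dvd[OF Zp_coherent[OF A(1)]]) simp
      hence "2 dvd A (Suc (n + N)) - A (Suc n)" using p2 by (metis dvd_mult_left of_nat_numeral power_Suc)
      thus "even (A (Suc n))" using ev[of "Suc (n + N)"] by simp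
    qed
  qed
  then obtain B where B: "B \<in> carrier Zp" "padd B B = A" using half_exists[OF A(1)] by blast
  have "frag_of (A, -1) \<asymp> frag_of (B, -1) + frag_of (B, -1)"
    using teq_padd[OF B(1) B(1) alg_unit_minus_1] B(2) by simp
  also have "\<dots> \<asymp> frag_of (B, (-1) * (-1))" by (rule teq_sym[OF teq_mult[OF B(1) alg_unit_minus_1 alg_unit_minus_1]])
  also have "\<dots> \<asymp> 0" using teq_one[OF B(1)] by simp
  finally have "c \<asymp> 0" using cA teq_trans by blast
  thus "c \<in> rel_group" by (simp add: teq_def)
qed

end

section \<open>The splitting field of a cubic\<close>

definition rpoly :: "rat poly \<Rightarrow> complex \<Rightarrow> complex"
  where "rpoly q t = poly (map_poly of_rat q) t"

lemma rpoly_0 [simp]: "rpoly 0 t = 0" by (simp add: rpoly_def)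

lemma rpoly_pCons [simp]: "rpoly (pCons c q) t = of_rat c + t * rpoly q t"
  by (cases "c = 0 \<and> q = 0") (auto simp: rpoly_def map_poly_pCons)

lemma rpoly_add [simp]: "rpoly (q + r) t = rpoly q t + rpoly r t"
  by (induction q r rule: poly_induct2) (auto simp: of_rat_add algebra_simps)

lemma rpoly_smult [simp]: "rpoly (smult c q) t = of_rat c * rpoly q t"
  by (induction q) (auto simp: of_rat_mult algebra_simps)

lemma rpoly_minus [simp]: "rpoly (- q) t = - rpoly q t"
  using rpoly_smult[of "-1" q t] by (simp del: rpoly_smult)

lemma rpoly_diff [simp]: "rpoly (q - r) t = rpoly q t - rpoly r t"
  using rpoly_add[of q "- r" t] by simp

lemma rpoly_mult [simp]: "rpoly (q * r) t = rpoly q t * rpoly r t"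
  by (induction q) (auto simp: algebra_simps)

lemma rpoly_1 [simp]: "rpoly 1 t = 1" by (simp add: one_pCons)

lemma rpoly_real: "t \<in> \<real> \<Longrightarrow> rpoly q t \<in> \<real>"
proof (induction q)
  case (pCons c q)
  have "(of_rat c :: complex) \<in> \<real>" by (cases c) (simp add: of_rat_rat)
  thus ?case using pCons by simp
qed simp

declare One_nat_def [simp del]

lemma nat_range_1_3: "{1..3::nat} = {1, 2, 3}" by auto

text \<open>An explicit inverse of the derivative at a root, up to the discriminant
  \<open>4 b ^ 3 - 27\<close> of \<open>x ^ 3 - b x - 1\<close>.\<close>

lemma cubic_discriminant_identity:
  fixes s b :: complex
  assumes "s ^ 3 = b * s + 1"
  shows "(6 * b * s ^ 2 - 9 * s - 4 * b ^ 2) * (3 * s ^ 2 - b) = 4 * b ^ 3 - 27"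
proof -
  have "(6 * b * s ^ 2 - 9 * s - 4 * b ^ 2) * (3 * s ^ 2 - b) =
      18 * b * (s * s ^ 3) - 27 * s ^ 3 - 18 * b ^ 2 * s ^ 2 + 9 * b * s + 4 * b ^ 3"
    by (simp add: power2_eq_square power3_eq_cube algebra_simps)
  thus ?thesis unfolding assms by (simp add: power2_eq_square power3_eq_cube algebra_simps)
qed

text \<open>The ordering of the roots is part of the data: a permuted family is again an instance
  (\<open>roots_permute\<close>), and the Galois action is obtained by comparing instances.\<close>

locale cubic_roots =
  fixes a :: nat and y :: "nat \<Rightarrow> complex"
  assumes a_ge_2: "a \<ge> 2"
    and root: "\<And>i. i \<in> {1..3} \<Longrightarrow> y i ^ 3 = of_nat a ^ 2 * y i + 1"
    and inj: "inj_on y {1..3}"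
    and real: "\<And>i. i \<in> {1..3} \<Longrightarrow> y i \<in> \<real>"
begin

lemma distinct: "y 1 \<noteq> y 2" "y 2 \<noteq> y 3" "y 1 \<noteq> y 3"
  using inj unfolding nat_range_1_3 inj_on_def by auto

lemma sum_roots: "y 1 + y 2 + y 3 = 0"
proof -
  have r: "y 1 ^ 3 = of_nat a ^ 2 * y 1 + 1" "y 2 ^ 3 = of_nat a ^ 2 * y 2 + 1" "y 3 ^ 3 = of_nat a ^ 2 * y 3 + 1"
    by (rule root, simp)+
  have "(y 1 - y 2) * (y 1 ^ 2 + y 1 * y 2 + y 2 ^ 2 - of_nat a ^ 2) = 0"
    using r by (simp add: power2_eq_square power3_eq_cube algebra_simps)
  hence 1: "y 1 ^ 2 + y 1 * y 2 + y 2 ^ 2 = of_nat a ^ 2" using distinct by simp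
  have "(y 1 - y 3) * (y 1 ^ 2 + y 1 * y 3 + y 3 ^ 2 - of_nat a ^ 2) = 0"
    using r by (simp add: power2_eq_square power3_eq_cube algebra_simps)
  hence 2: "y 1 ^ 2 + y 1 * y 3 + y 3 ^ 2 = of_nat a ^ 2" using distinct by simp
  have "(y 2 - y 3) * (y 1 + y 2 + y 3) = (y 1 ^ 2 + y 1 * y 2 + y 2 ^ 2) - (y 1 ^ 2 + y 1 * y 3 + y 3 ^ 2)"
    by (simp add: power2_eq_square algebra_simps)
  hence "(y 2 - y 3) * (y 1 + y 2 + y 3) = 0" unfolding 1 2 by simp
  thus ?thesis using distinct by simp
qed

lemma y3: "y 3 = - y 1 - y 2" using sum_roots by (simp add: algebra_simps eq_neg_iff_add_eq_0)

lemma quad: "y 1 ^ 2 + y 1 * y 2 + y 2 ^ 2 = of_nat a ^ 2"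
proof -
  have r: "y 1 ^ 3 = of_nat a ^ 2 * y 1 + 1" "y 2 ^ 3 = of_nat a ^ 2 * y 2 + 1" by (rule root, simp)+
  have "(y 1 - y 2) * (y 1 ^ 2 + y 1 * y 2 + y 2 ^ 2 - of_nat a ^ 2) = 0"
    using r by (simp add: power2_eq_square power3_eq_cube algebra_simps)
  thus ?thesis using distinct by simp
qed

lemma prod_roots: "y 1 * y 2 * y 3 = 1"
proof -
  have "y 1 ^ 3 = of_nat a ^ 2 * y 1 + 1" by (rule root) simp
  hence "1 = y 1 ^ 3 - (y 1 ^ 2 + y 1 * y 2 + y 2 ^ 2) * y 1" unfolding quad by simp
  also have "\<dots> = y 1 * y 2 * y 3" by (simp add: y3 power2_eq_square power3_eq_cube algebra_simps)
  finally show ?thesis by simp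
qed

definition D :: int where "D = 4 * int a ^ 6 - 27"

definition \<delta> :: complex where "\<delta> = (y 1 - y 2) * (y 2 - y 3) * (y 1 - y 3)"

lemma delta_sq: "\<delta> ^ 2 = of_int D"
proof -
  let ?s = "y 1" and ?t = "y 2"
  have "?s * ?t * (?s + ?t) = - (?s * ?t * y 3)" by (simp add: y3 algebra_simps)
  hence p: "?s * ?t * (?s + ?t) = - 1" unfolding prod_roots .
  have "of_int D = 4 * (of_nat a ^ 2) ^ 3 - 27 * 1 ^ 2" by (simp add: D_def power_mult[symmetric])
  also have "\<dots> = 4 * (?s ^ 2 + ?s * ?t + ?t ^ 2) ^ 3 - 27 * (?s * ?t * (?s + ?t)) ^ 2"
    unfolding quad p by simp
  also have "\<dots> = \<delta> ^ 2" unfolding \<delta>_def y3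
    by (simp add: power2_eq_square power3_eq_cube algebra_simps)
  finally show ?thesis by simp
qed

lemma D_pos: "D > 0"
proof -
  have "int a ^ 6 \<ge> 2 ^ 6" using a_ge_2 by (intro power_mono) auto
  thus ?thesis by (simp add: D_def)
qed

text \<open>With \<open>n = 2 a ^ 3\<close> the discriminant is \<open>n ^ 2 - 27\<close>, and since
  \<open>n\<close> is at least 16 it lies strictly between \<open>(n - 1) ^ 2\<close> and
  \<open>n ^ 2\<close>.\<close>

lemma delta_irrational: "\<delta> \<notin> \<rat>"
proof
  assume "\<delta> \<in> \<rat>"
  moreover have "algebraic_int \<delta>"
  proof (rule algebraic_int.intros)
    show "poly [:- of_int D, 0, 1:] \<delta> = 0" using delta_sq by (simp add: power2_eq_square)
    show "\<forall>i. coeff [:- of_int D, 0, 1:] i \<in> (\<int> :: complex set)" by (auto simp: coeff_pCons split: nat.splits)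
  qed simp
  ultimately have "\<delta> \<in> \<int>" by (rule rational_algebraic_int_is_int[rotated])
  then obtain m where m: "\<delta> = of_int m" by (auto simp: Ints_def)
  have "of_int (m ^ 2) = (of_int D :: complex)" using delta_sq by (simp add: m)
  hence mD: "m ^ 2 = D" by (metis of_int_eq_iff)
  define n where "n = 2 * int a ^ 3"
  have "int a ^ 3 \<ge> 2 ^ 3" using a_ge_2 by (intro power_mono) auto
  hence n: "n \<ge> 16" by (simp add: n_def)
  have eq: "\<bar>m\<bar> ^ 2 = n ^ 2 - 27" using mD by (simp add: D_def n_def power_mult_distrib power_mult[symmetric])
  hence "\<bar>m\<bar> ^ 2 < n ^ 2" by simp
  hence "\<bar>m\<bar> < n" using n by (meson power_less_imp_less_base order_trans zero_le_numeral)
  hence "\<bar>m\<bar> ^ 2 \<le> (n - 1) ^ 2" by (intro power_mono) auto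
  hence "2 * n \<le> 28" unfolding eq by (simp add: power2_eq_square algebra_simps)
  thus False using n by simp
qed

lemma delta_real: "\<delta> \<in> \<real>" using real by (simp add: \<delta>_def)

text \<open>A rational root is an integer dividing 1, and 1 and -1 fail because \<open>a ^ 2\<close>
  is at least 4.\<close>

lemma no_rational_root: assumes "t ^ 3 = of_nat a ^ 2 * t + 1" shows "t \<notin> (\<rat> :: complex set)"
proof
  assume "t \<in> \<rat>"
  moreover have "algebraic_int t"
  proof (rule algebraic_int.intros)
    show "poly [:- 1, - (of_nat a ^ 2), 0, 1:] t = 0"
      using assms by (simp add: power2_eq_square power3_eq_cube algebra_simps)
    show "\<forall>i. coeff [:- 1, - (of_nat a ^ 2), 0, 1:] i \<in> (\<int> :: complex set)" by (auto simp: coeff_pCons split: nat.splits)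
  qed simp
  ultimately have "t \<in> \<int>" by (rule rational_algebraic_int_is_int[rotated])
  then obtain z where z: "t = of_int z" by (auto simp: Ints_def)
  have "of_int (z ^ 3) = (of_int (int a ^ 2 * z + 1) :: complex)" using assms by (simp add: z)
  hence zz: "z ^ 3 = int a ^ 2 * z + 1" by (metis of_int_eq_iff)
  hence "z * (z ^ 2 - int a ^ 2) = 1" by (simp add: power2_eq_square power3_eq_cube algebra_simps)
  hence "z dvd 1" by (metis dvd_triv_left)
  hence "z = 1 \<or> z = - 1" by auto
  moreover have "int a ^ 2 \<ge> 2 ^ 2" using a_ge_2 by (intro power_mono) auto
  ultimately show False using zz by auto
qed

definition f :: "rat poly" where "f = [:- 1, - (of_nat a ^ 2), 0, 1:]"

lemma f_root: "rpoly f t = 0 \<longleftrightarrow> t ^ 3 = of_nat a ^ 2 * t + 1"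
proof -
  have "rpoly f t = t ^ 3 - (of_nat a ^ 2 * t + 1)"
    by (simp add: f_def power2_eq_square power3_eq_cube of_rat_minus of_rat_mult algebra_simps)
  thus ?thesis by simp
qed

lemma f_y: "i \<in> {1..3} \<Longrightarrow> rpoly f (y i) = 0" using root f_root by simp

lemma irreducible_f: "Factorial_Ring.irreducible f"
proof (rule Factorial_Ring.irreducibleI)
  show "f \<noteq> 0" by (simp add: f_def)
  show "\<not> is_unit f" by (simp add: f_def is_unit_iff_degree)
  fix g h assume fgh: "f = g * h"
  have nz: "g \<noteq> 0" "h \<noteq> 0" using fgh \<open>f \<noteq> 0\<close> by auto
  have deg: "Polynomial.degree g + Polynomial.degree h = 3"
  proof -
    have "Polynomial.degree (g * h) = 3" unfolding fgh[symmetric] by (simp add: f_def)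
    thus ?thesis using degree_mult_eq[OF nz] by simp
  qed
  have no1: False if "Polynomial.degree q = 1" "q dvd f" for q
  proof -
    define b c where "b = coeff q 0" and "c = coeff q 1"
    have q: "q = [:b, c:]"
    proof (rule poly_eqI)
      fix n show "coeff q n = coeff [:b, c:] n"
        using that(1) coeff_eq_0[of q n] by (auto simp: b_def c_def coeff_pCons One_nat_def split: nat.splits)
    qed
    have c: "c \<noteq> 0" using that(1) by (auto simp: q)
    from that(2) obtain r where "f = q * r" by (rule dvdE)
    hence "rpoly f (of_rat (- b / c)) = 0" using q c by (simp add: of_rat_divide of_rat_minus)
    hence "of_rat (- b / c) \<notin> (\<rat> :: complex set)" using no_rational_root f_root by blast
    thus False by simp
  qed
  have "Polynomial.degree g \<noteq> 1" "Polynomial.degree h \<noteq> 1"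
    using no1[of g] no1[of h] unfolding fgh by auto
  hence "Polynomial.degree g = 0 \<or> Polynomial.degree h = 0" using deg by linarith
  thus "is_unit g \<or> is_unit h" using nz by (auto simp: is_unit_iff_degree)
qed

lemma f_bezout: assumes "\<not> f dvd q" obtains r where "\<And>t. rpoly f t = 0 \<Longrightarrow> rpoly r t * rpoly q t = 1"
proof -
  have "prime_elem f" by (rule field_poly_irreducible_imp_prime[OF irreducible_f])
  hence "coprime f q" using assms by (rule prime_elem_imp_coprime)
  hence "fst (bezout_coefficients f q) * f + snd (bezout_coefficients f q) * q = 1"
    by (simp add: bezout_coefficients_fst_snd)
  hence b: "rpoly (fst (bezout_coefficients f q) * f + snd (bezout_coefficients f q) * q) t = 1" for t by simp
  show ?thesis
  proof (rule that[of "snd (bezout_coefficients f q)"])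
    fix t assume "rpoly f t = 0"
    thus "rpoly (snd (bezout_coefficients f q)) t * rpoly q t = 1" using b[of t] by simp
  qed
qed

lemma f_dvd: assumes "rpoly q (y 1) = 0" shows "f dvd q"
proof (rule ccontr)
  assume "\<not> f dvd q"
  then obtain r where "\<And>t. rpoly f t = 0 \<Longrightarrow> rpoly r t * rpoly q t = 1" by (rule f_bezout) blast
  from this[OF f_y[of 1]] show False using assms by simp
qed

lemma dvd_root: "f dvd q \<Longrightarrow> rpoly f t = 0 \<Longrightarrow> rpoly q t = 0"
  by (auto elim: dvdE)

lemma dvd_y: "f dvd q \<Longrightarrow> i \<in> {1..3} \<Longrightarrow> rpoly q (y i) = 0"
  by (rule dvd_root[OF _ f_y])

lemma power_sum_rational: "y 1 ^ n + y 2 ^ n + y 3 ^ n \<in> \<rat>"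
proof (induction n rule: less_induct)
  case (less n)
  consider "n = 0" | "n = 1" | "n = 2" | m where "n = m + 3" by (metis add.commute add_2_eq_Suc' eval_nat_numeral(3) less_Suc_eq less_one not_less_eq old.nat.exhaust le_Suc_ex not_less numeral_2_eq_2 One_nat_def)
  thus ?case
  proof cases
    case 3
    have "y 1 ^ 2 + y 2 ^ 2 + y 3 ^ 2 = 2 * of_nat a ^ 2"
      unfolding quad[symmetric] y3 by (simp add: power2_eq_square algebra_simps)
    thus ?thesis using 3 by simp
  next
    case (4 m)
    have "y i ^ n = of_nat a ^ 2 * y i ^ (m + 1) + y i ^ m" if "i \<in> {1..3}" for i
      using root[OF that] by (simp add: 4 power_add algebra_simps)
    from this[of 1] this[of 2] this[of 3]
    have "y 1 ^ n + y 2 ^ n + y 3 ^ n = of_nat a ^ 2 * (y 1 ^ (m+1) + y 2 ^ (m+1) + y 3 ^ (m+1)) + (y 1 ^ m + y 2 ^ m + y 3 ^ m)"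
      by (simp add: algebra_simps)
    moreover have "y 1 ^ (m+1) + y 2 ^ (m+1) + y 3 ^ (m+1) \<in> \<rat>" "y 1 ^ m + y 2 ^ m + y 3 ^ m \<in> \<rat>"
      using 4 by (intro less; simp)+
    moreover have "of_nat a ^ 2 \<in> (\<rat> :: complex set)" by simp
    ultimately show ?thesis by (metis Rats_add Rats_mult)
  qed (use sum_roots in simp_all)
qed

lemma trace_rational: "rpoly q (y 1) + rpoly q (y 2) + rpoly q (y 3) \<in> \<rat>"
proof -
  have "y 1 ^ n * rpoly q (y 1) + y 2 ^ n * rpoly q (y 2) + y 3 ^ n * rpoly q (y 3) \<in> \<rat>" for n
  proof (induction q arbitrary: n)
    case (pCons c q)
    have "y 1 ^ n * rpoly (pCons c q) (y 1) + y 2 ^ n * rpoly (pCons c q) (y 2) + y 3 ^ n * rpoly (pCons c q) (y 3)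
      = of_rat c * (y 1 ^ n + y 2 ^ n + y 3 ^ n) +
        (y 1 ^ Suc n * rpoly q (y 1) + y 2 ^ Suc n * rpoly q (y 2) + y 3 ^ Suc n * rpoly q (y 3))"
      by (simp add: algebra_simps)
    also have "\<dots> \<in> \<rat>" by (intro Rats_add Rats_mult pCons.IH power_sum_rational) simp
    finally show ?case .
  qed simp
  from this[of 0] show ?thesis by simp
qed

text \<open>All three conjugates of such a square root \<open>d\<close> are \<open>d\<close> or
  \<open>-d\<close>. Their sum is an odd, hence nonzero, multiple of \<open>d\<close>, and it is
  rational as a trace.\<close>

lemma sqrt_in_cubic_field:
  assumes "rpoly s (y 1) ^ 2 = of_int n"
  shows "rpoly s (y 1) \<in> \<rat>"
proof -
  define d where "d = rpoly s (y 1)"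
  have "rpoly (s * s - [:of_int n:]) (y 1) = 0" using assms by (simp add: power2_eq_square)
  hence dv: "f dvd s * s - [:of_int n:]" by (rule f_dvd)
  have pm: "rpoly s (y i) = d \<or> rpoly s (y i) = - d" if "i \<in> {1..3}" for i
  proof -
    have "rpoly s (y i) ^ 2 = d ^ 2" using dvd_y[OF dv that] assms by (simp add: power2_eq_square d_def)
    thus ?thesis by (simp add: power2_eq_iff)
  qed
  have "rpoly s (y 1) + rpoly s (y 2) + rpoly s (y 3) \<in> {d, 3 * d, - d}"
    using pm[of 2] pm[of 3] by (auto simp: d_def)
  hence "d \<in> \<rat> \<or> 3 * d \<in> \<rat> \<or> - d \<in> \<rat>" using trace_rational[of s] by auto
  moreover have "d \<in> \<rat>" if "3 * d \<in> \<rat>"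
  proof -
    have "(3 * d) / 3 \<in> \<rat>" using that by (intro Rats_divide) auto
    thus ?thesis by simp
  qed
  ultimately show ?thesis by (auto simp: d_def)
qed

text \<open>A nontrivial relation would put \<open>\<delta>\<close> into the cubic field, where
  square roots of integers are rational.\<close>

lemma unique_rep:
  assumes "rpoly q (y 1) + rpoly r (y 1) * \<delta> = 0"
  shows "f dvd q \<and> f dvd r"
proof (cases "f dvd r")
  case True
  hence "rpoly r (y 1) = 0" by (rule dvd_y) simp
  thus ?thesis using True assms f_dvd by simp
next
  case False
  then obtain v where v: "\<And>t. rpoly f t = 0 \<Longrightarrow> rpoly v t * rpoly r t = 1" by (rule f_bezout) blast
  have vr: "rpoly v (y 1) * rpoly r (y 1) = 1" using v[OF f_y[of 1]] by simp
  have "rpoly v (y 1) * (rpoly q (y 1) + rpoly r (y 1) * \<delta>) = 0" using assms by simp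
  hence "rpoly v (y 1) * rpoly q (y 1) + (rpoly v (y 1) * rpoly r (y 1)) * \<delta> = 0" by (simp only: distrib_left mult.assoc)
  hence "rpoly (- (v * q)) (y 1) = \<delta>" unfolding vr by (simp add: add_eq_0_iff)
  hence "\<delta> \<in> \<rat>" using sqrt_in_cubic_field[of "- (v * q)" D] delta_sq by metis
  thus ?thesis using delta_irrational by blast
qed

definition elt :: "rat poly \<Rightarrow> rat poly \<Rightarrow> complex"
  where "elt q r = rpoly q (y 1) + rpoly r (y 1) * \<delta>"

text \<open>The splitting field, written as a quadratic extension of the cubic field generated by
  \<open>y 1\<close>; \<open>y2_elt\<close> shows that it contains the other roots.\<close>

definition F :: "complex set" where "F = range (\<lambda>(q, r). elt q r)"

lemma elt_F [simp, intro]: "elt q r \<in> F" by (auto simp: F_def)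

lemma FE: assumes "x \<in> F" obtains q r where "x = elt q r" using assms by (auto simp: F_def)

lemma elt_add: "elt q r + elt q' r' = elt (q + q') (r + r')" by (simp add: elt_def algebra_simps)

lemma elt_diff: "elt q r - elt q' r' = elt (q - q') (r - r')" by (simp add: elt_def algebra_simps)

lemma elt_mult: "elt q r * elt q' r' = elt (q * q' + smult (of_int D) (r * r')) (q * r' + r * q')"
proof -
  have "elt q r * elt q' r' = rpoly q (y 1) * rpoly q' (y 1) + rpoly r (y 1) * rpoly r' (y 1) * \<delta> ^ 2
     + (rpoly q (y 1) * rpoly r' (y 1) + rpoly r (y 1) * rpoly q' (y 1)) * \<delta>"
    by (simp add: elt_def power2_eq_square algebra_simps)
  thus ?thesis unfolding delta_sq by (simp add: elt_def algebra_simps)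
qed

lemma elt_1: "elt 1 0 = 1" by (simp add: elt_def)

lemma elt_eq_0: "elt q r = 0 \<longleftrightarrow> f dvd q \<and> f dvd r"
proof
  assume "elt q r = 0"
  thus "f dvd q \<and> f dvd r" using unique_rep[of q r] unfolding elt_def by simp
next
  assume "f dvd q \<and> f dvd r"
  thus "elt q r = 0" using dvd_y[of q 1] dvd_y[of r 1] unfolding elt_def by simp
qed

lemma elt_eq: "elt q r = elt q' r' \<longleftrightarrow> f dvd q - q' \<and> f dvd r - r'"
proof -
  have "elt q r = elt q' r' \<longleftrightarrow> elt q r - elt q' r' = 0" by (rule eq_iff_diff_eq_0)
  also have "\<dots> \<longleftrightarrow> f dvd q - q' \<and> f dvd r - r'" by (simp only: elt_diff elt_eq_0)
  finally show ?thesis .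
qed

text \<open>The norm \<open>q^2 - D r^2\<close> to the cubic field is nonzero and is inverted there
  by a Bezout identity.\<close>

lemma F_inverse: assumes "x \<in> F" shows "inverse x \<in> F"
proof (cases "x = 0")
  case False
  obtain q r where x: "x = elt q r" using assms by (rule FE)
  define n where "n = q * q - smult (of_int D) (r * r)"
  have n: "x * elt q (- r) = elt n 0" unfolding x elt_mult n_def by (simp add: mult.commute)
  have "\<not> f dvd n"
  proof
    assume "f dvd n"
    hence "elt n 0 = 0" by (simp add: elt_eq_0)
    hence "elt q (- r) = 0" using n False by simp
    hence "f dvd q \<and> f dvd r" by (simp add: elt_eq_0)
    thus False using False x elt_eq_0 by simp
  qed
  then obtain v where v: "\<And>t. rpoly f t = 0 \<Longrightarrow> rpoly v t * rpoly n t = 1" by (rule f_bezout) blast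
  have "x * (elt q (- r) * elt v 0) = 1"
    unfolding mult.assoc[symmetric] n using v[OF f_y[of 1]] by (simp add: elt_def mult.commute)
  hence "inverse x = elt q (- r) * elt v 0" by (metis inverse_unique)
  thus ?thesis by (simp add: elt_mult)
qed (metis elt_F elt_eq_0 dvd_0_right inverse_zero)

lemma subfield_F: "subfield F complex_ring"
proof (rule subfield_complexI)
  show "1 \<in> F" using elt_1 elt_F by metis
qed (auto simp: F_inverse elt_diff elt_mult elim!: FE)

sublocale F: complex_subfield F by (rule complex_subfield.intro[OF subfield_F])

lemma y1_F: "y 1 \<in> F"
proof -
  have "y 1 = elt [:0, 1:] 0" by (simp add: elt_def)
  thus ?thesis by simp
qed

lemma delta_F: "\<delta> \<in> F"
proof -
  have "\<delta> = elt 0 1" by (simp add: elt_def)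
  thus ?thesis by simp
qed

definition q2 :: "rat poly"
  where "q2 = smult (1 / (2 * of_int D)) [:- (4 * of_nat a ^ 4), - 9, 6 * of_nat a ^ 2:]"

text \<open>\<open>y 2 - y 3 = \<delta> / f'(y 1)\<close> and \<open>f'(y 1) (6 a\<^sup>2 (y 1)\<^sup>2 - 9 y 1 - 4 a\<^sup>4) = D\<close>.\<close>

lemma y2_elt: "y 2 = elt [:0, - 1 / 2:] q2"
proof -
  have D0: "of_int D \<noteq> (0 :: complex)" using D_pos by simp
  let ?A = "of_nat a :: complex" and ?s = "y 1" and ?t = "y 2"
  have "?s * ?t * (?s + ?t) = - (?s * ?t * y 3)" by (simp add: y3 algebra_simps)
  hence p: "?s * ?t * (?s + ?t) = - 1" unfolding prod_roots .
  have Ds: "of_int D = 4 * (?A ^ 2) ^ 3 - 27" by (simp add: D_def power_mult[symmetric])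
  have "?s ^ 3 = ?A ^ 2 * ?s + 1" by (rule root) simp
  hence "(6 * ?A ^ 2 * ?s ^ 2 - 9 * ?s - 4 * (?A ^ 2) ^ 2) * (3 * ?s ^ 2 - ?A ^ 2) = 4 * (?A ^ 2) ^ 3 - 27"
    by (rule cubic_discriminant_identity)
  hence e: "(6 * ?A ^ 2 * ?s ^ 2 - 9 * ?s - 4 * (?A ^ 2) ^ 2) * (3 * ?s ^ 2 - ?A ^ 2) = of_int D" using Ds by simp
  have "3 * ?s ^ 2 - ?A ^ 2 = (?s - ?t) * (?s - y 3)" unfolding quad[symmetric] y3
    by (simp add: power2_eq_square algebra_simps)
  hence "\<delta> = (3 * ?s ^ 2 - ?A ^ 2) * (?t - y 3)" unfolding \<delta>_def by (simp add: ac_simps)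
  hence "(6 * ?A ^ 2 * ?s ^ 2 - 9 * ?s - 4 * (?A ^ 2) ^ 2) * \<delta> = of_int D * (?t - y 3)" using e by (simp add: mult.assoc[symmetric])
  hence "?t - y 3 = (6 * ?A ^ 2 * ?s ^ 2 - 9 * ?s - 4 * (?A ^ 2) ^ 2) / of_int D * \<delta>" using D0 by (simp add: field_simps)
  moreover have "?t = (- ?s + (?t - y 3)) / 2" by (simp add: y3)
  ultimately have "?t = (- ?s + (6 * ?A ^ 2 * ?s ^ 2 - 9 * ?s - 4 * (?A ^ 2) ^ 2) / of_int D * \<delta>) / 2" by simp
  also have "\<dots> = - ?s / 2 + (6 * ?A ^ 2 * ?s ^ 2 - 9 * ?s - 4 * (?A ^ 2) ^ 2) / (2 * of_int D) * \<delta>"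
    by (simp add: add_divide_distrib diff_divide_distrib)
  also have "(6 * ?A ^ 2 * ?s ^ 2 - 9 * ?s - 4 * (?A ^ 2) ^ 2) / (2 * of_int D) = rpoly q2 ?s"
  proof -
    have "of_rat (1 / (2 * of_int D)) = (1 / (2 * of_int D) :: complex)"
      by (simp only: of_rat_divide of_rat_mult of_rat_1 of_rat_of_int_eq of_rat_numeral_eq)
    moreover have "rpoly [:- (4 * of_nat a ^ 4), - 9, 6 * of_nat a ^ 2:] ?s = 6 * ?A ^ 2 * ?s ^ 2 - 9 * ?s - 4 * (?A ^ 2) ^ 2"
      by (simp add: of_rat_mult of_rat_minus of_rat_power power2_eq_square power4_eq_xxxx algebra_simps)
    ultimately show ?thesis unfolding q2_def rpoly_smult by simp
  qed
  also have "- ?s / 2 + rpoly q2 ?s * \<delta> = elt [:0, - 1 / 2:] q2"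
    by (simp add: elt_def of_rat_divide of_rat_minus)
  finally show ?thesis .
qed

lemma y_F: "i \<in> {1..3} \<Longrightarrow> y i \<in> F"
proof -
  assume "i \<in> {1..3}"
  hence "i = 1 \<or> i = 2 \<or> i = 3" by auto
  moreover have "y 2 \<in> F" using y2_elt by simp
  moreover have "y 3 \<in> F" unfolding y3 using y1_F \<open>y 2 \<in> F\<close> by auto
  ultimately show ?thesis using y1_F by auto
qed

lemma F_real: "F \<subseteq> \<real>"
  using rpoly_real[OF real[of 1]] delta_real by (auto simp: F_def elt_def)

lemma F_minimal:
  assumes "subfield E complex_ring" "y ` {1..3} \<subseteq> E"
  shows "F \<subseteq> E"
proof -
  interpret E: complex_subfield E by (rule complex_subfield.intro[OF assms(1)])
  have y: "y 1 \<in> E" "y 2 \<in> E" "y 3 \<in> E" using assms(2) by auto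
  have "rpoly q x \<in> E" if "x \<in> E" for q x using that by (induction q) auto
  moreover have "\<delta> \<in> E" using y by (auto simp: \<delta>_def)
  ultimately show ?thesis using y(1) by (auto simp: F_def elt_def)
qed

end

lemma cubic_roots_exist:
  assumes "a \<ge> 2"
  obtains y where "cubic_roots a y"
proof -
  define g where "g = [:- 1, - (real a ^ 2), 0, 1:]"
  have g: "poly g t = t ^ 3 - real a ^ 2 * t - 1" for t
    by (simp add: g_def power2_eq_square power3_eq_cube algebra_simps)
  have a: "real a \<ge> 2" using assms by simp
  hence a2: "real a ^ 2 \<ge> 2 ^ 2" by (intro power_mono) auto
  \<comment> \<open>The value is -1 at \<open>-a\<close>, 0 and \<open>a\<close>, and positive at -1
    and \<open>a + 1\<close>; this gives sign changes on three disjoint intervals.\<close>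
  have "poly g (- 1) > 0" "poly g (- real a) < 0" "poly g 0 < 0" "poly g (real a) < 0"
    using a a2 by (simp_all add: g power2_eq_square power3_eq_cube)
  moreover have "poly g (real a + 1) > 0"
  proof -
    have "poly g (real a + 1) = 2 * real a ^ 2 + 3 * real a" unfolding g by (simp add: power2_eq_square power3_eq_cube algebra_simps)
    thus ?thesis using a a2 by simp
  qed
  moreover have "- real a < - 1" "(- 1 :: real) < 0" "real a < real a + 1" using a by auto
  ultimately obtain r1 r2 r3 where r: "- real a < r1" "r1 < - 1" "poly g r1 = 0" "- 1 < r2" "r2 < 0" "poly g r2 = 0"
    "real a < r3" "poly g r3 = 0"
    using poly_IVT_pos[of "- real a" "- 1" g] poly_IVT_neg[of "- 1" 0 g] poly_IVT_pos[of "real a" "real a + 1" g] by metis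
  define y :: "nat \<Rightarrow> complex" where "y = (\<lambda>i. of_real (if i = 1 then r1 else if i = 2 then r2 else r3))"
  have "cubic_roots a y"
  proof
    show "a \<ge> 2" by (rule assms)
    have "r1 \<noteq> r2" "r2 \<noteq> r3" "r1 \<noteq> r3" using r a by auto
    thus "inj_on y {1..3}" unfolding nat_range_1_3 inj_on_def y_def by auto
    fix i
    show "y i \<in> \<real>" by (simp add: y_def)
    have root: "(of_real t :: complex) ^ 3 = of_nat a ^ 2 * of_real t + 1" if "poly g t = 0" for t
    proof -
      have "t ^ 3 = real a ^ 2 * t + 1" using that unfolding g by simp
      hence "of_real (t ^ 3) = (of_real (real a ^ 2 * t + 1) :: complex)" by simp
      thus ?thesis by simp
    qed
    show "y i ^ 3 = of_nat a ^ 2 * y i + 1" using r root unfolding y_def by simp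
  qed
  thus ?thesis by (rule that)
qed

section \<open>The Galois group\<close>

abbreviation S3 :: "(nat \<Rightarrow> nat) set" where "S3 \<equiv> {\<pi>. \<pi> permutes {1..3}}"

lemma finite_S3: "finite S3" by (rule finite_permutations) simp

lemma card_S3: "card S3 = 6"
  using card_permutations[of "{1..3::nat}" 3] by (simp add: fact_numeral)

lemma S3_comp: "\<pi> \<in> S3 \<Longrightarrow> \<rho> \<in> S3 \<Longrightarrow> \<pi> \<circ> \<rho> \<in> S3"
  by (simp add: permutes_compose)

lemma S3_mem: "\<pi> \<in> S3 \<Longrightarrow> i \<in> {1..3} \<Longrightarrow> \<pi> i \<in> {1..3}"
  using permutes_in_image[of \<pi> "{1..3}" i] by simp

lemma sum_S3_comp_right: assumes "\<rho> \<in> S3" shows "(\<Sum>\<pi>\<in>S3. g (\<pi> \<circ> \<rho>)) = (\<Sum>\<pi>\<in>S3. g \<pi> :: complex)"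
  using assms sum.reindex_bij_witness[of S3 "\<lambda>\<pi>. \<pi> \<circ> inv_into UNIV \<rho>" "\<lambda>\<pi>. \<pi> \<circ> \<rho>" S3 g "\<lambda>\<pi>. g (\<pi> \<circ> \<rho>)"]
  by (auto simp: permutes_compose permutes_inv comp_assoc permutes_inv_o)

lemma prod_S3_comp_left: assumes "\<rho> \<in> S3" shows "(\<Prod>\<pi>\<in>S3. g (\<rho> \<circ> \<pi>)) = (\<Prod>\<pi>\<in>S3. g \<pi> :: complex)"
  using assms prod.reindex_bij_witness[of S3 "\<lambda>\<pi>. inv_into UNIV \<rho> \<circ> \<pi>" "\<lambda>\<pi>. \<rho> \<circ> \<pi>" S3 g "\<lambda>\<pi>. g (\<rho> \<circ> \<pi>)"]
  by (auto simp: permutes_compose permutes_inv comp_assoc[symmetric] permutes_inv_o)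

lemma transpose_S3: "i \<in> {1..3} \<Longrightarrow> j \<in> {1..3} \<Longrightarrow> Transposition.transpose i j \<in> S3"
  by (simp add: permutes_swap_id)

locale subfield_hom = complex_subfield E for E :: "complex set" +
  fixes \<tau> :: "complex \<Rightarrow> complex"
  assumes hom_add: "\<And>x y. x \<in> E \<Longrightarrow> y \<in> E \<Longrightarrow> \<tau> (x + y) = \<tau> x + \<tau> y"
    and hom_mult: "\<And>x y. x \<in> E \<Longrightarrow> y \<in> E \<Longrightarrow> \<tau> (x * y) = \<tau> x * \<tau> y"
    and hom_1 [simp]: "\<tau> 1 = 1"
begin

lemma hom_0 [simp]: "\<tau> 0 = 0" using hom_add[of 0 0] by simp

lemma hom_minus: "x \<in> E \<Longrightarrow> \<tau> (- x) = - \<tau> x"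
  using hom_add[of x "- x"] by (simp add: eq_neg_iff_add_eq_0 add.commute)

lemma hom_diff: "x \<in> E \<Longrightarrow> y \<in> E \<Longrightarrow> \<tau> (x - y) = \<tau> x - \<tau> y"
  using hom_add[of x "- y"] hom_minus[of y] by auto

lemma hom_power: "x \<in> E \<Longrightarrow> \<tau> (x ^ n) = \<tau> x ^ n"
  by (induction n) (auto simp: hom_mult)

lemma hom_of_nat: "\<tau> (of_nat n) = of_nat n"
  by (induction n) (auto simp: hom_add)

lemma hom_of_int: "\<tau> (of_int n) = of_int n"
  by (cases n) (auto simp: hom_of_nat hom_minus simp del: of_nat_Suc)

lemma hom_nonzero: assumes "x \<in> E" "x \<noteq> 0" shows "\<tau> x \<noteq> 0"
proof
  assume "\<tau> x = 0"
  moreover have "\<tau> (x * inverse x) = \<tau> x * \<tau> (inverse x)" using assms by (intro hom_mult) auto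
  ultimately show False using assms by simp
qed

lemma hom_inverse: "x \<in> E \<Longrightarrow> \<tau> (inverse x) = inverse (\<tau> x)"
proof (cases "x = 0")
  case False
  assume x: "x \<in> E"
  have "\<tau> (x * inverse x) = \<tau> x * \<tau> (inverse x)" using x by (intro hom_mult) auto
  hence "\<tau> x * \<tau> (inverse x) = 1" using False by simp
  thus ?thesis by (metis inverse_unique)
qed simp

lemma hom_divide: "x \<in> E \<Longrightarrow> y \<in> E \<Longrightarrow> \<tau> (x / y) = \<tau> x / \<tau> y"
  by (simp add: divide_inverse hom_mult hom_inverse)

lemma hom_of_rat: "\<tau> (of_rat q) = of_rat q"
  by (cases q) (simp add: of_rat_rat hom_divide hom_of_int)

lemma hom_powi: "x \<in> E \<Longrightarrow> \<tau> (x powi n) = \<tau> x powi n"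
  by (auto simp: power_int_def hom_power hom_inverse)

lemma hom_sum: "(\<And>i. i \<in> I \<Longrightarrow> g i \<in> E) \<Longrightarrow> \<tau> (sum g I) = (\<Sum>i\<in>I. \<tau> (g i))"
  by (induction I rule: infinite_finite_induct) (auto simp: hom_add sum_mem)

lemma hom_prod: "(\<And>i. i \<in> I \<Longrightarrow> g i \<in> E) \<Longrightarrow> \<tau> (prod g I) = (\<Prod>i\<in>I. \<tau> (g i))"
  by (induction I rule: infinite_finite_induct) (auto simp: hom_mult prod_mem)

lemma hom_rpoly: "x \<in> E \<Longrightarrow> \<tau> (rpoly q x) = rpoly q (\<tau> x) \<and> rpoly q x \<in> E"
  by (induction q) (auto simp: hom_add hom_mult hom_of_rat)

lemma hom_algebraic_int: assumes "x \<in> E" "algebraic_int x" shows "algebraic_int (\<tau> x)"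
proof -
  obtain p where p: "poly (map_poly of_int p) x = 0" "lead_coeff p = 1"
    using assms(2) unfolding algebraic_int_altdef_ipoly by auto
  have "\<tau> (poly (map_poly of_int p) x) = poly (map_poly of_int p) (\<tau> x)"
    using assms(1) by (simp add: poly_altdef hom_sum hom_mult hom_of_int hom_power coeff_map_poly degree_map_poly mult_mem)
  thus ?thesis using p unfolding algebraic_int_altdef_ipoly by (metis hom_0)
qed

end

context cubic_roots
begin

lemma roots_permute: assumes "\<pi> \<in> S3" shows "cubic_roots a (y \<circ> \<pi>)"
proof
  show "a \<ge> 2" by (rule a_ge_2)
  show "inj_on (y \<circ> \<pi>) {1..3}"
  proof (rule comp_inj_on)
    show "inj_on \<pi> {1..3}" using assms permutes_inj_on by blast
    show "inj_on y (\<pi> ` {1..3})" using assms inj permutes_image[of \<pi> "{1..3}"] by simp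
  qed
  fix i :: nat assume "i \<in> {1..3}"
  hence "\<pi> i \<in> {1..3}" by (rule S3_mem[OF assms])
  thus "(y \<circ> \<pi>) i ^ 3 = of_nat a ^ 2 * (y \<circ> \<pi>) i + 1" "(y \<circ> \<pi>) i \<in> \<real>"
    unfolding comp_apply by (rule root, rule real)
qed

text \<open>By minimality the field depends only on the set of roots.\<close>

lemma F_permute: assumes "\<pi> \<in> S3" shows "cubic_roots.F (y \<circ> \<pi>) = F"
proof -
  interpret P: cubic_roots a "y \<circ> \<pi>" by (rule roots_permute[OF assms])
  have im: "(y \<circ> \<pi>) ` {1..3} = y ` {1..3}"
    using assms permutes_image[of \<pi> "{1..3}"] by (simp only: image_comp[symmetric] mem_Collect_eq)
  have "y ` {1..3} \<subseteq> F" using y_F by blast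
  hence 1: "P.F \<subseteq> F" by (intro P.F_minimal subfield_F) (simp only: im)
  have "(y \<circ> \<pi>) ` {1..3} \<subseteq> P.F" using P.y_F by blast
  hence "F \<subseteq> P.F" by (intro F_minimal P.subfield_F) (simp only: im)
  thus ?thesis using 1 by simp
qed

text \<open>A representation is evaluated again with permuted roots. The choice does not matter,
  because \<open>elt_eq\<close> is a condition on the polynomials that is blind to the ordering. The
  restriction to \<open>F\<close> provides the extensionality that \<open>Bij\<close>
  requires.\<close>

definition conj :: "(nat \<Rightarrow> nat) \<Rightarrow> complex \<Rightarrow> complex"
  where "conj \<pi> = (\<lambda>x\<in>F. case (SOME qr. x = elt (fst qr) (snd qr)) of (q, r) \<Rightarrow> cubic_roots.elt (y \<circ> \<pi>) q r)"

lemma conj_elt: assumes "\<pi> \<in> S3" shows "conj \<pi> (elt q r) = cubic_roots.elt (y \<circ> \<pi>) q r"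
proof -
  interpret P: cubic_roots a "y \<circ> \<pi>" by (rule roots_permute[OF assms])
  obtain q' r' where s: "(SOME qr. elt q r = elt (fst qr) (snd qr)) = (q', r')" by (cases "SOME qr. elt q r = elt (fst qr) (snd qr)")
  have "elt q r = elt (fst (q, r)) (snd (q, r))" by simp
  hence "elt q r = elt (fst (SOME qr. elt q r = elt (fst qr) (snd qr))) (snd (SOME qr. elt q r = elt (fst qr) (snd qr)))"
    by (rule someI)
  hence "elt q r = elt q' r'" unfolding s by simp
  hence "P.elt q r = P.elt q' r'" unfolding elt_eq P.elt_eq .
  thus ?thesis by (simp add: conj_def s)
qed

lemma conj_hom: assumes "\<pi> \<in> S3" shows "subfield_hom F (conj \<pi>)"
proof (rule subfield_hom.intro[OF complex_subfield.intro[OF subfield_F] subfield_hom_axioms.intro])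
  interpret P: cubic_roots a "y \<circ> \<pi>" by (rule roots_permute[OF assms])
  show "conj \<pi> 1 = 1" unfolding elt_1[symmetric] conj_elt[OF assms] by (simp add: P.elt_1 elt_1)
  fix x z assume "x \<in> F" "z \<in> F"
  obtain q r where x: "x = elt q r" using \<open>x \<in> F\<close> by (rule FE)
  obtain q' r' where z: "z = elt q' r'" using \<open>z \<in> F\<close> by (rule FE)
  show "conj \<pi> (x + z) = conj \<pi> x + conj \<pi> z"
    unfolding x z elt_add conj_elt[OF assms] P.elt_add ..
  show "conj \<pi> (x * z) = conj \<pi> x * conj \<pi> z"
    unfolding x z elt_mult conj_elt[OF assms] P.elt_mult ..
qed

lemma conj_F: assumes "\<pi> \<in> S3" "x \<in> F" shows "conj \<pi> x \<in> F"
proof -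
  interpret P: cubic_roots a "y \<circ> \<pi>" by (rule roots_permute[OF assms(1)])
  obtain q r where "x = elt q r" using assms(2) by (rule FE)
  thus ?thesis using conj_elt[OF assms(1)] P.elt_F F_permute[OF assms(1)] by simp
qed

text \<open>For \<open>y 2\<close>, the identity \<open>y2_elt\<close> holds with the same two
  polynomials in the permuted instance; \<open>y 3\<close> follows from the vanishing sum of the
  roots.\<close>

lemma conj_y: assumes "\<pi> \<in> S3" "i \<in> {1..3}" shows "conj \<pi> (y i) = y (\<pi> i)"
proof -
  interpret P: cubic_roots a "y \<circ> \<pi>" by (rule roots_permute[OF assms(1)])
  interpret h: subfield_hom F "conj \<pi>" by (rule conj_hom[OF assms(1)])
  have "y 1 = elt [:0, 1:] 0" by (simp add: elt_def)
  hence 1: "conj \<pi> (y 1) = y (\<pi> 1)" using conj_elt[OF assms(1)] by (simp add: P.elt_def)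
  have 2: "conj \<pi> (y 2) = y (\<pi> 2)" using conj_elt[OF assms(1)] y2_elt P.y2_elt by simp
  have "conj \<pi> (y 3) = - conj \<pi> (y 1) - conj \<pi> (y 2)"
    unfolding y3 using y_F[of 1] y_F[of 2] by (subst h.hom_diff h.hom_minus; simp add: h.hom_minus)
  hence 3: "conj \<pi> (y 3) = y (\<pi> 3)" using P.y3 1 2 by simp
  have "i = 1 \<or> i = 2 \<or> i = 3" using assms(2) by auto
  thus ?thesis using 1 2 3 by auto
qed

lemma conj_delta: assumes "\<pi> \<in> S3" shows "conj \<pi> \<delta> = cubic_roots.\<delta> (y \<circ> \<pi>)"
proof -
  interpret P: cubic_roots a "y \<circ> \<pi>" by (rule roots_permute[OF assms])
  have "\<delta> = elt 0 1" by (simp add: elt_def)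
  thus ?thesis using conj_elt[OF assms] by (simp add: P.elt_def)
qed

lemma hom_agree:
  assumes "subfield_hom F \<sigma>" "subfield_hom F \<tau>" "\<And>i. i \<in> {1..3} \<Longrightarrow> \<sigma> (y i) = \<tau> (y i)" "x \<in> F"
  shows "\<sigma> x = \<tau> x"
proof -
  interpret s: subfield_hom F \<sigma> by (rule assms)
  interpret t: subfield_hom F \<tau> by (rule assms)
  have y: "y 1 \<in> F" "y 2 \<in> F" "y 3 \<in> F" by (rule y_F, simp)+
  have eq: "\<sigma> (y 1) = \<tau> (y 1)" "\<sigma> (y 2) = \<tau> (y 2)" "\<sigma> (y 3) = \<tau> (y 3)" by (rule assms(3), simp)+
  have d: "\<sigma> \<delta> = \<tau> \<delta>" unfolding \<delta>_def using y eq by (simp add: s.hom_mult t.hom_mult s.hom_diff t.hom_diff)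
  obtain q r where x: "x = elt q r" using assms(4) by (rule FE)
  show ?thesis unfolding x elt_def
    using y delta_F eq d s.hom_rpoly[OF y(1)] t.hom_rpoly[OF y(1)]
    by (simp add: s.hom_add t.hom_add s.hom_mult t.hom_mult)
qed

lemma hom_root_cases:
  assumes "subfield_hom F \<tau>" "i \<in> {1..3}" shows "\<tau> (y i) \<in> y ` {1..3}"
proof -
  interpret t: subfield_hom F \<tau> by (rule assms)
  let ?t = "\<tau> (y i)"
  have yF: "y i \<in> F" by (rule y_F[OF assms(2)])
  have "\<tau> (y i ^ 3) = \<tau> (of_nat a ^ 2 * y i + 1)" by (simp only: root[OF assms(2)])
  hence "?t ^ 3 = of_nat a ^ 2 * ?t + 1"
    using yF by (simp add: t.hom_power t.hom_add t.hom_mult t.hom_of_nat)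
  moreover have "(?t - y 1) * (?t - y 2) * (?t - y 3) = ?t ^ 3 - (y 1 ^ 2 + y 1 * y 2 + y 2 ^ 2) * ?t - y 1 * y 2 * y 3"
    by (simp add: y3 power2_eq_square power3_eq_cube algebra_simps)
  ultimately have "(?t - y 1) * (?t - y 2) * (?t - y 3) = 0" unfolding quad prod_roots by simp
  thus ?thesis unfolding nat_range_1_3 by auto
qed

lemma conj_inj: assumes "\<pi> \<in> S3" "\<rho> \<in> S3" "conj \<pi> = conj \<rho>" shows "\<pi> = \<rho>"
proof
  fix i
  show "\<pi> i = \<rho> i"
  proof (cases "i \<in> {1..3}")
    case True
    have "y (\<pi> i) = y (\<rho> i)" using assms conj_y True by metis
    thus ?thesis using inj S3_mem[OF assms(1) True] S3_mem[OF assms(2) True] by (simp add: inj_on_eq_iff)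
  next
    case False
    thus ?thesis using assms permutes_not_in[of \<pi> "{1..3}" i] permutes_not_in[of \<rho> "{1..3}" i] by simp
  qed
qed

lemma conj_comp: assumes "\<pi> \<in> S3" "\<rho> \<in> S3" "x \<in> F" shows "conj (\<pi> \<circ> \<rho>) x = conj \<pi> (conj \<rho> x)"
proof -
  interpret p: subfield_hom F "conj \<pi>" by (rule conj_hom[OF assms(1)])
  interpret r: subfield_hom F "conj \<rho>" by (rule conj_hom[OF assms(2)])
  have "subfield_hom F (\<lambda>x. conj \<pi> (conj \<rho> x))"
    by (rule subfield_hom.intro[OF complex_subfield.intro[OF subfield_F] subfield_hom_axioms.intro])
      (simp_all add: r.hom_add r.hom_mult p.hom_add p.hom_mult conj_F[OF assms(2)])
  moreover have "conj (\<pi> \<circ> \<rho>) (y i) = conj \<pi> (conj \<rho> (y i))" if "i \<in> {1..3}" for i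
    using conj_y[OF S3_comp[OF assms(1,2)] that] conj_y[OF assms(2) that] conj_y[OF assms(1) S3_mem[OF assms(2) that]] by simp
  ultimately show ?thesis using hom_agree[OF conj_hom[OF S3_comp[OF assms(1,2)]]] assms(3) by blast
qed

lemma conj_bij: assumes "\<pi> \<in> S3" shows "conj \<pi> \<in> Bij F"
proof -
  interpret P: cubic_roots a "y \<circ> \<pi>" by (rule roots_permute[OF assms])
  interpret h: subfield_hom F "conj \<pi>" by (rule conj_hom[OF assms])
  have "inj_on (conj \<pi>) F"
  proof (rule inj_onI)
    fix x z assume "x \<in> F" "z \<in> F" "conj \<pi> x = conj \<pi> z"
    hence "conj \<pi> (x - z) = 0" by (simp add: h.hom_diff)
    thus "x = z" using h.hom_nonzero[of "x - z"] \<open>x \<in> F\<close> \<open>z \<in> F\<close> by auto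
  qed
  moreover have "conj \<pi> ` F = F"
  proof
    show "conj \<pi> ` F \<subseteq> F" using conj_F[OF assms] by blast
    show "F \<subseteq> conj \<pi> ` F"
    proof
      fix x assume "x \<in> F"
      hence "x \<in> P.F" using F_permute[OF assms] by simp
      then obtain q r where "x = P.elt q r" by (rule P.FE)
      thus "x \<in> conj \<pi> ` F" using conj_elt[OF assms, of q r] by (intro image_eqI[of _ _ "elt q r"]) auto
    qed
  qed
  ultimately show ?thesis by (simp add: Bij_def bij_betw_def conj_def)
qed

lemma galois_carrier: "carrier (galois_group \<rat> F) = conj ` S3"
proof
  show "conj ` S3 \<subseteq> carrier (galois_group \<rat> F)"
  proof
    fix \<sigma> assume "\<sigma> \<in> conj ` S3"
    then obtain \<pi> where p: "\<pi> \<in> S3" "\<sigma> = conj \<pi>" by blast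
    interpret h: subfield_hom F "conj \<pi>" by (rule conj_hom[OF p(1)])
    have "conj \<pi> \<in> ring_iso (subfield_ring F) (subfield_ring F)"
    proof -
      have "conj \<pi> \<in> Ring.ring_hom (subfield_ring F) (subfield_ring F)"
        by (rule ring_hom_memI) (simp_all add: conj_F[OF p(1)] h.hom_add h.hom_mult)
      moreover have "bij_betw (conj \<pi>) F F" using conj_bij[OF p(1)] by (simp add: Bij_def)
      ultimately show ?thesis by (simp add: ring_iso_def)
    qed
    moreover have "conj \<pi> x = x" if "x \<in> \<rat>" for x using that by (auto simp: Rats_def h.hom_of_rat)
    ultimately show "\<sigma> \<in> carrier (galois_group \<rat> F)" using conj_bij[OF p(1)] p by (simp add: galois_group_def)
  qed
  show "carrier (galois_group \<rat> F) \<subseteq> conj ` S3"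
  proof
    fix \<sigma> assume "\<sigma> \<in> carrier (galois_group \<rat> F)"
    hence s: "\<sigma> \<in> Bij F" "\<sigma> \<in> Ring.ring_hom (subfield_ring F) (subfield_ring F)"
      by (auto simp: galois_group_def ring_iso_def)
    have hom: "subfield_hom F \<sigma>"
      by (rule subfield_hom.intro[OF complex_subfield.intro[OF subfield_F] subfield_hom_axioms.intro])
        (use ring_hom_add[OF s(2)] ring_hom_mult[OF s(2)] ring_hom_one[OF s(2)] in auto)
    have "\<exists>j. j \<in> {1..3} \<and> \<sigma> (y i) = y j" if "i \<in> {1..3}" for i
      using hom_root_cases[OF hom that] by blast
    then obtain g where g: "\<And>i. i \<in> {1..3} \<Longrightarrow> g i \<in> {1..3} \<and> \<sigma> (y i) = y (g i)" by metis
    define \<pi> where "\<pi> = (\<lambda>i. if i \<in> {1..3} then g i else i)"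
    have "inj_on \<pi> {1..3}"
    proof (rule inj_onI)
      fix i j :: nat assume ij: "i \<in> {1..3}" "j \<in> {1..3}" "\<pi> i = \<pi> j"
      hence "\<sigma> (y i) = \<sigma> (y j)" using g by (simp add: \<pi>_def)
      moreover have "inj_on \<sigma> F" using s(1) by (simp add: Bij_def bij_betw_def)
      ultimately have "y i = y j" using y_F[OF ij(1)] y_F[OF ij(2)] by (auto dest: inj_onD)
      thus "i = j" using inj ij by (simp add: inj_on_eq_iff)
    qed
    moreover have "\<pi> ` {1..3} \<subseteq> {1..3}" using g by (auto simp: \<pi>_def)
    ultimately have "bij_betw \<pi> {1..3} {1..3}" by (simp add: bij_betw_def endo_inj_surj)
    moreover have "\<pi> i = i" if "i \<notin> {1..3}" for i using that by (simp only: \<pi>_def if_False)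
    ultimately have p: "\<pi> \<in> S3" using bij_imp_permutes by blast
    have "\<sigma> x = conj \<pi> x" for x
    proof (cases "x \<in> F")
      case True
      have "\<sigma> (y i) = conj \<pi> (y i)" if "i \<in> {1..3}" for i
        using g[OF that] conj_y[OF p that] that by (simp add: \<pi>_def)
      thus ?thesis using hom_agree[OF hom conj_hom[OF p]] True by blast
    next
      case False
      thus ?thesis using s(1) by (simp add: Bij_def extensional_def conj_def)
    qed
    thus "\<sigma> \<in> conj ` S3" using p by blast
  qed
qed

lemma galois_iso: "galois_group \<rat> F \<cong> sym_group 3"
proof -
  have "conj \<in> Group.iso (sym_group 3) (galois_group \<rat> F)"
  proof (rule isoI)
    show "conj \<in> hom (sym_group 3) (galois_group \<rat> F)"
    proof (rule homI)
      fix \<pi> assume "\<pi> \<in> carrier (sym_group 3)"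
      thus "conj \<pi> \<in> carrier (galois_group \<rat> F)" unfolding galois_carrier by (simp add: sym_group_def)
    next
      fix \<pi> \<rho> assume "\<pi> \<in> carrier (sym_group 3)" "\<rho> \<in> carrier (sym_group 3)"
      hence p: "\<pi> \<in> S3" "\<rho> \<in> S3" by (auto simp: sym_group_def)
      have "conj (\<pi> \<circ> \<rho>) = compose F (conj \<pi>) (conj \<rho>)"
      proof
        fix x show "conj (\<pi> \<circ> \<rho>) x = compose F (conj \<pi>) (conj \<rho>) x"
          using conj_comp[OF p, of x] by (cases "x \<in> F") (auto simp: compose_def conj_def)
      qed
      thus "conj (\<pi> \<otimes>\<^bsub>sym_group 3\<^esub> \<rho>) = conj \<pi> \<otimes>\<^bsub>galois_group \<rat> F\<^esub> conj \<rho>"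
        using conj_bij[OF p(1)] conj_bij[OF p(2)] by (simp add: galois_group_def BijGroup_def sym_group_def)
    qed
    show "bij_betw conj (carrier (sym_group 3)) (carrier (galois_group \<rat> F))"
      unfolding galois_carrier bij_betw_def using conj_inj by (auto simp: sym_group_def inj_on_def)
  qed
  hence "sym_group 3 \<cong> galois_group \<rat> F" by (rule is_isoI)
  thus ?thesis by (rule group.iso_sym[OF sym_group_is_group])
qed

text \<open>The transposition of 2 and 3 fixes \<open>y 1\<close> and changes the sign of
  \<open>\<delta>\<close>, so the second component cancels.\<close>

lemma conj_pair:
  assumes p: "\<pi> \<in> S3" shows "conj \<pi> (elt q r) + conj (\<pi> \<circ> Transposition.transpose 2 3) (elt q r) = 2 * rpoly q (y (\<pi> 1))"
proof -
  let ?t = "Transposition.transpose 2 (3::nat)"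
  have t: "?t \<in> S3" by (rule transpose_S3) auto
  have pt: "\<pi> \<circ> ?t \<in> S3" by (rule S3_comp[OF p t])
  interpret P: cubic_roots a "y \<circ> \<pi>" by (rule roots_permute[OF p])
  interpret T: cubic_roots a "y \<circ> (\<pi> \<circ> ?t)" by (rule roots_permute[OF pt])
  have [simp]: "?t 1 = 1" by (simp add: transpose_def)
  have "T.\<delta> = - P.\<delta>" by (simp add: T.\<delta>_def P.\<delta>_def algebra_simps)
  thus ?thesis unfolding conj_elt[OF p] conj_elt[OF pt] by (simp add: P.elt_def T.elt_def)
qed

text \<open>Pairing each permutation with its product by a transposition removes
  \<open>\<delta>\<close>. What remains depends on one root only and is averaged over the three
  roots, giving twice a trace from the cubic field.\<close>

lemma conj_sum_rational: assumes "x \<in> F" shows "(\<Sum>\<pi>\<in>S3. conj \<pi> x) \<in> \<rat>"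
proof -
  obtain q r where x: "x = elt q r" using assms by (rule FE)
  let ?t = "Transposition.transpose 2 (3::nat)"
  let ?g = "\<lambda>i \<pi>. rpoly q (y (\<pi> i))"
  have t: "?t \<in> S3" "Transposition.transpose 1 (2::nat) \<in> S3" "Transposition.transpose 1 (3::nat) \<in> S3"
    by (rule transpose_S3; simp)+
  have "2 * (\<Sum>\<pi>\<in>S3. conj \<pi> x) = (\<Sum>\<pi>\<in>S3. conj \<pi> x) + (\<Sum>\<pi>\<in>S3. conj (\<pi> \<circ> ?t) x)"
    using sum_S3_comp_right[OF t(1), of "\<lambda>\<pi>. conj \<pi> x"] by simp
  also have "\<dots> = (\<Sum>\<pi>\<in>S3. 2 * ?g 1 \<pi>)"
    unfolding sum.distrib[symmetric] x using conj_pair by (intro sum.cong) auto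
  finally have 1: "(\<Sum>\<pi>\<in>S3. conj \<pi> x) = (\<Sum>\<pi>\<in>S3. ?g 1 \<pi>)" by (simp add: sum_distrib_left[symmetric])
  have 2: "(\<Sum>\<pi>\<in>S3. ?g 2 \<pi>) = (\<Sum>\<pi>\<in>S3. ?g 1 \<pi>)"
    using sum_S3_comp_right[OF t(2), of "?g 2"] by simp
  have 3: "(\<Sum>\<pi>\<in>S3. ?g 3 \<pi>) = (\<Sum>\<pi>\<in>S3. ?g 1 \<pi>)"
    using sum_S3_comp_right[OF t(3), of "?g 3"] by simp
  have "3 * (\<Sum>\<pi>\<in>S3. ?g 1 \<pi>) = (\<Sum>\<pi>\<in>S3. ?g 1 \<pi> + ?g 2 \<pi> + ?g 3 \<pi>)"
    unfolding sum.distrib 2 3 by simp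
  also have "\<dots> = (\<Sum>\<pi>\<in>S3. rpoly q (y 1) + rpoly q (y 2) + rpoly q (y 3))"
  proof (rule sum.cong[OF refl])
    fix \<pi> assume "\<pi> \<in> S3"
    hence "(\<Sum>i\<in>{1..3}. rpoly q (y (\<pi> i))) = (\<Sum>i\<in>{1..3}. rpoly q (y i))"
      using sum.permute[of \<pi> "{1..3}" "\<lambda>i. rpoly q (y i)"] by (simp add: o_def)
    thus "?g 1 \<pi> + ?g 2 \<pi> + ?g 3 \<pi> = rpoly q (y 1) + rpoly q (y 2) + rpoly q (y 3)"
      unfolding nat_range_1_3 by (simp add: add.assoc)
  qed
  also have "\<dots> = 6 * (rpoly q (y 1) + rpoly q (y 2) + rpoly q (y 3))" by (simp only: sum_constant card_S3) simp
  finally have e: "3 * (\<Sum>\<pi>\<in>S3. ?g 1 \<pi>) = 6 * (rpoly q (y 1) + rpoly q (y 2) + rpoly q (y 3))" .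
  have "(\<Sum>\<pi>\<in>S3. ?g 1 \<pi>) = 3 * (\<Sum>\<pi>\<in>S3. ?g 1 \<pi>) / 3" by simp
  also have "\<dots> = 2 * (rpoly q (y 1) + rpoly q (y 2) + rpoly q (y 3))" unfolding e by simp
  finally have "(\<Sum>\<pi>\<in>S3. ?g 1 \<pi>) = 2 * (rpoly q (y 1) + rpoly q (y 2) + rpoly q (y 3))" .
  thus ?thesis unfolding 1 using trace_rational[of q] by (metis Rats_mult Rats_number_of)
qed

lemma fixed_rational: assumes "x \<in> F" "\<And>\<pi>. \<pi> \<in> S3 \<Longrightarrow> conj \<pi> x = x" shows "x \<in> \<rat>"
proof -
  have "(\<Sum>\<pi>\<in>S3. conj \<pi> x) = (\<Sum>\<pi>\<in>S3. x)" using assms(2) by (intro sum.cong) auto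
  also have "\<dots> = 6 * x" by (simp only: sum_constant card_S3) simp
  finally have "6 * x \<in> \<rat>" using conj_sum_rational[OF assms(1)] by simp
  hence "6 * x / 6 \<in> \<rat>" by (intro Rats_divide) auto
  thus ?thesis by simp
qed

section \<open>Finite dimension, the Galois property and total reality\<close>

lemma subfield_Rats: "subfield \<rat> complex_ring"
  by (rule subfield_complexI) auto

definition basis :: "complex list"
  where "basis = [1, y 1, y 1 ^ 2, \<delta>, y 1 * \<delta>, y 1 ^ 2 * \<delta>]"

lemma rpoly_reduce: "\<exists>b0 b1 b2. rpoly q (y 1) = of_rat b0 + of_rat b1 * y 1 + of_rat b2 * y 1 ^ 2"
proof -
  define r where "r = q mod f"
  have "q = (q div f) * f + r" by (simp add: r_def)
  hence "rpoly q (y 1) = rpoly ((q div f) * f + r) (y 1)" by simp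
  also have "\<dots> = rpoly r (y 1)" using f_y[of 1] by simp
  finally have 1: "rpoly q (y 1) = rpoly r (y 1)" .
  have deg: "r = 0 \<or> Polynomial.degree r < 3"
    using degree_mod_less[of f q] by (auto simp: r_def f_def)
  have "r = [:coeff r 0, coeff r 1, coeff r 2:]"
  proof (rule poly_eqI)
    fix n
    have "coeff r n = 0" if "n \<ge> 3" using deg that by (auto intro: coeff_eq_0)
    thus "coeff r n = coeff [:coeff r 0, coeff r 1, coeff r 2:] n"
      by (auto simp: coeff_pCons numeral_2_eq_2 One_nat_def split: nat.splits)
  qed
  then obtain b0 b1 b2 where "r = [:b0, b1, b2:]" by metis
  hence "rpoly r (y 1) = of_rat b0 + of_rat b1 * y 1 + of_rat b2 * y 1 ^ 2"
    by (simp add: power2_eq_square algebra_simps)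
  thus ?thesis using 1 by auto
qed

lemma basis_rep:
  assumes "x \<in> F"
  obtains b where "x = (\<Sum>i<6. of_rat (b i) * basis ! i)"
proof -
  obtain q r where x: "x = rpoly q (y 1) + rpoly r (y 1) * \<delta>" using assms by (auto simp: F_def elt_def)
  obtain b0 b1 b2 where b: "rpoly q (y 1) = of_rat b0 + of_rat b1 * y 1 + of_rat b2 * y 1 ^ 2" using rpoly_reduce by blast
  obtain b3 b4 b5 where b': "rpoly r (y 1) = of_rat b3 + of_rat b4 * y 1 + of_rat b5 * y 1 ^ 2" using rpoly_reduce by blast
  have six: "{..<6::nat} = {0, 1, 2, 3, 4, 5}" by auto
  have "x = (\<Sum>i<6. of_rat ([b0, b1, b2, b3, b4, b5] ! i) * basis ! i)"
    unfolding x b b' six basis_def by (simp add: algebra_simps One_nat_def eval_nat_numeral)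
  thus ?thesis by (rule that)
qed

lemma finite_dimension_F: "ring.finite_dimension complex_ring \<rat> F"
proof -
  interpret ring complex_ring by (rule complex_ring_ring)
  have carr: "set basis \<subseteq> carrier complex_ring" by simp
  have bF: "set basis \<subseteq> F" using y_F[of 1] delta_F by (auto simp: basis_def)
  have "F = Span \<rat> basis"
  proof
    show "F \<subseteq> Span \<rat> basis"
    proof
      fix x assume "x \<in> F"
      then obtain b where x: "x = (\<Sum>i<6. of_rat (b i) * basis ! i)" by (rule basis_rep)
      have "(\<Sum>i<length xs. of_rat (c i) * xs ! i) \<in> Span \<rat> xs" for c xs
      proof (induction xs arbitrary: c)
        case (Cons u xs)
        have "(\<Sum>i<length (u # xs). of_rat (c i) * (u # xs) ! i) = of_rat (c 0) * u + (\<Sum>i<length xs. of_rat (c (Suc i)) * xs ! i)"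
          by (simp add: sum.lessThan_Suc_shift del: sum.lessThan_Suc)
        moreover have "(of_rat (c 0) :: complex) \<in> \<rat>" by simp
        ultimately show ?case using Cons[of "\<lambda>i. c (Suc i)"] by (auto simp: line_extension_mem_iff)
      qed simp
      moreover have "length basis = 6" by (simp add: basis_def)
      ultimately show "x \<in> Span \<rat> basis" unfolding x by metis
    qed
    have "Span \<rat> xs \<subseteq> F" if "set xs \<subseteq> F" for xs
      using that
    proof (induction xs)
      case (Cons u xs)
      show ?case
      proof
        fix x assume "x \<in> Span \<rat> (u # xs)"
        then obtain k v where "k \<in> \<rat>" "v \<in> Span \<rat> xs" "x = k * u + v" by (auto simp: line_extension_mem_iff)
        thus "x \<in> F" using Cons F.Rats_subset by auto
      qed
    qed simp
    thus "Span \<rat> basis \<subseteq> F" using bF by blast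
  qed
  thus ?thesis using Span_finite_dimension[OF subfield_Rats carr] by simp
qed

lemma finite_galois_F: "finite_galois_extension \<rat> F"
  unfolding finite_galois_extension_def
proof (intro conjI subfield_Rats subfield_F F.Rats_subset finite_dimension_F equalityI subsetI)
  fix x assume "x \<in> {x \<in> F. \<forall>\<sigma>\<in>carrier (galois_group \<rat> F). \<sigma> x = x}"
  thus "x \<in> \<rat>" using fixed_rational unfolding galois_carrier by simp
next
  fix x :: complex assume "x \<in> \<rat>"
  thus "x \<in> {x \<in> F. \<forall>\<sigma>\<in>carrier (galois_group \<rat> F). \<sigma> x = x}"
    using F.Rats_subset by (auto simp: galois_group_def)
qed

lemma totally_real_F: "totally_real F"
  unfolding totally_real_def number_field_def
proof (intro conjI ballI subfield_F finite_dimension_F)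
  fix \<tau> assume t: "\<tau> \<in> Ring.ring_hom (subfield_ring F) complex_ring"
  have hom: "subfield_hom F \<tau>"
    by (rule subfield_hom.intro[OF complex_subfield.intro[OF subfield_F] subfield_hom_axioms.intro])
      (use ring_hom_add[OF t] ring_hom_mult[OF t] ring_hom_one[OF t] in auto)
  interpret t: subfield_hom F \<tau> by (rule hom)
  have r: "\<tau> (y i) \<in> \<real>" if "i \<in> {1..3}" for i using hom_root_cases[OF hom that] real by auto
  have y: "y 1 \<in> F" "y 2 \<in> F" "y 3 \<in> F" by (rule y_F, simp)+
  have "\<tau> \<delta> \<in> \<real>" unfolding \<delta>_def using y r[of 1] r[of 2] r[of 3] by (simp add: t.hom_mult t.hom_diff)
  show "\<tau> ` F \<subseteq> \<real>"
  proof
    fix z assume "z \<in> \<tau> ` F"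
    then obtain x where x: "x \<in> F" "z = \<tau> x" by blast
    obtain q s where qs: "x = elt q s" using x(1) by (rule FE)
    have "z = rpoly q (\<tau> (y 1)) + rpoly s (\<tau> (y 1)) * \<tau> \<delta>"
      unfolding x(2) qs elt_def using y delta_F t.hom_rpoly[OF y(1)] by (simp add: t.hom_add t.hom_mult)
    thus "z \<in> \<real>" using rpoly_real[OF r[of 1]] \<open>\<tau> \<delta> \<in> \<real>\<close> by simp
  qed
qed

end

section \<open>Units of the cubic fields and their \<open>p\<close>-adic independence\<close>

context cubic_roots
begin

section \<open>The explicit units attached to the roots\<close>

lemma y_algebraic_int: assumes "i \<in> {1..3}" shows "algebraic_int (y i)"
proof (rule algebraic_int.intros)
  show "poly [:- 1, - (of_nat a ^ 2), 0, 1:] (y i) = 0"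
    using root[OF assms] by (simp add: power2_eq_square power3_eq_cube algebra_simps)
  show "\<forall>j. coeff [:- 1, - (of_nat a ^ 2), 0, 1:] j \<in> (\<int> :: complex set)" by (auto simp: coeff_pCons split: nat.splits)
qed simp

lemma delta_algebraic_int: "algebraic_int \<delta>"
proof (rule algebraic_int.intros)
  show "poly [:- of_int D, 0, 1:] \<delta> = 0" using delta_sq by (simp add: power2_eq_square)
  show "\<forall>i. coeff [:- of_int D, 0, 1:] i \<in> (\<int> :: complex set)" by (auto simp: coeff_pCons split: nat.splits)
qed simp

lemma alg_unitI: assumes "u \<in> F" "algebraic_int u" "v \<in> F" "algebraic_int v" "u * v = 1" shows "alg_unit F u"
proof -
  have "u \<noteq> 0" "v = inverse u" using assms(5) by (auto simp: inverse_unique)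
  thus ?thesis using assms by (simp add: alg_unit_def)
qed

lemma root_product: "i \<in> {1..3} \<Longrightarrow> y i * ((y i - of_nat a) * (y i + of_nat a)) = 1"
  using root[of i] by (simp add: power2_eq_square power3_eq_cube algebra_simps)

lemma root_units:
  assumes "i \<in> {1..3}"
  shows "alg_unit F (y i)" "alg_unit F (y i - of_nat a)" "alg_unit F (y i + of_nat a)"
proof -
  have m: "y i \<in> F" "y i - of_nat a \<in> F" "y i + of_nat a \<in> F" using y_F[OF assms] by auto
  have al: "algebraic_int (y i)" "algebraic_int (y i - of_nat a)" "algebraic_int (y i + of_nat a)"
    using y_algebraic_int[OF assms] by (auto intro!: algebraic_int_add_mult algebraic_int_diff algebraic_int_of_nat)
  have e: "y i * ((y i - of_nat a) * (y i + of_nat a)) = 1" by (rule root_product[OF assms])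
  show "alg_unit F (y i)" using m al e by (intro alg_unitI[of _ "(y i - of_nat a) * (y i + of_nat a)"]) (auto simp: algebraic_int_add_mult)
  show "alg_unit F (y i - of_nat a)"
    using m al e by (intro alg_unitI[of _ "y i * (y i + of_nat a)"]) (auto simp: algebraic_int_add_mult ac_simps)
  show "alg_unit F (y i + of_nat a)"
    using m al e by (intro alg_unitI[of _ "y i * (y i - of_nat a)"]) (auto simp: algebraic_int_add_mult ac_simps)
qed

definition U :: "nat \<Rightarrow> complex" where "U i = (y i + of_nat a) / (y i - of_nat a)"

text \<open>The cube is congruent to 1 modulo \<open>a ^ 2\<close>, so the expansion of powers
  applies to it directly; \<open>y i\<close> itself need not be close to 1.\<close>

definition V :: "nat \<Rightarrow> complex" where "V i = y i ^ 3"

lemma alg_unit_mult': "alg_unit F u \<Longrightarrow> alg_unit F v \<Longrightarrow> alg_unit F (u * v)"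
  by (auto simp: alg_unit_def algebraic_int_add_mult)

lemma U_unit: "i \<in> {1..3} \<Longrightarrow> alg_unit F (U i)"
  unfolding U_def divide_inverse using root_units[of i] by (intro alg_unit_mult') (auto simp: alg_unit_def)

lemma V_unit: "i \<in> {1..3} \<Longrightarrow> alg_unit F (V i)"
  unfolding V_def power3_eq_cube using root_units(1)[of i] by (intro alg_unit_mult')

text \<open>The cubic takes the value -1 at both \<open>a\<close> and \<open>-a\<close>, so
  numerators and denominators each have product 1.\<close>

lemma U_prod: "U 1 * U 2 * U 3 = 1"
proof -
  let ?A = "of_nat a :: complex"
  have nz: "y 1 - ?A \<noteq> 0" "y 2 - ?A \<noteq> 0" "y 3 - ?A \<noteq> 0"
    using root_units(2)[of 1] root_units(2)[of 2] root_units(2)[of 3] by (auto simp: alg_unit_def)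
  have e: "(t - y 1) * (t - y 2) * (t - y 3) = t ^ 3 - ?A ^ 2 * t - 1" for t
  proof -
    have "(t - y 1) * (t - y 2) * (t - y 3) = t ^ 3 - (y 1 ^ 2 + y 1 * y 2 + y 2 ^ 2) * t - y 1 * y 2 * y 3"
      by (simp add: y3 power2_eq_square power3_eq_cube algebra_simps)
    thus ?thesis unfolding quad prod_roots .
  qed
  have "(y 1 - ?A) * (y 2 - ?A) * (y 3 - ?A) = - ((?A - y 1) * (?A - y 2) * (?A - y 3))" by (simp add: algebra_simps)
  hence 1: "(y 1 - ?A) * (y 2 - ?A) * (y 3 - ?A) = 1" unfolding e by (simp add: power2_eq_square power3_eq_cube)
  have "(y 1 + ?A) * (y 2 + ?A) * (y 3 + ?A) = - ((- ?A - y 1) * (- ?A - y 2) * (- ?A - y 3))" by (simp add: algebra_simps)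
  hence 2: "(y 1 + ?A) * (y 2 + ?A) * (y 3 + ?A) = 1" unfolding e by (simp add: power2_eq_square power3_eq_cube)
  have "U 1 * U 2 * U 3 = ((y 1 + ?A) * (y 2 + ?A) * (y 3 + ?A)) / ((y 1 - ?A) * (y 2 - ?A) * (y 3 - ?A))"
    by (simp add: U_def)
  thus ?thesis unfolding 1 2 by simp
qed

lemma V_prod: "V 1 * V 2 * V 3 = 1"
  using prod_roots by (simp add: V_def power_mult_distrib[symmetric])

lemma conj_U: assumes "\<pi> \<in> S3" "i \<in> {1..3}" shows "conj \<pi> (U i) = U (\<pi> i)"
proof -
  interpret h: subfield_hom F "conj \<pi>" by (rule conj_hom[OF assms(1)])
  have "y i \<in> F" by (rule y_F[OF assms(2)])
  thus ?thesis using conj_y[OF assms] by (simp add: U_def h.hom_divide h.hom_add h.hom_diff h.hom_of_nat)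
qed

lemma conj_V: assumes "\<pi> \<in> S3" "i \<in> {1..3}" shows "conj \<pi> (V i) = V (\<pi> i)"
proof -
  interpret h: subfield_hom F "conj \<pi>" by (rule conj_hom[OF assms(1)])
  have "y i \<in> F" by (rule y_F[OF assms(2)])
  thus ?thesis using conj_y[OF assms] by (simp add: V_def h.hom_power)
qed

lemma conj_alg_unit: assumes "\<pi> \<in> S3" "alg_unit F u" shows "alg_unit F (conj \<pi> u)"
proof -
  interpret h: subfield_hom F "conj \<pi>" by (rule conj_hom[OF assms(1)])
  show ?thesis using assms(2) conj_F[OF assms(1)] h.hom_nonzero[of u] h.hom_algebraic_int[of u]
      h.hom_algebraic_int[of "inverse u"] h.hom_inverse[of u] unfolding alg_unit_def by auto
qed

text \<open>Twisting a place by an automorphism gives a place. Hence a limit known at all places can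
  be read as all its conjugates at one place.\<close>

lemma conj_place:
  assumes w: "w \<in> places_above F p" and \<pi>: "\<pi> \<in> S3"
  shows "(\<lambda>x\<in>F. w (conj \<pi> x)) \<in> places_above F p"
proof -
  interpret h: subfield_hom F "conj \<pi>" by (rule conj_hom[OF \<pi>])
  have aw: "absolute_value F w" "\<And>q. w (of_rat q) = padic_abs p q" using w by (auto simp: places_above_def)
  have nn: "w x \<ge> 0" if "x \<in> F" for x using aw(1) that by (auto simp: absolute_value_def PiE_def Pi_def)
  have z: "w x = 0 \<longleftrightarrow> x = 0" if "x \<in> F" for x using aw(1) that by (auto simp: absolute_value_def)
  have z': "conj \<pi> x = 0 \<longleftrightarrow> x = 0" if "x \<in> F" for x using h.hom_nonzero[OF that] by auto
  have mt: "w (x * z) = w x * w z" "w (x + z) \<le> w x + w z" if "x \<in> F" "z \<in> F" for x z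
    using aw(1) that by (auto simp: absolute_value_def)
  show ?thesis unfolding places_above_def absolute_value_def
    using nn z z' mt conj_F[OF \<pi>] aw(2)
    by (auto simp: h.hom_mult h.hom_add h.hom_of_rat)
qed

end

locale cubic_place = cubic_roots a y + place "cubic_roots.F y" w p for a y w p +
  assumes p_sq_dvd: "p ^ 2 dvd a"
begin

abbreviation "A \<equiv> of_nat a :: complex"

lemma w_A: "w A \<le> 1 / real p ^ 2"
  using w_of_int_le_iff[of "int a" 2] p_sq_dvd by (simp flip: of_nat_power)

lemma inv_p: "1 / real p ^ 2 \<le> 1 / real p" "1 / real p < 1" "1 / real p > 0"
  using p_gt_1 by (auto simp: field_simps power2_eq_square)

lemma w_A_lt: "w A < 1" "w A \<le> 1 / p" using w_A inv_p by linarith+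

lemma w_A_nonneg: "w A \<ge> 0" by (rule w_nonneg) simp

lemma w_A_nonzero: "w A > 0" using a_ge_2 w_A_nonneg w_eq_0[of A] by force

lemma w_y: "i \<in> {1..3} \<Longrightarrow> w (y i) = 1" "i \<in> {1..3} \<Longrightarrow> w (y i - A) = 1"
  using root_units[of i] unit_w by auto

text \<open>The product of the differences from one root to the other two is the derivative
  \<open>3 y^2 - a^2\<close>, of absolute value \<open>w 3\<close>. So all three differences have
  the same size, the square root of \<open>w 3\<close>. For \<open>p = 3\<close> this is less than
  1, but still larger than \<open>1 / p\<close>.\<close>

lemma w_root_difference: "w (y 1 - y 2) > 1 / p"
proof -
  have yF: "y 1 \<in> F" "y 2 \<in> F" "y 3 \<in> F" by (rule y_F, simp)+
  have three: "w 3 \<ge> 1 / p" "w 3 \<le> 1"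
  proof -
    show "w 3 \<le> 1" using w_of_nat_le_1[of 3] by simp
    show "w 3 \<ge> 1 / p"
    proof (cases "p = 3")
      case True
      thus ?thesis using w_p by simp
    next
      case False
      have "\<not> p dvd 3"
      proof
        assume d: "p dvd 3"
        hence "p \<le> 3" by (rule dvd_imp_le) simp
        hence "p = 2" using False p_gt_1 by linarith
        thus False using d by simp
      qed
      hence "\<not> int p dvd 3" by (metis int_dvd_int_iff of_nat_numeral)
      hence "w 3 = 1" using w_of_int_unit[of 3] by simp
      thus ?thesis using inv_p by simp
    qed
  qed
  have A2: "w (A ^ 2) < w 3"
  proof -
    have "w (A ^ 2) = w A * w A" using w_mult[of A A] by (simp add: power2_eq_square)
    also have "\<dots> \<le> (1 / p) * w A" using w_A_lt w_A_nonneg by (intro mult_right_mono)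
    also have "\<dots> < (1 / p) * 1" by (intro mult_strict_left_mono w_A_lt(1) inv_p(3))
    finally show ?thesis using three by simp
  qed
  have d: "w (3 * t ^ 2 - A ^ 2) = w 3" if "t \<in> F" "w t = 1" for t
  proof -
    have "w (3 * t ^ 2) = w 3" using that by (simp add: w_mult w_power)
    moreover have "w (3 * t ^ 2 + - (A ^ 2)) = w (3 * t ^ 2)" using that A2 calculation by (intro w_add_eq) auto
    ultimately show ?thesis by simp
  qed
  have e1: "(y 1 - y 2) * (y 1 - y 3) = 3 * y 1 ^ 2 - A ^ 2" unfolding quad[symmetric] y3 by (simp add: power2_eq_square algebra_simps)
  have e2: "(y 2 - y 1) * (y 2 - y 3) = 3 * y 2 ^ 2 - A ^ 2" unfolding quad[symmetric] y3 by (simp add: power2_eq_square algebra_simps)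
  have e3: "(y 3 - y 1) * (y 3 - y 2) = 3 * y 3 ^ 2 - A ^ 2" unfolding quad[symmetric] y3 by (simp add: power2_eq_square algebra_simps)
  define q12 q13 q23 where "q12 = w (y 1 - y 2)" and "q13 = w (y 1 - y 3)" and "q23 = w (y 2 - y 3)"
  have q: "q12 * q13 = w 3" "q12 * q23 = w 3" "q13 * q23 = w 3"
    using arg_cong[OF e1, of w] arg_cong[OF e2, of w] arg_cong[OF e3, of w] d[OF yF(1) w_y(1)] d[OF yF(2) w_y(1)] d[OF yF(3) w_y(1)]
      yF w_diff_commute[of "y 1" "y 2"] w_diff_commute[of "y 1" "y 3"] w_diff_commute[of "y 2" "y 3"]
    unfolding q12_def q13_def q23_def by (simp_all add: w_mult)
  have pos: "w 3 > 0" using three inv_p by linarith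
  have nn: "q12 \<ge> 0" "q13 \<ge> 0" "q23 \<ge> 0" unfolding q12_def q13_def q23_def using yF by (auto intro!: w_nonneg)
  have nz: "q12 \<noteq> 0" "q23 \<noteq> 0" using q pos by auto
  have "q13 = q23" using q(1,2) nz by (metis mult_left_cancel)
  moreover have "q12 = q13" using q(2,3) nz by (metis mult_right_cancel)
  ultimately have "q12 ^ 2 = w 3" using q(1) by (simp add: power2_eq_square)
  hence "q12 ^ 2 \<ge> 1 / p" using three by simp
  moreover have "(1 / real p) ^ 2 < 1 / p" using p_gt_1 by (simp add: power2_eq_square field_simps)
  ultimately have "(1 / real p) ^ 2 < q12 ^ 2" by linarith
  thus ?thesis using nn(1) unfolding q12_def by (rule power_less_imp_less_base)
qed

text \<open>The first-order terms of \<open>U k powi b\<close> and \<open>V k powi g\<close> are proportional to \<open>1 / (y k)\<close> and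
  \<open>y k\<close>; these are not proportional as functions of \<open>k\<close> because \<open>(y k)\<^sup>2\<close> is not constant.\<close>

lemma log_independence:
  assumes near: "\<And>k. k \<in> {1..3} \<Longrightarrow> w (U k powi b * V k powi g - 1) \<le> e"
  shows "w (of_int b) * w (2 * A) \<le> real p * e" "w (of_int g) * w A ^ 2 \<le> real p * e"
proof -
  define B where "B = w (of_int b) * w (2 * A)"
  define G where "G = w (of_int g) * w A ^ 2"
  \<comment> \<open>The size of the dominant first-order term. If the defect \<open>e\<close> were
    below \<open>M / p\<close>, all corrections would be at most \<open>M / p\<close>, and two roots
    suffice for a contradiction.\<close>
  define M where "M = max B G"
  have nn: "B \<ge> 0" "G \<ge> 0" unfolding B_def G_def by (auto intro!: mult_nonneg_nonneg w_nonneg)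
  have "M \<le> real p * e"
  proof (rule ccontr)
    assume "\<not> ?thesis"
    hence eM: "e < M / p" using p_gt_1 by (simp add: field_simps not_le)
    have M0: "M \<ge> 0" using nn by (simp add: M_def)
    have Mpos: "M > 0"
    proof (rule ccontr)
      assume "\<not> M > 0"
      hence "e < 0" using eM M0 by simp
      moreover have "e \<ge> 0"
        using near[of 1] w_nonneg[of "U 1 powi b * V 1 powi g - 1"] U_unit[of 1] V_unit[of 1] unit_E by fastforce
      ultimately show False by simp
    qed
    \<comment> \<open>Both powers are replaced by their first-order terms, and multiplication by the
      unit \<open>y k - A\<close> clears the denominator of \<open>t\<close>. The cross term with
      \<open>A ^ 3\<close> is smaller by \<open>w A\<close> and is absorbed into the error.\<close>
    have key: "w (of_int b * (2 * A) + of_int g * A ^ 2 * y k ^ 2) \<le> M / p" if k: "k \<in> {1..3}" for k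
    proof -
      have yF: "y k \<in> F" by (rule y_F[OF k])
      have nzA: "y k - A \<noteq> 0" using root_units(2)[OF k] by (simp add: alg_unit_def)
      define t where "t = 2 * A / (y k - A)"
      define s where "s = A ^ 2 * y k"
      have tF: "t \<in> F" "s \<in> F" using yF by (auto simp: t_def s_def)
      have Ut: "U k = 1 + t" using nzA by (simp add: U_def t_def field_simps)
      have Vs: "V k = 1 + s" using root[OF k] by (simp add: V_def s_def)
      have wt: "w t = w (2 * A)" using yF w_y(2)[OF k] by (simp add: t_def w_divide)
      have ws: "w s = w A ^ 2" using yF w_y(1)[OF k] by (simp add: s_def w_mult w_power)
      have "w 2 * w A \<le> 1 * w A" using w_of_nat_le_1[of 2] w_A_nonneg by (intro mult_right_mono) auto
      hence "w (2 * A) \<le> w A" by (simp add: w_mult)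
      hence wt2: "w t \<le> 1 / real p ^ 2" using wt w_A by simp
      have "w A ^ 2 \<le> w A" using w_A_lt w_A_nonneg by (simp add: power2_eq_square mult_left_le)
      hence ws2: "w s \<le> 1 / real p ^ 2" using ws w_A by simp
      have VF: "V k \<noteq> 0" "w (V k) = 1" "V k \<in> F" "U k \<in> F" using V_unit[OF k] U_unit[OF k] by (auto simp: alg_unit_def unit_w[OF V_unit[OF k]])
      have "U k powi b - V k powi (- g) = (U k powi b * V k powi g - 1) * V k powi (- g)"
        using VF by (simp add: power_int_minus field_simps)
      hence 1: "w (U k powi b - V k powi (- g)) \<le> M / p"
        using near[OF k] eM VF by (simp add: w_mult w_power_int)
      have "w ((1 + t) powi b - 1 - of_int b * t) \<le> w (of_int b) * w t / p" by (rule power_int_expansion[OF tF(1) wt2])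
      also have "\<dots> \<le> M / p" unfolding wt B_def[symmetric] by (intro divide_right_mono) (auto simp: M_def)
      finally have 2: "w ((1 + t) powi b - 1 - of_int b * t) \<le> M / p" .
      have "w ((1 + s) powi (- g) - 1 - of_int (- g) * s) \<le> w (of_int (- g)) * w s / p" by (rule power_int_expansion[OF tF(2) ws2])
      also have "w (of_int (- g)) = w (of_int g)" using w_minus[of "of_int g"] by simp
      also have "w (of_int g) * w s / p \<le> M / p" unfolding ws G_def[symmetric] by (intro divide_right_mono) (auto simp: M_def)
      finally have 3: "w ((1 + s) powi (- g) - 1 - of_int (- g) * s) \<le> M / p" .
      have "of_int b * t + of_int g * s = (U k powi b - V k powi (- g)) - ((1 + t) powi b - 1 - of_int b * t)
          + ((1 + s) powi (- g) - 1 - of_int (- g) * s)" by (simp add: Ut Vs)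
      also have "w \<dots> \<le> M / p" using 1 2 3 tF VF by (intro w_add_le w_diff_le[of "U k powi b - V k powi (- g)"]) auto
      finally have 4: "w (of_int b * t + of_int g * s) \<le> M / p" .
      have "w ((of_int b * t + of_int g * s) * (y k - A)) \<le> M / p"
        using 4 tF yF w_y(2)[OF k] by (simp add: w_mult)
      moreover have "(of_int b * t + of_int g * s) * (y k - A) = of_int b * (2 * A) + of_int g * A ^ 2 * y k ^ 2 - of_int g * A ^ 2 * (y k * A)"
      proof -
        have "t * (y k - A) = 2 * A" using nzA by (simp add: t_def)
        hence "of_int b * t * (y k - A) = of_int b * (2 * A)" by (simp only: mult.assoc)
        thus ?thesis by (simp add: distrib_right s_def power2_eq_square algebra_simps)
      qed
      moreover have "w (of_int g * A ^ 2 * (y k * A)) \<le> M / p"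
      proof -
        have "w (of_int g * A ^ 2 * (y k * A)) = G * w A" using yF w_y(1)[OF k] by (simp add: w_mult w_power G_def)
        also have "\<dots> \<le> M * (1 / p)" using nn w_A_lt w_A_nonneg by (intro mult_mono) (auto simp: M_def)
        finally show ?thesis by simp
      qed
      ultimately have "w ((of_int b * t + of_int g * s) * (y k - A) + of_int g * A ^ 2 * (y k * A)) \<le> M / p"
        using tF yF by (intro w_add_le) auto
      thus ?thesis using \<open>(of_int b * t + of_int g * s) * (y k - A) = _\<close> by simp
    qed
    have yF: "y 1 \<in> F" "y 2 \<in> F" "y 3 \<in> F" by (rule y_F, simp)+
    \<comment> \<open>Subtraction cancels the \<open>b\<close> term. In the difference of squares
      one factor is \<open>- y 3\<close>, a unit, and the other exceeds \<open>1 / p\<close>, so the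
      \<open>g\<close> term cannot be the dominant one.\<close>
    have "w ((of_int b * (2 * A) + of_int g * A ^ 2 * y 1 ^ 2) - (of_int b * (2 * A) + of_int g * A ^ 2 * y 2 ^ 2)) \<le> M / p"
      using yF by (intro w_diff_le key) auto
    also have "(of_int b * (2 * A) + of_int g * A ^ 2 * y 1 ^ 2) - (of_int b * (2 * A) + of_int g * A ^ 2 * y 2 ^ 2)
       = - (of_int g * A ^ 2 * (y 1 - y 2) * y 3)" by (simp add: y3 power2_eq_square algebra_simps)
    also have "w \<dots> = G * w (y 1 - y 2)" using yF w_y(1)[of 3] by (simp add: w_mult w_power G_def)
    finally have G1: "G * w (y 1 - y 2) \<le> M / p" .
    have GM: "G < M"
    proof (rule ccontr)
      assume "\<not> G < M"
      hence "M * (1 / p) < G * w (y 1 - y 2)"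
        using Mpos w_root_difference inv_p by (intro mult_le_less_imp_less) auto
      thus False using G1 by simp
    qed
    hence BM: "B = M" by (simp add: M_def max_def split: if_splits)
    have "w ((of_int b * (2 * A) + of_int g * A ^ 2 * y 1 ^ 2) - of_int g * A ^ 2 * y 1 ^ 2) < M"
    proof (rule w_diff_less)
      have "M / p < M" using Mpos p_gt_1 by (simp add: field_simps)
      thus "w (of_int b * (2 * A) + of_int g * A ^ 2 * y 1 ^ 2) < M" using key[of 1] by simp
      show "w (of_int g * A ^ 2 * y 1 ^ 2) < M" using GM yF w_y(1)[of 1] by (simp add: w_mult w_power G_def)
    qed (use yF in auto)
    hence "B < M" by (simp add: B_def w_mult)
    thus False using BM by simp
  qed
  thus "w (of_int b) * w (2 * A) \<le> real p * e" "w (of_int g) * w A ^ 2 \<le> real p * e"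
    unfolding B_def[symmetric] G_def[symmetric] by (auto simp: M_def)
qed

lemma log_independence_limit:
  assumes lim: "\<And>k. k \<in> {1..3} \<Longrightarrow> (\<lambda>n. w (U k powi b n * V k powi g n - 1)) \<longlonglongrightarrow> 0"
  shows "(\<lambda>n. w (of_int (b n))) \<longlonglongrightarrow> 0" "(\<lambda>n. w (of_int (g n))) \<longlonglongrightarrow> 0"
proof -
  define e where "e = (\<lambda>n. \<Sum>k\<in>{1..3}. w (U k powi b n * V k powi g n - 1))"
  have e0: "e \<longlonglongrightarrow> 0" unfolding e_def using tendsto_sum[of "{1..3::nat}" _ "\<lambda>_. 0"] lim by fastforce
  have le: "w (U k powi b n * V k powi g n - 1) \<le> e n" if "k \<in> {1..3}" for k n
    unfolding e_def
  proof (rule member_le_sum[OF that])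
    fix i assume "i \<in> {1..3} - {k}"
    hence "U i \<in> F" "V i \<in> F" using U_unit[of i] V_unit[of i] by (auto simp: alg_unit_def)
    thus "0 \<le> w (U i powi b n * V i powi g n - 1)" by (intro w_nonneg) auto
  qed simp
  have w2A: "w (2 * A) > 0"
    using a_ge_2 w_nonneg[of "2 * A"] w_eq_0[of "2 * A"] by (simp add: less_le)
  have "w (of_int (b n)) \<le> e n * (p / w (2 * A))" for n
    using log_independence(1)[of "b n" "g n" "e n"] le w2A by (simp add: field_simps)
  moreover have "(\<lambda>n. e n * (p / w (2 * A))) \<longlonglongrightarrow> 0" by (rule tendsto_mult_left_zero[OF e0])
  ultimately show "(\<lambda>n. w (of_int (b n))) \<longlonglongrightarrow> 0"
    by (intro null_bound[where g = "\<lambda>n. e n * (p / w (2 * A))"]) auto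
  have "w (of_int (g n)) \<le> e n * (p / w A ^ 2)" for n
    using log_independence(2)[of "b n" "g n" "e n"] le w_A_nonzero by (simp add: field_simps)
  moreover have "(\<lambda>n. e n * (p / w A ^ 2)) \<longlonglongrightarrow> 0" by (rule tendsto_mult_left_zero[OF e0])
  ultimately show "(\<lambda>n. w (of_int (g n))) \<longlonglongrightarrow> 0"
    by (intro null_bound[where g = "\<lambda>n. e n * (p / w A ^ 2)"]) auto
qed

lemma null_powi:
  assumes "\<And>n. s n \<in> F" "\<And>n. w (s n) = 1" "(\<lambda>n. w (s n - 1)) \<longlonglongrightarrow> 0"
  shows "(\<lambda>n. w (s n powi k - 1)) \<longlonglongrightarrow> 0"
proof (rule null_bound[where g = "\<lambda>n. w (s n - 1)"])
  show "\<forall>\<^sub>F n in sequentially. w (s n powi k - 1) \<le> w (s n - 1)"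
    by (intro always_eventually allI power_int_near_1) (use assms w_nonneg in auto)
qed (use assms in auto)

lemma w_proj: "n > 0 \<Longrightarrow> w (of_int (proj n)) = 1"
proof (rule w_of_int_unit)
  assume n: "n > 0"
  have "int p dvd int p ^ n" using n by simp
  hence "int p dvd proj n - 1" using proj_cong dvd_trans by blast
  thus "\<not> int p dvd proj n" using p_gt_1 by (metis dvd_add_right_iff diff_add_cancel int_dvd_int_iff nat_dvd_1_iff_1 of_nat_1 less_irrefl)
qed

text \<open>The factors \<open>proj n\<close> are \<open>p\<close>-adic units for positive
  \<open>n\<close>; a sufficiently late entry is divisible by \<open>p ^ n\<close>, and coherence
  transfers this to level \<open>n\<close>.\<close>

lemma coherent_null:
  assumes B: "coherent B" and lim: "(\<lambda>n. w (of_int (proj n * B n))) \<longlonglongrightarrow> 0"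
  shows "int p ^ n dvd B n"
proof -
  have "\<forall>\<^sub>F m in sequentially. w (of_int (proj m * B m)) < 1 / real p ^ n"
    using p_gt_1 by (intro order_tendstoD(2)[OF lim]) simp
  moreover have "\<forall>\<^sub>F m in sequentially. m \<ge> n" "\<forall>\<^sub>F m in sequentially. m > 0"
    by (rule eventually_ge_at_top eventually_gt_at_top)+
  ultimately have "\<forall>\<^sub>F m in sequentially. w (of_int (proj m * B m)) < 1 / real p ^ n \<and> m \<ge> n \<and> m > 0"
    by eventually_elim auto
  then obtain m where m: "w (of_int (proj m * B m)) < 1 / real p ^ n" "m \<ge> n" "m > 0"
    unfolding eventually_sequentially by blast
  have "w (of_int (B m)) \<le> 1 / real p ^ n" using m w_proj[OF m(3)] by (simp add: w_mult)
  hence "int p ^ n dvd B m" by (simp add: w_of_int_le_iff)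
  moreover have "int p ^ n dvd B m - B n" by (rule coherent_dvd[OF B m(2)])
  ultimately show ?thesis by (metis dvd_diff_right_iff dvd_minus_iff dvd_diff diff_diff_eq2 add_diff_cancel_left' diff_add_cancel)
qed

text \<open>Some fixed power of \<open>u\<close> is \<open>1 + t\<close> with \<open>t\<close>
  small, and nonzero since \<open>u\<close> has infinite order. The powers of \<open>1 + t\<close>
  measure their exponents exactly, up to the constant \<open>w t\<close>.\<close>

lemma unit_log_nonzero:
  assumes u: "unit u" and nr: "\<And>m. m > 0 \<Longrightarrow> u ^ m \<noteq> 1" and lim: "(\<lambda>n. w (u powi b n - 1)) \<longlonglongrightarrow> 0"
  shows "(\<lambda>n. w (of_int (b n))) \<longlonglongrightarrow> 0"
proof -
  obtain f r \<theta> where f: "f > 0" "0 \<le> r" "r < 1" "0 \<le> \<theta>" "\<theta> < 1"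
    and near: "\<And>n k. int (p ^ f - 1) dvd k \<Longrightarrow> int p ^ n dvd k \<Longrightarrow> w (u powi k - 1) \<le> r * \<theta> ^ n"
    using unit_exponents[OF u] by metis
  have "(\<lambda>n. r * \<theta> ^ n) \<longlonglongrightarrow> 0" using f by (intro tendsto_mult_right_zero LIMSEQ_realpow_zero)
  moreover have "real p > 0" using p_gt_1 by linarith
  hence "1 / real p ^ 2 > 0" by simp
  ultimately have "\<forall>\<^sub>F n in sequentially. r * \<theta> ^ n < 1 / real p ^ 2" by (rule order_tendstoD(2))
  then obtain l where l: "r * \<theta> ^ l < 1 / real p ^ 2" unfolding eventually_sequentially by blast
  define m where "m = (p ^ f - 1) * p ^ l"
  have "p ^ f > 1" by (rule one_less_power[OF p_gt_1 f(1)])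
  hence m: "m > 0" using p_gt_1 by (simp add: m_def)
  define t where "t = u ^ m - 1"
  have tF: "t \<in> F" using u by (auto simp: t_def)
  have "w (u powi (int m) - 1) \<le> r * \<theta> ^ l" by (rule near) (auto simp: m_def)
  hence t: "w t \<le> 1 / real p ^ 2" using l by (simp add: t_def)
  have "t \<noteq> 0" using nr[OF m] by (simp add: t_def)
  hence t0: "w t > 0" using tF w_nonneg[OF tF] w_eq_0[OF tF] by simp
  have uF: "u \<in> F" "w u = 1" using u by auto
  have "(\<lambda>n. w ((u powi b n) powi int m - 1)) \<longlonglongrightarrow> 0"
    using lim uF by (intro null_powi) (auto simp: w_power_int)
  moreover have "(u powi b n) powi int m = (1 + t) powi b n" for n
    by (simp add: t_def power_int_mult[symmetric] mult.commute flip: power_int_of_nat)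
  ultimately have "(\<lambda>n. w (of_int (b n)) * w t) \<longlonglongrightarrow> 0"
    using w_power_int_minus_1[OF tF t] by simp
  hence "(\<lambda>n. w (of_int (b n)) * w t * (1 / w t)) \<longlonglongrightarrow> 0 * (1 / w t)" by (intro tendsto_mult tendsto_const)
  thus ?thesis using t0 by simp
qed

end

context cubic_place
begin

definition near_one :: "(nat \<Rightarrow> complex) \<Rightarrow> bool"
  where "near_one s \<longleftrightarrow> (\<forall>n. s n \<in> F \<and> w (s n) = 1) \<and> (\<lambda>n. w (s n - 1)) \<longlonglongrightarrow> 0"

lemma near_one_mult: assumes "near_one s" "near_one t" shows "near_one (\<lambda>n. s n * t n)"
proof -
  have m: "s n \<in> F" "t n \<in> F" "w (s n) = 1" "w (t n) = 1" for n using assms by (auto simp: near_one_def)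
  have "(\<lambda>n. w ((s n - 1) * t n + (t n - 1))) \<longlonglongrightarrow> 0"
    by (intro null_add null_mult_bounded[where B = 1]) (use assms m in \<open>auto simp: near_one_def\<close>)
  hence "(\<lambda>n. w (s n * t n - 1)) \<longlonglongrightarrow> 0" by (simp add: algebra_simps)
  thus ?thesis using m by (simp add: near_one_def w_mult)
qed

lemma near_one_inverse: assumes "near_one s" shows "near_one (\<lambda>n. inverse (s n))"
proof -
  have m: "s n \<in> F" "w (s n) = 1" "s n \<noteq> 0" for n using assms unfolding near_one_def by (auto, metis w_0 zero_neq_one)
  have "inverse (s n) - 1 = - ((s n - 1) * inverse (s n))" for n using m(3) by (simp add: algebra_simps)
  hence "w (inverse (s n) - 1) = w (s n - 1)" for n using m by (simp add: w_mult w_inverse)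
  thus ?thesis using assms m by (simp add: near_one_def w_inverse)
qed

text \<open>The part of the relation without \<open>\<eta>\<close>, after an automorphism moving
  roots 1 and 2 to \<open>i\<close> and \<open>j\<close>. The exponents are numbered from 1 because
  index 0 belongs to \<open>\<eta>\<close>.\<close>

definition G :: "(nat \<Rightarrow> nat \<Rightarrow> int) \<Rightarrow> nat \<Rightarrow> nat \<Rightarrow> nat \<Rightarrow> complex"
  where "G b i j n = U i powi b 1 n * V i powi b 2 n * (U j powi b 3 n * V j powi b 4 n)"

lemma UV_nonzero: assumes "i \<in> {1..3}" shows "U i \<noteq> 0" "V i \<noteq> 0"
  using U_unit[OF assms] V_unit[OF assms] by (auto simp: alg_unit_def)

lemma complement_product:
  assumes "{i, j, k} = {1..3}" "i \<noteq> j" "i \<noteq> k" "j \<noteq> k" shows "U i * U j = inverse (U k)" "V i * V j = inverse (V k)"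
proof -
  have k: "k \<in> {1..3}" using assms by auto
  have p: "g i * g j * g k = g 1 * g 2 * g 3" for g :: "nat \<Rightarrow> complex"
  proof -
    have "prod g {i, j, k} = prod g {1, 2, 3}" using assms(1) unfolding nat_range_1_3 by simp
    thus ?thesis using assms(2-4) by (simp add: mult.assoc)
  qed
  have "U i * U j * U k = 1" "V i * V j * V k = 1" unfolding p by (simp_all only: U_prod V_prod)
  thus "U i * U j = inverse (U k)" "V i * V j = inverse (V k)" using UV_nonzero[OF k] by (simp_all add: field_simps)
qed

text \<open>For \<open>{i, j, k} = {1..3}\<close> the products \<open>G b i j n * G b j i n\<close>
  and \<open>G b k i n * G b k j n\<close> involve the root \<open>k\<close> alone, so
  \<open>log_independence_limit\<close> applies to both. It annihilates \<open>b 1 + b 3\<close> and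
  \<open>2 b 1 - b 3\<close> in the limit, hence \<open>3 b 1\<close>; likewise for
  \<open>b 2\<close> and \<open>b 4\<close>.\<close>

lemma cubic_independence:
  assumes G: "\<And>i j. i \<in> {1..3} \<Longrightarrow> j \<in> {1..3} \<Longrightarrow> i \<noteq> j \<Longrightarrow> near_one (G b i j)" and j: "j \<in> {1..4}"
  shows "(\<lambda>n. w (of_int (b j n))) \<longlonglongrightarrow> 0"
proof -
  have third: "\<exists>i j. {i, j, k} = {1..3} \<and> i \<noteq> j \<and> i \<noteq> k \<and> j \<noteq> k" if k: "k \<in> {1..3}" for k :: nat
  proof -
    have "k = 1 \<or> k = 2 \<or> k = 3" using k by auto
    moreover have "{2, 3, 1} = {1..3::nat}" "{1, 3, 2} = {1..3::nat}" "{1, 2, 3} = {1..3::nat}" by auto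
    ultimately show ?thesis
      by (elim disjE) (rule exI[of _ 2] exI[of _ 1], rule exI[of _ 3] exI[of _ 2], simp)+
  qed
  have pp: "u powi s * v powi s = (u * v) powi s" for u v :: complex and s by (simp add: power_int_mult_distrib)
  have "(\<lambda>n. w (U k powi (- (b 1 n + b 3 n)) * V k powi (- (b 2 n + b 4 n)) - 1)) \<longlonglongrightarrow> 0" if k: "k \<in> {1..3}" for k
  proof -
    obtain i j where ij: "{i, j, k} = {1..3}" "i \<noteq> j" "i \<noteq> k" "j \<noteq> k" using third[OF k] by blast
    have m: "i \<in> {1..3}" "j \<in> {1..3}" using ij(1) by auto
    note nz = UV_nonzero[OF m(1)] UV_nonzero[OF m(2)] UV_nonzero[OF k]
    have "G b i j n * G b j i n = U k powi (- (b 1 n + b 3 n)) * V k powi (- (b 2 n + b 4 n))" for n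
    proof -
      have "G b i j n * G b j i n = (U i * U j) powi (b 1 n + b 3 n) * (V i * V j) powi (b 2 n + b 4 n)"
        using nz unfolding G_def by (simp add: power_int_mult_distrib power_int_add ac_simps)
      thus ?thesis unfolding complement_product[OF ij] by (simp only: power_int_minus power_int_inverse)
    qed
    moreover have "near_one (\<lambda>n. G b i j n * G b j i n)" using ij m by (intro near_one_mult G) auto
    ultimately show ?thesis by (simp add: near_one_def)
  qed
  from log_independence_limit[OF this]
  have s: "(\<lambda>n. w (of_int (- (b 1 n + b 3 n)))) \<longlonglongrightarrow> 0" "(\<lambda>n. w (of_int (- (b 2 n + b 4 n)))) \<longlonglongrightarrow> 0" by auto
  have "(\<lambda>n. w (U k powi (2 * b 1 n - b 3 n) * V k powi (2 * b 2 n - b 4 n) - 1)) \<longlonglongrightarrow> 0" if k: "k \<in> {1..3}" for k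
  proof -
    obtain i j where ij: "{i, j, k} = {1..3}" "i \<noteq> j" "i \<noteq> k" "j \<noteq> k" using third[OF k] by blast
    have m: "i \<in> {1..3}" "j \<in> {1..3}" using ij(1) by auto
    note nz = UV_nonzero[OF m(1)] UV_nonzero[OF m(2)] UV_nonzero[OF k]
    have "G b k i n * G b k j n = U k powi (2 * b 1 n - b 3 n) * V k powi (2 * b 2 n - b 4 n)" for n
    proof -
      have "G b k i n * G b k j n = U k powi (b 1 n + b 1 n) * V k powi (b 2 n + b 2 n) * ((U i * U j) powi b 3 n * (V i * V j) powi b 4 n)"
        using nz unfolding G_def by (simp only: power_int_mult_distrib power_int_add simp_thms not_False_eq_True) (simp add: ac_simps)
      thus ?thesis using nz unfolding complement_product[OF ij]
        by (simp only: power_int_diff power_int_inverse divide_inverse mult_2 ac_simps power_int_add simp_thms)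
    qed
    moreover have "near_one (\<lambda>n. G b k i n * G b k j n)" using ij m k by (intro near_one_mult G) auto
    ultimately show ?thesis by (simp add: near_one_def)
  qed
  from log_independence_limit[OF this]
  have d: "(\<lambda>n. w (of_int (2 * b 1 n - b 3 n))) \<longlonglongrightarrow> 0" "(\<lambda>n. w (of_int (2 * b 2 n - b 4 n))) \<longlonglongrightarrow> 0" by auto
  \<comment> \<open>For \<open>p = 3\<close> this is less than 1, but division by a fixed nonzero
    constant preserves null sequences.\<close>
  have w3: "w 3 > 0" using w_nonneg[of 3] w_eq_0[of 3] by (simp add: less_le)
  have div3: "(\<lambda>n. w (of_int (x n))) \<longlonglongrightarrow> 0" if "(\<lambda>n. w (of_int (3 * x n))) \<longlonglongrightarrow> 0" for x
  proof -
    have "(\<lambda>n. w (of_int (3 * x n)) * (1 / w 3)) \<longlonglongrightarrow> 0" by (rule tendsto_mult_left_zero[OF that])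
    thus ?thesis using w3 by (simp add: w_mult)
  qed
  have comb: "(\<lambda>n. w (of_int (x n - z n))) \<longlonglongrightarrow> 0"
    if "(\<lambda>n. w (of_int (x n))) \<longlonglongrightarrow> 0" "(\<lambda>n. w (of_int (z n))) \<longlonglongrightarrow> 0" for x z
  proof -
    have "(\<lambda>n. w (of_int (x n) + - of_int (z n))) \<longlonglongrightarrow> 0" by (rule null_add) (use that in \<open>simp_all add: w_minus\<close>)
    thus ?thesis by simp
  qed
  have "(\<lambda>n. w (of_int ((2 * b 1 n - b 3 n) - (- (b 1 n + b 3 n))))) \<longlonglongrightarrow> 0" by (rule comb[OF d(1) s(1)])
  hence 1: "(\<lambda>n. w (of_int (b 1 n))) \<longlonglongrightarrow> 0" using div3[of "b 1"] by (simp add: algebra_simps)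
  have "(\<lambda>n. w (of_int ((2 * b 2 n - b 4 n) - (- (b 2 n + b 4 n))))) \<longlonglongrightarrow> 0" by (rule comb[OF d(2) s(2)])
  hence 2: "(\<lambda>n. w (of_int (b 2 n))) \<longlonglongrightarrow> 0" using div3[of "b 2"] by (simp add: algebra_simps)
  have "(\<lambda>n. w (of_int (- (b 1 n + b 3 n) - - b 1 n))) \<longlonglongrightarrow> 0"
    using 1 by (intro comb s(1)) (simp add: w_minus)
  hence "(\<lambda>n. w (- of_int (b 3 n))) \<longlonglongrightarrow> 0" by simp
  hence 3: "(\<lambda>n. w (of_int (b 3 n))) \<longlonglongrightarrow> 0" by (simp add: w_minus)
  have "(\<lambda>n. w (of_int (- (b 2 n + b 4 n) - - b 2 n))) \<longlonglongrightarrow> 0"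
    using 2 by (intro comb s(2)) (simp add: w_minus)
  hence "(\<lambda>n. w (- of_int (b 4 n))) \<longlonglongrightarrow> 0" by simp
  hence 4: "(\<lambda>n. w (of_int (b 4 n))) \<longlonglongrightarrow> 0" by (simp add: w_minus)
  have "j = 1 \<or> j = 2 \<or> j = 3 \<or> j = 4" using j by auto
  thus ?thesis using 1 2 3 4 by auto
qed

end

text \<open>For \<open>a = 3 c\<close> the discriminant is \<open>9 ((18 c\<^sup>3)\<^sup>2 - 3)\<close>, and \<open>(18 c\<^sup>3 + \<delta> / 3)\<^sup>2 / 3\<close> is a unit of
  the quadratic subfield.\<close>

locale cubic_units = cubic_roots "3 * c" y for c :: nat and y
begin

definition \<eta> :: complex where "\<eta> = 216 * of_nat c ^ 6 - 1 + 4 * of_nat c ^ 3 * \<delta>"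

lemma c_pos: "c \<ge> 1" using a_ge_2 by simp

lemma D_eq: "of_int D = 2916 * of_nat c ^ 6 - (27 :: complex)"
  by (simp add: D_def power_mult_distrib)

lemma eta_inverse: "\<eta> * (216 * of_nat c ^ 6 - 1 - 4 * of_nat c ^ 3 * \<delta>) = 1"
proof -
  let ?c = "of_nat c :: complex"
  have "\<eta> * (216 * ?c ^ 6 - 1 - 4 * ?c ^ 3 * \<delta>) = (216 * ?c ^ 6 - 1) ^ 2 - 16 * (?c ^ 3) ^ 2 * \<delta> ^ 2"
    by (simp add: \<eta>_def power2_eq_square algebra_simps)
  also have "\<dots> = 1" unfolding delta_sq D_eq by (simp add: power2_eq_square algebra_simps flip: power_add)
  finally show ?thesis .
qed

lemma eta_unit: "alg_unit F \<eta>"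
proof (rule alg_unitI[OF _ _ _ _ eta_inverse])
  have n: "algebraic_int (216 * of_nat c ^ 6 - 1 :: complex)" "algebraic_int (4 * of_nat c ^ 3 :: complex)"
    using algebraic_int_of_int[of "216 * int c ^ 6 - 1"] algebraic_int_of_int[of "4 * int c ^ 3"] by simp_all
  show "algebraic_int \<eta>" "algebraic_int (216 * of_nat c ^ 6 - 1 - 4 * of_nat c ^ 3 * \<delta>)"
    unfolding \<eta>_def using n delta_algebraic_int by (auto intro: algebraic_int_add_mult algebraic_int_diff)
  show "\<eta> \<in> F" "216 * of_nat c ^ 6 - 1 - 4 * of_nat c ^ 3 * \<delta> \<in> F"
    unfolding \<eta>_def using delta_F by auto
qed

text \<open>A real root of unity is 1 or -1, which would make the sum of \<open>\<eta>\<close> and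
  its inverse 2 or -2; that sum is \<open>432 c^6 - 2\<close>.\<close>

lemma eta_not_root: assumes "m > 0" shows "\<eta> ^ m \<noteq> 1"
proof
  assume "\<eta> ^ m = 1"
  hence n1: "norm \<eta> = 1" using power_eq_1_iff assms by blast
  have "\<eta> \<in> \<real>" using eta_unit F_real by (auto simp: alg_unit_def)
  then obtain r where r: "\<eta> = of_real r" by (rule Reals_cases)
  hence "r = 1 \<or> r = -1" using n1 by auto
  hence pm: "\<eta> = 1 \<or> \<eta> = -1" using r by auto
  let ?e = "216 * of_nat c ^ 6 - 1 - 4 * of_nat c ^ 3 * \<delta>"
  have "\<eta> * \<eta> = 1" using pm by auto
  hence "?e = \<eta>" using eta_inverse pm by (metis mult_cancel_left mult_zero_left zero_neq_one)
  moreover have "\<eta> + ?e = 432 * of_nat c ^ 6 - 2" by (simp add: \<eta>_def)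
  ultimately have "432 * of_nat c ^ 6 - 2 = 2 * \<eta>" by simp
  hence "432 * of_nat c ^ 6 = (4 :: complex) \<or> 432 * of_nat c ^ 6 = (0 :: complex)" using pm by auto
  hence "of_nat (432 * c ^ 6) = (of_nat 4 :: complex) \<or> of_nat (432 * c ^ 6) = (of_nat 0 :: complex)" by simp
  hence "432 * c ^ 6 = 4 \<or> 432 * c ^ 6 = 0" by (metis of_nat_eq_iff)
  moreover have "c ^ 6 \<ge> 1" using c_pos by simp
  ultimately show False by linarith
qed

lemma conj_eta: assumes "\<pi> \<in> S3" shows "conj \<pi> \<eta> = 216 * of_nat c ^ 6 - 1 + 4 * of_nat c ^ 3 * cubic_roots.\<delta> (y \<circ> \<pi>)"
proof -
  interpret h: subfield_hom F "conj \<pi>" by (rule conj_hom[OF assms])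
  have nat: "conj \<pi> (numeral k) = numeral k" for k using h.hom_of_nat[of "numeral k"] by simp
  show ?thesis unfolding \<eta>_def using delta_F
    by (simp add: h.hom_add h.hom_diff h.hom_mult h.hom_power h.hom_of_nat nat conj_delta[OF assms])
qed

definition cyc :: "nat \<Rightarrow> nat" where "cyc = Transposition.transpose 1 2 \<circ> Transposition.transpose 2 3"

lemma cyc_S3: "cyc \<in> S3" unfolding cyc_def by (intro S3_comp transpose_S3) auto

lemma cyc_simps [simp]: "cyc 1 = 2" "cyc 2 = 3" "cyc 3 = 1" by (auto simp: cyc_def transpose_def)

text \<open>Even permutations fix \<open>\<delta>\<close>, so rotations do not move
  \<open>\<eta>\<close>.\<close>

lemma conj_cyc_eta: "conj cyc \<eta> = \<eta>" "conj (cyc \<circ> cyc) \<eta> = \<eta>"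
proof -
  interpret P: cubic_roots "3 * c" "y \<circ> cyc" by (rule roots_permute[OF cyc_S3])
  interpret Q: cubic_roots "3 * c" "y \<circ> (cyc \<circ> cyc)" by (rule roots_permute[OF S3_comp[OF cyc_S3 cyc_S3]])
  have "P.\<delta> = \<delta>" "Q.\<delta> = \<delta>" by (simp_all add: P.\<delta>_def Q.\<delta>_def \<delta>_def algebra_simps)
  thus "conj cyc \<eta> = \<eta>" "conj (cyc \<circ> cyc) \<eta> = \<eta>"
    using conj_eta[OF cyc_S3] conj_eta[OF S3_comp[OF cyc_S3 cyc_S3]] by (simp_all add: \<eta>_def)
qed

definition \<epsilon> :: "nat \<Rightarrow> complex" where "\<epsilon> j = [\<eta>, U 1, V 1, U 2, V 2] ! j"

lemma lessThan_5: "{..<5::nat} = {0, 1, 2, 3, 4}" by auto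

lemma eps_simps: "\<epsilon> 0 = \<eta>" "\<epsilon> 1 = U 1" "\<epsilon> 2 = V 1" "\<epsilon> 3 = U 2" "\<epsilon> 4 = V 2"
  by (simp_all add: \<epsilon>_def One_nat_def eval_nat_numeral)

lemma eps_prod: "(\<Prod>j<5. g j (\<epsilon> j)) = g 0 \<eta> * (g 1 (U 1) * g 2 (V 1) * (g 3 (U 2) * g 4 (V 2)) :: complex)"
  unfolding lessThan_5 by (simp add: eps_simps ac_simps)

lemma eps_unit: "j < 5 \<Longrightarrow> alg_unit F (\<epsilon> j)"
proof -
  assume "j < 5"
  hence "j = 0 \<or> j = 1 \<or> j = 2 \<or> j = 3 \<or> j = 4" by auto
  thus ?thesis using eta_unit U_unit[of 1] U_unit[of 2] V_unit[of 1] V_unit[of 2] eps_simps by auto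
qed

lemma S3_exists: assumes "i \<in> {1..3}" "j \<in> {1..3}" "i \<noteq> j" obtains \<pi> where "\<pi> \<in> S3" "\<pi> 1 = i" "\<pi> 2 = j"
proof -
  define \<rho> where "\<rho> = Transposition.transpose 1 i"
  define \<sigma> where "\<sigma> = Transposition.transpose (\<rho> 2) j"
  have \<rho>: "\<rho> \<in> S3" unfolding \<rho>_def using assms by (intro transpose_S3) auto
  have \<sigma>: "\<sigma> \<in> S3" unfolding \<sigma>_def using assms S3_mem[OF \<rho>, of 2] by (intro transpose_S3) auto
  have "\<rho> 1 = i" by (simp add: \<rho>_def)
  moreover have "\<rho> 2 \<noteq> i" using permutes_inj[of \<rho> "{1..3}"] \<rho> \<open>\<rho> 1 = i\<close> by (metis injD mem_Collect_eq numeral_One numeral_eq_iff verit_eq_simplify(10))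
  ultimately have "(\<sigma> \<circ> \<rho>) 1 = i" "(\<sigma> \<circ> \<rho>) 2 = j" using assms(3) by (auto simp: \<sigma>_def transpose_apply_other)
  thus ?thesis using that S3_comp[OF \<sigma> \<rho>] by blast
qed

text \<open>By \<open>conj_place\<close> the hypotheses at all places amount to all conjugates of a
  single relation at the fixed place \<open>w\<close>.\<close>

lemma independence:
  assumes p: "Factorial_Ring.prime p" "p ^ 2 dvd 3 * c" and w: "w \<in> places_above F p"
    and B: "\<And>j. j < 5 \<Longrightarrow> padic_coherent p (B j)"
    and lim: "\<And>w. w \<in> places_above F p \<Longrightarrow> (\<lambda>n. w ((\<Prod>j<5. \<epsilon> j powi (proj_exp p n * B j n)) - 1)) \<longlonglongrightarrow> 0"
    and j: "j < 5"
  shows "int p ^ n dvd B j n"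
proof -
  interpret pl: cubic_place "3 * c" y w p
  proof (intro cubic_place.intro cubic_place_axioms.intro)
    show "cubic_roots (3 * c) y" by (rule cubic_roots_axioms)
    show "place F w p"
      by (rule place.intro[OF complex_subfield.intro[OF subfield_F] place_axioms.intro])
        (use w p in \<open>auto simp: places_above_def\<close>)
  qed (rule p)
  define b where "b = (\<lambda>j n. proj_exp p n * B j n)"
  have R: "pl.near_one (\<lambda>n. conj \<pi> \<eta> powi b 0 n * pl.G b (\<pi> 1) (\<pi> 2) n)" if \<pi>: "\<pi> \<in> S3" for \<pi>
  proof -
    interpret h: subfield_hom F "conj \<pi>" by (rule conj_hom[OF \<pi>])
    have uF: "\<eta> \<in> F" "U 1 \<in> F" "U 2 \<in> F" "V 1 \<in> F" "V 2 \<in> F"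
      using eta_unit U_unit[of 1] U_unit[of 2] V_unit[of 1] V_unit[of 2] by (auto simp: alg_unit_def)
    define z where "z = (\<lambda>n. \<Prod>j<5. \<epsilon> j powi b j n)"
    have z: "z n = \<eta> powi b 0 n * (U 1 powi b 1 n * V 1 powi b 2 n * (U 2 powi b 3 n * V 2 powi b 4 n))" for n
      unfolding z_def by (rule eps_prod[where g = "\<lambda>j u. u powi b j n"])
    have zF: "z n \<in> F" for n unfolding z using uF by (intro F.mult_mem F.power_int_mem)
    have cz: "conj \<pi> (z n) = conj \<pi> \<eta> powi b 0 n * pl.G b (\<pi> 1) (\<pi> 2) n" for n
      unfolding z pl.G_def using uF conj_U[OF \<pi>, of 1] conj_U[OF \<pi>, of 2] conj_V[OF \<pi>, of 1] conj_V[OF \<pi>, of 2]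
      by (simp add: h.hom_mult h.hom_powi)
    have "(\<lambda>n. (\<lambda>x\<in>F. w (conj \<pi> x)) (z n - 1)) \<longlonglongrightarrow> 0"
      using lim[OF conj_place[OF w \<pi>]] unfolding z_def b_def .
    hence "(\<lambda>n. w (conj \<pi> (z n) - 1)) \<longlonglongrightarrow> 0" using zF by (simp add: h.hom_diff)
    moreover have "conj \<pi> (z n) \<in> F" for n by (rule conj_F[OF \<pi> zF])
    moreover have "w (conj \<pi> (z n)) = 1" for n
    proof -
      have u: "w (conj \<pi> \<eta>) = 1" "conj \<pi> \<eta> \<in> F" using pl.unit_w[OF conj_alg_unit[OF \<pi> eta_unit]] conj_F[OF \<pi> uF(1)] by auto
      have "\<pi> 1 \<in> {1..3}" "\<pi> 2 \<in> {1..3}" by (rule S3_mem[OF \<pi>], simp)+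
      hence "w (U (\<pi> 1)) = 1" "w (V (\<pi> 1)) = 1" "w (U (\<pi> 2)) = 1" "w (V (\<pi> 2)) = 1"
        "U (\<pi> 1) \<in> F" "V (\<pi> 1) \<in> F" "U (\<pi> 2) \<in> F" "V (\<pi> 2) \<in> F"
        using pl.unit_w U_unit V_unit by (auto intro: pl.unit_E)
      thus ?thesis unfolding cz pl.G_def using u by (simp add: pl.w_mult pl.w_power_int)
    qed
    ultimately show ?thesis unfolding pl.near_one_def cz by simp
  qed
  have B0: "int p ^ n dvd B 0 n" for n
  proof -
    have id: "id \<in> S3" by (simp add: permutes_id)
    interpret h: subfield_hom F "conj id" by (rule conj_hom[OF id])
    have "conj id \<eta> = \<eta>" using conj_eta[OF id] by (simp add: \<eta>_def)
    hence r: "pl.near_one (\<lambda>n. \<eta> powi b 0 n * pl.G b 1 2 n)" "pl.near_one (\<lambda>n. \<eta> powi b 0 n * pl.G b 2 3 n)"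
      "pl.near_one (\<lambda>n. \<eta> powi b 0 n * pl.G b 3 1 n)"
      using R[OF id] R[OF cyc_S3] R[OF S3_comp[OF cyc_S3 cyc_S3]] by (simp_all add: conj_cyc_eta)
    \<comment> \<open>Over the three rotations every root occurs once with each exponent, so the
      factors \<open>U\<close> and \<open>V\<close> multiply to 1 and only a cube remains.\<close>
    have "pl.near_one (\<lambda>n. (\<eta> powi b 0 n * pl.G b 1 2 n) * ((\<eta> powi b 0 n * pl.G b 2 3 n) * (\<eta> powi b 0 n * pl.G b 3 1 n)))"
      by (rule pl.near_one_mult[OF r(1) pl.near_one_mult[OF r(2) r(3)]])
    moreover have "(\<eta> powi b 0 n * pl.G b 1 2 n) * ((\<eta> powi b 0 n * pl.G b 2 3 n) * (\<eta> powi b 0 n * pl.G b 3 1 n)) = \<eta> powi (3 * b 0 n)" for n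
    proof -
      have "(\<eta> powi b 0 n * pl.G b 1 2 n) * ((\<eta> powi b 0 n * pl.G b 2 3 n) * (\<eta> powi b 0 n * pl.G b 3 1 n))
        = (\<eta> powi b 0 n * \<eta> powi b 0 n * \<eta> powi b 0 n) * ((U 1 * U 2 * U 3) powi b 1 n * (V 1 * V 2 * V 3) powi b 2 n
           * ((U 1 * U 2 * U 3) powi b 3 n * (V 1 * V 2 * V 3) powi b 4 n))"
        unfolding pl.G_def power_int_mult_distrib by (simp only: ac_simps)
      also have "\<dots> = \<eta> powi b 0 n * \<eta> powi b 0 n * \<eta> powi b 0 n" unfolding U_prod V_prod by simp
      also have "\<dots> = (\<eta> powi b 0 n) ^ 3" by (simp add: power3_eq_cube)
      also have "\<dots> = \<eta> powi (3 * b 0 n)" by (simp add: power_int_power_nat mult.commute)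
      finally show ?thesis .
    qed
    ultimately have "(\<lambda>n. w (\<eta> powi (3 * b 0 n) - 1)) \<longlonglongrightarrow> 0" by (simp add: pl.near_one_def)
    hence "(\<lambda>n. w (of_int (3 * b 0 n))) \<longlonglongrightarrow> 0" using eta_not_root by (intro pl.unit_log_nonzero[OF eta_unit])
    hence "(\<lambda>n. w (of_int (3 * b 0 n)) * (1 / w 3)) \<longlonglongrightarrow> 0" by (rule tendsto_mult_left_zero)
    moreover have "w 3 \<noteq> 0" using pl.w_eq_0[of 3] by simp
    ultimately have "(\<lambda>n. w (of_int (b 0 n))) \<longlonglongrightarrow> 0" by (simp add: pl.w_mult)
    thus ?thesis using B[of 0] unfolding b_def by (intro pl.coherent_null) auto
  qed
  have "pl.near_one (pl.G b i k)" if ik: "i \<in> {1..3}" "k \<in> {1..3}" "i \<noteq> k" for i k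
  proof -
    obtain \<pi> where \<pi>: "\<pi> \<in> S3" "\<pi> 1 = i" "\<pi> 2 = k" using S3_exists[OF ik] by blast
    have u: "alg_unit F (conj \<pi> \<eta>)" by (rule conj_alg_unit[OF \<pi>(1) eta_unit])
    \<comment> \<open>With \<open>B 0\<close> vanishing, every conjugate of \<open>\<eta>\<close>
      contributes a factor tending to 1, which can be divided out.\<close>
    hence e: "pl.near_one (\<lambda>n. conj \<pi> \<eta> powi b 0 n)"
      using pl.proj_powers_null[OF u B0] by (simp add: pl.near_one_def b_def pl.w_power_int F.power_int_mem alg_unit_def)
    have nz: "conj \<pi> \<eta> \<noteq> 0" using u by (simp add: alg_unit_def)
    have "pl.near_one (\<lambda>n. inverse (conj \<pi> \<eta> powi b 0 n) * (conj \<pi> \<eta> powi b 0 n * pl.G b i k n))"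
      by (rule pl.near_one_mult[OF pl.near_one_inverse[OF e] R[OF \<pi>(1), unfolded \<pi>(2,3)]])
    thus ?thesis using nz by (simp add: mult.assoc[symmetric])
  qed
  from pl.cubic_independence[OF this]
  have lim': "(\<lambda>n. w (of_int (b j n))) \<longlonglongrightarrow> 0" if "j \<in> {1..4}" for j using that by blast
  show ?thesis
  proof (cases "j = 0")
    case True
    thus ?thesis using B0 by simp
  next
    case False
    thus ?thesis using lim'[of j] j B[of j] unfolding b_def by (intro pl.coherent_null) auto
  qed
qed

end

section \<open>The rank of the unit group\<close>

context cubic_roots
begin

abbreviation trace :: "complex \<Rightarrow> complex" where "trace x \<equiv> \<Sum>\<pi>\<in>S3. conj \<pi> x"

lemma trace_int: assumes "x \<in> F" "algebraic_int x" shows "trace x \<in> \<int>"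
proof (rule rational_algebraic_int_is_int)
  show "algebraic_int (trace x)"
    using assms by (intro algebraic_int_sum subfield_hom.hom_algebraic_int[OF conj_hom]) auto
  show "trace x \<in> \<rat>" by (rule conj_sum_rational[OF assms(1)])
qed

lemma basis_integral: assumes "k < 6" shows "basis ! k \<in> F" "algebraic_int (basis ! k)"
proof -
  have y: "y 1 \<in> F" "algebraic_int (y 1)" using y_F y_algebraic_int by auto
  have "\<forall>b\<in>set basis. b \<in> F \<and> algebraic_int b"
    using y delta_F delta_algebraic_int by (auto simp: basis_def algebraic_int_pow intro!: algebraic_int_add_mult(2))
  moreover have "basis ! k \<in> set basis" using assms by (intro nth_mem) (simp add: basis_def)
  ultimately show "basis ! k \<in> F" "algebraic_int (basis ! k)" by auto
qed

text \<open>For nonzero \<open>x\<close>, expanding \<open>1 / x\<close> in \<open>basis\<close>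
  would express the trace of 1, which is 6, through the vanishing traces.\<close>

lemma trace_nondegenerate:
  assumes x: "x \<in> F" and tr: "\<And>k. k < 6 \<Longrightarrow> trace (x * basis ! k) = 0" shows "x = 0"
proof (rule ccontr)
  assume x0: "x \<noteq> 0"
  have "inverse x \<in> F" using x by simp
  then obtain b where b: "inverse x = (\<Sum>i<6. of_rat (b i) * basis ! i)" by (rule basis_rep)
  have "conj \<pi> 1 = (\<Sum>i<6. of_rat (b i) * conj \<pi> (x * basis ! i))" if \<pi>: "\<pi> \<in> S3" for \<pi>
  proof -
    interpret h: subfield_hom F "conj \<pi>" by (rule conj_hom[OF \<pi>])
    have "1 = x * inverse x" using x0 by simp
    also have "\<dots> = (\<Sum>i<6. of_rat (b i) * (x * basis ! i))" unfolding b by (simp add: sum_distrib_left mult.left_commute)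
    finally have "conj \<pi> 1 = conj \<pi> (\<Sum>i<6. of_rat (b i) * (x * basis ! i))" by simp
    also have "\<dots> = (\<Sum>i<6. conj \<pi> (of_rat (b i) * (x * basis ! i)))" using x basis_integral by (intro h.hom_sum) auto
    also have "\<dots> = (\<Sum>i<6. of_rat (b i) * conj \<pi> (x * basis ! i))"
      using x basis_integral by (intro sum.cong refl) (simp add: h.hom_mult h.hom_of_rat)
    finally show ?thesis .
  qed
  hence "trace 1 = (\<Sum>\<pi>\<in>S3. \<Sum>i<6. of_rat (b i) * conj \<pi> (x * basis ! i))" by (intro sum.cong) auto
  also have "\<dots> = (\<Sum>i<6. \<Sum>\<pi>\<in>S3. of_rat (b i) * conj \<pi> (x * basis ! i))" by (rule sum.swap)
  also have "\<dots> = (\<Sum>i<6. of_rat (b i) * trace (x * basis ! i))" by (simp only: sum_distrib_left)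
  also have "\<dots> = 0" using tr by (intro sum.neutral) auto
  finally have "trace 1 = 0" .
  moreover have "trace 1 = (\<Sum>\<pi>\<in>S3. 1)" using subfield_hom.hom_of_nat[OF conj_hom, of _ 1] by (intro sum.cong) auto
  moreover have "(\<Sum>\<pi>\<in>S3. 1 :: complex) = 6" by (simp only: sum_constant card_S3) simp
  ultimately show False by simp
qed

lemma trace_diff: assumes "x \<in> F" "z \<in> F" shows "trace (x - z) = trace x - trace z"
  using subfield_hom.hom_diff[OF conj_hom assms] by (simp add: sum_subtractf)

text \<open>An element is determined by its traces against \<open>basis\<close>. For an algebraic
  integer these are integers, and bounded conjugates leave finitely many values.\<close>

lemma finite_bounded_conjugates:
  "finite {x \<in> F. algebraic_int x \<and> (\<forall>\<pi>\<in>S3. norm (conj \<pi> x) \<le> C)}" (is "finite ?X")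
proof -
  define N where "N k = (\<Sum>\<pi>\<in>S3. C * norm (conj \<pi> (basis ! k)))" for k
  define Z where "Z = (\<Union>k<6. of_int ` {m. real_of_int \<bar>m\<bar> \<le> N k} :: complex set)"
  have "{m. real_of_int \<bar>m\<bar> \<le> N k} \<subseteq> {- \<lceil>N k\<rceil>..\<lceil>N k\<rceil>}" for k by (auto; linarith)
  hence "finite {m. real_of_int \<bar>m\<bar> \<le> N k}" for k by (rule finite_subset) simp
  hence fZ: "finite Z" unfolding Z_def by auto
  define \<Phi> where "\<Phi> = (\<lambda>x. map (\<lambda>k. trace (x * basis ! k)) [0..<6])"
  have "trace (x * basis ! k) \<in> Z" if x: "x \<in> ?X" and k: "k < 6" for x k
  proof -
    have b: "x * basis ! k \<in> F" "algebraic_int (x * basis ! k)"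
      using x basis_integral[OF k] algebraic_int_add_mult(2) by auto
    obtain m where m: "trace (x * basis ! k) = of_int m" using trace_int[OF b] by (elim Ints_cases)
    have "norm (trace (x * basis ! k)) \<le> N k" unfolding N_def
    proof (rule sum_norm_le)
      fix \<pi> assume \<pi>: "\<pi> \<in> S3"
      interpret h: subfield_hom F "conj \<pi>" by (rule conj_hom[OF \<pi>])
      have "norm (conj \<pi> x) \<le> C" using x \<pi> by blast
      thus "norm (conj \<pi> (x * basis ! k)) \<le> C * norm (conj \<pi> (basis ! k))"
        using x basis_integral[OF k] by (simp add: h.hom_mult norm_mult mult_right_mono)
    qed
    hence "real_of_int \<bar>m\<bar> \<le> N k" unfolding m by simp
    thus ?thesis unfolding m Z_def using k by blast
  qed
  hence "\<Phi> ` ?X \<subseteq> {xs. set xs \<subseteq> Z \<and> length xs = 6}" by (auto simp: \<Phi>_def)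
  hence "finite (\<Phi> ` ?X)" using finite_lists_length_eq[OF fZ] by (rule finite_subset)
  moreover have "inj_on \<Phi> ?X"
  proof (rule inj_onI)
    fix x z assume xz: "x \<in> ?X" "z \<in> ?X" "\<Phi> x = \<Phi> z"
    have "x - z = 0"
    proof (rule trace_nondegenerate)
      show "x - z \<in> F" using xz by auto
      fix k :: nat assume k: "k < 6"
      have "trace (x * basis ! k) = trace (z * basis ! k)"
        using arg_cong[OF xz(3), of "\<lambda>l. l ! k"] k by (simp add: \<Phi>_def)
      moreover have "trace ((x - z) * basis ! k) = trace (x * basis ! k) - trace (z * basis ! k)"
        unfolding left_diff_distrib using xz basis_integral[OF k] by (intro trace_diff) auto
      ultimately show "trace ((x - z) * basis ! k) = 0" by simp
    qed
    thus "x = z" by simp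
  qed
  ultimately show ?thesis using finite_imageD by blast
qed

lemma norm_integral_rational:
  assumes "alg_unit F u" shows "(\<Prod>\<pi>\<in>S3. conj \<pi> u) \<in> \<int>"
proof (rule rational_algebraic_int_is_int)
  have u: "u \<in> F" "algebraic_int u" using assms by (auto simp: alg_unit_def)
  show "algebraic_int (\<Prod>\<pi>\<in>S3. conj \<pi> u)"
    using u by (intro algebraic_int_prod subfield_hom.hom_algebraic_int[OF conj_hom]) auto
  show "(\<Prod>\<pi>\<in>S3. conj \<pi> u) \<in> \<rat>"
  proof (rule fixed_rational)
    show "(\<Prod>\<pi>\<in>S3. conj \<pi> u) \<in> F" using u conj_F by (intro F.prod_mem) auto
    fix \<rho> assume \<rho>: "\<rho> \<in> S3"
    have "conj \<rho> (\<Prod>\<pi>\<in>S3. conj \<pi> u) = (\<Prod>\<pi>\<in>S3. conj \<rho> (conj \<pi> u))"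
      using u conj_F by (intro subfield_hom.hom_prod[OF conj_hom[OF \<rho>]]) auto
    also have "\<dots> = (\<Prod>\<pi>\<in>S3. conj (\<rho> \<circ> \<pi>) u)" using conj_comp[OF \<rho>] u by (intro prod.cong) auto
    also have "\<dots> = (\<Prod>\<pi>\<in>S3. conj \<pi> u)" by (rule prod_S3_comp_left[OF \<rho>])
    finally show "conj \<rho> (\<Prod>\<pi>\<in>S3. conj \<pi> u) = (\<Prod>\<pi>\<in>S3. conj \<pi> u)" .
  qed
qed

text \<open>The products of conjugates of a unit and of its inverse are integers with product 1, so
  both have absolute value 1.\<close>

lemma sum_log_conjugates:
  assumes u: "alg_unit F u" shows "(\<Sum>\<pi>\<in>S3. ln (norm (conj \<pi> u))) = 0"
proof -
  define N where "N = (\<Prod>\<pi>\<in>S3. conj \<pi> u)"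
  have uF: "u \<in> F" using u by (simp add: alg_unit_def)
  have "(\<Prod>\<pi>\<in>S3. conj \<pi> (inverse u)) = (\<Prod>\<pi>\<in>S3. inverse (conj \<pi> u))"
    using subfield_hom.hom_inverse[OF conj_hom uF] by (intro prod.cong) auto
  also have "\<dots> = inverse N" unfolding N_def by (simp add: o_def flip: prod_inversef)
  finally have "inverse N \<in> \<int>" using norm_integral_rational[OF F.alg_unit_inverse[OF u]] by simp
  moreover have "N \<in> \<int>" unfolding N_def by (rule norm_integral_rational[OF u])
  ultimately obtain m m' where m: "N = of_int m" "inverse N = of_int m'" by (elim Ints_cases)
  have nz: "conj \<pi> u \<noteq> 0" if "\<pi> \<in> S3" for \<pi> using conj_alg_unit[OF that u] by (simp add: alg_unit_def)
  hence "N \<noteq> 0" unfolding N_def using finite_S3 by simp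
  hence "N * inverse N = 1" by simp
  hence "of_int (m * m') = (1 :: complex)" unfolding m(2) unfolding m(1) by simp
  hence "m * m' = 1" by (metis of_int_eq_1_iff)
  hence "\<bar>m\<bar> = 1" using zmult_eq_1_iff by auto
  hence "norm N = 1" unfolding m(1) norm_of_int by (simp flip: of_int_abs)
  hence "(\<Prod>\<pi>\<in>S3. norm (conj \<pi> u)) = 1" unfolding N_def by (simp add: prod_norm)
  moreover have "ln (\<Prod>\<pi>\<in>S3. norm (conj \<pi> u)) = (\<Sum>\<pi>\<in>S3. ln (norm (conj \<pi> u)))"
    using nz finite_S3 by (intro ln_prod) auto
  ultimately show ?thesis by simp
qed

lemma conj_powi_prod:
  assumes "\<pi> \<in> S3" "\<And>i. i \<in> I \<Longrightarrow> v i \<in> F" shows "conj \<pi> (\<Prod>i\<in>I. v i powi n i) = (\<Prod>i\<in>I. conj \<pi> (v i) powi n i)"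
proof -
  interpret h: subfield_hom F "conj \<pi>" by (rule conj_hom[OF assms(1)])
  have "conj \<pi> (\<Prod>i\<in>I. v i powi n i) = (\<Prod>i\<in>I. conj \<pi> (v i powi n i))" using assms(2) by (intro h.hom_prod) auto
  also have "\<dots> = (\<Prod>i\<in>I. conj \<pi> (v i) powi n i)" using assms(2) by (intro prod.cong) (auto simp: h.hom_powi)
  finally show ?thesis .
qed

text \<open>The logarithm vectors satisfy a real linear relation \<open>c\<close>; the products with exponents
  \<open>\<lfloor>t c\<^sub>i\<rfloor>\<close> have bounded conjugates, so two of them coincide.\<close>

lemma unit_relation:
  assumes v: "\<And>i. i \<le> 5 \<Longrightarrow> alg_unit F (v i)"
  obtains n :: "nat \<Rightarrow> int" where "\<exists>i\<le>5. n i \<noteq> 0" "(\<Prod>i\<le>5. v i powi n i) = 1"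
proof -
  define L where "L \<pi> i = ln (norm (conj \<pi> (v i)))" for \<pi> i
  have vF: "v i \<in> F" "v i \<noteq> 0" if "i \<le> 5" for i using v[OF that] by (auto simp: alg_unit_def)
  have cnz: "conj \<pi> (v i) \<noteq> 0" if "\<pi> \<in> S3" "i \<le> 5" for \<pi> i
    using conj_alg_unit[OF that(1) v[OF that(2)]] by (simp add: alg_unit_def)
  have id: "id \<in> S3" by (simp add: permutes_id)
  \<comment> \<open>One embedding is left out: logarithms of a unit sum to 0, so five equations
    imply the sixth, and six unknowns admit a nontrivial solution.\<close>
  have "card (S3 - {id}) = 5" using id finite_S3 card_S3 by (simp add: card_Diff_singleton)
  then obtain h where h: "bij_betw h {..<5::nat} (S3 - {id})"
    using ex_bij_betw_nat_finite[of "S3 - {id}"] finite_S3 by (metis atLeast0LessThan finite_Diff)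
  obtain c where c: "\<exists>i\<le>5. c i \<noteq> 0" "\<And>j. j < 5 \<Longrightarrow> (\<Sum>i\<le>5. L (h j) i * c i) = 0"
    using homogeneous_system_nontrivial[of 5 "\<lambda>j. L (h j)"] by blast
  have rel': "(\<Sum>i\<le>5. L \<pi> i * c i) = 0" if "\<pi> \<in> S3 - {id}" for \<pi>
  proof -
    have "\<pi> \<in> h ` {..<5}" using that unfolding bij_betw_imp_surj_on[OF h] .
    then obtain j where "\<pi> = h j" "j \<in> {..<5}" by (rule imageE)
    thus ?thesis using c(2) by (simp only: lessThan_iff)
  qed
  have "(\<Sum>\<pi>\<in>S3. \<Sum>i\<le>5. L \<pi> i * c i) = (\<Sum>i\<le>5. (\<Sum>\<pi>\<in>S3. L \<pi> i) * c i)"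
    unfolding sum_distrib_right by (rule sum.swap)
  also have "\<dots> = 0" unfolding L_def using sum_log_conjugates[OF v] by (intro sum.neutral) auto
  finally have "(\<Sum>i\<le>5. L id i * c i) + (\<Sum>\<pi>\<in>S3 - {id}. \<Sum>i\<le>5. L \<pi> i * c i) = 0"
    using sum.remove[OF finite_S3 id, of "\<lambda>\<pi>. \<Sum>i\<le>5. L \<pi> i * c i"] by simp
  hence rel: "(\<Sum>i\<le>5. L \<pi> i * c i) = 0" if "\<pi> \<in> S3" for \<pi>
    using rel' that by (cases "\<pi> = id") auto
  obtain i0 where i0: "i0 \<le> 5" "c i0 \<noteq> 0" using c(1) by blast
  \<comment> \<open>Division by \<open>c i0\<close> makes the exponent of \<open>v i0\<close> equal
    to \<open>t\<close>, so a coincidence between different parameters gives a nontrivial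
    relation.\<close>
  define e where "e t i = \<lfloor>real t * (c i / c i0)\<rfloor>" for t i
  define z where "z t = (\<Prod>i\<le>5. v i powi e t i)" for t
  define K where "K = (\<Sum>\<pi>\<in>S3. \<Sum>i\<le>5. \<bar>L \<pi> i\<bar>)"
  have zu: "alg_unit F (z t)" for t unfolding z_def by (intro F.alg_unit_prod F.alg_unit_powi v) simp
  have bound: "norm (conj \<pi> (z t)) \<le> exp K" if \<pi>: "\<pi> \<in> S3" for \<pi> t
  proof -
    define x where "x i = real t * (c i / c i0)" for i
    have "norm (conj \<pi> (z t)) = (\<Prod>i\<le>5. norm (conj \<pi> (v i)) powi e t i)"
      unfolding z_def by (subst conj_powi_prod[OF \<pi>]) (use vF in \<open>auto simp: norm_power_int simp flip: prod_norm\<close>)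
    hence "ln (norm (conj \<pi> (z t))) = (\<Sum>i\<le>5. ln (norm (conj \<pi> (v i)) powi e t i))"
      using cnz[OF \<pi>] by (simp only:) (rule ln_prod, auto intro: zero_less_power_int)
    also have "\<dots> = (\<Sum>i\<le>5. L \<pi> i * of_int (e t i))"
      using cnz[OF \<pi>] unfolding L_def
      by (intro sum.cong) (simp_all add: ln_powr mult.commute flip: powr_real_of_int')
    \<comment> \<open>The unrounded exponents are orthogonal to the logarithms, so only rounding
      errors of size at most 1 survive, uniformly in \<open>t\<close>.\<close>
    also have "\<dots> = (\<Sum>i\<le>5. L \<pi> i * (of_int (e t i) - x i)) + real t / c i0 * (\<Sum>i\<le>5. L \<pi> i * c i)"
      unfolding sum_distrib_left sum.distrib[symmetric] by (intro sum.cong) (simp_all add: x_def algebra_simps)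
    also have "\<dots> = (\<Sum>i\<le>5. L \<pi> i * (of_int (e t i) - x i))" unfolding rel[OF \<pi>] by simp
    also have "\<dots> \<le> (\<Sum>i\<le>5. \<bar>L \<pi> i\<bar>)"
    proof (rule sum_mono)
      fix i
      have "\<bar>of_int (e t i) - x i\<bar> \<le> 1" unfolding e_def x_def by linarith
      hence "\<bar>L \<pi> i * (of_int (e t i) - x i)\<bar> \<le> \<bar>L \<pi> i\<bar>" unfolding abs_mult by (rule mult_left_le) simp
      thus "L \<pi> i * (of_int (e t i) - x i) \<le> \<bar>L \<pi> i\<bar>" by linarith
    qed
    also have "\<dots> \<le> K" unfolding K_def
      by (rule member_le_sum[OF \<pi>, where f = "\<lambda>\<pi>. \<Sum>i\<le>5. \<bar>L \<pi> i\<bar>"]) (auto simp: finite_S3 intro: sum_nonneg)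
    finally have "ln (norm (conj \<pi> (z t))) \<le> K" .
    moreover have "norm (conj \<pi> (z t)) > 0" using conj_alg_unit[OF \<pi> zu] by (simp add: alg_unit_def)
    ultimately show ?thesis by (metis exp_le_cancel_iff exp_ln)
  qed
  have "range z \<subseteq> {x \<in> F. algebraic_int x \<and> (\<forall>\<pi>\<in>S3. norm (conj \<pi> x) \<le> exp K)}"
    using zu bound by (auto simp: alg_unit_def)
  hence "finite (range z)" by (rule finite_subset[OF _ finite_bounded_conjugates])
  hence "\<not> inj z" using finite_imageD infinite_UNIV_nat by blast
  then obtain s t where st: "z s = z t" "s \<noteq> t" by (auto simp: inj_def)
  define n where "n i = e s i - e t i" for i
  have "n i0 = int s - int t" using i0 by (simp add: n_def e_def)
  hence "n i0 \<noteq> 0" using st by simp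
  moreover have "(\<Prod>i\<le>5. v i powi n i) = z s / z t"
    unfolding z_def n_def prod_dividef[symmetric] using vF by (intro prod.cong) (auto simp: power_int_diff)
  hence "(\<Prod>i\<le>5. v i powi n i) = 1" using st zu[of t] by (simp add: alg_unit_def)
  ultimately show ?thesis using that i0(1) by blast
qed

lemma denominator: assumes "x \<in> F" shows "\<exists>d::nat. d > 0 \<and> algebraic_int (of_nat d * x)"
proof -
  define Q where "Q x \<longleftrightarrow> (\<exists>d::nat. d > 0 \<and> algebraic_int (of_nat d * x))" for x :: complex
  have add: "Q (x + z)" if "Q x" "Q z" for x z
  proof -
    obtain d where d: "d > 0" "algebraic_int (of_nat d * x)" using \<open>Q x\<close> unfolding Q_def by (elim exE conjE)
    obtain d' where d': "d' > 0" "algebraic_int (of_nat d' * z)" using \<open>Q z\<close> unfolding Q_def by (elim exE conjE)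
    have "of_nat (d * d') * (x + z) = of_nat d' * (of_nat d * x) + of_nat d * (of_nat d' * z)" by (simp add: algebra_simps)
    hence "algebraic_int (of_nat (d * d') * (x + z))" using d d' by (auto intro!: algebraic_int_add_mult algebraic_int_of_nat)
    thus ?thesis unfolding Q_def using d d' by (intro exI[of _ "d * d'"]) simp
  qed
  have scaled: "Q (of_rat q * b)" if "algebraic_int b" for q b
  proof -
    obtain m k where mk: "q = of_int m / of_int k" "k > 0" by (metis quotient_of_unique quotient_of_div quotient_of_denom_pos surj_pair)
    have "of_nat (nat k) = (of_int k :: complex)" using mk(2) by simp
    hence "of_nat (nat k) * (of_rat q * b) = of_int m * b" using mk by (simp only: of_rat_divide of_rat_of_int_eq) simp
    moreover have "algebraic_int (of_int m * b)" using that by (intro algebraic_int_add_mult algebraic_int_of_int)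
    ultimately have "algebraic_int (of_nat (nat k) * (of_rat q * b))" by (simp only:)
    thus ?thesis unfolding Q_def using mk(2) by (intro exI[of _ "nat k"]) simp
  qed
  have sum: "Q (sum g I)" if "\<And>i. i \<in> I \<Longrightarrow> Q (g i)" for g and I :: "nat set"
    using that by (induction I rule: infinite_finite_induct) (auto intro: add simp: Q_def[of 0])
  obtain b where "x = (\<Sum>i<6. of_rat (b i) * basis ! i)" using basis_rep[OF assms] .
  hence "Q x" using sum[of "{..<6}"] scaled basis_integral(2) by auto
  thus ?thesis by (simp add: Q_def)
qed

text \<open>The transposition fixing \<open>y 1\<close> sends \<open>z\<close> to \<open>z\<close>
  or \<open>-z\<close>. In the first case \<open>z\<close> lies in the cubic field and would be
  rational; in the second \<open>\<delta> * z\<close> lies there and has an integer square. So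
  \<open>F\<close> has only one quadratic subfield.\<close>

lemma sqrt_in_F:
  assumes z: "z \<in> F" "z \<notin> \<rat>" "z ^ 2 = of_int n" shows "\<delta> * z \<in> \<rat>"
proof -
  obtain q r where qr: "z = elt q r" using z(1) by (rule FE)
  let ?t = "Transposition.transpose 2 (3::nat)"
  have id: "id \<in> S3" by (simp add: permutes_id)
  have t: "?t \<in> S3" by (rule transpose_S3) auto
  interpret h: subfield_hom F "conj ?t" by (rule conj_hom[OF t])
  have "conj ?t z ^ 2 = z ^ 2" using h.hom_power[OF z(1), of 2] z(3) by (simp add: h.hom_of_int)
  hence "conj ?t z = z \<or> conj ?t z = - z" by (simp add: power2_eq_iff)
  moreover have "z + conj ?t z = 2 * rpoly q (y 1)" using conj_pair[OF id, of q r] conj_elt[OF id, of q r] unfolding qr by simp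
  ultimately consider "z = rpoly q (y 1)" | "rpoly q (y 1) = 0" by auto
  thus ?thesis
  proof cases
    case 1
    thus ?thesis using sqrt_in_cubic_field[of q n] z by simp
  next
    case 2
    define s where "s = smult (of_int D) r"
    have "\<delta> * z = \<delta> ^ 2 * rpoly r (y 1)" using 2 by (simp add: qr elt_def power2_eq_square)
    hence s: "\<delta> * z = rpoly s (y 1)" by (simp add: delta_sq s_def)
    have "(\<delta> * z) ^ 2 = of_int (D * n)" unfolding power_mult_distrib delta_sq z(3) by simp
    thus ?thesis using sqrt_in_cubic_field[of s "D * n"] unfolding s by blast
  qed
qed

end

context cubic_units
begin

section \<open>Finite index of the explicit units and Leopoldt's conjecture for
  \<open>F\<close>\<close>

lemma place_above: "Factorial_Ring.prime p \<Longrightarrow> \<exists>w. w \<in> places_above F p"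
  using place_exists[OF subfield_F] denominator by blast

text \<open>A multiplicative relation is a \<open>p\<close>-adic one with constant exponents, which
  are then divisible by every power of \<open>p\<close>.\<close>

lemma eps_independent:
  assumes p: "Factorial_Ring.prime p" "p ^ 2 dvd 3 * c" and n: "(\<Prod>j<5. \<epsilon> j powi n j) = 1" and j: "j < 5"
  shows "n j = 0"
proof (rule ccontr)
  assume nz: "n j \<noteq> 0"
  obtain w where w: "w \<in> places_above F p" using place_above[OF p(1)] by blast
  have one: "(\<Prod>j<5. \<epsilon> j powi (proj_exp p k * n j)) = 1" for k
  proof -
    have "(\<Prod>j<5. \<epsilon> j powi (proj_exp p k * n j)) = (\<Prod>j<5. \<epsilon> j powi n j) powi proj_exp p k"
      unfolding prod_powi by (simp add: power_int_mult[symmetric] mult.commute)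
    thus ?thesis by (simp add: n)
  qed
  have "int p ^ k dvd n j" for k
  proof (rule independence[OF p w, of "\<lambda>j _. n j"])
    fix w assume "w \<in> places_above F p"
    hence "w (0::complex) = 0" unfolding places_above_def absolute_value_def by auto
    thus "(\<lambda>k. w ((\<Prod>j<5. \<epsilon> j powi (proj_exp p k * n j)) - 1)) \<longlonglongrightarrow> 0" by (simp add: one)
  qed (use j in \<open>simp_all add: padic_coherent_def\<close>)
  hence "int p ^ nat \<bar>n j\<bar> \<le> \<bar>n j\<bar>" using nz by (simp add: zdvd_imp_le)
  moreover have "nat \<bar>n j\<bar> < p ^ nat \<bar>n j\<bar>" using prime_gt_1_nat[OF p(1)] by (intro power_gt_expt) simp
  hence "int (nat \<bar>n j\<bar>) < int p ^ nat \<bar>n j\<bar>" by (metis of_nat_less_iff of_nat_power)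
  ultimately show False by simp
qed

text \<open>Six units satisfy a relation by \<open>unit_relation\<close>, and the exponent of
  \<open>u\<close> in it is nonzero because the other five are independent.\<close>

lemma eps_finite_index:
  assumes p: "Factorial_Ring.prime p" "p ^ 2 dvd 3 * c" and u: "alg_unit F u"
  shows "\<exists>m>0. \<exists>x :: nat \<Rightarrow> int. u ^ m = (\<Prod>j<5. \<epsilon> j powi x j)"
proof -
  define v where "v i = (case i of 0 \<Rightarrow> u | Suc j \<Rightarrow> \<epsilon> j)" for i
  have "alg_unit F (v i)" if "i \<le> 5" for i using that u eps_unit by (auto simp: v_def split: nat.splits)
  then obtain n :: "nat \<Rightarrow> int" where n: "\<exists>i\<le>5. n i \<noteq> 0" "(\<Prod>i\<le>5. v i powi n i) = 1" by (rule unit_relation)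
  have "{..5} = {..<Suc 5}" by auto
  also have "\<dots> = insert 0 (Suc ` {..<5})" by (rule lessThan_Suc_eq_insert_0)
  finally have "{..5} = insert 0 (Suc ` {..<5})" .
  hence split: "u powi n 0 * (\<Prod>j<5. \<epsilon> j powi n (Suc j)) = 1"
    using n(2) by (simp add: prod.reindex v_def)
  have n0: "n 0 \<noteq> 0"
  proof
    assume 0: "n 0 = 0"
    have "n (Suc j) = 0" if "j < 5" for j
      by (rule eps_independent[OF p _ that, of "\<lambda>j. n (Suc j)"]) (use split 0 in simp)
    moreover obtain i where "i \<le> 5" "n i \<noteq> 0" using n(1) by blast
    ultimately show False using 0 by (cases i) auto
  qed
  \<comment> \<open>The sign makes the exponent of \<open>u\<close> positive, as a natural number
    power demands.\<close>
  define x where "x j = - sgn (n 0) * n (Suc j)" for j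
  have "(\<Prod>j<5. \<epsilon> j powi x j) = (\<Prod>j<5. \<epsilon> j powi n (Suc j)) powi (- sgn (n 0))"
    unfolding prod_powi x_def by (simp add: power_int_mult[symmetric] mult.commute)
  also have "(\<Prod>j<5. \<epsilon> j powi n (Suc j)) = u powi (- n 0)"
    using split u by (simp add: power_int_minus alg_unit_def field_simps)
  also have "(u powi (- n 0)) powi (- sgn (n 0)) = u powi \<bar>n 0\<bar>" by (simp add: power_int_mult[symmetric] abs_sgn)
  also have "\<dots> = u ^ nat \<bar>n 0\<bar>" by (simp add: power_int_def)
  finally have "u ^ nat \<bar>n 0\<bar> = (\<Prod>j<5. \<epsilon> j powi x j)" by simp
  moreover have "nat \<bar>n 0\<bar> > 0" using n0 by simp
  ultimately show ?thesis by blast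
qed

lemma Leo_F: assumes p: "Factorial_Ring.prime p" "p ^ 2 dvd 3 * c" shows "Leo F p"
proof (rule unit_tensor.Leo_criterion[where \<epsilon> = \<epsilon> and d = 5])
  show "unit_tensor F p" by (intro unit_tensor.intro unit_tensor_axioms.intro p(1) complex_subfield.intro subfield_F)
  obtain w where w: "w \<in> places_above F p" using place_above[OF p(1)] by blast
  fix B :: "nat \<Rightarrow> nat \<Rightarrow> int" and j n :: nat
  assume "\<And>j. j < 5 \<Longrightarrow> padic_coherent p (B j)" "j < 5"
    "\<And>w. w \<in> places_above F p \<Longrightarrow> (\<lambda>n. w ((\<Prod>j<5. \<epsilon> j powi (proj_exp p n * B j n)) - 1)) \<longlonglongrightarrow> 0"
  thus "int p ^ n dvd B j n" using independence[OF p w] by blast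
qed (use F_real place_above[OF p(1)] eps_unit eps_finite_index[OF p] in auto)

end

section \<open>Infinitely many different fields\<close>

definition disc_factor :: "nat \<Rightarrow> nat" where "disc_factor c = 108 * c ^ 6 - 1"

lemma disc_factor_not_square: assumes "c \<ge> 1" shows "\<not> is_nth_power 2 (disc_factor c)"
proof
  assume "is_nth_power 2 (disc_factor c)"
  then obtain k where k: "disc_factor c = k ^ 2" by (elim is_nth_powerE)
  have "c ^ 6 \<ge> 1" using assms by simp
  hence "disc_factor c = 4 * (27 * c ^ 6 - 1) + 3" by (simp add: disc_factor_def)
  hence "k ^ 2 mod 4 = 3" unfolding k by simp
  moreover have "k ^ 2 mod 4 = (k mod 4) ^ 2 mod 4" by (simp add: power_mod)
  moreover have "k mod 4 = 0 \<or> k mod 4 = 1 \<or> k mod 4 = 2 \<or> k mod 4 = 3" by presburger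
  ultimately show False by auto
qed

text \<open>In a common field the product of the two square roots of the discriminants is rational.
  The discriminants are 27 times the factors, so the product of the factors is a square; being
  coprime, each is a square, which is impossible modulo 4.\<close>

lemma cubic_fields_distinct:
  assumes "cubic_units c y" "cubic_units c' y'" and cop: "disc_factor c dvd c'"
  shows "cubic_roots.F y \<noteq> cubic_roots.F y'"
proof
  interpret A: cubic_units c y by fact
  interpret B: cubic_units c' y' by fact
  assume F: "A.F = B.F"
  have "A.\<delta> * B.\<delta> \<in> \<rat>" using B.delta_F B.delta_irrational B.delta_sq unfolding F[symmetric] by (intro A.sqrt_in_F)
  hence "A.\<delta> * B.\<delta> \<in> \<int>"
    using A.delta_algebraic_int B.delta_algebraic_int by (intro rational_algebraic_int_is_int algebraic_int_add_mult)
  then obtain k where k: "A.\<delta> * B.\<delta> = of_int k" by (elim Ints_cases)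
  have "of_int (A.D * B.D) = (of_int (k ^ 2) :: complex)"
    using A.delta_sq B.delta_sq arg_cong[OF k, of "\<lambda>x. x ^ 2"] by (simp add: power_mult_distrib)
  hence kD: "A.D * B.D = k ^ 2" by (metis of_int_eq_iff)
  have D: "4 * int (3 * c) ^ 6 - 27 = int (27 * disc_factor c)" if "c \<ge> 1" for c
  proof -
    have "c ^ 6 \<ge> 1" using that by simp
    hence "108 * c ^ 6 \<ge> 1" by linarith
    thus ?thesis by (simp add: disc_factor_def of_nat_diff power_mult_distrib algebra_simps)
  qed
  have "int ((27 * disc_factor c) * (27 * disc_factor c')) = int (nat \<bar>k\<bar> ^ 2)"
    using kD unfolding A.D_def B.D_def D[OF A.c_pos] D[OF B.c_pos] by simp
  hence "27 ^ 2 * (disc_factor c * disc_factor c') = nat \<bar>k\<bar> ^ 2" unfolding of_nat_eq_iff by (simp add: power2_eq_square ac_simps)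
  hence "is_nth_power 2 (27 ^ 2 * (disc_factor c * disc_factor c'))" by (metis is_nth_power_nth_power)
  hence "is_nth_power 2 (disc_factor c * disc_factor c')" by (subst (asm) is_nth_power_mult_cancel_left[OF is_nth_power_nth_power]) auto
  \<comment> \<open>The second factor is -1 modulo \<open>c'\<close>, while the first divides
    \<open>c'\<close>.\<close>
  moreover have "coprime (disc_factor c) (disc_factor c')"
  proof (rule coprimeI)
    fix d assume d: "d dvd disc_factor c" "d dvd disc_factor c'"
    have "c' dvd c' ^ 6" by (rule dvd_power) simp
    hence "d dvd c' ^ 6" using dvd_trans[OF d(1) cop] dvd_trans by blast
    hence "d dvd 108 * c' ^ 6" by (rule dvd_mult)
    moreover have "c' ^ 6 \<ge> 1" using B.c_pos by simp
    hence "108 * c' ^ 6 = disc_factor c' + 1" unfolding disc_factor_def by linarith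
    ultimately have "d dvd disc_factor c' + 1" by (simp only:)
    thus "is_unit d" using dvd_add_right_iff[OF d(2)] by blast
  qed
  ultimately have "is_nth_power 2 (disc_factor c)" by (simp add: is_nth_power_mult_coprime_nat_iff)
  thus False using disc_factor_not_square[OF A.c_pos] by blast
qed

text \<open>As in Euclid's proof that there are infinitely many primes, each parameter is divisible
  by all earlier factors, and it remains a multiple of the start \<open>s\<close>.\<close>

primrec param :: "nat \<Rightarrow> nat \<Rightarrow> nat" where
  "param s 0 = s"
| "param s (Suc n) = param s n * disc_factor (param s n)"

lemma param_pos: assumes "s \<ge> 1" shows "param s n \<ge> 1"
proof (induction n)
  case (Suc n)
  hence "param s n ^ 6 \<ge> 1" by simp
  hence "disc_factor (param s n) \<ge> 1" by (simp add: disc_factor_def)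
  from mult_le_mono[OF Suc this] show ?case by simp
qed (use assms in simp)

lemma param_dvd: "m \<le> n \<Longrightarrow> param s m dvd param s n"
  by (induction rule: dec_induct) auto

lemma disc_factor_dvd_param: "m < n \<Longrightarrow> disc_factor (param s m) dvd param s n"
  using param_dvd[of "Suc m" n s] by (metis Suc_leI dvd_mult_right param.simps(2))

theorem theorem6p12:
  fixes P :: "nat set"
  assumes "finite P" and "\<And>p. p \<in> P \<Longrightarrow> Factorial_Ring.prime p"
  shows "\<exists>\<F> :: complex set set. infinite \<F> \<and>
    (\<forall>F\<in>\<F>. totally_real F \<and> finite_galois_extension \<rat> F \<and>
       galois_group \<rat> F \<cong> sym_group 3 \<and>
       (\<forall>p\<in>P. Leo F p))"
proof -
  define s where "s = (\<Prod>p\<in>P. p ^ 2)"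
  have "s > 0" unfolding s_def using assms(2) by (intro prod_pos) (auto intro: prime_gt_0_nat)
  hence pos: "param s n \<ge> 1" for n by (intro param_pos) simp
  have "\<exists>y. cubic_units (param s n) y" for n
  proof -
    have "3 * param s n \<ge> 2" using pos[of n] by linarith
    then obtain y where "cubic_roots (3 * param s n) y" by (rule cubic_roots_exist)
    thus ?thesis using cubic_units.intro by blast
  qed
  then obtain Y where Y: "\<And>n. cubic_units (param s n) (Y n)" by metis
  define K where "K n = cubic_roots.F (Y n)" for n
  have "K m \<noteq> K n" if "m < n" for m n
    unfolding K_def by (rule cubic_fields_distinct[OF Y Y disc_factor_dvd_param[OF that]])
  hence "inj K" by (metis injI nat_neq_iff)
  hence "infinite (range K)" by (simp add: finite_image_iff)
  moreover have "totally_real (K n) \<and> finite_galois_extension \<rat> (K n) \<and> galois_group \<rat> (K n) \<cong> sym_group 3 \<and>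
    (\<forall>p\<in>P. Leo (K n) p)" for n
  proof -
    interpret cubic_units "param s n" "Y n" by (rule Y)
    have "Leo F p" if "p \<in> P" for p
    proof (rule Leo_F)
      show "Factorial_Ring.prime p" by (rule assms(2)[OF that])
      have "p ^ 2 dvd s" unfolding s_def using assms(1) that by (rule dvd_prodI)
      also have "s dvd param s n" using param_dvd[of 0 n s] by simp
      finally show "p ^ 2 dvd 3 * param s n" by simp
    qed
    thus ?thesis unfolding K_def using totally_real_F finite_galois_F galois_iso by blast
  qed
  ultimately show ?thesis by (intro exI[of _ "range K"]) blast
qed

end
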